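(* Let $\Gamma$ be a finite quiver without oriented cycles, $t\in\Gamma_0$, $d>0$ an integer, and suppose $V^t_d\ne0$. With $l$, $V_i$, $W_i$, $x_i$, $M_i$, $B'$ as defined in the context and $U=V^t_d$, fix integers $a_i$ satisfying $0\le a_i\le(\dim V_i)(\dim W_i)$, $i=1,\dots,l$, and $\sum_{i=1}^l a_i=\dim U$. For each $i$ choose $a_i$ linearly independent elements of $M_i$ and call them $m(i,j)$, $1\le j\le a_i$. Then there exists a Zariski open dense subset $E$ of $B'$ such that if $b'=[b'_1,b'_2,\dots,b'_l]\in E$, then the elements $b'_i\,m(i,j)\,x_i$, $1\le i\le l$, $1\le j\le a_i$, form a basis for $U=V^t_d$.
   Context: $k$ is a fixed algebraically closed field and $\dim=\dim_k$. $\Gamma=(\Gamma_0,\Gamma_1)$ is a finite quiver (vertices $\Gamma_0$, arrows $\Gamma_1$) without oriented cycles; $s(\gamma)$ and $e(\gamma)$ are the starting and end points of $\gamma\in\Gamma_1$. $\bar\Gamma$ is the quiver with the same vertices and with arrows $\Gamma_1\cup\Gamma_1^*$ (disjoint union), where for each $\gamma:t\to v$ in $\Gamma_1$ there is exactly one arrow $\gamma^*:v\to t$ in $\Gamma_1^*$. In the path algebra $k\bar\Gamma$ a product $pq$ of paths means "first $q$, then $p$" (so paths starting at a fixed vertex span a left ideal). $k\bar\Gamma$ is graded by giving trivial paths and arrows of $\Gamma_1$ degree $0$ and arrows of $\Gamma_1^*$ degree $1$. Fix functions $a,b:\Gamma_1\to k$ with $a(\gamma)\ne0$, $b(\gamma)\ne0$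 for all $\gamma$. Let $m_t=\sum_{\gamma\in\Gamma_1,\,s(\gamma)=t}a(\gamma)\gamma^*\gamma-\sum_{\gamma\in\Gamma_1,\,e(\gamma)=t}b(\gamma)\gamma\gamma^*$ and let $J$ be the two-sided ideal of $k\bar\Gamma$ generated by $\sum_{t\in\Gamma_0}m_t$. The $(a,b)$-preprojective algebra is the graded algebra $\mathcal P_k(\Gamma)_{a,b}=k\bar\Gamma/J$. For $t\in\Gamma_0$ and an integer $d\ge0$, $V^t_d$ is the (finite dimensional) $k$-span in $\mathcal P_k(\Gamma)_{a,b}$ of the images of all paths of $\bar\Gamma$ of degree $d$ starting at $t$. Arrows $\beta\in\Gamma_1$ and $\beta^*\in\Gamma_1^*$ are also used to denote their images in $\mathcal P_k(\Gamma)_{a,b}$. Fix $t$ and $d$. Let $s_1,\dots,s_m$ be the distinct vertices having arrows in $\Gamma_1$ from them to $t$, let $u_1,\dots,u_n$ be the distinct vertices with arrows in $\Gamma_1$ going from $t$ to them, and put $l=m+n$. - For $1\le i\le m$: $V_i=V^{s_i}_{d-1}$; $W_i$ is the $k$-linear span of the arrows $\beta^*_{i,j}\in\Gamma_1^*$ going from $t$ to $s_i$ (where $\beta_{i,j}\in\Gamma_1$ are the arrows from $s_i$ to $t$); $w_{i,j}=-b(\beta_{i,j})\beta^*_{i,j}$. - For $m+1\le i\le l$: $V_i=V^{u_{i-m}}_{d}$; $W_i$ is the $k$-linear span of the arrows $\beta_{i,j}\in\Gamma_1$ going from $t$ to $u_{i-m}$; $w_{i,j}=a(\beta_{i,j})\beta_{i,j}$.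 For all $i$, $\{w_{i,j}\}_{j}$ is the chosen basis of $W_i$ (so $\dim W_i$ is the number of arrows involved), and $x_i$ is the column vector with entries $w_{i,j}$, $1\le j\le\dim W_i$. $M_i$ is the vector space of $\dim V_i\times\dim W_i$ matrices over $k$. $B'$ is the affine space $\prod_{i=1}^l V_i^{\dim V_i}$; an element $b'=[b'_1,\dots,b'_l]$ of it consists of $\dim V_i$-tuples $b'_i$ of elements of $V_i$, written as row vectors. For $m(i)\in M_i$, the product $b'_i\,m(i)\,x_i$ is formed by matrix multiplication using the operations of the preprojective algebra; it is an element of $V^t_d$. *)

theory Defs
  imports
    "HOL-Library.Poly_Mapping"
    "HOL-Algebra.QuotRing"
    "HOL-Analysis.Abstract_Topology"
    "Graph_Theory.Arc_Walk"
    "Jordan_Normal_Form.VS_Connect"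
begin

section \<open>Path algebras\<close>

text \<open>A quiver is a \<open>pre_digraph\<close>; parallel arrows and loops are allowed.
  In the double quiver, \<open>Inl \<gamma>\<close> is the arrow \<open>\<gamma>\<close> and \<open>Inr \<gamma>\<close> is \<open>\<gamma>\<^sup>*\<close>.\<close>

definition double_quiver :: "('v, 'e) pre_digraph \<Rightarrow> ('v, 'e + 'e) pre_digraph" where
  "double_quiver G =
     \<lparr> verts = verts G, arcs = Inl ` arcs G \<union> Inr ` arcs G,
       tail = case_sum (tail G) (head G), head = case_sum (head G) (tail G) \<rparr>"

text \<open>A path is its starting vertex together with the list of its arrows in the order in which
  they are traversed; \<open>(v, [])\<close> is the trivial path at \<open>v\<close>.\<close>

type_synonym ('v, 'a) qpath = "'v \<times> 'a list"

definition qpaths :: "('v, 'a) pre_digraph \<Rightarrow> ('v, 'a) qpath set" where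
  "qpaths H = {(u, es). \<exists>v. pre_digraph.awalk H u es v}"

definition qpath_end :: "('v, 'a) pre_digraph \<Rightarrow> ('v, 'a) qpath \<Rightarrow> 'v" where
  "qpath_end H p = last (pre_digraph.awalk_verts H (fst p) (snd p))"

text \<open>The product is the bilinear extension of composition of paths, where \<open>p q\<close> means first \<open>q\<close>,
  then \<open>p\<close>.\<close>

definition qpath_mult ::
  "('v, 'a) pre_digraph \<Rightarrow> (('v, 'a) qpath \<Rightarrow>\<^sub>0 'k) \<Rightarrow> (('v, 'a) qpath \<Rightarrow>\<^sub>0 'k)
     \<Rightarrow> (('v, 'a) qpath \<Rightarrow>\<^sub>0 'k::comm_ring_1)" where
  "qpath_mult H f g =
     (\<Sum>p\<in>Poly_Mapping.keys f. \<Sum>q\<in>Poly_Mapping.keys g.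
        if qpath_end H q = fst p
        then Poly_Mapping.single (fst q, snd q @ snd p)
               (Poly_Mapping.lookup f p * Poly_Mapping.lookup g q)
        else 0)"

definition path_algebra ::
  "('v, 'a) pre_digraph \<Rightarrow> ('k::comm_ring_1, ('v, 'a) qpath \<Rightarrow>\<^sub>0 'k) module" where
  "path_algebra H =
     \<lparr> carrier = {f. Poly_Mapping.keys f \<subseteq> qpaths H},
       mult = qpath_mult H,
       one = (\<Sum>v\<in>verts H. Poly_Mapping.single (v, []) 1),
       zero = 0,
       add = (+),
       smult = (\<lambda>c. Poly_Mapping.map ((*) c)) \<rparr>"

definition arrow_elem :: "('v, 'a) pre_digraph \<Rightarrow> 'a \<Rightarrow> (('v, 'a) qpath \<Rightarrow>\<^sub>0 'k::comm_ring_1)" where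
  "arrow_elem H e = Poly_Mapping.single (tail H e, [e]) 1"

lemma qpath_mult_superset:
  assumes "finite A" "finite B" "Poly_Mapping.keys f \<subseteq> A" "Poly_Mapping.keys g \<subseteq> B"
  shows "qpath_mult H f g = (\<Sum>p\<in>A. \<Sum>q\<in>B.
        if qpath_end H q = fst p
        then Poly_Mapping.single (fst q, snd q @ snd p)
               (Poly_Mapping.lookup f p * Poly_Mapping.lookup g q)
        else 0)"
  unfolding qpath_mult_def
  by (rule sum.mono_neutral_cong_left)
     (use assms in \<open>auto simp: in_keys_iff intro!: sum.neutral sum.mono_neutral_left\<close>)

lemma qpath_mult_add_left: "qpath_mult H (f + f') g = qpath_mult H f g + qpath_mult H f' g"
proof -
  let ?A = "Poly_Mapping.keys f \<union> Poly_Mapping.keys f'" and ?B = "Poly_Mapping.keys g"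
  show ?thesis
    using qpath_mult_superset[of ?A ?B "f + f'" g H] qpath_mult_superset[of ?A ?B f g H]
      qpath_mult_superset[of ?A ?B f' g H] Poly_Mapping.keys_add[of f f']
    by (simp add: sum.distrib[symmetric] lookup_add distrib_right single_add if_distrib cong: if_cong)
qed

lemma qpath_mult_add_right: "qpath_mult H g (f + f') = qpath_mult H g f + qpath_mult H g f'"
proof -
  let ?A = "Poly_Mapping.keys f \<union> Poly_Mapping.keys f'" and ?B = "Poly_Mapping.keys g"
  show ?thesis
    using qpath_mult_superset[of ?B ?A g "f + f'" H] qpath_mult_superset[of ?B ?A g f H]
      qpath_mult_superset[of ?B ?A g f' H] Poly_Mapping.keys_add[of f f']
    by (simp add: sum.distrib[symmetric] lookup_add distrib_left single_add if_distrib cong: if_cong)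
qed

lemma qpath_mult_zero [simp]: "qpath_mult H 0 g = 0" "qpath_mult H g 0 = 0"
  by (simp_all add: qpath_mult_def)

lemma qpath_mult_single:
  "qpath_mult H (Poly_Mapping.single p x) (Poly_Mapping.single q y) =
     (if qpath_end H q = fst p then Poly_Mapping.single (fst q, snd q @ snd p) (x * y) else 0)"
  by (subst qpath_mult_superset[of "{p}" "{q}"]) (auto simp: )

lemma poly_mapping_single_induct [case_names zero single add]:
  fixes f :: "'a \<Rightarrow>\<^sub>0 'b::comm_monoid_add"
  assumes "P 0" "\<And>p x. p \<in> A \<Longrightarrow> P (Poly_Mapping.single p x)" "\<And>f g. P f \<Longrightarrow> P g \<Longrightarrow> P (f + g)"
    and "Poly_Mapping.keys f \<subseteq> A"
  shows "P f"
proof -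
  have "P (\<Sum>p\<in>B. Poly_Mapping.single p (Poly_Mapping.lookup f p))" if "finite B" "B \<subseteq> A" for B
    using that by (induction B) (auto intro: assms(1-3))
  from this[OF finite_keys assms(4)]
  have "P (\<Sum>p\<in>Poly_Mapping.keys f. Poly_Mapping.single p (Poly_Mapping.lookup f p))" .
  also have "(\<Sum>p\<in>Poly_Mapping.keys f. Poly_Mapping.single p (Poly_Mapping.lookup f p)) = f"
    by (rule poly_mapping_eqI)
       (simp add: lookup_sum lookup_single when_def sum.delta in_keys_iff)
  finally show ?thesis .
qed

lemma qpath_end_append:
  "qpath_end H (u, es @ es') = qpath_end H (qpath_end H (u, es), es')"
  unfolding qpath_end_def
proof (induction es arbitrary: u)
  case (Cons e es)
  have ne: "pre_digraph.awalk_verts H v xs \<noteq> []" for v xs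
    by (cases xs) (simp_all add: pre_digraph.awalk_verts.simps)
  show ?case using Cons[of "head H e"] by (simp add: pre_digraph.awalk_verts.simps ne)
qed (simp add: pre_digraph.awalk_verts.simps)

lemma qpath_mult_assoc:
  "qpath_mult H (qpath_mult H f g) h = qpath_mult H f (qpath_mult H g h)"
proof (induction f rule: poly_mapping_single_induct[where A = UNIV])
  case (single p x)
  show ?case
  proof (induction g rule: poly_mapping_single_induct[where A = UNIV])
    case (single q y)
    show ?case
    proof (induction h rule: poly_mapping_single_induct[where A = UNIV])
      case (single r z)
      have "qpath_end H (fst r, snd r @ snd q) = qpath_end H q" if "qpath_end H r = fst q"
        using that qpath_end_append[of H "fst r" "snd r" "snd q"] by simp
      then show ?case
        by (auto simp: qpath_mult_single mult_ac)
    qed (simp_all add: qpath_mult_add_left qpath_mult_add_right)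
  qed (simp_all add: qpath_mult_add_left qpath_mult_add_right)
qed (simp_all add: qpath_mult_add_left qpath_mult_add_right)

lemma keys_qpath_mult:
  assumes "wf_digraph H" "Poly_Mapping.keys f \<subseteq> qpaths H" "Poly_Mapping.keys g \<subseteq> qpaths H"
  shows "Poly_Mapping.keys (qpath_mult H f g) \<subseteq> qpaths H"
proof -
  interpret wf_digraph H by fact
  have *: "(fst q, snd q @ snd p) \<in> qpaths H" if "p \<in> qpaths H" "q \<in> qpaths H" "qpath_end H q = fst p" for p q
    using that by (auto simp: qpaths_def qpath_end_def)
  show ?thesis
    unfolding qpath_mult_def
  proof (intro order_trans[OF Poly_Mapping.keys_sum] UN_least)
    fix p q assume "p \<in> Poly_Mapping.keys f" "q \<in> Poly_Mapping.keys g"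
    then have "p \<in> qpaths H" "q \<in> qpaths H" using assms by auto
    then show "Poly_Mapping.keys (if qpath_end H q = fst p
        then Poly_Mapping.single (fst q, snd q @ snd p)
               (Poly_Mapping.lookup f p * Poly_Mapping.lookup g q) else 0) \<subseteq> qpaths H"
      using * [of p q] by simp
  qed
qed

lemma keys_scale: "Poly_Mapping.keys (Poly_Mapping.map ((*) (c::'k::comm_ring_1)) f) \<subseteq> Poly_Mapping.keys f"
  by (auto simp: in_keys_iff Poly_Mapping.map.rep_eq when_def)

lemma lookup_scale: "Poly_Mapping.lookup (Poly_Mapping.map ((*) (c::'k::comm_ring_1)) f) p = c * Poly_Mapping.lookup f p"
  by (auto simp: Poly_Mapping.map.rep_eq when_def)

lemma ring_path_algebra:
  assumes "fin_digraph H"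
  shows "ring (path_algebra H :: ('k::comm_ring_1, ('v, 'a) qpath \<Rightarrow>\<^sub>0 'k) module)"
proof -
  interpret fin_digraph H by fact
  let ?A = "path_algebra H :: ('k, ('v, 'a) qpath \<Rightarrow>\<^sub>0 'k) module"
  let ?e = "(\<Sum>v\<in>verts H. Poly_Mapping.single (v, []) 1) :: ('v, 'a) qpath \<Rightarrow>\<^sub>0 'k"
  have suml: "qpath_mult H (sum F S) g = (\<Sum>s\<in>S. qpath_mult H (F s) g)" for F g and S :: "'v set"
    by (induction S rule: infinite_finite_induct) (auto simp: qpath_mult_add_left)
  have sumr: "qpath_mult H g (sum F S) = (\<Sum>s\<in>S. qpath_mult H g (F s))" for F g and S :: "'v set"
    by (induction S rule: infinite_finite_induct) (auto simp: qpath_mult_add_right)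
  have e0: "qpath_end H (v, []) = v" for v by (simp add: qpath_end_def)
  have l: "qpath_mult H ?e f = f" if "Poly_Mapping.keys f \<subseteq> qpaths H" for f
  proof (induction f rule: poly_mapping_single_induct[where A = "qpaths H"])
    case (single p x)
    then have "qpath_end H p \<in> verts H"
      by (auto simp: qpaths_def qpath_end_def)
    then show ?case by (simp add: suml qpath_mult_single sum.delta')
  qed (use that in \<open>auto simp: qpath_mult_add_right\<close>)
  have r: "qpath_mult H f ?e = f" if "Poly_Mapping.keys f \<subseteq> qpaths H" for f
  proof (induction f rule: poly_mapping_single_induct[where A = "qpaths H"])
    case (single p x)
    then have "fst p \<in> verts H"
      by (auto simp: qpaths_def)
    then show ?case by (simp add: sumr qpath_mult_single sum.delta e0)
  qed (use that in \<open>auto simp: qpath_mult_add_left\<close>)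
  have ec: "Poly_Mapping.keys ?e \<subseteq> qpaths H"
    by (intro order_trans[OF Poly_Mapping.keys_sum] UN_least) (auto simp: qpaths_def awalk_Nil_iff)
  show ?thesis
  proof (rule ringI)
    show "abelian_group ?A"
    proof (rule abelian_groupI)
      fix f assume "f \<in> carrier ?A"
      then show "\<exists>g\<in>carrier ?A. g \<oplus>\<^bsub>?A\<^esub> f = \<zero>\<^bsub>?A\<^esub>"
        by (intro bexI[of _ "- f"]) (auto simp: path_algebra_def)
    next
      fix f g assume "f \<in> carrier ?A" "g \<in> carrier ?A"
      then show "f \<oplus>\<^bsub>?A\<^esub> g \<in> carrier ?A"
        using Poly_Mapping.keys_add[of f g] by (auto simp: path_algebra_def)
    qed (simp_all add: path_algebra_def ac_simps)
    show "Group.monoid ?A"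
      by (rule monoidI) (use l r ec in \<open>simp_all add: path_algebra_def qpath_mult_assoc keys_qpath_mult[OF wf_digraph_axioms]\<close>)
  qed (auto simp: path_algebra_def qpath_mult_add_left qpath_mult_add_right)
qed

lemma scale_distribs:
  fixes f g :: "'z \<Rightarrow>\<^sub>0 'k::comm_ring_1"
  shows "Poly_Mapping.map ((*) c) (f + g) = Poly_Mapping.map ((*) c) f + Poly_Mapping.map ((*) c) g"
    and "Poly_Mapping.map ((*) (c + c')) f = Poly_Mapping.map ((*) c) f + Poly_Mapping.map ((*) c') f"
    and "Poly_Mapping.map ((*) (c * c')) f = Poly_Mapping.map ((*) c) (Poly_Mapping.map ((*) c') f)"
    and "Poly_Mapping.map ((*) 1) f = f"
    and "Poly_Mapping.map ((*) c) 0 = (0 :: 'z \<Rightarrow>\<^sub>0 'k)"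
    and "Poly_Mapping.map ((*) c) (Poly_Mapping.single z c') = Poly_Mapping.single z (c * c')"
  by (auto intro!: poly_mapping_eqI
      simp: lookup_scale lookup_add distrib_left distrib_right mult.assoc lookup_single when_def)

lemma scale_eq_mult:
  fixes c :: "'k::comm_ring_1"
  assumes "fin_digraph H" "Poly_Mapping.keys f \<subseteq> qpaths H"
  shows "Poly_Mapping.map ((*) c) f =
    qpath_mult H (Poly_Mapping.map ((*) c) (\<Sum>v\<in>verts H. Poly_Mapping.single (v, []) 1)) f"
proof -
  interpret ring "path_algebra H :: ('k::comm_ring_1, _) module" by (rule ring_path_algebra) fact
  have *: "qpath_mult H (Poly_Mapping.map ((*) c) g) f = Poly_Mapping.map ((*) c) (qpath_mult H g f)" for g f
  proof (induction g rule: poly_mapping_single_induct[where A = UNIV])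
    case (single p x)
    show ?case
      by (induction f rule: poly_mapping_single_induct[where A = UNIV])
         (auto simp: qpath_mult_add_right qpath_mult_single scale_distribs mult.assoc)
  qed (auto simp: qpath_mult_add_left scale_distribs)
  show ?thesis
    using assms(2) l_one[of f] by (simp add: * path_algebra_def)
qed


section \<open>Preprojective algebras\<close>

lemma fin_digraph_double_quiver:
  assumes "fin_digraph G" shows "fin_digraph (double_quiver G)"
proof -
  interpret fin_digraph G by fact
  show ?thesis by unfold_locales (auto simp: double_quiver_def)
qed

definition preproj_relation ::
  "('v, 'e) pre_digraph \<Rightarrow> ('e \<Rightarrow> 'k) \<Rightarrow> ('e \<Rightarrow> 'k) \<Rightarrow> 'v
     \<Rightarrow> (('v, 'e + 'e) qpath \<Rightarrow>\<^sub>0 'k::comm_ring_1)" where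
  "preproj_relation G a b t =
     (let H = double_quiver G; A = path_algebra H; el = arrow_elem H in
       (\<Sum>\<gamma>\<in>{\<gamma> \<in> arcs G. tail G \<gamma> = t}. a \<gamma> \<odot>\<^bsub>A\<^esub> (el (Inr \<gamma>) \<otimes>\<^bsub>A\<^esub> el (Inl \<gamma>)))
     - (\<Sum>\<gamma>\<in>{\<gamma> \<in> arcs G. head G \<gamma> = t}. b \<gamma> \<odot>\<^bsub>A\<^esub> (el (Inl \<gamma>) \<otimes>\<^bsub>A\<^esub> el (Inr \<gamma>))))"

definition preproj_ideal ::
  "('v, 'e) pre_digraph \<Rightarrow> ('e \<Rightarrow> 'k) \<Rightarrow> ('e \<Rightarrow> 'k)
     \<Rightarrow> (('v, 'e + 'e) qpath \<Rightarrow>\<^sub>0 'k::comm_ring_1) set" where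
  "preproj_ideal G a b =
     Idl\<^bsub>path_algebra (double_quiver G)\<^esub> {\<Sum>t\<in>verts G. preproj_relation G a b t}"

definition algebra_Quot ::
  "('k, 'c, 'd) module_scheme \<Rightarrow> 'c set \<Rightarrow> ('k, 'c set) module" where
  "algebra_Quot A I =
     \<lparr> carrier = carrier (A Quot I), mult = mult (A Quot I), one = one (A Quot I),
       zero = zero (A Quot I), add = add (A Quot I),
       smult = (\<lambda>c X. \<Union>x\<in>X. I +>\<^bsub>A\<^esub> (c \<odot>\<^bsub>A\<^esub> x)) \<rparr>"

definition preproj_algebra ::
  "('v, 'e) pre_digraph \<Rightarrow> ('e \<Rightarrow> 'k) \<Rightarrow> ('e \<Rightarrow> 'k)
     \<Rightarrow> ('k::comm_ring_1, (('v, 'e + 'e) qpath \<Rightarrow>\<^sub>0 'k) set) module" where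
  "preproj_algebra G a b = algebra_Quot (path_algebra (double_quiver G)) (preproj_ideal G a b)"

lemma ideal_preproj_ideal:
  fixes a b :: "'e \<Rightarrow> 'k::comm_ring_1"
  assumes "fin_digraph (G :: ('v, 'e) pre_digraph)"
  shows "ideal (preproj_ideal G a b) (path_algebra (double_quiver G))"
proof -
  interpret G: fin_digraph G by fact
  let ?H = "double_quiver G"
  interpret H: fin_digraph ?H by (rule fin_digraph_double_quiver) fact
  let ?A = "path_algebra ?H :: ('k, ('v, 'e + 'e) qpath \<Rightarrow>\<^sub>0 'k) module"
  interpret A: ring ?A by (rule ring_path_algebra) unfold_locales
  have arrow: "Poly_Mapping.keys (arrow_elem ?H e :: _ \<Rightarrow>\<^sub>0 'k) \<subseteq> qpaths ?H" if "e \<in> arcs ?H" for e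
    using H.arc_implies_awalk[OF that] by (auto simp: arrow_elem_def qpaths_def)
  have diff: "Poly_Mapping.keys (f - g) \<subseteq> qpaths ?H"
    if "Poly_Mapping.keys f \<subseteq> qpaths ?H" "Poly_Mapping.keys g \<subseteq> qpaths ?H" for f g :: "_ \<Rightarrow>\<^sub>0 'k"
    using that Poly_Mapping.keys_diff[of f g] by auto
  have sum: "Poly_Mapping.keys (sum F S) \<subseteq> qpaths ?H"
    if "\<And>s. s \<in> S \<Longrightarrow> Poly_Mapping.keys (F s) \<subseteq> qpaths ?H" for F :: "_ \<Rightarrow> _ \<Rightarrow>\<^sub>0 'k" and S :: "'z set"
    using that by (intro order_trans[OF Poly_Mapping.keys_sum] UN_least)
  have arcs: "Inl \<gamma> \<in> arcs ?H" "Inr \<gamma> \<in> arcs ?H" if "\<gamma> \<in> arcs G" for \<gamma>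
    using that by (auto simp: double_quiver_def)
  have "Poly_Mapping.keys (preproj_relation G a b t) \<subseteq> qpaths ?H" for t
    unfolding preproj_relation_def Let_def path_algebra_def
    by (intro diff sum; simp; intro order_trans[OF keys_scale] keys_qpath_mult arrow H.wf_digraph_axioms arcs)
       auto
  then have "(\<Sum>t\<in>verts G. preproj_relation G a b t) \<in> carrier ?A"
    by (auto simp: path_algebra_def intro!: sum)
  then show ?thesis
    unfolding preproj_ideal_def by (intro A.genideal_ideal) auto
qed

lemma algebra_Quot_smult:
  fixes c :: "'k::comm_ring_1" and H :: "('v, 'a) pre_digraph"
  assumes "fin_digraph H" "ideal J (path_algebra H)" "f \<in> carrier (path_algebra H)"
  shows "c \<odot>\<^bsub>algebra_Quot (path_algebra H) J\<^esub> (J +>\<^bsub>path_algebra H\<^esub> f) =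
    J +>\<^bsub>path_algebra H\<^esub> (c \<odot>\<^bsub>path_algebra H\<^esub> f)"
proof -
  let ?A = "path_algebra H :: ('k, ('v, 'a) qpath \<Rightarrow>\<^sub>0 'k) module"
  interpret ideal J ?A by fact
  define c1 where "c1 = Poly_Mapping.map ((*) c) (\<one>\<^bsub>?A\<^esub>)"
  have c1: "c1 \<in> carrier ?A"
    using keys_scale[of c "\<one>\<^bsub>?A\<^esub>"] one_closed unfolding c1_def by (auto simp: path_algebra_def)
  have s: "c \<odot>\<^bsub>?A\<^esub> g = c1 \<otimes>\<^bsub>?A\<^esub> g" if "g \<in> carrier ?A" for g
    using that scale_eq_mult[OF assms(1), of g c] by (simp add: path_algebra_def c1_def)
  have "J +>\<^bsub>?A\<^esub> (c \<odot>\<^bsub>?A\<^esub> g) = J +>\<^bsub>?A\<^esub> (c \<odot>\<^bsub>?A\<^esub> f)" if g: "g \<in> J +>\<^bsub>?A\<^esub> f" for g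
  proof -
    obtain h where h: "h \<in> J" "g = h \<oplus>\<^bsub>?A\<^esub> f"
      using g by (auto simp: a_r_coset_def')
    have hc: "h \<in> carrier ?A" using h(1) by (rule a_Hcarr)
    have "c1 \<otimes>\<^bsub>?A\<^esub> g = c1 \<otimes>\<^bsub>?A\<^esub> h \<oplus>\<^bsub>?A\<^esub> c1 \<otimes>\<^bsub>?A\<^esub> f"
      using h hc c1 assms(3) by (simp add: r_distr)
    moreover have "c1 \<otimes>\<^bsub>?A\<^esub> h \<in> J" by (rule I_l_closed[OF h(1) c1])
    ultimately have "c1 \<otimes>\<^bsub>?A\<^esub> g \<in> J +>\<^bsub>?A\<^esub> (c1 \<otimes>\<^bsub>?A\<^esub> f)"
      by (auto simp: a_r_coset_def')
    then have "J +>\<^bsub>?A\<^esub> (c1 \<otimes>\<^bsub>?A\<^esub> g) = J +>\<^bsub>?A\<^esub> (c1 \<otimes>\<^bsub>?A\<^esub> f)"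
      by (rule a_repr_independence'[symmetric]) (simp add: c1 assms(3))
    then show ?thesis using s h hc assms(3) by simp
  qed
  moreover have "f \<in> J +>\<^bsub>?A\<^esub> f" using assms(3) by (rule a_rcos_self)
  ultimately show ?thesis unfolding algebra_Quot_def module.simps by blast
qed

lemma vectorspace_preproj_algebra:
  fixes a b :: "'e \<Rightarrow> 'k::field"
  assumes "fin_digraph (G :: ('v, 'e) pre_digraph)"
  shows "vectorspace class_ring (preproj_algebra G a b)"
proof -
  let ?H = "double_quiver G"
  let ?A = "path_algebra ?H :: ('k, ('v, 'e + 'e) qpath \<Rightarrow>\<^sub>0 'k) module"
  let ?P = "preproj_algebra G a b"
  let ?J = "preproj_ideal G a b"
  have fH: "fin_digraph ?H" by (rule fin_digraph_double_quiver) fact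
  have id: "ideal ?J ?A" by (rule ideal_preproj_ideal) fact
  interpret ideal ?J ?A by fact
  interpret Q: ring "?A Quot ?J" by (rule quotient_is_ring)
  have add: "add ?P = add (?A Quot ?J)" and zero: "zero ?P = zero (?A Quot ?J)"
    and car: "carrier ?P = carrier (?A Quot ?J)"
    by (simp_all add: preproj_algebra_def algebra_Quot_def)
  have el: "\<exists>f\<in>carrier ?A. X = ?J +>\<^bsub>?A\<^esub> f" if "X \<in> carrier ?P" for X
    using that by (auto simp: car FactRing_def A_RCOSETS_def')
  have inP: "?J +>\<^bsub>?A\<^esub> f \<in> carrier ?P" if "f \<in> carrier ?A" for f
    using that by (auto simp: car FactRing_def A_RCOSETS_def')
  have sm: "c \<odot>\<^bsub>?P\<^esub> (?J +>\<^bsub>?A\<^esub> f) = ?J +>\<^bsub>?A\<^esub> (c \<odot>\<^bsub>?A\<^esub> f)" if "f \<in> carrier ?A" for c f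
    unfolding preproj_algebra_def by (rule algebra_Quot_smult[OF fH id that])
  have smc: "c \<odot>\<^bsub>?A\<^esub> f \<in> carrier ?A" if "f \<in> carrier ?A" for c f
    using that keys_scale[of c f] by (auto simp: path_algebra_def)
  have pl: "(?J +>\<^bsub>?A\<^esub> f) \<oplus>\<^bsub>?P\<^esub> (?J +>\<^bsub>?A\<^esub> g) = ?J +>\<^bsub>?A\<^esub> (f \<oplus>\<^bsub>?A\<^esub> g)"
    if "f \<in> carrier ?A" "g \<in> carrier ?A" for f g
    using that by (simp add: add FactRing_def a_rcos_sum)
  have A_ops: "f \<oplus>\<^bsub>?A\<^esub> g = f + g" "c \<odot>\<^bsub>?A\<^esub> f = Poly_Mapping.map ((*) c) f" for f g c
    by (simp_all add: path_algebra_def)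
  have ab: "abelian_group ?P"
    by (rule abelian_groupI) (use Q.a_assoc Q.a_comm Q.l_neg in \<open>auto simp: add zero car intro: bexI[of _ "\<ominus>\<^bsub>?A Quot ?J\<^esub> _"]\<close>)
  have "module class_ring ?P"
  proof (rule moduleI)
    show "cring (class_ring :: 'k ring)" by (rule class_cring.is_cring)
    show "abelian_group ?P" by fact
  next
    fix c c' :: 'k and X Y assume "X \<in> carrier ?P" "Y \<in> carrier ?P"
    then obtain f g where f: "f \<in> carrier ?A" "X = ?J +>\<^bsub>?A\<^esub> f" and g: "g \<in> carrier ?A" "Y = ?J +>\<^bsub>?A\<^esub> g"
      using el by metis
    note [simp] = f g sm[unfolded A_ops] smc[unfolded A_ops] pl[unfolded A_ops] a_closed[unfolded A_ops] inP
    show "c \<odot>\<^bsub>?P\<^esub> (X \<oplus>\<^bsub>?P\<^esub> Y) = c \<odot>\<^bsub>?P\<^esub> X \<oplus>\<^bsub>?P\<^esub> c \<odot>\<^bsub>?P\<^esub> Y"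
      by (simp add: A_ops scale_distribs)
  next
    fix c c' :: 'k and X assume "X \<in> carrier ?P"
    then obtain f where f: "f \<in> carrier ?A" "X = ?J +>\<^bsub>?A\<^esub> f" using el by metis
    note [simp] = f sm[unfolded A_ops] smc[unfolded A_ops] pl[unfolded A_ops] a_closed[unfolded A_ops] inP
    show "c \<odot>\<^bsub>?P\<^esub> X \<in> carrier ?P" by simp
    show "(c \<oplus>\<^bsub>class_ring\<^esub> c') \<odot>\<^bsub>?P\<^esub> X = c \<odot>\<^bsub>?P\<^esub> X \<oplus>\<^bsub>?P\<^esub> c' \<odot>\<^bsub>?P\<^esub> X"
      by (simp add: A_ops scale_distribs)
    show "(c \<otimes>\<^bsub>class_ring\<^esub> c') \<odot>\<^bsub>?P\<^esub> X = c \<odot>\<^bsub>?P\<^esub> (c' \<odot>\<^bsub>?P\<^esub> X)"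
      by (simp add: A_ops scale_distribs)
    show "\<one>\<^bsub>class_ring\<^esub> \<odot>\<^bsub>?P\<^esub> X = X"
      by (simp add: A_ops scale_distribs)
  qed
  then show ?thesis
    by (simp add: vectorspace_def class_field.field_axioms)
qed

definition preproj_proj ::
  "('v, 'e) pre_digraph \<Rightarrow> ('e \<Rightarrow> 'k) \<Rightarrow> ('e \<Rightarrow> 'k)
     \<Rightarrow> (('v, 'e + 'e) qpath \<Rightarrow>\<^sub>0 'k) \<Rightarrow> (('v, 'e + 'e) qpath \<Rightarrow>\<^sub>0 'k::comm_ring_1) set" where
  "preproj_proj G a b f = preproj_ideal G a b +>\<^bsub>path_algebra (double_quiver G)\<^esub> f"

definition preproj_arrow ::
  "('v, 'e) pre_digraph \<Rightarrow> ('e \<Rightarrow> 'k) \<Rightarrow> ('e \<Rightarrow> 'k)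
     \<Rightarrow> 'e + 'e \<Rightarrow> (('v, 'e + 'e) qpath \<Rightarrow>\<^sub>0 'k::comm_ring_1) set" where
  "preproj_arrow G a b e = preproj_proj G a b (arrow_elem (double_quiver G) e)"

definition star_degree :: "('v, 'e + 'e) qpath \<Rightarrow> nat" where
  "star_degree p = length (filter (\<lambda>e. \<not> isl e) (snd p))"

definition preproj_V ::
  "('v, 'e) pre_digraph \<Rightarrow> ('e \<Rightarrow> 'k) \<Rightarrow> ('e \<Rightarrow> 'k) \<Rightarrow> 'v \<Rightarrow> nat
     \<Rightarrow> (('v, 'e + 'e) qpath \<Rightarrow>\<^sub>0 'k::field) set set" where
  "preproj_V G a b t d =
     LinearCombinations.module.span class_ring (preproj_algebra G a b)
       ((\<lambda>p. preproj_proj G a b (Poly_Mapping.single p 1)) `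
          {p \<in> qpaths (double_quiver G). fst p = t \<and> star_degree p = d})"

text \<open>Dimension over \<open>k\<close> of a subspace \<open>W\<close> of the vector space (or algebra) \<open>M\<close>.\<close>

definition subspace_dim :: "('k::field, 'c, 'd) module_scheme \<Rightarrow> 'c set \<Rightarrow> nat" where
  "subspace_dim M W = VectorSpace.vectorspace.dim class_ring (M\<lparr>carrier := W\<rparr>)"


section \<open>The data attached to a vertex \<open>t\<close>, a degree \<open>d\<close> and enumerations\<close>

text \<open>In the following, \<open>ss\<close> and \<open>us\<close> list the vertices \<open>s\<^sub>1, \<dots>, s\<^sub>m\<close> and \<open>u\<^sub>1, \<dots>, u\<^sub>n\<close>, and
  \<open>\<beta> i\<close> lists the arrows \<open>\<beta>\<^sub>i\<^sub>,\<^sub>1, \<beta>\<^sub>i\<^sub>,\<^sub>2, \<dots>\<close> of \<open>\<Gamma>\<close>. All indices start from 0, so \<open>i\<close> ranges over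
  \<open>i < l = length ss + length us\<close>, with \<open>i < length ss\<close> for arrows into \<open>t\<close>.
  The truncated subtraction in \<open>nbr_V\<close> is harmless, as only \<open>d > 0\<close> is of interest.\<close>

definition nbr_enum ::
  "('v, 'e) pre_digraph \<Rightarrow> 'v \<Rightarrow> 'v list \<Rightarrow> 'v list \<Rightarrow> (nat \<Rightarrow> 'e list) \<Rightarrow> bool" where
  "nbr_enum G t ss us \<beta> \<longleftrightarrow>
     distinct ss \<and> set ss = {s. \<exists>\<gamma>\<in>arcs G. tail G \<gamma> = s \<and> head G \<gamma> = t} \<and>
     distinct us \<and> set us = {u. \<exists>\<gamma>\<in>arcs G. tail G \<gamma> = t \<and> head G \<gamma> = u} \<and>
     (\<forall>i < length ss. distinct (\<beta> i) \<and>
        set (\<beta> i) = {\<gamma> \<in> arcs G. tail G \<gamma> = ss ! i \<and> head G \<gamma> = t}) \<and>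
     (\<forall>i < length us. distinct (\<beta> (length ss + i)) \<and>
        set (\<beta> (length ss + i)) = {\<gamma> \<in> arcs G. tail G \<gamma> = t \<and> head G \<gamma> = us ! i})"

definition nbr_V ::
  "('v, 'e) pre_digraph \<Rightarrow> ('e \<Rightarrow> 'k) \<Rightarrow> ('e \<Rightarrow> 'k) \<Rightarrow> nat \<Rightarrow> 'v list \<Rightarrow> 'v list
     \<Rightarrow> nat \<Rightarrow> (('v, 'e + 'e) qpath \<Rightarrow>\<^sub>0 'k::field) set set" where
  "nbr_V G a b d ss us i =
     (if i < length ss then preproj_V G a b (ss ! i) (d - 1)
      else preproj_V G a b (us ! (i - length ss)) d)"

definition nbr_W ::
  "('v, 'e) pre_digraph \<Rightarrow> ('e \<Rightarrow> 'k) \<Rightarrow> ('e \<Rightarrow> 'k) \<Rightarrow> 'v list \<Rightarrow> (nat \<Rightarrow> 'e list)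
     \<Rightarrow> nat \<Rightarrow> (('v, 'e + 'e) qpath \<Rightarrow>\<^sub>0 'k::field) set set" where
  "nbr_W G a b ss \<beta> i =
     LinearCombinations.module.span class_ring (preproj_algebra G a b)
       ((\<lambda>\<gamma>. preproj_arrow G a b (if i < length ss then Inr \<gamma> else Inl \<gamma>)) ` set (\<beta> i))"

definition nbr_x ::
  "('v, 'e) pre_digraph \<Rightarrow> ('e \<Rightarrow> 'k) \<Rightarrow> ('e \<Rightarrow> 'k) \<Rightarrow> 'v list \<Rightarrow> (nat \<Rightarrow> 'e list)
     \<Rightarrow> nat \<Rightarrow> nat \<Rightarrow> (('v, 'e + 'e) qpath \<Rightarrow>\<^sub>0 'k::field) set" where
  "nbr_x G a b ss \<beta> i j =
     (let P = preproj_algebra G a b; \<gamma> = \<beta> i ! j in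
      if i < length ss then (- b \<gamma>) \<odot>\<^bsub>P\<^esub> preproj_arrow G a b (Inr \<gamma>)
      else a \<gamma> \<odot>\<^bsub>P\<^esub> preproj_arrow G a b (Inl \<gamma>))"

text \<open>The affine space \<open>B'\<close>; the entry in position \<open>p\<close> of the row vector \<open>b'\<^sub>i\<close> is \<open>b' i p\<close>.\<close>

definition nbr_B ::
  "('k::field, 'c, 'd) module_scheme \<Rightarrow> nat \<Rightarrow> (nat \<Rightarrow> 'c set) \<Rightarrow> (nat \<Rightarrow> nat \<Rightarrow> 'c) set" where
  "nbr_B P l V = (\<Pi>\<^sub>E i\<in>{..<l}. \<Pi>\<^sub>E p\<in>{..<subspace_dim P (V i)}. V i)"

text \<open>The product \<open>r m x\<close> of a row vector \<open>r\<close> over the algebra \<open>P\<close>, a scalar matrix \<open>m\<close> and a column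
  vector \<open>x\<close> over \<open>P\<close>.\<close>

definition row_mat_col ::
  "('k::field, 'c, 'd) module_scheme \<Rightarrow> (nat \<Rightarrow> 'c) \<Rightarrow> 'k mat \<Rightarrow> (nat \<Rightarrow> 'c) \<Rightarrow> 'c" where
  "row_mat_col P r m x =
     (\<Oplus>\<^bsub>P\<^esub> q\<in>{..<dim_col m}. (\<Oplus>\<^bsub>P\<^esub> p\<in>{..<dim_row m}. (m $$ (p, q)) \<odot>\<^bsub>P\<^esub> r p) \<otimes>\<^bsub>P\<^esub> x q)"


section \<open>The Zariski topology\<close>

inductive_set poly_funs :: "('b \<Rightarrow> 'k::comm_ring_1) set \<Rightarrow> ('b \<Rightarrow> 'k) set"
  for L :: "('b \<Rightarrow> 'k) set" where
  const: "(\<lambda>_. c) \<in> poly_funs L"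
| coord: "f \<in> L \<Longrightarrow> f \<in> poly_funs L"
| add: "f \<in> poly_funs L \<Longrightarrow> g \<in> poly_funs L \<Longrightarrow> (\<lambda>x. f x + g x) \<in> poly_funs L"
| mult: "f \<in> poly_funs L \<Longrightarrow> g \<in> poly_funs L \<Longrightarrow> (\<lambda>x. f x * g x) \<in> poly_funs L"

text \<open>The topology on \<open>X\<close> whose closed sets are the common zero sets of families of polynomials in the
  coordinate functions \<open>L\<close>.\<close>

definition zariski_topology :: "'b set \<Rightarrow> ('b \<Rightarrow> 'k::idom) set \<Rightarrow> 'b topology" where
  "zariski_topology X L =
     topology (\<lambda>U. \<exists>F \<subseteq> poly_funs L. U = X - {x \<in> X. \<forall>f\<in>F. f x = 0})"

lemma openin_zariski_topology:
  "openin (zariski_topology X L) U \<longleftrightarrow>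
     (\<exists>F \<subseteq> poly_funs L. U = X - {x \<in> X. \<forall>f\<in>F. f x = 0})"
proof -
  have "istopology (\<lambda>U. \<exists>F \<subseteq> poly_funs L. U = X - {x \<in> X. \<forall>f\<in>F. f x = 0})"
    (is "istopology ?O")
    unfolding istopology_def
  proof (intro conjI allI impI)
    fix S T assume "?O S" "?O T"
    then obtain F H where FH: "F \<subseteq> poly_funs L" "H \<subseteq> poly_funs L"
      and S: "S = X - {x \<in> X. \<forall>f\<in>F. f x = 0}" and T: "T = X - {x \<in> X. \<forall>f\<in>H. f x = 0}"
      by (elim exE conjE)
    let ?K = "(\<lambda>(f, g) x. f x * g x) ` (F \<times> H)"
    have "?K \<subseteq> poly_funs L"
      using FH by (auto intro: poly_funs.mult)
    moreover have "S \<inter> T = X - {x \<in> X. \<forall>f\<in>?K. f x = 0}"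
      unfolding S T by (auto simp: split_beta)
    ultimately show "?O (S \<inter> T)" by (intro exI[of _ ?K] conjI)
  next
    fix \<K> assume "\<forall>K\<in>\<K>. ?O K"
    then obtain F where F: "\<forall>K\<in>\<K>. F K \<subseteq> poly_funs L \<and> K = X - {x \<in> X. \<forall>f\<in>F K. f x = 0}"
      by (rule bchoice[THEN exE])
    let ?F = "\<Union>K\<in>\<K>. F K"
    have K: "y \<in> K \<longleftrightarrow> y \<in> X \<and> (\<exists>f\<in>F K. f y \<noteq> 0)" if "K \<in> \<K>" for K y
    proof -
      have "K = X - {x \<in> X. \<forall>f\<in>F K. f x = 0}" using F that by simp
      then have "y \<in> K \<longleftrightarrow> y \<in> X - {x \<in> X. \<forall>f\<in>F K. f x = 0}" by (rule arg_cong)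
      then show ?thesis by (rule trans) (simp cong: conj_cong)
    qed
    have "?F \<subseteq> poly_funs L" using F by (intro UN_least) simp
    moreover have "\<Union>\<K> = X - {x \<in> X. \<forall>f\<in>?F. f x = 0}"
      by (rule Set.set_eqI) (auto simp: K)
    ultimately show "?O (\<Union>\<K>)" by (intro exI[of _ ?F] conjI)
  qed
  then show ?thesis
    unfolding zariski_topology_def by (simp add: topology_inverse')
qed

lemma topspace_zariski_topology: "topspace (zariski_topology X L) = X"
proof
  show "topspace (zariski_topology X L) \<subseteq> X"
    using openin_topspace[of "zariski_topology X L"] unfolding openin_zariski_topology by auto
  have "openin (zariski_topology X L) X"
    unfolding openin_zariski_topology
    by (rule exI[of _ "{\<lambda>_. 1}"]) (auto intro: poly_funs.const)
  then show "X \<subseteq> topspace (zariski_topology X L)"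
    by (rule openin_subset)
qed

definition scalar_module :: "('k::comm_ring_1, 'k) module" where
  "scalar_module =
     \<lparr> carrier = UNIV, mult = (*), one = 1, zero = 0, add = (+), smult = (*) \<rparr>"

text \<open>The coordinate functions on \<open>B'\<close>: all linear functionals on all entries.  Choosing bases of the
  \<open>V\<^sub>i\<close> gives linear coordinates that generate the same algebra of polynomial functions.\<close>

definition nbr_B_coords ::
  "('k::field, 'c, 'd) module_scheme \<Rightarrow> nat \<Rightarrow> (nat \<Rightarrow> 'c set)
     \<Rightarrow> ((nat \<Rightarrow> nat \<Rightarrow> 'c) \<Rightarrow> 'k) set" where
  "nbr_B_coords P l V =
     {\<lambda>b'. \<phi> (b' i p) | \<phi> i p. i < l \<and> p < subspace_dim P (V i) \<and>
        \<phi> \<in> module_hom class_ring (P\<lparr>carrier := V i\<rparr>) scalar_module}"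

definition nbr_B_zariski ::
  "('k::field, 'c, 'd) module_scheme \<Rightarrow> nat \<Rightarrow> (nat \<Rightarrow> 'c set) \<Rightarrow> (nat \<Rightarrow> nat \<Rightarrow> 'c) topology" where
  "nbr_B_zariski P l V = zariski_topology (nbr_B P l V) (nbr_B_coords P l V)"

end

theory Submission
  imports Defs
begin

text \<open>
  Over the path algebra of \<open>\<Gamma>\<close> the module \<open>V\<^sup>t\<^sub>d\<close> is \<open>\<tau>\<^sup>-\<^sup>d\<close> of the projective module at \<open>t\<close>, and right
  multiplication by the arrows at \<open>t\<close> gives the almost split sequence
  \<open>V\<^sup>t\<^sub>d \<rightarrow> \<Oplus>\<^sub>i V\<^sub>i \<otimes> W\<^sub>i \<rightarrow> V\<^sup>t\<^sub>d\<^sub>+\<^sub>1\<close>. Homomorphisms between these modules lift along \<open>\<tau>\<^sup>-\<close>, so that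
  endomorphisms are scalars, and irreducible maps are injective or surjective. As a consequence, for
  \<open>0 \<noteq> x \<in> V\<^sup>t\<^sub>d\<close> the elements obtained by replacing the \<open>V\<^sub>i\<close>-components of the image of \<open>x\<close> by arbitrary
  elements span \<open>V\<^sup>t\<^sub>d\<^sub>+\<^sub>1\<close>.

  The vectors \<open>b'\<^sub>i m(i, j) x\<^sub>i\<close> are the columns of a square matrix that is linear in \<open>b'\<close>. Let its rank be
  maximal at \<open>b'\<close>, where every \<open>b'\<^sub>i\<close> may be taken to be a basis of \<open>V\<^sub>i\<close>. Every matrix of the family then
  maps the kernel into the image. A nonzero vector of the kernel comes from some \<open>x \<noteq> 0\<close> by exactness,
  and varying \<open>b'\<close> shows that the image is all of \<open>V\<^sup>t\<^sub>d\<^sub>+\<^sub>1\<close>, a contradiction. So the determinant is not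
  identically zero, and its nonvanishing set is dense since one can restrict to lines.
\<close>

text \<open>Extensions over k\<Gamma> are handled as families of linear maps
  \<open>c \<gamma>\<close>, one for each arrow, modulo the coboundaries
  \<open>a \<gamma> \<gamma> k - b \<gamma> k \<gamma>\<close>. A homomorphism out of
  \<open>V\<^sup>t\<^sub>d\<^sub>+\<^sub>1\<close> is determined by its values
  \<open>\<psi> \<gamma>\<close> on the elements \<open>\<gamma>\<^sup>* x\<close>, and the sum of
  the traces of \<open>c \<gamma> \<psi> \<gamma>\<close> pairs extensions with homomorphisms, since
  it kills coboundaries. Together with the Fredholm alternative this stands in for the
  Auslander-Reiten formula; the lifting along \<open>\<tau>\<^sup>-\<close> and the vanishing of
  extensions come from it. Two \<open>k\<close> with the same coboundary differ by a map that
  commutes with the arrows only up to the factors a/b, so homomorphisms must be allowed a twist. The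
  almost split sequence enters as a cocycle with a single nonzero entry, placed where its pairing
  with the identity is not zero. If the elements of the overview spanned only a proper subspace,
  this class would split over a proper submodule containing them, and comparing splittings would
  force x = 0.\<close>

abbreviation lookup :: "('p \<Rightarrow>\<^sub>0 'k::zero) \<Rightarrow> 'p \<Rightarrow> 'k" where "lookup \<equiv> Poly_Mapping.lookup"
abbreviation keys :: "('p \<Rightarrow>\<^sub>0 'k::zero) \<Rightarrow> 'p set" where "keys \<equiv> Poly_Mapping.keys"

abbreviation pscale :: "'k::comm_ring_1 \<Rightarrow> ('p \<Rightarrow>\<^sub>0 'k) \<Rightarrow> ('p \<Rightarrow>\<^sub>0 'k)" (infixr "*\<^sub>p" 75) where
  "c *\<^sub>p f \<equiv> Poly_Mapping.map ((*) c) f"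

declare Poly_Mapping.map_single [simp del]

section \<open>Linear maps between spaces of finitely supported functions\<close>

lemma pscale_left_diff: "(c - c') *\<^sub>p (f :: 'p \<Rightarrow>\<^sub>0 'k::comm_ring_1) = c *\<^sub>p f - c' *\<^sub>p f"
  by (auto intro!: poly_mapping_eqI simp: lookup_scale lookup_minus left_diff_distrib)

lemma pscale_right_diff: "c *\<^sub>p (f - g :: 'p \<Rightarrow>\<^sub>0 'k::comm_ring_1) = c *\<^sub>p f - c *\<^sub>p g"
  by (auto intro!: poly_mapping_eqI simp: lookup_scale lookup_minus right_diff_distrib)

lemmas pscale_distribs = scale_distribs(1,2,6)

lemma pscale_0_left [simp]: "0 *\<^sub>p (f :: 'p \<Rightarrow>\<^sub>0 'k::comm_ring_1) = 0"
  by (auto intro!: poly_mapping_eqI simp: lookup_scale)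

lemma pscale_0_right [simp]: "c *\<^sub>p (0 :: 'p \<Rightarrow>\<^sub>0 'k::comm_ring_1) = 0"
  by (rule scale_distribs)

lemma pscale_one [simp]: "1 *\<^sub>p (f :: 'p \<Rightarrow>\<^sub>0 'k::comm_ring_1) = f"
  by (rule scale_distribs)

lemma pscale_pscale [simp]: "c *\<^sub>p c' *\<^sub>p (f :: 'p \<Rightarrow>\<^sub>0 'k::comm_ring_1) = (c * c') *\<^sub>p f"
  by (simp add: scale_distribs)

lemma pscale_sum: "c *\<^sub>p (\<Sum>s\<in>S. f s :: 'p \<Rightarrow>\<^sub>0 'k::comm_ring_1) = (\<Sum>s\<in>S. c *\<^sub>p f s)"
  by (induction S rule: infinite_finite_induct) (auto simp: pscale_distribs)

interpretation pm: vector_space "\<lambda>c f. c *\<^sub>p (f :: 'p \<Rightarrow>\<^sub>0 'k::field)"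
  by unfold_locales (auto simp: pscale_distribs)

text \<open>A bare predicate over any commutative ring: linearity of the many composites below is
  then obtained by chaining rules.\<close>

definition linmap :: "(('p \<Rightarrow>\<^sub>0 'k::comm_ring_1) \<Rightarrow> ('q \<Rightarrow>\<^sub>0 'k)) \<Rightarrow> bool" where
  "linmap F \<longleftrightarrow> (\<forall>x y. F (x + y) = F x + F y) \<and> (\<forall>c x. F (c *\<^sub>p x) = c *\<^sub>p F x)"

lemma linmapI: "(\<And>x y. F (x + y) = F x + F y) \<Longrightarrow> (\<And>c x. F (c *\<^sub>p x) = c *\<^sub>p F x) \<Longrightarrow> linmap F"
  by (auto simp: linmap_def)

lemma linmap_add: "linmap F \<Longrightarrow> F (x + y) = F x + F y"
  and linmap_scale: "linmap F \<Longrightarrow> F (c *\<^sub>p x) = c *\<^sub>p F x"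
  by (auto simp: linmap_def)

lemma linmap_0: "linmap F \<Longrightarrow> F 0 = 0"
  using linmap_scale[of F 0 0] by simp

lemma linmap_diff: "linmap F \<Longrightarrow> F (x - y) = F x - F y"
  using linmap_add[of F "x - y" y] by simp

lemma linmap_uminus: "linmap F \<Longrightarrow> F (- x) = - F x"
  using linmap_diff[of F 0 x] linmap_0[of F] by simp

lemma linmap_sum: "linmap F \<Longrightarrow> F (\<Sum>s\<in>S. f s) = (\<Sum>s\<in>S. F (f s))"
  by (induction S rule: infinite_finite_induct) (auto simp: linmap_add linmap_0)

lemma linmap_id: "linmap (\<lambda>x. x)"
  by (simp add: linmap_def)

lemma linmap_zero: "linmap (\<lambda>x. 0)"
  by (simp add: linmap_def)

lemma linmap_comp: "linmap F \<Longrightarrow> linmap F' \<Longrightarrow> linmap (\<lambda>x. F (F' x))"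
  by (simp add: linmap_def)

lemma linmap_plus: "linmap F \<Longrightarrow> linmap F' \<Longrightarrow> linmap (\<lambda>x. F x + F' x)"
  by (simp add: linmap_def pscale_distribs)

lemma linmap_minus: "linmap F \<Longrightarrow> linmap F' \<Longrightarrow> linmap (\<lambda>x. F x - F' x)"
  by (simp add: linmap_def pscale_right_diff)

lemma linmap_scaled: "linmap F \<Longrightarrow> linmap (\<lambda>x. c *\<^sub>p F x)"
  by (simp add: linmap_def pscale_distribs mult.commute)

lemma linmap_sums: "(\<And>s. s \<in> S \<Longrightarrow> linmap (F s)) \<Longrightarrow> linmap (\<lambda>x. \<Sum>s\<in>S. F s x)"
  by (induction S rule: infinite_finite_induct) (auto intro: linmap_zero linmap_plus)

lemma linmap_coord: "linmap (\<lambda>x. lookup x p *\<^sub>p f)"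
  by (simp add: linmap_def lookup_add lookup_scale pscale_distribs)

abbreviation sg :: "'p \<Rightarrow> 'p \<Rightarrow>\<^sub>0 'k::comm_ring_1" where
  "sg p \<equiv> Poly_Mapping.single p 1"

lemma sum_sg: "(f :: 'p \<Rightarrow>\<^sub>0 'k::comm_ring_1) = (\<Sum>p\<in>keys f. lookup f p *\<^sub>p sg p)"
  by (rule poly_mapping_eqI)
    (simp add: lookup_sum lookup_scale lookup_single when_def if_distrib[of "\<lambda>x. _ * x"] sum.delta' in_keys_iff cong: if_cong)

lemma sum_sg_superset:
  assumes "finite A" "keys (f :: 'p \<Rightarrow>\<^sub>0 'k::comm_ring_1) \<subseteq> A"
  shows "f = (\<Sum>p\<in>A. lookup f p *\<^sub>p sg p)"
  by (subst sum_sg, rule sum.mono_neutral_left) (use assms in \<open>auto simp: in_keys_iff\<close>)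

lemma linmap_expand:
  assumes "linmap F" "finite A" "keys f \<subseteq> A"
  shows "F f = (\<Sum>p\<in>A. lookup f p *\<^sub>p F (sg p))"
  by (subst sum_sg_superset[OF assms(2,3)]) (simp add: linmap_sum[OF assms(1)] linmap_scale[OF assms(1)])

text \<open>Statements about supports express the grading; this reduces them to single
  paths.\<close>

lemma keys_in_linmap:
  fixes F :: "('p \<Rightarrow>\<^sub>0 'k::comm_ring_1) \<Rightarrow> ('q \<Rightarrow>\<^sub>0 'k)"
  assumes "linmap F" "\<And>p. p \<in> S \<Longrightarrow> keys (F (sg p)) \<subseteq> T" "keys f \<subseteq> S"
  shows "keys (F f) \<subseteq> T"
  by (subst linmap_expand[OF assms(1) finite_keys order_refl])
    (intro order_trans[OF Poly_Mapping.keys_sum] UN_least order_trans[OF keys_scale] assms(2), use assms(3) in auto)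

lemma linmap_eq_on:
  fixes F :: "('p \<Rightarrow>\<^sub>0 'k::comm_ring_1) \<Rightarrow> ('q \<Rightarrow>\<^sub>0 'k)"
  assumes "linmap F" "linmap F'" "\<And>p. p \<in> S \<Longrightarrow> F (sg p) = F' (sg p)" "keys f \<subseteq> S"
  shows "F f = F' f"
  using linmap_expand[OF assms(1) finite_keys order_refl, of f]
    linmap_expand[OF assms(2) finite_keys order_refl, of f] assms(3,4)
  by (auto intro!: sum.cong)

lemma linmap_eq:
  "linmap F \<Longrightarrow> linmap F' \<Longrightarrow> (\<And>p. F (sg p) = F' (sg p)) \<Longrightarrow> F f = F' f"
  by (rule linmap_eq_on[where S = UNIV]) auto

lemma in_subspace_linmap:
  fixes F :: "('p \<Rightarrow>\<^sub>0 'k::field) \<Rightarrow> ('q \<Rightarrow>\<^sub>0 'k)"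
  assumes "pm.subspace S" "linmap F" "\<And>p. p \<in> A \<Longrightarrow> F (sg p) \<in> S" "keys f \<subseteq> A"
  shows "F f \<in> S"
  by (subst linmap_expand[OF assms(2) finite_keys order_refl])
    (intro pm.subspace_sum pm.subspace_scale assms(1,3), use assms(4) in auto)

definition lext :: "('p \<Rightarrow> 'q \<Rightarrow>\<^sub>0 'k) \<Rightarrow> ('p \<Rightarrow>\<^sub>0 'k) \<Rightarrow> ('q \<Rightarrow>\<^sub>0 'k::comm_ring_1)" where
  "lext g f = (\<Sum>p\<in>keys f. lookup f p *\<^sub>p g p)"

lemma lext_superset:
  assumes "finite A" "keys f \<subseteq> A"
  shows "lext g f = (\<Sum>p\<in>A. lookup f p *\<^sub>p g p)"
  unfolding lext_def by (rule sum.mono_neutral_left) (use assms in \<open>auto simp: in_keys_iff\<close>)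

lemma lext_sg [simp]: "lext g (sg p) = g p"
  by (subst lext_superset[of "{p}"]) auto

lemma linmap_lext [simp]: "linmap (lext (g :: 'p \<Rightarrow> 'q \<Rightarrow>\<^sub>0 'k::comm_ring_1))"
proof (rule linmapI)
  fix x y :: "'p \<Rightarrow>\<^sub>0 'k"
  let ?A = "keys x \<union> keys y"
  show "lext g (x + y) = lext g x + lext g y"
    using lext_superset[of ?A "x + y" g] lext_superset[of ?A x g] lext_superset[of ?A y g] Poly_Mapping.keys_add[of x y]
    by (simp add: lookup_add pscale_distribs sum.distrib)
next
  fix c and x :: "'p \<Rightarrow>\<^sub>0 'k"
  show "lext g (c *\<^sub>p x) = c *\<^sub>p lext g x"
    using lext_superset[of "keys x" "c *\<^sub>p x" g] keys_scale[of c x]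
    by (simp add: lext_def lookup_scale pscale_sum)
qed

text \<open>For a condition \<open>Q\<close> on start, end and degree of a path this is the
  projection to homogeneous components.\<close>

definition supp_restrict :: "('p \<Rightarrow> bool) \<Rightarrow> ('p \<Rightarrow>\<^sub>0 'k) \<Rightarrow> ('p \<Rightarrow>\<^sub>0 'k::comm_ring_1)" where
  "supp_restrict Q = lext (\<lambda>p. if Q p then sg p else 0)"

lemma linmap_supp_restrict [simp]: "linmap (supp_restrict Q)"
  by (simp add: supp_restrict_def)

lemma supp_restrict_sg: "supp_restrict Q (sg p) = (if Q p then sg p else 0)"
  by (simp add: supp_restrict_def)

lemma keys_supp_restrict: "keys (supp_restrict Q f) \<subseteq> {p \<in> keys f. Q p}"
  by (rule keys_in_linmap[of _ "keys f"]) (auto simp: supp_restrict_sg)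

lemma supp_restrict_id: "(\<And>p. p \<in> keys f \<Longrightarrow> Q p) \<Longrightarrow> supp_restrict Q f = f"
  using linmap_eq_on[OF linmap_supp_restrict linmap_id, of "keys f" Q f] by (auto simp: supp_restrict_sg)

lemma supp_restrict_none: "(\<And>p. p \<in> keys f \<Longrightarrow> \<not> Q p) \<Longrightarrow> supp_restrict Q f = 0"
  using linmap_eq_on[OF linmap_supp_restrict linmap_zero, of "keys f" Q f] by (auto simp: supp_restrict_sg)

subsection \<open>Path algebras\<close>

lemma qpath_mult_scale_left: "qpath_mult H (c *\<^sub>p f) g = c *\<^sub>p qpath_mult H f g"
proof (induction f rule: poly_mapping_single_induct[where A = UNIV])
  case (single p x)
  show ?case
    by (induction g rule: poly_mapping_single_induct[where A = UNIV])
      (auto simp: qpath_mult_add_right qpath_mult_single pscale_distribs mult.assoc)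
qed (auto simp: qpath_mult_add_left pscale_distribs)

lemma qpath_mult_scale_right: "qpath_mult H f (c *\<^sub>p g) = c *\<^sub>p qpath_mult H f g"
proof (induction f rule: poly_mapping_single_induct[where A = UNIV])
  case (single p x)
  show ?case
    by (induction g rule: poly_mapping_single_induct[where A = UNIV])
      (auto simp: qpath_mult_add_right qpath_mult_single pscale_distribs mult.left_commute[of x c])
qed (auto simp: qpath_mult_add_left pscale_distribs)

lemma linmap_mult_left: "linmap F \<Longrightarrow> linmap (\<lambda>f. qpath_mult H (F f) g)"
  and linmap_mult_right: "linmap F \<Longrightarrow> linmap (\<lambda>g. qpath_mult H f (F g))"
  by (auto simp: linmap_def qpath_mult_add_left qpath_mult_add_right qpath_mult_scale_left
    qpath_mult_scale_right)

lemma linmap_mult_right': "linmap (qpath_mult H f)"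
  using linmap_mult_right[OF linmap_id] .

lemma linmap_mult_left': "linmap (\<lambda>f. qpath_mult H f g)"
  using linmap_mult_left[OF linmap_id] .

lemma qpath_end_Nil [simp]: "qpath_end H (u, []) = u"
  by (simp add: qpath_end_def pre_digraph.awalk_verts.simps)

lemma awalk_verts_ne: "pre_digraph.awalk_verts H u es \<noteq> []"
  by (cases es) (simp_all add: pre_digraph.awalk_verts.simps)

lemma qpath_end_Cons: "qpath_end H (u, e # es) = qpath_end H (head H e, es)"
  by (simp add: qpath_end_def pre_digraph.awalk_verts.simps awalk_verts_ne)

lemma qpath_end_snoc [simp]: "qpath_end H (u, es @ [e]) = head H e"
  by (simp add: qpath_end_append qpath_end_Cons)

lemma (in wf_digraph) qpaths_Nil: "(u, []) \<in> qpaths G \<longleftrightarrow> u \<in> verts G"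
  by (auto simp: qpaths_def awalk_Nil_iff)

lemma (in wf_digraph) qpaths_Cons:
  "(u, e # es) \<in> qpaths G \<longleftrightarrow> e \<in> arcs G \<and> u = tail G e \<and> (head G e, es) \<in> qpaths G"
  by (auto simp: qpaths_def awalk_Cons_iff)

lemma (in wf_digraph) qpaths_append:
  "(u, es @ es') \<in> qpaths G \<longleftrightarrow> (u, es) \<in> qpaths G \<and> (qpath_end G (u, es), es') \<in> qpaths G"
proof (induction es arbitrary: u)
  case Nil
  have "u \<in> verts G" if "(u, es') \<in> qpaths G" using that by (auto simp: qpaths_def)
  then show ?case by (auto simp: qpaths_Nil)
qed (auto simp: qpaths_Cons qpath_end_Cons)

lemma (in wf_digraph) qpath_end_verts: "p \<in> qpaths G \<Longrightarrow> qpath_end G p \<in> verts G"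
  by (auto simp: qpaths_def qpath_end_def)

lemma (in wf_digraph) qpaths_snoc:
  "(u, es @ [e]) \<in> qpaths G \<longleftrightarrow> (u, es) \<in> qpaths G \<and> e \<in> arcs G \<and> tail G e = qpath_end G (u, es)"
  by (auto simp: qpaths_append qpaths_Cons qpaths_Nil)

lemma path_algebra_sel [simp]:
  "carrier (path_algebra H) = {f. keys f \<subseteq> qpaths H}"
  "mult (path_algebra H) = qpath_mult H"
  "add (path_algebra H) = (+)"
  "zero (path_algebra H) = 0"
  "smult (path_algebra H) = pscale"
  by (simp_all add: path_algebra_def)

section \<open>The double quiver and the ideal of relations\<close>

locale preproj = fin_digraph G for G :: "('v, 'e) pre_digraph" +
  fixes a b :: "'e \<Rightarrow> 'k::field"
  assumes no_cycle: "\<nexists>c. cycle c"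
    and a_nz: "\<gamma> \<in> arcs G \<Longrightarrow> a \<gamma> \<noteq> 0"
    and b_nz: "\<gamma> \<in> arcs G \<Longrightarrow> b \<gamma> \<noteq> 0"
begin

abbreviation H where "H \<equiv> double_quiver G"

sublocale H: fin_digraph H
  by (rule fin_digraph_double_quiver) unfold_locales

lemma H_simps [simp]:
  "verts H = verts G" "tail H (Inl \<gamma>) = tail G \<gamma>" "tail H (Inr \<gamma>) = head G \<gamma>"
  "head H (Inl \<gamma>) = head G \<gamma>" "head H (Inr \<gamma>) = tail G \<gamma>"
  "Inl \<gamma> \<in> arcs H \<longleftrightarrow> \<gamma> \<in> arcs G" "Inr \<gamma> \<in> arcs H \<longleftrightarrow> \<gamma> \<in> arcs G"
  by (auto simp: double_quiver_def)

abbreviation mul :: "(('v, 'e + 'e) qpath \<Rightarrow>\<^sub>0 'k) \<Rightarrow> _ \<Rightarrow> _" (infixl "\<star>" 70) where "f \<star> g \<equiv> qpath_mult H f g"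
abbreviation arr :: "'e + 'e \<Rightarrow> ('v, 'e + 'e) qpath \<Rightarrow>\<^sub>0 'k" where "arr \<equiv> arrow_elem H"
abbreviation pend where "pend \<equiv> qpath_end H"

text \<open>In this notation \<open>m\<^sub>t\<close> is the sum of all \<open>\<epsilon>\<^sub>\<alpha> \<alpha>\<^sup>* \<alpha>\<close> over the arrows \<open>\<alpha>\<close> of the double quiver that start in \<open>t\<close>.\<close>

fun bar :: "'e + 'e \<Rightarrow> 'e + 'e" where
  "bar (Inl \<gamma>) = Inr \<gamma>"
| "bar (Inr \<gamma>) = Inl \<gamma>"

fun eps :: "'e + 'e \<Rightarrow> 'k" where
  "eps (Inl \<gamma>) = a \<gamma>"
| "eps (Inr \<gamma>) = - b \<gamma>"

lemma bar_simps [simp]: "tail H (bar \<alpha>) = head H \<alpha>" "head H (bar \<alpha>) = tail H \<alpha>" "bar (bar \<alpha>) = \<alpha>"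
  "bar \<alpha> \<in> arcs H \<longleftrightarrow> \<alpha> \<in> arcs H"
  by (cases \<alpha>; simp)+

lemma eps_nz: "\<alpha> \<in> arcs H \<Longrightarrow> eps \<alpha> \<noteq> 0"
  by (cases \<alpha>) (auto simp: a_nz b_nz)

lemma arr_mult_sg: "arr \<alpha> \<star> sg q = (if pend q = tail H \<alpha> then sg (fst q, snd q @ [\<alpha>]) else 0)"
  by (auto simp: arrow_elem_def qpath_mult_single)

lemma sg_mult_arr: "sg q \<star> arr \<alpha> = (if head H \<alpha> = fst q then sg (tail H \<alpha>, \<alpha> # snd q) else 0)"
  by (auto simp: arrow_elem_def qpath_mult_single qpath_end_Cons)

lemma sg_mult_sg: "sg p \<star> sg q = (if pend q = fst p then sg (fst q, snd q @ snd p) else (0 :: _ \<Rightarrow>\<^sub>0 'k))"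
  by (simp add: qpath_mult_single)

definition rel :: "('v, 'e + 'e) qpath \<Rightarrow>\<^sub>0 'k" where
  "rel = (\<Sum>\<alpha>\<in>arcs H. eps \<alpha> *\<^sub>p sg (tail H \<alpha>, [\<alpha>, bar \<alpha>]))"

lemma arcs_H: "arcs H = Inl ` arcs G \<union> Inr ` arcs G"
  by (auto simp: double_quiver_def)

lemma sum_arcs_H: "(\<Sum>\<alpha>\<in>arcs H. f \<alpha>) = (\<Sum>\<gamma>\<in>arcs G. f (Inl \<gamma>)) + (\<Sum>\<gamma>\<in>arcs G. f (Inr \<gamma>) :: 'z::comm_monoid_add)"
  unfolding arcs_H by (subst sum.union_disjoint) (auto simp: sum.reindex)

lemma sum_by_key:
  assumes "\<And>x. x \<in> S \<Longrightarrow> k x \<in> T" "finite S" "finite T"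
  shows "(\<Sum>t\<in>T. \<Sum>x\<in>{x \<in> S. k x = t}. f x) = sum f S"
proof -
  have "(\<Sum>t\<in>T. \<Sum>x\<in>{x \<in> S. k x = t}. f x) = sum f (\<Union>t\<in>T. {x \<in> S. k x = t})"
    by (rule sum.UNION_disjoint[symmetric]) (use assms in auto)
  also have "(\<Union>t\<in>T. {x \<in> S. k x = t}) = S"
    using assms by auto
  finally show ?thesis .
qed

lemma rel_eq: "(\<Sum>t\<in>verts G. preproj_relation G a b t) = rel"
proof -
  have "(\<Sum>t\<in>verts G. preproj_relation G a b t) =
    (\<Sum>\<gamma>\<in>arcs G. a \<gamma> *\<^sub>p (arr (Inr \<gamma>) \<star> arr (Inl \<gamma>))) - (\<Sum>\<gamma>\<in>arcs G. b \<gamma> *\<^sub>p (arr (Inl \<gamma>) \<star> arr (Inr \<gamma>)))"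
    by (simp add: preproj_relation_def Let_def sum_subtractf sum_by_key)
  also have "\<dots> = rel"
    by (simp add: rel_def sum_arcs_H arrow_elem_def qpath_mult_single qpath_end_Cons sum_negf)
  finally show ?thesis .
qed

text \<open>The ideal as a span of explicit vectors, which admits induction over generators;
  \<open>Idl\<close> is an intersection of ideals and does not. The two are identified in
  \<open>ideal_eq_J\<close>.\<close>

definition J :: "(('v, 'e + 'e) qpath \<Rightarrow>\<^sub>0 'k) set" where
  "J = pm.span {sg p \<star> rel \<star> sg q | p q. p \<in> qpaths H \<and> q \<in> qpaths H}"

lemma subspace_J: "pm.subspace J"
  by (simp add: J_def)

lemma J_add: "f \<in> J \<Longrightarrow> g \<in> J \<Longrightarrow> f + g \<in> J"
  and J_diff: "f \<in> J \<Longrightarrow> g \<in> J \<Longrightarrow> f - g \<in> J"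
  and J_scale: "f \<in> J \<Longrightarrow> c *\<^sub>p f \<in> J"
  and J_0 [simp]: "0 \<in> J"
  and J_sum: "(\<And>s. s \<in> S \<Longrightarrow> F s \<in> J) \<Longrightarrow> sum F S \<in> J"
  using subspace_J by (auto intro: pm.subspace_add pm.subspace_diff pm.subspace_scale pm.subspace_0 pm.subspace_sum)

lemma J_scale_iff: "c \<noteq> 0 \<Longrightarrow> c *\<^sub>p f \<in> J \<longleftrightarrow> f \<in> J"
  using J_scale[of f c] J_scale[of "c *\<^sub>p f" "inverse c"] by auto

lemma J_gen: "p \<in> qpaths H \<Longrightarrow> q \<in> qpaths H \<Longrightarrow> sg p \<star> rel \<star> sg q \<in> J"
  unfolding J_def by (rule pm.span_base) blast

text \<open>The map \<open>F\<close> is built into the rule because what is proved is usually that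
  an image of \<open>f\<close> (a product, a homogeneous component, a reweighting) stays in
  \<open>J\<close>, or, with \<open>S = {0}\<close>, that it vanishes.\<close>

lemma J_induct:
  assumes "f \<in> J" "linmap F" "pm.subspace S"
    and "\<And>p q. p \<in> qpaths H \<Longrightarrow> q \<in> qpaths H \<Longrightarrow> F (sg p \<star> rel \<star> sg q) \<in> S"
  shows "F f \<in> S"
  using assms(1) unfolding J_def
proof (induction rule: pm.span_induct_alt)
  case base show ?case using assms(2,3) by (simp add: linmap_0 pm.subspace_0)
next
  case (step c x y)
  then show ?case
    using assms(2-4) by (auto simp: linmap_add linmap_scale intro!: pm.subspace_add pm.subspace_scale)
qed

lemma qpaths_comp: "p \<in> qpaths H \<Longrightarrow> q \<in> qpaths H \<Longrightarrow> pend q = fst p \<Longrightarrow> (fst q, snd q @ snd p) \<in> qpaths H"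
  by (cases p; cases q) (simp add: H.qpaths_append)

lemma mult_J_left: "f \<in> J \<Longrightarrow> keys g \<subseteq> qpaths H \<Longrightarrow> g \<star> f \<in> J"
proof (erule in_subspace_linmap[OF subspace_J linmap_mult_left', rotated])
  fix r assume r: "r \<in> qpaths H" and "f \<in> J"
  from this(2) show "sg r \<star> f \<in> J"
  proof (rule J_induct[OF _ linmap_mult_right' subspace_J])
    fix p q assume pq: "p \<in> qpaths H" "q \<in> qpaths H"
    show "sg r \<star> (sg p \<star> rel \<star> sg q) \<in> J"
      using pq r J_gen[OF qpaths_comp[of r p] pq(2)]
      by (simp add: qpath_mult_assoc[symmetric] sg_mult_sg)
  qed
qed

lemma mult_J_right: "f \<in> J \<Longrightarrow> keys g \<subseteq> qpaths H \<Longrightarrow> f \<star> g \<in> J"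
proof (erule in_subspace_linmap[OF subspace_J linmap_mult_right', rotated])
  fix r assume r: "r \<in> qpaths H" and "f \<in> J"
  from this(2) show "f \<star> sg r \<in> J"
  proof (rule J_induct[OF _ linmap_mult_left' subspace_J])
    fix p q assume pq: "p \<in> qpaths H" "q \<in> qpaths H"
    show "sg p \<star> rel \<star> sg q \<star> sg r \<in> J"
      using pq r J_gen[OF pq(1) qpaths_comp[of q r]]
      by (simp add: qpath_mult_assoc sg_mult_sg)
  qed
qed

lemma rel_keys: "keys rel \<subseteq> qpaths H"
  unfolding rel_def
proof (intro order_trans[OF Poly_Mapping.keys_sum] UN_least order_trans[OF keys_scale])
  fix \<alpha> assume "\<alpha> \<in> arcs H"
  then show "keys (sg (tail H \<alpha>, [\<alpha>, bar \<alpha>]) :: _ \<Rightarrow>\<^sub>0 'k) \<subseteq> qpaths H"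
    using H.tail_in_verts[of \<alpha>] by (simp add: H.qpaths_Cons H.qpaths_Nil)
qed

lemma J_keys: "f \<in> J \<Longrightarrow> keys f \<subseteq> qpaths H"
proof -
  have sub: "pm.subspace {f :: _ \<Rightarrow>\<^sub>0 'k. keys f \<subseteq> qpaths H}"
    unfolding pm.subspace_def using Poly_Mapping.keys_add keys_scale by (fastforce simp: subset_iff)
  assume f: "f \<in> J"
  have "f \<in> {f :: _ \<Rightarrow>\<^sub>0 'k. keys f \<subseteq> qpaths H}"
  proof (rule J_induct[OF f linmap_id sub])
    fix p q assume "p \<in> qpaths H" "q \<in> qpaths H"
    then show "sg p \<star> rel \<star> sg q \<in> {f :: _ \<Rightarrow>\<^sub>0 'k. keys f \<subseteq> qpaths H}"
      using keys_qpath_mult[OF H.wf_digraph_axioms keys_qpath_mult[OF H.wf_digraph_axioms _ rel_keys], of "sg p" "sg q"]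
      by simp
  qed
  then show ?thesis by simp
qed

lemma ring_A: "ring (path_algebra H :: ('k, ('v, 'e + 'e) qpath \<Rightarrow>\<^sub>0 'k) module)"
  by (rule ring_path_algebra) (rule H.fin_digraph_axioms)

lemma rel_in_J: "rel \<in> J"
proof -
  let ?e = "(\<Sum>v\<in>verts G. sg (v, [])) :: _ \<Rightarrow>\<^sub>0 'k"
  interpret A: ring "path_algebra H :: ('k, ('v, 'e + 'e) qpath \<Rightarrow>\<^sub>0 'k) module" by (rule ring_A)
  have e: "?e = \<one>\<^bsub>path_algebra H\<^esub>" by (simp add: path_algebra_def)
  have suml: "qpath_mult H (sum F S) g = (\<Sum>s\<in>S. qpath_mult H (F s) g)" for F S and g :: "_ \<Rightarrow>\<^sub>0 'k"
    by (rule linmap_sum[OF linmap_mult_left'])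
  \<comment> \<open>The unit is the sum of the trivial paths, so inserting it on both sides writes
    \<open>rel\<close> through the generators of \<open>J\<close>.\<close>
  have "rel = ?e \<star> rel \<star> ?e"
    using A.l_one[of rel] A.r_one[of rel] rel_keys by (simp add: e)
  also have "\<dots> = (\<Sum>v\<in>verts G. \<Sum>w\<in>verts G. sg (v, []) \<star> rel \<star> sg (w, []))"
    by (subst sum.swap) (simp add: suml linmap_sum[OF linmap_mult_right'])
  also have "\<dots> \<in> J"
    by (intro J_sum J_gen) (auto simp: H.qpaths_Nil)
  finally show ?thesis .
qed

lemma ideal_eq_J: "preproj_ideal G a b = J"
proof
  interpret A: ring "path_algebra H :: ('k, ('v, 'e + 'e) qpath \<Rightarrow>\<^sub>0 'k) module" by (rule ring_A)
  have uminus: "\<ominus>\<^bsub>path_algebra H\<^esub> x = - x" if "keys x \<subseteq> qpaths H" for x :: "_ \<Rightarrow>\<^sub>0 'k"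
    by (rule A.minus_equality) (use that in auto)
  have "ideal J (path_algebra H)"
  proof (rule idealI)
    show "subgroup J (add_monoid (path_algebra H))"
    proof (rule subgroup.intro)
      show "J \<subseteq> carrier (add_monoid (path_algebra H))" using J_keys by auto
    next
      fix x assume x: "x \<in> J"
      have "\<ominus>\<^bsub>path_algebra H\<^esub> x \<in> J"
        using uminus[OF J_keys[OF x]] J_diff[OF J_0 x] by simp
      then show "inv\<^bsub>add_monoid (path_algebra H)\<^esub> x \<in> J" by (simp add: a_inv_def)
    qed (auto intro: J_add)
  qed (auto simp: A.ring_axioms intro: mult_J_left mult_J_right)
  then show "preproj_ideal G a b \<subseteq> J"
    unfolding preproj_ideal_def rel_eq by (rule A.genideal_minimal) (simp add: rel_in_J)
next
  interpret I: ideal "preproj_ideal G a b" "path_algebra H"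
    by (rule ideal_preproj_ideal) unfold_locales
  have "rel \<in> preproj_ideal G a b"
    unfolding preproj_ideal_def rel_eq using rel_keys by (intro I.genideal_self') simp
  then have gens: "sg p \<star> rel \<star> sg q \<in> preproj_ideal G a b" if "p \<in> qpaths H" "q \<in> qpaths H" for p q
    using that I.I_l_closed I.I_r_closed by simp
  have "pm.subspace (preproj_ideal G a b)"
    unfolding pm.subspace_def
  proof (intro conjI allI impI ballI)
    show "0 \<in> preproj_ideal G a b"
      using additive_subgroup.zero_closed[OF I.additive_subgroup_axioms] by simp
    fix x y assume x: "x \<in> preproj_ideal G a b"
    then have xc: "keys x \<subseteq> qpaths H" using I.a_subset by auto
    \<comment> \<open>A ring ideal carries no scalar action of its own; scaling by \<open>c\<close>
      is multiplication by \<open>c\<close> times the unit.\<close>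
    have "c *\<^sub>p x = (c *\<^sub>p (\<one>\<^bsub>path_algebra H\<^esub>)) \<star> x" for c
      using scale_eq_mult[OF H.fin_digraph_axioms xc] by (simp add: path_algebra_def)
    moreover have "keys (c *\<^sub>p (\<one>\<^bsub>path_algebra H\<^esub> :: _ \<Rightarrow>\<^sub>0 'k)) \<subseteq> qpaths H" for c
      using keys_scale I.one_closed by fastforce
    ultimately show "c *\<^sub>p x \<in> preproj_ideal G a b" for c
      using I.I_l_closed[OF x] by simp
    assume "y \<in> preproj_ideal G a b"
    then show "x + y \<in> preproj_ideal G a b"
      using additive_subgroup.a_closed[OF I.additive_subgroup_axioms x] by simp
  qed
  then show "J \<subseteq> preproj_ideal G a b"
    unfolding J_def by (intro pm.span_minimal) (auto simp: gens)
qed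

subsection \<open>Grading and normal forms\<close>

definition deg :: "'e + 'e \<Rightarrow> nat" where
  "deg \<alpha> = (if isl \<alpha> then 0 else 1)"

lemma deg_simps [simp]: "deg (Inl \<gamma>) = 0" "deg (Inr \<gamma>) = 1" "deg (bar \<alpha>) = 1 - deg \<alpha>"
  by (simp_all add: deg_def) (cases \<alpha>; simp)

lemma deg_le_1: "deg \<alpha> \<le> 1"
  by (simp add: deg_def)

definition ldeg :: "('e + 'e) list \<Rightarrow> nat" where
  "ldeg es = length (filter (\<lambda>e. \<not> isl e) es)"

lemma ldeg_simps [simp]:
  "ldeg [] = 0" "ldeg (\<alpha> # es) = deg \<alpha> + ldeg es" "ldeg (es @ es') = ldeg es + ldeg es'"
  by (auto simp: ldeg_def deg_def)

lemma star_degree_ldeg [simp]: "star_degree p = ldeg (snd p)"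
  by (simp add: star_degree_def ldeg_def)

text \<open>\<open>J\<close> is homogeneous for these three data, so passing to normal forms
  preserves them (\<open>keys_nf_sg\<close>).\<close>

definition path_class :: "('v, 'e + 'e) qpath \<Rightarrow> 'v \<times> 'v \<times> nat" where
  "path_class p = (fst p, pend p, star_degree p)"

lemma gen_eq: "sg p \<star> rel \<star> sg q = (\<Sum>\<alpha>\<in>arcs H. eps \<alpha> *\<^sub>p
    (if tail H \<alpha> = fst p \<and> pend q = tail H \<alpha> then sg (fst q, snd q @ [\<alpha>, bar \<alpha>] @ snd p) else 0))"
  unfolding rel_def linmap_sum[OF linmap_mult_right'] linmap_sum[OF linmap_mult_left']
    qpath_mult_scale_left qpath_mult_scale_right
  by (intro sum.cong refl arg_cong[where f = "pscale _"]) (auto simp: sg_mult_sg qpath_end_Cons)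

lemma gen_keys:
  assumes "r \<in> keys (sg p \<star> rel \<star> sg q)"
  shows "path_class r = (fst q, pend p, star_degree p + 1 + star_degree q)" "length (snd r) \<ge> 2"
proof -
  have "keys (sg p \<star> rel \<star> sg q) \<subseteq> {(fst q, snd q @ [\<alpha>, bar \<alpha>] @ snd p) | \<alpha>.
      \<alpha> \<in> arcs H \<and> tail H \<alpha> = fst p \<and> pend q = tail H \<alpha>}"
    unfolding gen_eq
    by (intro order_trans[OF Poly_Mapping.keys_sum] UN_least order_trans[OF keys_scale]) auto
  then obtain \<alpha> where \<alpha>: "r = (fst q, snd q @ [\<alpha>, bar \<alpha>] @ snd p)" "tail H \<alpha> = fst p" "pend q = tail H \<alpha>"
    using assms by blast
  then show "length (snd r) \<ge> 2" by simp
  have "pend r = pend p"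
    using \<alpha> by (cases p; cases q) (simp add: qpath_end_append qpath_end_Cons)
  moreover have "star_degree r = star_degree p + 1 + star_degree q"
    using \<alpha>(1) deg_le_1[of \<alpha>] by simp
  ultimately show "path_class r = (fst q, pend p, star_degree p + 1 + star_degree q)"
    using \<alpha>(1) by (simp add: path_class_def)
qed

lemma supp_restrict_J: "f \<in> J \<Longrightarrow> supp_restrict (\<lambda>p. R (path_class p)) f \<in> J"
proof (rule J_induct[OF _ linmap_supp_restrict subspace_J])
  fix p q assume pq: "p \<in> qpaths H" "q \<in> qpaths H"
  let ?c = "(fst q, pend p, star_degree p + 1 + star_degree q)"
  show "supp_restrict (\<lambda>p. R (path_class p)) (sg p \<star> rel \<star> sg q) \<in> J"
  proof (cases "R ?c")
    case True
    have "supp_restrict (\<lambda>p. R (path_class p)) (sg p \<star> rel \<star> sg q) = sg p \<star> rel \<star> sg q"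
      by (rule supp_restrict_id) (use True in \<open>simp add: gen_keys(1)\<close>)
    then show ?thesis using J_gen[OF pq] by simp
  next
    case False
    have "supp_restrict (\<lambda>p. R (path_class p)) (sg p \<star> rel \<star> sg q) = 0"
      by (rule supp_restrict_none) (use False in \<open>simp add: gen_keys(1)\<close>)
    then show ?thesis by simp
  qed
qed

lemma J_length: "f \<in> J \<Longrightarrow> r \<in> keys f \<Longrightarrow> length (snd r) \<ge> 2"
proof -
  let ?S = "{f :: _ \<Rightarrow>\<^sub>0 'k. keys f \<subseteq> {r. length (snd r) \<ge> 2}}"
  have sub: "pm.subspace ?S"
    unfolding pm.subspace_def using Poly_Mapping.keys_add keys_scale by (fastforce simp: subset_iff)
  assume f: "f \<in> J" and r: "r \<in> keys f"
  have "f \<in> ?S"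
    by (rule J_induct[OF f linmap_id sub]) (use gen_keys(2) in blast)
  then show ?thesis using r by blast
qed

lemma J_star_degree: "f \<in> J \<Longrightarrow> r \<in> keys f \<Longrightarrow> star_degree r \<ge> 1"
proof -
  let ?S = "{f :: _ \<Rightarrow>\<^sub>0 'k. keys f \<subseteq> {r. star_degree r \<ge> 1}}"
  have sub: "pm.subspace ?S"
    unfolding pm.subspace_def using Poly_Mapping.keys_add keys_scale by (fastforce simp: subset_iff)
  assume f: "f \<in> J" and r: "r \<in> keys f"
  have "f \<in> ?S"
    by (rule J_induct[OF f linmap_id sub]) (use gen_keys(1) in \<open>auto simp: path_class_def\<close>)
  then show ?thesis using r by blast
qed

text \<open>A basis of \<open>J\<close> is extended by paths to a basis of the whole space, and
  \<open>N\<close> is the projection along \<open>J\<close> onto the span of the added paths. Adding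
  paths only keeps the resulting basis of the quotient homogeneous.\<close>

lemma normal_form_exists:
  "\<exists>(N :: (('v, 'e + 'e) qpath \<Rightarrow>\<^sub>0 'k) \<Rightarrow> _) basis_paths. linmap N \<and> (\<forall>f. f - N f \<in> J) \<and> (\<forall>f\<in>J. N f = 0) \<and>
     (\<forall>f. keys (N f) \<subseteq> basis_paths) \<and> (\<forall>p\<in>basis_paths. N (sg p) = sg p)"
proof -
  interpret pp: vector_space_pair "pscale :: 'k \<Rightarrow> (('v, 'e + 'e) qpath \<Rightarrow>\<^sub>0 'k) \<Rightarrow> _"
    "pscale :: 'k \<Rightarrow> (('v, 'e + 'e) qpath \<Rightarrow>\<^sub>0 'k) \<Rightarrow> _" ..
  obtain BJ where BJ: "BJ \<subseteq> J" "pm.independent BJ" "J \<subseteq> pm.span BJ"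
    using pm.maximal_independent_subset by blast
  obtain B where B: "BJ \<subseteq> B" "B \<subseteq> BJ \<union> range sg" "pm.independent B" "BJ \<union> range sg \<subseteq> pm.span B"
    using pm.maximal_independent_subset_extend[of BJ "BJ \<union> range sg"] BJ by blast
  have UN: "f \<in> pm.span B" for f
    by (rule in_subspace_linmap[OF pm.subspace_span linmap_id, of UNIV]) (use B in auto)
  define N where "N = pp.construct B (\<lambda>b. if b \<in> BJ then 0 else b)"
  have N_basis: "N b = (if b \<in> BJ then 0 else b)" if "b \<in> B" for b
    unfolding N_def by (rule pp.construct_basis[OF B(3) that])
  have "Vector_Spaces.linear pscale pscale N"
    unfolding N_def by (rule pp.linear_construct[OF B(3)])
  then have lin: "linmap N"
    by (auto intro!: linmapI simp: Vector_Spaces.linear_iff)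
  let ?basis_paths = "{p. sg p \<in> B - BJ}"
  have "f - N f \<in> J \<and> keys (N f) \<subseteq> ?basis_paths" for f
    using UN[of f]
  proof (induction rule: pm.span_induct_alt)
    case base
    show ?case using lin by (simp add: linmap_0)
  next
    case (step c x y)
    have x: "x - N x \<in> J" "keys (N x) \<subseteq> ?basis_paths"
      using step.hyps N_basis[of x] B(2) BJ(1) by auto
    have "c *\<^sub>p x + y - N (c *\<^sub>p x + y) = c *\<^sub>p (x - N x) + (y - N y)"
      by (simp add: linmap_add[OF lin] linmap_scale[OF lin] pscale_right_diff)
    also have "\<dots> \<in> J" using x step by (intro J_add J_scale) auto
    finally have "c *\<^sub>p x + y - N (c *\<^sub>p x + y) \<in> J" .
    moreover have "keys (N (c *\<^sub>p x + y)) \<subseteq> ?basis_paths"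
      using Poly_Mapping.keys_add[of "c *\<^sub>p N x" "N y"] keys_scale[of c "N x"] x step
      by (auto simp: linmap_add[OF lin] linmap_scale[OF lin])
    ultimately show ?case ..
  qed
  moreover have "N f = 0" if "f \<in> J" for f
  proof -
    have "f \<in> pm.span BJ" using that BJ by blast
    then show ?thesis
    proof (induction rule: pm.span_induct_alt)
      case (step c x y)
      then show ?case using N_basis[of x] B(1) lin by (auto simp: linmap_add linmap_scale)
    qed (simp add: linmap_0[OF lin])
  qed
  moreover have "N (sg p) = sg p" if "p \<in> ?basis_paths" for p
    using that N_basis by auto
  ultimately show ?thesis using lin by blast
qed

definition nf :: "(('v, 'e + 'e) qpath \<Rightarrow>\<^sub>0 'k) \<Rightarrow> (('v, 'e + 'e) qpath \<Rightarrow>\<^sub>0 'k)" where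
  "nf = (SOME N. \<exists>basis_paths. linmap N \<and> (\<forall>f. f - N f \<in> J) \<and> (\<forall>f\<in>J. N f = 0) \<and>
     (\<forall>f. keys (N f) \<subseteq> basis_paths) \<and> (\<forall>p\<in>basis_paths. N (sg p) = sg p))"

definition basis_paths :: "('v, 'e + 'e) qpath set" where
  "basis_paths = {p. nf (sg p) = sg p}"

lemma nf_props: "\<exists>basis_paths. linmap nf \<and> (\<forall>f. f - nf f \<in> J) \<and> (\<forall>f\<in>J. nf f = 0) \<and>
     (\<forall>f. keys (nf f) \<subseteq> basis_paths) \<and> (\<forall>p\<in>basis_paths. nf (sg p) = sg p)"
  unfolding nf_def by (rule someI_ex[OF normal_form_exists])

lemma linmap_nf [simp]: "linmap nf"
  and nf_cong_J: "f - nf f \<in> J"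
  and nf_J: "f \<in> J \<Longrightarrow> nf f = 0"
  and keys_nf: "keys (nf f) \<subseteq> basis_paths"
proof -
  obtain B where B: "linmap nf" "\<forall>f. f - nf f \<in> J" "\<forall>f\<in>J. nf f = 0" "\<forall>f. keys (nf f) \<subseteq> B"
    "\<forall>p\<in>B. nf (sg p) = sg p"
    using nf_props by blast
  then show "linmap nf" "f - nf f \<in> J" "f \<in> J \<Longrightarrow> nf f = 0" by simp_all
  show "keys (nf f) \<subseteq> basis_paths" using B(4,5) by (auto simp: basis_paths_def)
qed

lemma nf_eq_0_iff: "nf f = 0 \<longleftrightarrow> f \<in> J"
  using nf_J nf_cong_J[of f] by auto

lemma nf_eq_iff: "nf f = nf g \<longleftrightarrow> f - g \<in> J"
  using nf_eq_0_iff[of "f - g"] by (simp add: linmap_diff[OF linmap_nf])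

lemma nf_id: "keys f \<subseteq> basis_paths \<Longrightarrow> nf f = f"
  by (rule linmap_eq_on[OF linmap_nf linmap_id, of basis_paths]) (auto simp: basis_paths_def)

lemma nf_nf [simp]: "nf (nf f) = nf f"
  by (rule nf_id) (rule keys_nf)

text \<open>The part of \<open>nf (sg p)\<close> in the class of \<open>p\<close> is congruent to
  \<open>sg p\<close> too, because \<open>J\<close> is homogeneous, and it is in normal form.
  Uniqueness of normal forms leaves nothing outside that class.\<close>

lemma keys_nf_sg: "keys (nf (sg p)) \<subseteq> {q \<in> basis_paths. path_class q = path_class p}"
proof -
  let ?Q = "\<lambda>q. path_class q = path_class p"
  have "supp_restrict ?Q (sg p - nf (sg p)) \<in> J"
    by (rule supp_restrict_J) (rule nf_cong_J)
  then have "sg p - supp_restrict ?Q (nf (sg p)) \<in> J"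
    by (simp add: linmap_diff[OF linmap_supp_restrict] supp_restrict_sg)
  then have "nf (sg p) = nf (supp_restrict ?Q (nf (sg p)))"
    by (simp add: nf_eq_iff)
  also have "\<dots> = supp_restrict ?Q (nf (sg p))"
    by (rule nf_id) (use keys_supp_restrict keys_nf in fastforce)
  finally have "keys (nf (sg p)) \<subseteq> {q. path_class q = path_class p}"
    using keys_supp_restrict[of ?Q "nf (sg p)"] by auto
  then show ?thesis using keys_nf by auto
qed

lemma keys_nf_sg_qpaths: "p \<in> qpaths H \<Longrightarrow> keys (nf (sg p)) \<subseteq> qpaths H"
  using J_keys[OF nf_cong_J[of "sg p"]] Poly_Mapping.keys_diff[of "sg p" "sg p - nf (sg p)"] by auto

text \<open>\<open>PT t d v\<close> is the set of paths of degree \<open>d\<close> from \<open>t\<close> to \<open>v\<close>, and \<open>IX t d v\<close> consists of those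
  whose images form the chosen basis of the component of \<open>V\<^sup>t\<^sub>d\<close> at \<open>v\<close>.\<close>

definition PT :: "'v \<Rightarrow> nat \<Rightarrow> 'v \<Rightarrow> ('v, 'e + 'e) qpath set" where
  "PT t d v = {p \<in> qpaths H. path_class p = (t, v, d)}"

definition IX :: "'v \<Rightarrow> nat \<Rightarrow> 'v \<Rightarrow> ('v, 'e + 'e) qpath set" where
  "IX t d v = basis_paths \<inter> PT t d v"

lemma keys_nf_sg_IX: "p \<in> PT t d v \<Longrightarrow> keys (nf (sg p)) \<subseteq> IX t d v"
  using keys_nf_sg[of p] keys_nf_sg_qpaths[of p] by (auto simp: PT_def IX_def)

lemma keys_nf_IX: "keys f \<subseteq> PT t d v \<Longrightarrow> keys (nf f) \<subseteq> IX t d v"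
  by (rule keys_in_linmap[OF linmap_nf]) (rule keys_nf_sg_IX)

lemma nf_id_IX: "keys f \<subseteq> IX t d v \<Longrightarrow> nf f = f"
  by (rule nf_id) (auto simp: IX_def)

lemma IX_subset: "IX t d v \<subseteq> PT t d v"
  by (auto simp: IX_def)

text \<open>The order (head, tail) is chosen so that well-founded induction on a vertex may assume
  the claim for the heads of its outgoing arrows; sinks are minimal.\<close>

definition arrow_rel :: "('v \<times> 'v) set" where
  "arrow_rel = {(head G \<gamma>, tail G \<gamma>) | \<gamma>. \<gamma> \<in> arcs G}"

lemma arrow_rel_trancl_awalk: "(v, u) \<in> arrow_rel\<^sup>+ \<Longrightarrow> \<exists>p. awalk u p v \<and> p \<noteq> []"
proof (induction rule: trancl.induct)
  case (r_into_trancl v u)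
  then obtain \<gamma> where "\<gamma> \<in> arcs G" "v = head G \<gamma>" "u = tail G \<gamma>"
    by (auto simp: arrow_rel_def)
  then show ?case by (intro exI[of _ "[\<gamma>]"]) (simp add: arc_implies_awalk)
next
  case (trancl_into_trancl v u w)
  then obtain p \<gamma> where "awalk u p v" "\<gamma> \<in> arcs G" "u = head G \<gamma>" "w = tail G \<gamma>"
    by (auto simp: arrow_rel_def)
  then show ?case by (intro exI[of _ "\<gamma> # p"]) (auto simp: awalk_Cons_iff)
qed

lemma wf_arrow_rel: "wf arrow_rel"
proof (rule finite_acyclic_wf)
  have "arrow_rel \<subseteq> (\<lambda>\<gamma>. (head G \<gamma>, tail G \<gamma>)) ` arcs G" by (auto simp: arrow_rel_def)
  then show "finite arrow_rel" by (rule finite_subset) simp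
  show "acyclic arrow_rel"
    unfolding acyclic_def
    using arrow_rel_trancl_awalk closed_w_imp_cycle no_cycle by (fastforce simp: closed_w_def)
qed

text \<open>Lexicographic induction on the degree and the starting vertex: a first arrow of \<Gamma>
  leads to a smaller vertex, a first starred arrow uses up one degree.\<close>

lemma finite_paths_from: "finite {p \<in> qpaths H. fst p = t \<and> star_degree p \<le> d}" (is "finite (?S t d)")
proof (induction d arbitrary: t rule: less_induct)
  case (less d)
  show ?case
  proof (induction t rule: wf_induct_rule[OF wf_arrow_rel])
    case (1 t)
    let ?T = "{(t, [])} \<union> (\<Union>\<gamma>\<in>{\<gamma> \<in> arcs G. tail G \<gamma> = t}. (\<lambda>p. (t, Inl \<gamma> # snd p)) ` ?S (head G \<gamma>) d) \<union>
      (if d = 0 then {} else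
       (\<Union>\<gamma>\<in>{\<gamma> \<in> arcs G. head G \<gamma> = t}. (\<lambda>p. (t, Inr \<gamma> # snd p)) ` ?S (tail G \<gamma>) (d - 1)))"
    have "finite (?S (head G \<gamma>) d)" if "\<gamma> \<in> arcs G" "tail G \<gamma> = t" for \<gamma>
      by (rule 1) (use that in \<open>auto simp: arrow_rel_def\<close>)
    moreover have "finite (?S s (d - 1))" if "d \<noteq> 0" for s
      by (rule less) (use that in simp)
    ultimately have "finite ?T"
      by (intro finite_UnI finite_UN_I finite_imageI) (auto simp del: star_degree_ldeg)
    moreover have "?S t d \<subseteq> ?T"
    proof
      fix p assume p: "p \<in> ?S t d"
      obtain es where ues: "p = (t, es)" using p by (cases p) auto
      show "p \<in> ?T"
      proof (cases es)
        case (Cons e es')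
        have es': "(head H e, es') \<in> qpaths H" "e \<in> arcs H" "t = tail H e"
          and d: "deg e + star_degree (head H e, es') \<le> d"
          using p unfolding ues Cons by (auto simp: H.qpaths_Cons)
        show ?thesis
        proof (cases e)
          case (Inl \<gamma>)
          then have "(head G \<gamma>, es') \<in> ?S (head G \<gamma>) d" "\<gamma> \<in> {\<gamma> \<in> arcs G. tail G \<gamma> = t}"
            using es' d by auto
          moreover have "p = (t, Inl \<gamma> # snd (head G \<gamma>, es'))" by (simp add: ues Cons Inl)
          ultimately show ?thesis by blast
        next
          case (Inr \<gamma>)
          then have "(tail G \<gamma>, es') \<in> ?S (tail G \<gamma>) (d - 1)" "\<gamma> \<in> {\<gamma> \<in> arcs G. head G \<gamma> = t}"
            and d0: "d \<noteq> 0"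
            using es' d by auto
          moreover have "p = (t, Inr \<gamma> # snd (tail G \<gamma>, es'))" by (simp add: ues Cons Inr)
          ultimately show ?thesis unfolding if_not_P[OF d0] by blast
        qed
      qed (use ues in auto)
    qed
    ultimately show ?case by (rule finite_subset[rotated])
  qed
qed

lemma finite_PT [simp]: "finite (PT t d v)"
  by (rule finite_subset[OF _ finite_paths_from[of t d]]) (auto simp: PT_def path_class_def)

lemma finite_IX [simp]: "finite (IX t d v)"
  by (simp add: IX_def)

text \<open>If \<open>f\<close> has no trivial paths, it is the sum of all \<open>strip \<alpha> f \<star> arr \<alpha>\<close>.\<close>

definition strip :: "'e + 'e \<Rightarrow> (('v, 'e + 'e) qpath \<Rightarrow>\<^sub>0 'k) \<Rightarrow> (('v, 'e + 'e) qpath \<Rightarrow>\<^sub>0 'k)" where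
  "strip \<alpha> = lext (\<lambda>p. if snd p \<noteq> [] \<and> hd (snd p) = \<alpha> \<and> fst p = tail H \<alpha>
     then sg (head H \<alpha>, tl (snd p)) else 0)"

lemma linmap_strip [simp]: "linmap (strip \<alpha>)"
  by (simp add: strip_def)

lemma strip_0 [simp]: "strip \<alpha> 0 = 0"
  by (rule linmap_0) simp

lemma strip_sg: "strip \<alpha> (sg p) = (if snd p \<noteq> [] \<and> hd (snd p) = \<alpha> \<and> fst p = tail H \<alpha>
     then sg (head H \<alpha>, tl (snd p)) else 0)"
  by (simp add: strip_def)

lemma strip_mult: "snd q \<noteq> [] \<Longrightarrow> strip \<alpha> (f \<star> sg q) = f \<star> strip \<alpha> (sg q)"
proof (rule linmap_eq[of "\<lambda>f. strip \<alpha> (f \<star> sg q)"])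
  fix p assume "snd q \<noteq> []"
  then show "strip \<alpha> (sg p \<star> sg q) = sg p \<star> strip \<alpha> (sg q)"
    by (cases q; cases "snd q") (auto simp: sg_mult_sg strip_sg qpath_end_Cons)
qed (rule linmap_comp[OF linmap_strip linmap_mult_left'] linmap_mult_left[OF linmap_id, of _ "strip _ _"])+

lemma strip_mult_arr:
  assumes "\<And>p. p \<in> keys f \<Longrightarrow> fst p = head H \<beta>"
  shows "strip \<alpha> (f \<star> arr \<beta>) = (if \<alpha> = \<beta> then f else 0)"
proof -
  have "strip \<alpha> (f \<star> arr \<beta>) = f \<star> strip \<alpha> (arr \<beta>)"
    unfolding arrow_elem_def by (rule strip_mult) simp
  also have "\<dots> = (if \<alpha> = \<beta> then f \<star> sg (head H \<beta>, []) else 0)"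
    by (auto simp: arrow_elem_def strip_sg)
  also have "f \<star> sg (head H \<beta>, []) = f"
  proof (rule linmap_eq_on[OF linmap_mult_left' linmap_id, of "keys f"])
    fix p assume "p \<in> keys f"
    from assms[OF this] show "sg p \<star> sg (head H \<beta>, []) = sg p"
      by (cases p) (simp add: sg_mult_sg)
  qed simp
  finally show ?thesis .
qed

lemma strip_rel: "strip \<alpha> (f \<star> rel \<star> sg (u, [])) =
  (if \<alpha> \<in> arcs H \<and> tail H \<alpha> = u then eps \<alpha> *\<^sub>p (f \<star> arr (bar \<alpha>)) else 0)"
proof -
  have "f \<star> rel \<star> sg (u, []) = (\<Sum>\<beta>\<in>arcs H. eps \<beta> *\<^sub>p (if tail H \<beta> = u then f \<star> sg (u, [\<beta>, bar \<beta>]) else 0))"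
    unfolding rel_def linmap_sum[OF linmap_mult_right'] linmap_sum[OF linmap_mult_left']
      qpath_mult_scale_left qpath_mult_scale_right qpath_mult_assoc
    by (intro sum.cong refl arg_cong[where f = "pscale _"]) (auto simp: sg_mult_sg)
  then have "strip \<alpha> (f \<star> rel \<star> sg (u, [])) =
     (\<Sum>\<beta>\<in>arcs H. eps \<beta> *\<^sub>p (if tail H \<beta> = u then strip \<alpha> (f \<star> sg (u, [\<beta>, bar \<beta>])) else 0))"
    by (simp add: linmap_sum[OF linmap_strip] linmap_scale[OF linmap_strip] linmap_0[OF linmap_strip] if_distrib cong: if_cong)
  also have "\<dots> = (\<Sum>\<beta>\<in>arcs H. if \<beta> = \<alpha> then if tail H \<alpha> = u then eps \<alpha> *\<^sub>p (f \<star> arr (bar \<alpha>)) else 0 else 0)"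
    by (intro sum.cong refl) (auto simp: strip_mult strip_sg arrow_elem_def)
  finally show ?thesis by (simp add: sum.delta)
qed

text \<open>Checked on the generators \<open>sg p \<star> rel \<star> sg q\<close>. If
  \<open>q\<close> is not trivial, stripping an arrow from it leaves a generator or zero, and
  \<open>x = 0\<close> works. If \<open>q\<close> is trivial, the relation itself is cut open, and
  \<open>x\<close> is the product of \<open>p\<close> and \<open>q\<close>.\<close>

lemma J_strip: "f \<in> J \<Longrightarrow> \<exists>x. \<forall>\<alpha>\<in>arcs H. strip \<alpha> f - eps \<alpha> *\<^sub>p (x \<star> arr (bar \<alpha>)) \<in> J"
proof -
  let ?S = "{f. \<exists>x. \<forall>\<alpha>\<in>arcs H. strip \<alpha> f - eps \<alpha> *\<^sub>p (x \<star> arr (bar \<alpha>)) \<in> J}"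
  have sub: "pm.subspace ?S"
    unfolding pm.subspace_def
  proof (intro conjI ballI allI)
    show "0 \<in> ?S" by (auto intro!: exI[of _ 0] simp: linmap_0[OF linmap_strip])
  next
    fix f g assume "f \<in> ?S" "g \<in> ?S"
    then obtain x y where xy: "\<forall>\<alpha>\<in>arcs H. strip \<alpha> f - eps \<alpha> *\<^sub>p (x \<star> arr (bar \<alpha>)) \<in> J"
      "\<forall>\<alpha>\<in>arcs H. strip \<alpha> g - eps \<alpha> *\<^sub>p (y \<star> arr (bar \<alpha>)) \<in> J" by blast
    have "strip \<alpha> (f + g) - eps \<alpha> *\<^sub>p ((x + y) \<star> arr (bar \<alpha>)) =
      (strip \<alpha> f - eps \<alpha> *\<^sub>p (x \<star> arr (bar \<alpha>))) + (strip \<alpha> g - eps \<alpha> *\<^sub>p (y \<star> arr (bar \<alpha>)))" for \<alpha>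
      by (simp add: linmap_add[OF linmap_strip] qpath_mult_add_left pscale_distribs)
    then show "f + g \<in> ?S" using xy J_add by (auto intro!: exI[of _ "x + y"])
  next
    fix c f assume "f \<in> ?S"
    then obtain x where x: "\<forall>\<alpha>\<in>arcs H. strip \<alpha> f - eps \<alpha> *\<^sub>p (x \<star> arr (bar \<alpha>)) \<in> J" by blast
    have "strip \<alpha> (c *\<^sub>p f) - eps \<alpha> *\<^sub>p ((c *\<^sub>p x) \<star> arr (bar \<alpha>)) =
      c *\<^sub>p (strip \<alpha> f - eps \<alpha> *\<^sub>p (x \<star> arr (bar \<alpha>)))" for \<alpha>
      by (simp add: linmap_scale[OF linmap_strip] qpath_mult_scale_left pscale_right_diff mult.commute)
    then show "c *\<^sub>p f \<in> ?S" using x J_scale by (auto intro!: exI[of _ "c *\<^sub>p x"])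
  qed
  assume "f \<in> J"
  then have "f \<in> ?S"
  proof (rule J_induct[OF _ linmap_id sub])
    fix p q assume pq: "p \<in> qpaths H" "q \<in> qpaths H"
    show "sg p \<star> rel \<star> sg q \<in> ?S"
    proof (cases "snd q = []")
      case True
      then obtain u where q: "q = (u, [])" by (cases q) auto
      have "(sg p \<star> sg (u, [])) \<star> arr (bar \<alpha>) = (if tail H \<alpha> = u then sg p \<star> arr (bar \<alpha>) else 0)" for \<alpha>
        by (simp add: qpath_mult_assoc sg_mult_arr[of "(u, [])"]) (simp add: arrow_elem_def)
      then have "strip \<alpha> (sg p \<star> rel \<star> sg q) - eps \<alpha> *\<^sub>p ((sg p \<star> sg (u, [])) \<star> arr (bar \<alpha>)) = 0"
        if "\<alpha> \<in> arcs H" for \<alpha>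
        using that by (simp add: q strip_rel)
      then show ?thesis by (auto intro!: exI[of _ "sg p \<star> sg (u, [])"])
    next
      case False
      have "strip \<alpha> (sg p \<star> rel \<star> sg q) \<in> J" for \<alpha>
        using False pq J_gen[OF pq(1), of "(head H (hd (snd q)), tl (snd q))"]
        by (cases q; cases "snd q") (auto simp: strip_mult strip_sg H.qpaths_Cons)
      then show ?thesis by (auto intro!: exI[of _ 0])
    qed
  qed
  then show ?thesis by blast
qed

definition PTs :: "'v \<Rightarrow> nat \<Rightarrow> ('v, 'e + 'e) qpath set" where
  "PTs t d = {p \<in> qpaths H. fst p = t \<and> star_degree p = d}"

lemma PTs_UN: "PTs t d = (\<Union>v\<in>verts G. PT t d v)"
  using H.qpath_end_verts by (auto simp: PTs_def PT_def path_class_def)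

lemma PT_subset_PTs: "PT t d v \<subseteq> PTs t d"
  by (auto simp: PTs_def PT_def path_class_def)

lemma finite_PTs [simp]: "finite (PTs t d)"
  by (simp add: PTs_UN)

text \<open>Exactness at the middle term: the kernel of \<open>(z\<^sub>\<alpha>) \<mapsto> \<Sum> z\<^sub>\<alpha> \<alpha>\<close> consists of the tuples
  \<open>z\<^sub>\<alpha> = \<epsilon>\<^sub>\<alpha> x \<alpha>\<^sup>*\<close>.\<close>

lemma J_strip_homogeneous:
  assumes "f \<in> J" "keys f \<subseteq> PTs t (Suc d)"
  shows "\<exists>x. keys x \<subseteq> PTs t d \<and>
    (\<forall>\<alpha>\<in>arcs H. tail H \<alpha> = t \<longrightarrow> strip \<alpha> f - eps \<alpha> *\<^sub>p (x \<star> arr (bar \<alpha>)) \<in> J)"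
proof -
  obtain x where x: "\<forall>\<alpha>\<in>arcs H. strip \<alpha> f - eps \<alpha> *\<^sub>p (x \<star> arr (bar \<alpha>)) \<in> J"
    using J_strip[OF assms(1)] by blast
  \<comment> \<open>The \<open>x\<close> above need be neither homogeneous nor supported on paths of
    the quiver, so only its component of degree \<open>d\<close> from \<open>t\<close> is
    kept.\<close>
  let ?y = "supp_restrict (\<lambda>p. p \<in> qpaths H) (supp_restrict (\<lambda>p. fst p = t \<and> star_degree p = d) x)"
  have "strip \<alpha> f - eps \<alpha> *\<^sub>p (?y \<star> arr (bar \<alpha>)) \<in> J" if \<alpha>: "\<alpha> \<in> arcs H" "tail H \<alpha> = t" for \<alpha>
  proof -
    \<comment> \<open>The degree that remains after \<alpha> is removed from a path of degree
      \<open>Suc d\<close>, written as a sum to avoid truncated subtraction. Projecting the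
      congruence to these degrees keeps \<open>strip \<alpha> f\<close> and replaces
      \<open>x\<close> by \<open>?y\<close>.\<close>
    let ?R = "\<lambda>(u, v, e). e + deg \<alpha> = Suc d"
    let ?g = "strip \<alpha> f - eps \<alpha> *\<^sub>p (x \<star> arr (bar \<alpha>))"
    have g: "supp_restrict (\<lambda>p. ?R (path_class p)) ?g \<in> J"
      by (rule supp_restrict_J) (use x \<alpha> in blast)
    have "supp_restrict (\<lambda>p. p \<in> qpaths H) (supp_restrict (\<lambda>p. ?R (path_class p)) ?g) = supp_restrict (\<lambda>p. ?R (path_class p)) ?g"
      by (rule supp_restrict_id) (use J_keys[OF g] in blast)
    then have g': "supp_restrict (\<lambda>p. p \<in> qpaths H) (supp_restrict (\<lambda>p. ?R (path_class p)) ?g) \<in> J"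
      using g by (simp only:)
    have "keys (strip \<alpha> f) \<subseteq> {p \<in> qpaths H. ?R (path_class p)}"
    proof (rule keys_in_linmap[OF linmap_strip _ assms(2)])
      fix p assume "p \<in> PTs t (Suc d)"
      then show "keys (strip \<alpha> (sg p)) \<subseteq> {p \<in> qpaths H. ?R (path_class p)}"
        by (cases p; cases "snd p") (auto simp: strip_sg PTs_def path_class_def H.qpaths_Cons)
    qed
    then have 1: "supp_restrict (\<lambda>p. p \<in> qpaths H) (supp_restrict (\<lambda>p. ?R (path_class p)) (strip \<alpha> f)) = strip \<alpha> f"
      by (subst supp_restrict_id; (subst supp_restrict_id)?) auto
    have 2: "supp_restrict (\<lambda>p. p \<in> qpaths H) (supp_restrict (\<lambda>p. ?R (path_class p)) (x \<star> arr (bar \<alpha>))) = ?y \<star> arr (bar \<alpha>)"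
    proof (rule linmap_eq[of "\<lambda>x. supp_restrict (\<lambda>p. p \<in> qpaths H) (supp_restrict (\<lambda>p. ?R (path_class p)) (x \<star> arr (bar \<alpha>)))"])
      fix p :: "('v, 'e + 'e) qpath"
      show "supp_restrict (\<lambda>p. p \<in> qpaths H) (supp_restrict (\<lambda>p. ?R (path_class p)) (sg p \<star> arr (bar \<alpha>))) =
        supp_restrict (\<lambda>p. p \<in> qpaths H) (supp_restrict (\<lambda>p. fst p = t \<and> star_degree p = d) (sg p)) \<star> arr (bar \<alpha>)"
        using \<alpha> deg_le_1[of \<alpha>]
        by (cases p) (auto simp: sg_mult_arr supp_restrict_sg path_class_def H.qpaths_Cons linmap_0[OF linmap_supp_restrict])
    qed (rule linmap_comp[OF linmap_supp_restrict linmap_comp[OF linmap_supp_restrict linmap_mult_left']]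
        linmap_mult_left[OF linmap_comp[OF linmap_supp_restrict linmap_supp_restrict]])+
    show ?thesis
      using g' unfolding linmap_diff[OF linmap_supp_restrict] linmap_scale[OF linmap_supp_restrict] 1 2 .
  qed
  moreover have "keys ?y \<subseteq> PTs t d"
    using keys_supp_restrict[of "\<lambda>p. p \<in> qpaths H" "supp_restrict (\<lambda>p. fst p = t \<and> star_degree p = d) x"]
      keys_supp_restrict[of "\<lambda>p. fst p = t \<and> star_degree p = d" x] by (auto simp: PTs_def)
  ultimately show ?thesis by blast
qed

end

subsection \<open>Linear systems\<close>

text \<open>Induction on the rows. A row that vanishes on the common kernel of the others gets the
  coefficient 0. Otherwise some \<open>x1\<close> in that kernel has value 1 under the row, and the
  coefficient must be the value of \<open>c\<close> at \<open>x1\<close>.\<close>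

lemma fredholm:
  fixes A :: "'r \<Rightarrow> 'i \<Rightarrow> 'k::field"
  assumes "finite R" "finite I"
    and "\<And>x. (\<And>r. r \<in> R \<Longrightarrow> (\<Sum>i\<in>I. A r i * x i) = 0) \<Longrightarrow> (\<Sum>i\<in>I. c i * x i) = 0"
  shows "\<exists>y. \<forall>i\<in>I. c i = (\<Sum>r\<in>R. y r * A r i)"
  using assms(1,3)
proof (induction R arbitrary: c rule: finite_induct)
  case empty
  have "c i = 0" if "i \<in> I" for i
    using empty[of "\<lambda>j. if j = i then 1 else 0"] that assms(2) by (simp add: if_distrib cong: if_cong)
  then show ?case by simp
next
  case (insert r R)
  let ?dot = "\<lambda>f g. \<Sum>i\<in>I. f i * g i :: 'k"
  show ?case
  proof (cases "\<forall>x. (\<forall>s\<in>R. ?dot (A s) x = 0) \<longrightarrow> ?dot (A r) x = 0")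
    case True
    have "\<exists>y. \<forall>i\<in>I. c i = (\<Sum>r\<in>R. y r * A r i)"
    proof (rule insert.IH)
      fix x assume "\<And>s. s \<in> R \<Longrightarrow> ?dot (A s) x = 0"
      then show "?dot c x = 0" by (intro insert.prems) (use True in auto)
    qed
    then obtain y where y: "\<forall>i\<in>I. c i = (\<Sum>r\<in>R. y r * A r i)" by blast
    show ?thesis
    proof (intro exI[of _ "y(r := 0)"] ballI)
      fix i assume "i \<in> I"
      have "(\<Sum>s\<in>R. (y(r := 0)) s * A s i) = (\<Sum>s\<in>R. y s * A s i)"
        by (intro sum.cong refl) (use insert.hyps in auto)
      then show "c i = (\<Sum>s\<in>insert r R. (y(r := 0)) s * A s i)"
        using y \<open>i \<in> I\<close> insert.hyps by simp
    qed
  next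
    case False
    then obtain x0 where x0: "\<forall>s\<in>R. ?dot (A s) x0 = 0" "?dot (A r) x0 \<noteq> 0" by blast
    define x1 where "x1 = (\<lambda>i. x0 i / ?dot (A r) x0)"
    have x1_dot: "?dot f x1 = ?dot f x0 / ?dot (A r) x0" for f
      by (simp add: x1_def sum_divide_distrib)
    have x1: "?dot (A s) x1 = 0" if "s \<in> R" for s
      using x0 that by (simp add: x1_dot)
    have x1r: "?dot (A r) x1 = 1"
      using x0 by (simp add: x1_dot)
    let ?c = "\<lambda>i. c i - ?dot c x1 * A r i"
    have dot_diff: "?dot f (\<lambda>i. x i - l * x1 i) = ?dot f x - l * ?dot f x1" for f x l
      by (simp add: algebra_simps sum_subtractf sum_distrib_left)
    have "\<exists>y. \<forall>i\<in>I. ?c i = (\<Sum>r\<in>R. y r * A r i)"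
    proof (rule insert.IH)
      fix x assume x: "\<And>s. s \<in> R \<Longrightarrow> ?dot (A s) x = 0"
      have "?dot c (\<lambda>i. x i - ?dot (A r) x * x1 i) = 0"
        by (rule insert.prems) (use x x1 x1r in \<open>auto simp: dot_diff\<close>)
      then have "?dot c x = ?dot (A r) x * ?dot c x1"
        by (simp add: dot_diff)
      moreover have "?dot ?c x = ?dot c x - ?dot c x1 * ?dot (A r) x"
        by (simp add: left_diff_distrib sum_subtractf sum_distrib_left mult.assoc)
      ultimately show "?dot ?c x = 0" by simp
    qed
    then obtain y where y: "\<forall>i\<in>I. ?c i = (\<Sum>r\<in>R. y r * A r i)" by blast
    show ?thesis
    proof (intro exI[of _ "y(r := ?dot c x1)"] ballI)
      fix i assume "i \<in> I"
      have "(\<Sum>s\<in>R. (y(r := ?dot c x1)) s * A s i) = (\<Sum>s\<in>R. y s * A s i)"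
        by (intro sum.cong refl) (use insert.hyps in auto)
      moreover have "c i = ?dot c x1 * A r i + (\<Sum>s\<in>R. y s * A s i)"
        using bspec[OF y \<open>i \<in> I\<close>] unfolding diff_eq_eq by (simp only: add.commute)
      ultimately show "c i = (\<Sum>s\<in>insert r R. (y(r := ?dot c x1)) s * A s i)"
        using insert.hyps by simp
    qed
  qed
qed

lemma fredholm_solvable:
  fixes A :: "'r \<Rightarrow> 'i \<Rightarrow> 'k::field"
  assumes "finite R" "finite I"
    and "\<And>y. (\<And>i. i \<in> I \<Longrightarrow> (\<Sum>r\<in>R. A r i * y r) = 0) \<Longrightarrow> (\<Sum>r\<in>R. b r * y r) = 0"
  shows "\<exists>x. \<forall>r\<in>R. (\<Sum>i\<in>I. x i * A r i) = b r"
  using fredholm[of I R "\<lambda>i r. A r i" b, OF assms(2,1,3)] by metis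

text \<open>This is tr(AB) = tr(BA) for maps back and forth between two spaces with bases
  \<open>S\<close> and \<open>T\<close>.\<close>

lemma trace_comm:
  fixes A B :: "('p \<Rightarrow>\<^sub>0 'k::field) \<Rightarrow> ('p \<Rightarrow>\<^sub>0 'k)"
  assumes "linmap A" "linmap B" "finite S" "finite T"
    and "\<And>j. j \<in> S \<Longrightarrow> keys (B (sg j)) \<subseteq> T" "\<And>l. l \<in> T \<Longrightarrow> keys (A (sg l)) \<subseteq> S"
  shows "(\<Sum>j\<in>S. lookup (A (B (sg j))) j) = (\<Sum>l\<in>T. lookup (B (A (sg l))) l)"
proof -
  have "(\<Sum>j\<in>S. lookup (A (B (sg j))) j) = (\<Sum>j\<in>S. \<Sum>l\<in>T. lookup (B (sg j)) l * lookup (A (sg l)) j)"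
  proof (rule sum.cong)
    fix j assume "j \<in> S"
    from linmap_expand[OF assms(1,4) assms(5)[OF this]]
    show "lookup (A (B (sg j))) j = (\<Sum>l\<in>T. lookup (B (sg j)) l * lookup (A (sg l)) j)"
      by (simp add: lookup_sum lookup_scale)
  qed simp
  also have "\<dots> = (\<Sum>l\<in>T. \<Sum>j\<in>S. lookup (B (sg j)) l * lookup (A (sg l)) j)"
    by (rule sum.swap)
  also have "\<dots> = (\<Sum>l\<in>T. lookup (B (A (sg l))) l)"
  proof (rule sum.cong)
    fix l assume "l \<in> T"
    from linmap_expand[OF assms(2,3) assms(6)[OF this]]
    show "(\<Sum>j\<in>S. lookup (B (sg j)) l * lookup (A (sg l)) j) = lookup (B (A (sg l))) l"
      by (simp add: lookup_sum lookup_scale mult.commute)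
  qed simp
  finally show ?thesis .
qed

section \<open>Multiplication by arrows and maps defined on generators\<close>

context preproj
begin

abbreviation L :: "'e \<Rightarrow> (('v, 'e + 'e) qpath \<Rightarrow>\<^sub>0 'k) \<Rightarrow> (('v, 'e + 'e) qpath \<Rightarrow>\<^sub>0 'k)" where
  "L \<gamma> z \<equiv> arr (Inl \<gamma>) \<star> z"
abbreviation Ls :: "'e \<Rightarrow> (('v, 'e + 'e) qpath \<Rightarrow>\<^sub>0 'k) \<Rightarrow> (('v, 'e + 'e) qpath \<Rightarrow>\<^sub>0 'k)" where
  "Ls \<gamma> z \<equiv> arr (Inr \<gamma>) \<star> z"

lemma linmap_L: "linmap (\<lambda>z. arr \<alpha> \<star> z)"
  by (rule linmap_mult_right')

lemma linmap_R: "linmap (\<lambda>z. z \<star> arr \<alpha>)"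
  by (rule linmap_mult_left')

lemma arcs_keys: "\<alpha> \<in> arcs H \<Longrightarrow> keys (arr \<alpha>) \<subseteq> qpaths H"
  using H.head_in_verts[of \<alpha>] by (simp add: arrow_elem_def H.qpaths_Cons H.qpaths_Nil)

lemma arr_mult_J: "\<alpha> \<in> arcs H \<Longrightarrow> f \<in> J \<Longrightarrow> arr \<alpha> \<star> f \<in> J"
  by (rule mult_J_left[OF _ arcs_keys])

lemma J_mult_arr: "\<alpha> \<in> arcs H \<Longrightarrow> f \<in> J \<Longrightarrow> f \<star> arr \<alpha> \<in> J"
  by (rule mult_J_right[OF _ arcs_keys])

lemma nf_arr_nf: "\<alpha> \<in> arcs H \<Longrightarrow> nf (arr \<alpha> \<star> nf z) = nf (arr \<alpha> \<star> z)"
  unfolding nf_eq_iff linmap_diff[OF linmap_L, symmetric]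
  using arr_mult_J[OF _ nf_cong_J[of z]] J_scale[of "arr \<alpha> \<star> (z - nf z)" "-1"]
  by (simp add: linmap_diff[OF linmap_L] pscale_right_diff)

lemma PT_snoc: "(u, es @ [\<alpha>]) \<in> PT t d v \<longleftrightarrow>
  \<alpha> \<in> arcs H \<and> v = head H \<alpha> \<and> (\<exists>c. d = c + deg \<alpha> \<and> (u, es) \<in> PT t c (tail H \<alpha>))"
  by (auto simp: PT_def path_class_def H.qpaths_snoc)

lemma arr_mult_PT:
  assumes "q \<in> PT t d (tail H \<alpha>)" "\<alpha> \<in> arcs H"
  shows "arr \<alpha> \<star> sg q = sg (fst q, snd q @ [\<alpha>])" "(fst q, snd q @ [\<alpha>]) \<in> PT t (d + deg \<alpha>) (head H \<alpha>)"
proof -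
  show "arr \<alpha> \<star> sg q = sg (fst q, snd q @ [\<alpha>])"
    using assms by (auto simp: arr_mult_sg PT_def path_class_def)
  show "(fst q, snd q @ [\<alpha>]) \<in> PT t (d + deg \<alpha>) (head H \<alpha>)"
    unfolding PT_snoc using assms by (cases q) auto
qed

lemma keys_arr_mult:
  assumes "\<alpha> \<in> arcs H" "keys z \<subseteq> PT t d (tail H \<alpha>)"
  shows "keys (arr \<alpha> \<star> z) \<subseteq> PT t (d + deg \<alpha>) (head H \<alpha>)"
  by (rule keys_in_linmap[OF linmap_L _ assms(2)])
    (use arr_mult_PT[OF _ assms(1)] in auto)

lemma keys_L: "\<gamma> \<in> arcs G \<Longrightarrow> keys z \<subseteq> PT t d (tail G \<gamma>) \<Longrightarrow> keys (L \<gamma> z) \<subseteq> PT t d (head G \<gamma>)"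
  using keys_arr_mult[of "Inl \<gamma>" z t d] by simp

lemma keys_Ls: "\<gamma> \<in> arcs G \<Longrightarrow> keys z \<subseteq> PT t d (head G \<gamma>) \<Longrightarrow> keys (Ls \<gamma> z) \<subseteq> PT t (Suc d) (tail G \<gamma>)"
  using keys_arr_mult[of "Inr \<gamma>" z t d] by simp

lemma mult_arr_PT:
  assumes "q \<in> PT (head H \<alpha>) d v" "\<alpha> \<in> arcs H"
  shows "sg q \<star> arr \<alpha> = sg (tail H \<alpha>, \<alpha> # snd q)" "(tail H \<alpha>, \<alpha> # snd q) \<in> PT (tail H \<alpha>) (d + deg \<alpha>) v"
  using assms by (cases q; auto simp: sg_mult_arr PT_def path_class_def H.qpaths_Cons qpath_end_Cons)+

lemma keys_mult_arr:
  assumes "\<alpha> \<in> arcs H" "keys z \<subseteq> PT (head H \<alpha>) d v"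
  shows "keys (z \<star> arr \<alpha>) \<subseteq> PT (tail H \<alpha>) (d + deg \<alpha>) v"
  by (rule keys_in_linmap[OF linmap_R _ assms(2)])
    (use mult_arr_PT[OF _ assms(1)] in auto)

lemma keys_IX_PT: "keys z \<subseteq> IX t d v \<Longrightarrow> keys z \<subseteq> PT t d v"
  using IX_subset by blast

lemma keys_nf_L: "\<gamma> \<in> arcs G \<Longrightarrow> keys z \<subseteq> IX t d (tail G \<gamma>) \<Longrightarrow> keys (nf (L \<gamma> z)) \<subseteq> IX t d (head G \<gamma>)"
  by (intro keys_nf_IX keys_L keys_IX_PT)

text \<open>Computes the map \<open>F\<close> of \<open>universal_property\<close> on a path given
  by its reversed list of arrows. The trailing arrows of \<Gamma> act through \<Theta> and
  \<open>C\<close>; a path of degree \<open>Suc d\<close> contains a starred arrow, and the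
  recursion stops at the last one, where \<psi> takes over.\<close>

primrec upf where
  "upf \<Theta> C \<psi> u [] = (0 :: ('v, 'e + 'e) qpath \<Rightarrow>\<^sub>0 'k)"
| "upf \<Theta> C \<psi> u (\<alpha> # r) = (case \<alpha> of
     Inl \<gamma> \<Rightarrow> \<Theta> \<gamma> (upf \<Theta> C \<psi> u r) + C \<gamma> (sg (u, rev r))
   | Inr \<gamma> \<Rightarrow> \<psi> \<gamma> (sg (u, rev r)))"

text \<open>\<open>V\<^sup>t\<^sub>d\<^sub>+\<^sub>1\<close> is generated over the path algebra of \<open>\<Gamma>\<close> by the elements \<open>\<gamma>\<^sup>* x\<close> with \<open>x \<in> V\<^sup>t\<^sub>d\<close>, subject only
  to the relations \<open>m\<^sub>v x = 0\<close>. The cocycle \<open>C\<close> and the twist \<open>\<tau>\<close> allow crossed homomorphisms.\<close>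

lemma universal_property:
  assumes lin: "\<And>\<gamma>. linmap (\<psi> \<gamma>)" "\<And>\<gamma>. linmap (C \<gamma>)"
    and \<psi>: "\<And>\<gamma> q. \<gamma> \<in> arcs G \<Longrightarrow> q \<in> PT t d (head G \<gamma>) \<Longrightarrow> keys (\<psi> \<gamma> (sg q)) \<subseteq> IX r e (tail G \<gamma>)"
    and C: "\<And>\<gamma> q. \<gamma> \<in> arcs G \<Longrightarrow> q \<in> PT t (Suc d) (tail G \<gamma>) \<Longrightarrow> keys (C \<gamma> (sg q)) \<subseteq> IX r e (head G \<gamma>)"
    and \<psi>J: "\<And>\<gamma> f. \<gamma> \<in> arcs G \<Longrightarrow> f \<in> J \<Longrightarrow> keys f \<subseteq> PT t d (head G \<gamma>) \<Longrightarrow> \<psi> \<gamma> f = 0"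
    and CJ: "\<And>\<gamma> f. \<gamma> \<in> arcs G \<Longrightarrow> f \<in> J \<Longrightarrow> keys f \<subseteq> PT t (Suc d) (tail G \<gamma>) \<Longrightarrow> C \<gamma> f = 0"
    and rel: "\<And>v q. q \<in> PT t d v \<Longrightarrow>
      (\<Sum>\<gamma>\<in>{\<gamma> \<in> arcs G. tail G \<gamma> = v}. a \<gamma> *\<^sub>p \<psi> \<gamma> (L \<gamma> (sg q))) =
      (\<Sum>\<gamma>\<in>{\<gamma> \<in> arcs G. head G \<gamma> = v}. b \<gamma> *\<^sub>p (\<tau> \<gamma> *\<^sub>p nf (L \<gamma> (\<psi> \<gamma> (sg q))) + C \<gamma> (Ls \<gamma> (sg q))))"
  obtains F where "linmap F" "\<And>v q. q \<in> PT t (Suc d) v \<Longrightarrow> keys (F (sg q)) \<subseteq> IX r e v"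
    "\<And>f v. f \<in> J \<Longrightarrow> keys f \<subseteq> PT t (Suc d) v \<Longrightarrow> F f = 0"
    "\<And>\<gamma> q. \<gamma> \<in> arcs G \<Longrightarrow> q \<in> PT t d (head G \<gamma>) \<Longrightarrow> F (Ls \<gamma> (sg q)) = \<psi> \<gamma> (sg q)"
    "\<And>\<gamma> q. \<gamma> \<in> arcs G \<Longrightarrow> q \<in> PT t (Suc d) (tail G \<gamma>) \<Longrightarrow>
       F (L \<gamma> (sg q)) = \<tau> \<gamma> *\<^sub>p nf (L \<gamma> (F (sg q))) + C \<gamma> (sg q)"
proof -
  define \<Theta> where "\<Theta> = (\<lambda>\<gamma> z. \<tau> \<gamma> *\<^sub>p nf (L \<gamma> z))"
  have lin_\<Theta>: "linmap (\<Theta> \<gamma>)" for \<gamma>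
    unfolding \<Theta>_def by (rule linmap_scaled[OF linmap_comp[OF linmap_nf linmap_L]])
  define F where "F = lext (\<lambda>p. upf \<Theta> C \<psi> (fst p) (rev (snd p)))"
  have lF: "linmap F" by (simp add: F_def)
  have F_Inl: "F (sg (u, es @ [Inl \<gamma>])) = \<Theta> \<gamma> (F (sg (u, es))) + C \<gamma> (sg (u, es))" for u es \<gamma>
    by (simp add: F_def)
  have F_Inr: "F (sg (u, es @ [Inr \<gamma>])) = \<psi> \<gamma> (sg (u, es))" for u es \<gamma>
    by (simp add: F_def)
  have FL: "F (L \<gamma> (sg q)) = \<Theta> \<gamma> (F (sg q)) + C \<gamma> (sg q)"
    if "\<gamma> \<in> arcs G" "q \<in> PT t d' (tail G \<gamma>)" for \<gamma> q d'
    using arr_mult_PT(1)[of q t d' "Inl \<gamma>"] that F_Inl[of "fst q" "snd q" \<gamma>] by simp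
  have FLs: "F (Ls \<gamma> (sg q)) = \<psi> \<gamma> (sg q)" if "\<gamma> \<in> arcs G" "q \<in> PT t d' (head G \<gamma>)" for \<gamma> q d'
    using arr_mult_PT(1)[of q t d' "Inr \<gamma>"] that F_Inr[of "fst q" "snd q" \<gamma>] by simp
  have FL': "F (L \<gamma> z) = \<Theta> \<gamma> (F z) + C \<gamma> z" if "\<gamma> \<in> arcs G" "keys z \<subseteq> PT t d' (tail G \<gamma>)" for \<gamma> z d'
    by (rule linmap_eq_on[OF linmap_comp[OF lF linmap_L] linmap_plus[OF linmap_comp[OF lin_\<Theta> lF] lin(2)] _ that(2)])
      (rule FL[OF that(1)])
  have FLs': "F (Ls \<gamma> z) = \<psi> \<gamma> z" if "\<gamma> \<in> arcs G" "keys z \<subseteq> PT t d' (head G \<gamma>)" for \<gamma> z d'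
    by (rule linmap_eq_on[OF linmap_comp[OF lF linmap_L] lin(1) _ that(2)])
      (rule FLs[OF that(1)])
  have keysF: "keys (F (sg (u, es))) \<subseteq> IX r e v" if "(u, es) \<in> PT t (Suc d) v" for u es v
    using that
  proof (induction es arbitrary: v rule: rev_induct)
    case Nil
    then show ?case by (simp add: PT_def path_class_def)
  next
    case (snoc \<alpha> es)
    show ?case
    proof (cases \<alpha>)
      case (Inl \<gamma>)
      then have *: "\<gamma> \<in> arcs G" "v = head G \<gamma>" "(u, es) \<in> PT t (Suc d) (tail G \<gamma>)"
        using snoc.prems by (auto simp: PT_snoc)
      have "keys (\<Theta> \<gamma> (F (sg (u, es)))) \<subseteq> IX r e v"
        unfolding \<Theta>_def *(2) using snoc.IH[OF *(3)] *(1)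
        by (intro order_trans[OF keys_scale] keys_nf_L)
      then show ?thesis
        using C[OF *(1,3)] Poly_Mapping.keys_add[of "\<Theta> \<gamma> (F (sg (u, es)))" "C \<gamma> (sg (u, es))"]
        by (auto simp: Inl F_Inl *(2))
    next
      case (Inr \<gamma>)
      then have *: "\<gamma> \<in> arcs G" "v = tail G \<gamma>" "(u, es) \<in> PT t d (head G \<gamma>)"
        using snoc.prems by (auto simp: PT_snoc)
      then show ?thesis using \<psi>[OF *(1,3)] by (simp add: Inr F_Inr)
    qed
  qed
  \<comment> \<open>Vanishing on the generators of \<open>J\<close>, by induction on their left
    factor. For the trivial path this is the assumption \<open>rel\<close>; a further arrow
    multiplies from the left, where \<open>F\<close> is known and \<psi> and \<open>C\<close>
    respect \<open>J\<close>.\<close>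
  have gen: "F (sg (w, es) \<star> rel \<star> sg q) = 0"
    if "(w, es) \<in> qpaths H" "q \<in> qpaths H" "fst q = t" "pend q = w" "ldeg es + star_degree q = d" for w es q
    using that(1,5)
  proof (induction es rule: rev_induct)
    case Nil
    have q: "q \<in> PT t d w" using that Nil by (auto simp: PT_def path_class_def)
    have "F (sg (w, []) \<star> rel \<star> sg q) =
      (\<Sum>\<alpha>\<in>arcs H. eps \<alpha> *\<^sub>p (if tail H \<alpha> = w then F (sg (fst q, snd q @ [\<alpha>, bar \<alpha>])) else 0))"
      unfolding gen_eq linmap_sum[OF lF] linmap_scale[OF lF]
      by (intro sum.cong refl arg_cong[where f = "pscale _"]) (simp add: that(4) linmap_0[OF lF])
    also have "\<dots> = (\<Sum>\<gamma>\<in>arcs G. if tail G \<gamma> = w then a \<gamma> *\<^sub>p \<psi> \<gamma> (L \<gamma> (sg q)) else 0) -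
      (\<Sum>\<gamma>\<in>arcs G. if head G \<gamma> = w then b \<gamma> *\<^sub>p (\<tau> \<gamma> *\<^sub>p nf (L \<gamma> (\<psi> \<gamma> (sg q))) + C \<gamma> (Ls \<gamma> (sg q))) else 0)"
    proof -
      have 1: "F (sg (fst q, snd q @ [Inl \<gamma>, Inr \<gamma>])) = \<psi> \<gamma> (L \<gamma> (sg q))"
        if "\<gamma> \<in> arcs G" "tail G \<gamma> = w" for \<gamma>
        using F_Inr[of "fst q" "snd q @ [Inl \<gamma>]" \<gamma>] arr_mult_PT(1)[of q t d "Inl \<gamma>"] q that by simp
      have 2: "F (sg (fst q, snd q @ [Inr \<gamma>, Inl \<gamma>])) = \<tau> \<gamma> *\<^sub>p nf (L \<gamma> (\<psi> \<gamma> (sg q))) + C \<gamma> (Ls \<gamma> (sg q))"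
        if "\<gamma> \<in> arcs G" "head G \<gamma> = w" for \<gamma>
        using F_Inl[of "fst q" "snd q @ [Inr \<gamma>]" \<gamma>] arr_mult_PT(1)[of q t d "Inr \<gamma>"] q that
          F_Inr[of "fst q" "snd q" \<gamma>] by (simp add: \<Theta>_def)
      show ?thesis
        unfolding sum_arcs_H diff_conv_add_uminus sum_negf[symmetric]
        by (intro arg_cong2[where f = "(+)"] sum.cong refl) (auto simp: 1 2)
    qed
    also have "\<dots> = 0"
      using rel[OF q] by (simp add: sum.inter_filter)
    finally show ?case .
  next
    case (snoc \<alpha> es)
    have \<alpha>: "\<alpha> \<in> arcs H" "tail H \<alpha> = pend (w, es)" "(w, es) \<in> qpaths H"
      using snoc.prems by (auto simp: H.qpaths_snoc)
    let ?g = "sg (w, es) \<star> rel \<star> sg q"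
    have gJ: "?g \<in> J" by (rule J_gen) (use \<alpha> that in auto)
    have g: "keys ?g \<subseteq> PT t (ldeg es + 1 + star_degree q) (tail H \<alpha>)"
      using gen_keys(1)[of _ "(w, es)" q] J_keys[OF gJ] \<alpha> that by (auto simp: PT_def)
    have eq: "sg (w, es @ [\<alpha>]) \<star> rel \<star> sg q = arr \<alpha> \<star> ?g"
      using \<alpha> by (simp add: qpath_mult_assoc[symmetric] arr_mult_sg)
    show ?case
    proof (cases \<alpha>)
      case (Inl \<gamma>)
      have g': "keys ?g \<subseteq> PT t (Suc d) (tail G \<gamma>)" using g snoc.prems Inl by simp
      show ?thesis
        using FL'[OF _ g'] snoc.IH CJ[OF _ gJ g'] \<alpha> snoc.prems
        unfolding eq by (simp add: Inl linmap_0[OF lin_\<Theta>])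
    next
      case (Inr \<gamma>)
      have g': "keys ?g \<subseteq> PT t d (head G \<gamma>)" using g snoc.prems Inr by simp
      show ?thesis
        using FLs'[OF _ g'] \<psi>J[OF _ gJ g'] \<alpha> unfolding eq by (simp add: Inr)
    qed
  qed
  have FJ: "F f = 0" if "f \<in> J" "keys f \<subseteq> PT t (Suc d) v" for f v
  proof -
    \<comment> \<open>The projection removes the generators of other classes, so only those treated
      in \<open>gen\<close> and products of paths that do not compose remain.\<close>
    let ?supp_restrict = "supp_restrict (\<lambda>p. path_class p = (t, v, Suc d))"
    have "F (?supp_restrict f) \<in> {0}"
    proof (rule J_induct[OF that(1) linmap_comp[OF lF linmap_supp_restrict]])
      fix p q assume pq: "p \<in> qpaths H" "q \<in> qpaths H"
      show "F (?supp_restrict (sg p \<star> rel \<star> sg q)) \<in> {0}"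
      proof (cases "(fst q, pend p, star_degree p + 1 + star_degree q) = (t, v, Suc d) \<and> pend q = fst p")
        case True
        have "?supp_restrict (sg p \<star> rel \<star> sg q) = sg p \<star> rel \<star> sg q"
          by (rule supp_restrict_id) (use True gen_keys(1) in auto)
        then show ?thesis using gen[of "fst p" "snd p" q] True pq by simp
      next
        case False
        have "?supp_restrict (sg p \<star> rel \<star> sg q) = 0"
        proof (cases "pend q = fst p")
          case True
          then show ?thesis using False gen_keys(1) by (intro supp_restrict_none) fastforce
        next
          case False
          then have "sg p \<star> rel \<star> sg q = 0"
            unfolding gen_eq by (intro sum.neutral) auto
          then show ?thesis by (simp add: linmap_0[OF linmap_supp_restrict])
        qed
        then show ?thesis by (simp add: linmap_0[OF lF])
      qed
    qed simp
    moreover have "?supp_restrict f = f" by (rule supp_restrict_id) (use that in \<open>auto simp: PT_def\<close>)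
    ultimately show ?thesis by simp
  qed
  show thesis
  proof (rule that[OF lF])
    show "keys (F (sg q)) \<subseteq> IX r e v" if "q \<in> PT t (Suc d) v" for q v
      using keysF[of "fst q" "snd q"] that by simp
  qed (use FJ FL FLs in \<open>auto simp: \<Theta>_def\<close>)
qed

subsection \<open>Matrices and traces\<close>

lemma finite_sums_by_tail: "(\<Sum>v\<in>verts G. \<Sum>\<gamma>\<in>{\<gamma> \<in> arcs G. tail G \<gamma> = v}. f \<gamma>) = sum f (arcs G)"
  and finite_sums_by_head: "(\<Sum>v\<in>verts G. \<Sum>\<gamma>\<in>{\<gamma> \<in> arcs G. head G \<gamma> = v}. f \<gamma>) = sum f (arcs G)"
  by (rule sum_by_key; simp)+

lemma rel_mult:
  assumes "q \<in> PT t d v"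
  shows "rel \<star> sg q = (\<Sum>\<gamma>\<in>{\<gamma> \<in> arcs G. tail G \<gamma> = v}. a \<gamma> *\<^sub>p Ls \<gamma> (L \<gamma> (sg q))) -
    (\<Sum>\<gamma>\<in>{\<gamma> \<in> arcs G. head G \<gamma> = v}. b \<gamma> *\<^sub>p L \<gamma> (Ls \<gamma> (sg q)))"
proof -
  have v: "pend q = v" using assms by (simp add: PT_def path_class_def)
  have "rel \<star> sg q = (\<Sum>\<alpha>\<in>arcs H. if tail H \<alpha> = v then eps \<alpha> *\<^sub>p (arr (bar \<alpha>) \<star> (arr \<alpha> \<star> sg q)) else 0)"
    unfolding rel_def linmap_sum[OF linmap_mult_left'] qpath_mult_scale_left
    by (intro sum.cong refl) (auto simp: arr_mult_sg sg_mult_sg v)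
  also have "\<dots> = (\<Sum>\<gamma>\<in>arcs G. if tail G \<gamma> = v then a \<gamma> *\<^sub>p Ls \<gamma> (L \<gamma> (sg q)) else 0) -
    (\<Sum>\<gamma>\<in>arcs G. if head G \<gamma> = v then b \<gamma> *\<^sub>p L \<gamma> (Ls \<gamma> (sg q)) else 0)"
    unfolding sum_arcs_H diff_conv_add_uminus sum_negf[symmetric]
    by (intro arg_cong2[where f = "(+)"] sum.cong refl) auto
  finally show ?thesis by (simp add: sum.inter_filter)
qed

lemma rel_mult_J: "q \<in> qpaths H \<Longrightarrow> rel \<star> sg q \<in> J"
  by (rule mult_J_right[OF rel_in_J]) simp

lemma keys_rel_mult:
  assumes "q \<in> PT t d v"
  shows "keys (rel \<star> sg q) \<subseteq> PT t (Suc d) v"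
proof
  fix r assume r: "r \<in> keys (rel \<star> sg q)"
  have q: "q \<in> qpaths H" "path_class q = (t, v, d)" using assms by (auto simp: PT_def)
  have "rel \<star> sg q = sg (v, []) \<star> rel \<star> sg q"
    unfolding rel_def linmap_sum[OF linmap_mult_left'] linmap_sum[OF linmap_mult_right']
      qpath_mult_scale_left qpath_mult_scale_right
    using q(2) by (intro sum.cong refl arg_cong[where f = "pscale _"]) (auto simp: sg_mult_sg path_class_def qpath_end_Cons)
  then show "r \<in> PT t (Suc d) v"
    using r gen_keys(1)[of r "(v, [])" q] J_keys[OF rel_mult_J[OF q(1)]] q(2) by (auto simp: PT_def path_class_def)
qed

text \<open>The map with matrix \<open>f\<close> in the basis paths; \<open>X i\<close> collects the positions in column \<open>i\<close> that the
  grading permits.\<close>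

definition mat_map :: "(('v, 'e + 'e) qpath \<Rightarrow> ('v, 'e + 'e) qpath set) \<Rightarrow>
    (('v, 'e + 'e) qpath \<Rightarrow> ('v, 'e + 'e) qpath \<Rightarrow> 'k) \<Rightarrow>
    (('v, 'e + 'e) qpath \<Rightarrow>\<^sub>0 'k) \<Rightarrow> (('v, 'e + 'e) qpath \<Rightarrow>\<^sub>0 'k)" where
  "mat_map X f z = lext (\<lambda>i. \<Sum>j\<in>X i. f i j *\<^sub>p sg j) (nf z)"

lemma linmap_mat_map [simp]: "linmap (mat_map X f)"
  unfolding mat_map_def[abs_def] by (rule linmap_comp[OF linmap_lext linmap_nf])

lemma mat_map_J: "z \<in> J \<Longrightarrow> mat_map X f z = 0"
  by (simp add: mat_map_def nf_J linmap_0)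

lemma keys_mat_map: "(\<And>i. i \<in> keys (nf z) \<Longrightarrow> X i \<subseteq> T) \<Longrightarrow> keys (mat_map X f z) \<subseteq> T"
  unfolding mat_map_def
proof (rule keys_in_linmap[OF linmap_lext _ order_refl])
  fix i assume "i \<in> keys (nf z)" "\<And>i. i \<in> keys (nf z) \<Longrightarrow> X i \<subseteq> T"
  then have i: "X i \<subseteq> T" by blast
  show "keys (lext (\<lambda>i. \<Sum>j\<in>X i. f i j *\<^sub>p sg j) (sg i)) \<subseteq> T"
    unfolding lext_sg
    by (intro order_trans[OF Poly_Mapping.keys_sum] UN_least order_trans[OF keys_scale]) (use i in auto)
qed

lemma lookup_sum_sg: "finite X \<Longrightarrow> lookup (\<Sum>j\<in>X. f j *\<^sub>p sg j) j0 = (if j0 \<in> X then f j0 else (0::'k))"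
  by (simp add: lookup_sum lookup_scale lookup_single when_def if_distrib[of "(*) _"] sum.delta' cong: if_cong)

lemma lookup_lincomb: "lookup (\<Sum>i\<in>S. f i *\<^sub>p g i) j = (\<Sum>i\<in>S. f i * lookup (g i) j :: 'k)"
  by (simp add: lookup_sum lookup_scale)

lemma lookup_mat_map:
  assumes "finite S" "keys (nf z) \<subseteq> S" "\<And>i. i \<in> S \<Longrightarrow> finite (X i)"
  shows "lookup (mat_map X f z) j = (\<Sum>i\<in>S. lookup (nf z) i * (if j \<in> X i then f i j else 0))"
  unfolding mat_map_def lext_superset[OF assms(1,2)] lookup_lincomb[of _ _ S]
  by (intro sum.cong refl arg_cong2[where f = "(*)"] lookup_sum_sg assms(3))

lemma lookup_mat_map_sg:
  assumes "i \<in> IX t d v" "finite (X i)"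
  shows "lookup (mat_map X f (sg i)) j = (if j \<in> X i then f i j else 0)"
proof -
  have "nf (sg i) = sg i" using assms(1) by (simp add: IX_def basis_paths_def)
  then show ?thesis using lookup_mat_map[of "{i}" "sg i" X f j] assms(2) by simp
qed

lemma lookup_linmap:
  assumes "linmap F" "finite S" "keys z \<subseteq> S"
  shows "lookup (F z) j = (\<Sum>i\<in>S. lookup z i * lookup (F (sg i)) j)"
  unfolding linmap_expand[OF assms] by (simp add: lookup_sum lookup_scale)

lemma linmap_nf_cong:
  assumes "linmap F" "\<And>f. f \<in> J \<Longrightarrow> keys f \<subseteq> PT t d v \<Longrightarrow> F f = 0" "keys z \<subseteq> PT t d v"
  shows "F (nf z) = F z"
proof -
  have "keys (z - nf z) \<subseteq> PT t d v"
    using keys_nf_IX[OF assms(3)] IX_subset[of t d v] assms(3) Poly_Mapping.keys_diff[of z "nf z"] by blast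
  then have "F (z - nf z) = 0" by (intro assms(2) nf_cong_J)
  then show ?thesis by (simp add: linmap_diff[OF assms(1)])
qed

lemma poly_mapping_eq_IX:
  fixes f g :: "_ \<Rightarrow>\<^sub>0 'k"
  assumes "keys f \<subseteq> IX t d v" "keys g \<subseteq> IX t d v" "\<And>j. j \<in> IX t d v \<Longrightarrow> lookup f j = lookup g j"
  shows "f = g"
  using assms by (intro poly_mapping_eqI) (metis in_keys_iff subsetD)

text \<open>By tr(AB) = tr(BA) the trace of \<open>L \<gamma> k \<psi>\<close> at the head of
  \<gamma> becomes the trace of \<open>k \<psi> L \<gamma>\<close> at its tail. Grouped by vertices,
  the two kinds of terms are then the traces of \<open>k\<close> applied to the two sides of
  \<open>rel\<close>. Hence the solutions \<psi>, which amount to homomorphisms from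
  \<open>V\<^sup>t\<^sub>d\<^sub>+\<^sub>1\<close> to \<open>V\<^sup>r\<^sub>e\<close>, pair to zero
  with the coboundary of \<open>k\<close>.\<close>

lemma trace_relation:
  assumes lin: "\<And>\<gamma>. linmap (\<psi> \<gamma>)" "linmap k"
    and \<psi>: "\<And>\<gamma> q. \<gamma> \<in> arcs G \<Longrightarrow> q \<in> PT t d (head G \<gamma>) \<Longrightarrow> keys (\<psi> \<gamma> (sg q)) \<subseteq> IX r e (tail G \<gamma>)"
    and \<psi>J: "\<And>\<gamma> f. \<gamma> \<in> arcs G \<Longrightarrow> f \<in> J \<Longrightarrow> keys f \<subseteq> PT t d (head G \<gamma>) \<Longrightarrow> \<psi> \<gamma> f = 0"
    and k: "\<And>v q. q \<in> PT r e v \<Longrightarrow> keys (k (sg q)) \<subseteq> IX t d v"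
    and kJ: "\<And>v f. f \<in> J \<Longrightarrow> keys f \<subseteq> PT r e v \<Longrightarrow> k f = 0"
    and rel: "\<And>v q. q \<in> IX t d v \<Longrightarrow>
      (\<Sum>\<gamma>\<in>{\<gamma> \<in> arcs G. tail G \<gamma> = v}. a \<gamma> *\<^sub>p \<psi> \<gamma> (L \<gamma> (sg q))) =
      (\<Sum>\<gamma>\<in>{\<gamma> \<in> arcs G. head G \<gamma> = v}. b \<gamma> *\<^sub>p nf (L \<gamma> (\<psi> \<gamma> (sg q))))"
  shows "(\<Sum>\<gamma>\<in>arcs G. \<Sum>j\<in>IX t d (head G \<gamma>).
    lookup (a \<gamma> *\<^sub>p nf (L \<gamma> (k (\<psi> \<gamma> (sg j)))) - b \<gamma> *\<^sub>p k (L \<gamma> (\<psi> \<gamma> (sg j)))) j) = 0"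
proof -
  have IP: "q \<in> IX t d v \<Longrightarrow> q \<in> PT t d v" for q v using IX_subset by blast
  have kk: "keys (k z) \<subseteq> IX t d v" if "keys z \<subseteq> PT r e v" for z v
    by (rule keys_in_linmap[OF lin(2) k that])
  have T1: "(\<Sum>j\<in>IX t d (head G \<gamma>). lookup (nf (L \<gamma> (k (\<psi> \<gamma> (sg j))))) j) =
      (\<Sum>l\<in>IX t d (tail G \<gamma>). lookup (k (\<psi> \<gamma> (L \<gamma> (sg l)))) l)" if \<gamma>: "\<gamma> \<in> arcs G" for \<gamma>
  proof -
    have "(\<Sum>j\<in>IX t d (head G \<gamma>). lookup (nf (L \<gamma> (k (\<psi> \<gamma> (sg j))))) j) =
      (\<Sum>l\<in>IX t d (tail G \<gamma>). lookup (k (\<psi> \<gamma> (nf (L \<gamma> (sg l))))) l)"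
    proof (rule trace_comm[OF linmap_comp[OF linmap_nf linmap_L] linmap_comp[OF lin(2) lin(1)]])
      fix j assume "j \<in> IX t d (head G \<gamma>)"
      then show "keys (k (\<psi> \<gamma> (sg j))) \<subseteq> IX t d (tail G \<gamma>)"
        by (intro kk keys_IX_PT \<psi>[OF \<gamma>] IP)
    next
      fix l assume "l \<in> IX t d (tail G \<gamma>)"
      then show "keys (nf (L \<gamma> (sg l))) \<subseteq> IX t d (head G \<gamma>)"
        by (intro keys_nf_L \<gamma>) simp
    qed simp_all
    also have "\<dots> = (\<Sum>l\<in>IX t d (tail G \<gamma>). lookup (k (\<psi> \<gamma> (L \<gamma> (sg l)))) l)"
    proof (intro sum.cong refl)
      fix l assume "l \<in> IX t d (tail G \<gamma>)"
      then have "keys (L \<gamma> (sg l)) \<subseteq> PT t d (head G \<gamma>)"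
        by (intro keys_L[OF \<gamma>]) (simp add: IP)
      then have "\<psi> \<gamma> (nf (L \<gamma> (sg l))) = \<psi> \<gamma> (L \<gamma> (sg l))"
        by (intro linmap_nf_cong[OF lin(1) \<psi>J[OF \<gamma>]])
      then show "lookup (k (\<psi> \<gamma> (nf (L \<gamma> (sg l))))) l = lookup (k (\<psi> \<gamma> (L \<gamma> (sg l)))) l"
        by (rule arg_cong)
    qed
    finally show ?thesis .
  qed
  have T2: "k (nf (L \<gamma> (\<psi> \<gamma> (sg j)))) = k (L \<gamma> (\<psi> \<gamma> (sg j)))"
    if "\<gamma> \<in> arcs G" "j \<in> IX t d (head G \<gamma>)" for \<gamma> j
    by (rule linmap_nf_cong[OF lin(2) kJ keys_L[OF that(1) keys_IX_PT[OF \<psi>[OF that(1) IP[OF that(2)]]]]])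
  have 1: "(\<Sum>\<gamma>\<in>arcs G. a \<gamma> * (\<Sum>l\<in>IX t d (tail G \<gamma>). lookup (k (\<psi> \<gamma> (L \<gamma> (sg l)))) l)) =
      (\<Sum>v\<in>verts G. \<Sum>l\<in>IX t d v. lookup (k (\<Sum>\<gamma>\<in>{\<gamma> \<in> arcs G. tail G \<gamma> = v}. a \<gamma> *\<^sub>p \<psi> \<gamma> (L \<gamma> (sg l)))) l)"
    unfolding finite_sums_by_tail[symmetric]
  proof (intro sum.cong refl)
    fix v
    have "(\<Sum>\<gamma>\<in>{\<gamma> \<in> arcs G. tail G \<gamma> = v}. a \<gamma> * (\<Sum>l\<in>IX t d (tail G \<gamma>). lookup (k (\<psi> \<gamma> (L \<gamma> (sg l)))) l)) =
      (\<Sum>\<gamma>\<in>{\<gamma> \<in> arcs G. tail G \<gamma> = v}. \<Sum>l\<in>IX t d v. a \<gamma> * lookup (k (\<psi> \<gamma> (L \<gamma> (sg l)))) l)"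
      by (intro sum.cong refl) (simp add: sum_distrib_left)
    also have "\<dots> = (\<Sum>l\<in>IX t d v. \<Sum>\<gamma>\<in>{\<gamma> \<in> arcs G. tail G \<gamma> = v}. a \<gamma> * lookup (k (\<psi> \<gamma> (L \<gamma> (sg l)))) l)"
      by (rule sum.swap)
    finally show "(\<Sum>\<gamma>\<in>{\<gamma> \<in> arcs G. tail G \<gamma> = v}. a \<gamma> * (\<Sum>l\<in>IX t d (tail G \<gamma>). lookup (k (\<psi> \<gamma> (L \<gamma> (sg l)))) l)) =
      (\<Sum>l\<in>IX t d v. lookup (k (\<Sum>\<gamma>\<in>{\<gamma> \<in> arcs G. tail G \<gamma> = v}. a \<gamma> *\<^sub>p \<psi> \<gamma> (L \<gamma> (sg l)))) l)"
      by (simp add: linmap_sum[OF lin(2)] linmap_scale[OF lin(2)] lookup_sum lookup_scale)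
  qed
  have 2: "(\<Sum>\<gamma>\<in>arcs G. b \<gamma> * (\<Sum>j\<in>IX t d (head G \<gamma>). lookup (k (nf (L \<gamma> (\<psi> \<gamma> (sg j))))) j)) =
      (\<Sum>v\<in>verts G. \<Sum>l\<in>IX t d v. lookup (k (\<Sum>\<gamma>\<in>{\<gamma> \<in> arcs G. head G \<gamma> = v}. b \<gamma> *\<^sub>p nf (L \<gamma> (\<psi> \<gamma> (sg l))))) l)"
    unfolding finite_sums_by_head[symmetric]
  proof (intro sum.cong refl)
    fix v
    have "(\<Sum>\<gamma>\<in>{\<gamma> \<in> arcs G. head G \<gamma> = v}. b \<gamma> * (\<Sum>l\<in>IX t d (head G \<gamma>). lookup (k (nf (L \<gamma> (\<psi> \<gamma> (sg l))))) l)) =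
      (\<Sum>\<gamma>\<in>{\<gamma> \<in> arcs G. head G \<gamma> = v}. \<Sum>l\<in>IX t d v. b \<gamma> * lookup (k (nf (L \<gamma> (\<psi> \<gamma> (sg l))))) l)"
      by (intro sum.cong refl) (simp add: sum_distrib_left)
    also have "\<dots> = (\<Sum>l\<in>IX t d v. \<Sum>\<gamma>\<in>{\<gamma> \<in> arcs G. head G \<gamma> = v}. b \<gamma> * lookup (k (nf (L \<gamma> (\<psi> \<gamma> (sg l))))) l)"
      by (rule sum.swap)
    finally show "(\<Sum>\<gamma>\<in>{\<gamma> \<in> arcs G. head G \<gamma> = v}. b \<gamma> * (\<Sum>l\<in>IX t d (head G \<gamma>). lookup (k (nf (L \<gamma> (\<psi> \<gamma> (sg l))))) l)) =
      (\<Sum>l\<in>IX t d v. lookup (k (\<Sum>\<gamma>\<in>{\<gamma> \<in> arcs G. head G \<gamma> = v}. b \<gamma> *\<^sub>p nf (L \<gamma> (\<psi> \<gamma> (sg l))))) l)"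
      by (simp add: linmap_sum[OF lin(2)] linmap_scale[OF lin(2)] lookup_sum lookup_scale)
  qed
  have "(\<Sum>\<gamma>\<in>arcs G. \<Sum>j\<in>IX t d (head G \<gamma>).
      lookup (a \<gamma> *\<^sub>p nf (L \<gamma> (k (\<psi> \<gamma> (sg j)))) - b \<gamma> *\<^sub>p k (L \<gamma> (\<psi> \<gamma> (sg j)))) j) =
    (\<Sum>\<gamma>\<in>arcs G. a \<gamma> * (\<Sum>l\<in>IX t d (tail G \<gamma>). lookup (k (\<psi> \<gamma> (L \<gamma> (sg l)))) l)) -
    (\<Sum>\<gamma>\<in>arcs G. b \<gamma> * (\<Sum>j\<in>IX t d (head G \<gamma>). lookup (k (nf (L \<gamma> (\<psi> \<gamma> (sg j))))) j))"
    unfolding sum_subtractf[symmetric]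
    by (intro sum.cong refl)
      (simp add: lookup_minus lookup_scale sum_subtractf sum_distrib_left[symmetric] T1 T2)
  also have "\<dots> = 0"
    unfolding 1 2 by (simp add: rel)
  finally show ?thesis .
qed

end

lemma sum_triple:
  assumes "finite S" "\<And>\<gamma>. \<gamma> \<in> S \<Longrightarrow> finite (X \<gamma>)" "\<And>\<gamma>. \<gamma> \<in> S \<Longrightarrow> finite (Y \<gamma>)"
  shows "(\<Sum>p\<in>(SIGMA \<gamma>:S. X \<gamma> \<times> Y \<gamma>). f p) = (\<Sum>\<gamma>\<in>S. \<Sum>i\<in>X \<gamma>. \<Sum>j\<in>Y \<gamma>. f (\<gamma>, i, j))"
proof -
  have "(\<Sum>p\<in>(SIGMA \<gamma>:S. X \<gamma> \<times> Y \<gamma>). f p) = (\<Sum>\<gamma>\<in>S. \<Sum>q\<in>X \<gamma> \<times> Y \<gamma>. f (\<gamma>, q))"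
    using assms by (subst sum.Sigma) (auto simp: split_beta)
  then show ?thesis by (simp add: sum.cartesian_product split_beta)
qed

lemma keys_add_subset: "keys f \<subseteq> T \<Longrightarrow> keys g \<subseteq> T \<Longrightarrow> keys (f + g) \<subseteq> T"
  using Poly_Mapping.keys_add[of f g] by blast

lemma keys_diff_subset: "keys f \<subseteq> T \<Longrightarrow> keys g \<subseteq> T \<Longrightarrow> keys (f - g :: _ \<Rightarrow>\<^sub>0 'k::ab_group_add) \<subseteq> T"
  using Poly_Mapping.keys_diff[of f g] by blast

lemma keys_sum_subset: "(\<And>s. s \<in> S \<Longrightarrow> keys (f s) \<subseteq> T) \<Longrightarrow> keys (sum f S) \<subseteq> T"
  by (intro order_trans[OF Poly_Mapping.keys_sum] UN_least)

lemma keys_scale_subset: "keys f \<subseteq> T \<Longrightarrow> keys (c *\<^sub>p f) \<subseteq> T"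
  using keys_scale[of c f] by blast

section \<open>Homomorphisms over the path algebra of \<Gamma> and their lifts\<close>

context preproj
begin

text \<open>Homomorphisms \<open>V\<^sup>s\<^sub>c \<rightarrow> V\<^sup>t\<^sub>d\<close> of modules over the path algebra of \<open>\<Gamma>\<close>, where each arrow \<open>\<gamma>\<close> of \<open>\<Gamma>\<close> acts on
  the target through \<open>\<sigma>\<^sub>\<gamma> \<gamma>\<close>.\<close>

definition hom :: "('e \<Rightarrow> 'k) \<Rightarrow> 'v \<Rightarrow> nat \<Rightarrow> 'v \<Rightarrow> nat \<Rightarrow>
    ((('v, 'e + 'e) qpath \<Rightarrow>\<^sub>0 'k) \<Rightarrow> (('v, 'e + 'e) qpath \<Rightarrow>\<^sub>0 'k)) \<Rightarrow> bool" where
  "hom \<sigma> s c t d F \<longleftrightarrow> linmap F \<and> (\<forall>v. \<forall>q\<in>PT s c v. keys (F (sg q)) \<subseteq> IX t d v) \<and>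
     (\<forall>v. \<forall>f\<in>J. keys f \<subseteq> PT s c v \<longrightarrow> F f = 0) \<and>
     (\<forall>\<gamma>\<in>arcs G. \<forall>q\<in>PT s c (tail G \<gamma>). F (L \<gamma> (sg q)) = \<sigma> \<gamma> *\<^sub>p nf (L \<gamma> (F (sg q))))"

lemma homI:
  assumes "linmap F" "\<And>v q. q \<in> PT s c v \<Longrightarrow> keys (F (sg q)) \<subseteq> IX t d v"
    "\<And>v f. f \<in> J \<Longrightarrow> keys f \<subseteq> PT s c v \<Longrightarrow> F f = 0"
    "\<And>\<gamma> q. \<gamma> \<in> arcs G \<Longrightarrow> q \<in> PT s c (tail G \<gamma>) \<Longrightarrow> F (L \<gamma> (sg q)) = \<sigma> \<gamma> *\<^sub>p nf (L \<gamma> (F (sg q)))"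
  shows "hom \<sigma> s c t d F"
  using assms by (auto simp: hom_def)

lemma homD:
  assumes "hom \<sigma> s c t d F"
  shows "linmap F" "\<And>v z. keys z \<subseteq> PT s c v \<Longrightarrow> keys (F z) \<subseteq> IX t d v"
    "\<And>v f. f \<in> J \<Longrightarrow> keys f \<subseteq> PT s c v \<Longrightarrow> F f = 0"
    "\<And>\<gamma> z. \<gamma> \<in> arcs G \<Longrightarrow> keys z \<subseteq> PT s c (tail G \<gamma>) \<Longrightarrow> F (L \<gamma> z) = \<sigma> \<gamma> *\<^sub>p nf (L \<gamma> (F z))"
proof -
  show lin: "linmap F" using assms by (simp add: hom_def)
  show "keys (F z) \<subseteq> IX t d v" if "keys z \<subseteq> PT s c v" for v z
    by (rule keys_in_linmap[OF lin _ that]) (use assms in \<open>auto simp: hom_def\<close>)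
  show "F f = 0" if "f \<in> J" "keys f \<subseteq> PT s c v" for v f
    using assms that unfolding hom_def by blast
  show "F (L \<gamma> z) = \<sigma> \<gamma> *\<^sub>p nf (L \<gamma> (F z))" if "\<gamma> \<in> arcs G" "keys z \<subseteq> PT s c (tail G \<gamma>)" for \<gamma> z
    by (rule linmap_eq_on[OF linmap_comp[OF lin linmap_L]
          linmap_scaled[OF linmap_comp[OF linmap_comp[OF linmap_nf linmap_L] lin]] _ that(2)])
      (use assms that(1) in \<open>auto simp: hom_def\<close>)
qed

lemma IX_unique: "i \<in> IX t d v \<Longrightarrow> i \<in> IX t' d' v' \<Longrightarrow> t = t' \<and> d = d' \<and> v = v'"
  by (auto simp: IX_def PT_def)

lemma IX_end: "i \<in> IX t d v \<Longrightarrow> pend i = v" "i \<in> PT t d v \<Longrightarrow> pend i = v"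
  by (auto simp: IX_def PT_def path_class_def)

lemma IX_verts: "i \<in> IX t d v \<Longrightarrow> v \<in> verts G"
  using H.qpath_end_verts[of i] by (auto simp: IX_def PT_def path_class_def)

lemma IX_PT: "i \<in> IX t d v \<Longrightarrow> i \<in> PT t d v"
  using IX_subset by blast

definition IXs :: "'v \<Rightarrow> nat \<Rightarrow> ('v, 'e + 'e) qpath set" where
  "IXs s c = (\<Union>v\<in>verts G. IX s c v)"

lemma finite_IXs [simp]: "finite (IXs s c)"
  by (simp add: IXs_def)

lemma IXs_iff: "i \<in> IXs s c \<longleftrightarrow> i \<in> IX s c (pend i)"
proof
  assume "i \<in> IXs s c"
  then obtain v where v: "i \<in> IX s c v" by (auto simp: IXs_def)
  then show "i \<in> IX s c (pend i)" using IX_end(1)[OF v] by simp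
next
  assume i: "i \<in> IX s c (pend i)"
  show "i \<in> IXs s c" unfolding IXs_def using IX_verts[OF i] i by blast
qed

lemma IXs_end: "{i \<in> IXs s c. pend i = v} = IX s c v"
proof (intro Set.set_eqI iffI)
  fix i assume "i \<in> IX s c v"
  moreover from this have "pend i = v" by (rule IX_end)
  ultimately show "i \<in> {i \<in> IXs s c. pend i = v}" by (simp add: IXs_iff)
qed (auto simp: IXs_iff)

lemma sum_pairs_fst:
  assumes "j \<in> IX s c v"
  shows "(\<Sum>p\<in>(SIGMA j:IXs s c. IX t d (pend j)). if fst p = j then g (snd p) else 0) =
    (\<Sum>i\<in>IX t d v. g i :: 'k)"
proof -
  have "(\<Sum>p\<in>(SIGMA j:IXs s c. IX t d (pend j)). if fst p = j then g (snd p) else 0) =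
    (\<Sum>j0\<in>IXs s c. \<Sum>i\<in>IX t d (pend j0). if j0 = j then g i else 0)"
    by (subst sum.Sigma) (auto simp: split_beta)
  also have "\<dots> = (\<Sum>j0\<in>IXs s c. if j0 = j then \<Sum>i\<in>IX t d v. g i else 0)"
    using IX_end[of j] assms by (intro sum.cong refl) auto
  finally show ?thesis using assms IX_end[of j] by (simp add: IXs_iff)
qed

lemma sum_pairs_snd:
  assumes "i \<in> IX t d v"
  shows "(\<Sum>p\<in>(SIGMA j:IXs s c. IX t d (pend j)). if snd p = i then g (fst p) else 0) =
    (\<Sum>j\<in>IX s c v. g j :: 'k)"
proof -
  have "(\<Sum>p\<in>(SIGMA j:IXs s c. IX t d (pend j)). if snd p = i then g (fst p) else 0) =
    (\<Sum>j0\<in>IXs s c. \<Sum>i0\<in>IX t d (pend j0). if i0 = i then g j0 else 0)"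
    by (subst sum.Sigma) (auto simp: split_beta)
  also have "\<dots> = (\<Sum>j0\<in>IXs s c. if pend j0 = v then g j0 else 0)"
  proof (intro sum.cong refl)
    fix j0
    have "i \<in> IX t d (pend j0) \<longleftrightarrow> pend j0 = v"
      using IX_unique[OF assms, of t d "pend j0"] assms by blast
    then show "(\<Sum>i0\<in>IX t d (pend j0). if i0 = i then g j0 else 0) = (if pend j0 = v then g j0 else 0)"
      by simp
  qed
  also have "\<dots> = (\<Sum>j0\<in>{j \<in> IXs s c. pend j = v}. g j0)"
    by (simp add: sum.inter_filter)
  finally show ?thesis by (simp add: IXs_end)
qed

text \<open>\<open>\<tau>\<^sup>-\<close> is full on the modules \<open>V\<^sup>s\<^sub>c\<close>: by the Fredholm alternative, an obstruction to lifting would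
  pair nontrivially with a coboundary.\<close>

lemma hom_lift:
  assumes F: "hom (\<lambda>_. 1) s (Suc c) t (Suc d) F"
  obtains h where "hom (\<lambda>_. 1) s c t d h"
    "\<And>\<gamma> q. \<gamma> \<in> arcs G \<Longrightarrow> q \<in> PT s c (head G \<gamma>) \<Longrightarrow> F (Ls \<gamma> (sg q)) = nf (Ls \<gamma> (h (sg q)))"
proof -
  note F = homD[OF F]
  \<comment> \<open>The unknowns \<open>?I\<close> are the matrix entries of \<open>h\<close> that
    the grading permits. The equations \<open>?R1\<close> say that \<open>F\<close> after
    \<open>\<gamma>\<^sup>*\<close> is \<open>\<gamma>\<^sup>*\<close> after \<open>h\<close>, the
    equations \<open>?R2\<close> that \<open>h\<close> commutes with the arrows of \<Gamma>.\<close>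
  let ?I = "SIGMA j:IXs s c. IX t d (pend j)"
  let ?R1 = "SIGMA \<gamma>:arcs G. IX t (Suc d) (tail G \<gamma>) \<times> IX s c (head G \<gamma>)"
  let ?R2 = "SIGMA \<gamma>:arcs G. IX t d (head G \<gamma>) \<times> IX s c (tail G \<gamma>)"
  define A where "A = (\<lambda>r p. case r of
      Inl (\<gamma>, i', j) \<Rightarrow> if fst p = j then lookup (nf (Ls \<gamma> (sg (snd p)))) i' else 0
    | Inr (\<gamma>, i, j) \<Rightarrow> (if snd p = i then lookup (nf (L \<gamma> (sg j))) (fst p) else 0) -
        (if fst p = j then lookup (nf (L \<gamma> (sg (snd p)))) i else (0::'k)))"
  define rhs where "rhs = (\<lambda>r :: ('e \<times> _ \<times> _) + ('e \<times> ('v, 'e + 'e) qpath \<times> ('v, 'e + 'e) qpath). case r of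
      Inl (\<gamma>, i', j) \<Rightarrow> lookup (F (Ls \<gamma> (sg j))) i' | Inr _ \<Rightarrow> 0)"
  have fR: "finite (?R1 <+> ?R2)" and fI: "finite ?I"
    by auto
  have sumR: "(\<Sum>r\<in>?R1 <+> ?R2. f r) =
      (\<Sum>\<gamma>\<in>arcs G. \<Sum>i\<in>IX t (Suc d) (tail G \<gamma>). \<Sum>j\<in>IX s c (head G \<gamma>). f (Inl (\<gamma>, i, j))) +
      (\<Sum>\<gamma>\<in>arcs G. \<Sum>i\<in>IX t d (head G \<gamma>). \<Sum>j\<in>IX s c (tail G \<gamma>). f (Inr (\<gamma>, i, j)))" for f :: "_ \<Rightarrow> 'k"
    by (subst sum.Plus) (auto simp: sum_triple)
  have "\<exists>x. \<forall>r\<in>?R1 <+> ?R2. (\<Sum>p\<in>?I. x p * A r p) = rhs r"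
  proof (rule fredholm_solvable[OF fR fI])
    fix y assume y: "\<And>p. p \<in> ?I \<Longrightarrow> (\<Sum>r\<in>?R1 <+> ?R2. A r p * y r) = 0"
    \<comment> \<open>A solution \<open>y\<close> of the adjoint system is read as two families of
      maps in the opposite direction, from the modules at \<open>t\<close> to the module at
      \<open>s\<close>.\<close>
    define cc where "cc = (\<lambda>\<gamma>. mat_map (\<lambda>_. IX s c (head G \<gamma>)) (\<lambda>i' j. y (Inl (\<gamma>, i', j))))"
    define zz where "zz = (\<lambda>\<gamma>. mat_map (\<lambda>_. IX s c (tail G \<gamma>)) (\<lambda>i j. y (Inr (\<gamma>, i, j))))"
    have cc_lin: "linmap (cc \<gamma>)" and zz_lin: "linmap (zz \<gamma>)" for \<gamma>
      by (simp_all add: cc_def zz_def)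
    have cc_keys: "keys (cc \<gamma> z) \<subseteq> IX s c (head G \<gamma>)" and zz_keys: "keys (zz \<gamma> z) \<subseteq> IX s c (tail G \<gamma>)" for \<gamma> z
      by (simp_all add: cc_def zz_def keys_mat_map)
    have cc_J: "f \<in> J \<Longrightarrow> cc \<gamma> f = 0" and zz_J: "f \<in> J \<Longrightarrow> zz \<gamma> f = 0" for \<gamma> f
      by (simp_all add: cc_def zz_def mat_map_J)
    have cc_nf: "cc \<gamma> (nf z) = cc \<gamma> z" and zz_nf: "zz \<gamma> (nf z) = zz \<gamma> z" for \<gamma> z
      by (simp_all add: cc_def zz_def mat_map_def)
    \<comment> \<open>The adjoint equations, read entry by entry as an identity of maps. It has the
      shape of the relation in \<open>universal_property\<close>, with \<open>zz\<close> as the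
      values on generators and \<open>cc\<close> as the cocycle.\<close>
    have dual: "(\<Sum>\<gamma>\<in>{\<gamma> \<in> arcs G. tail G \<gamma> = v}. zz \<gamma> (L \<gamma> (sg i))) =
      (\<Sum>\<gamma>\<in>{\<gamma> \<in> arcs G. head G \<gamma> = v}. nf (L \<gamma> (zz \<gamma> (sg i))) + cc \<gamma> (Ls \<gamma> (sg i)))"
      if i: "i \<in> IX t d v" for i v
    proof (rule poly_mapping_eq_IX[of _ s c v])
      show "keys (\<Sum>\<gamma>\<in>{\<gamma> \<in> arcs G. tail G \<gamma> = v}. zz \<gamma> (L \<gamma> (sg i))) \<subseteq> IX s c v"
      proof (rule keys_sum_subset)
        fix \<gamma> assume "\<gamma> \<in> {\<gamma> \<in> arcs G. tail G \<gamma> = v}"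
        then show "keys (zz \<gamma> (L \<gamma> (sg i))) \<subseteq> IX s c v" using zz_keys[of \<gamma> "L \<gamma> (sg i)"] by simp
      qed
      show "keys (\<Sum>\<gamma>\<in>{\<gamma> \<in> arcs G. head G \<gamma> = v}. nf (L \<gamma> (zz \<gamma> (sg i))) + cc \<gamma> (Ls \<gamma> (sg i))) \<subseteq> IX s c v"
      proof (intro keys_sum_subset keys_add_subset)
        fix \<gamma> assume "\<gamma> \<in> {\<gamma> \<in> arcs G. head G \<gamma> = v}"
        then show "keys (nf (L \<gamma> (zz \<gamma> (sg i)))) \<subseteq> IX s c v" "keys (cc \<gamma> (Ls \<gamma> (sg i))) \<subseteq> IX s c v"
          using keys_nf_L[OF _ zz_keys, of \<gamma> "sg i"] cc_keys[of \<gamma> "Ls \<gamma> (sg i)"] by simp_all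
      qed
      fix j assume j: "j \<in> IX s c v"
      have p: "(j, i) \<in> ?I" using i j IX_end[of j] by (auto simp: IXs_iff)
      have e1: "(\<Sum>i'\<in>IX t (Suc d) (tail G \<gamma>). \<Sum>j'\<in>IX s c (head G \<gamma>). A (Inl (\<gamma>, i', j')) (j, i) * y (Inl (\<gamma>, i', j'))) =
        (if head G \<gamma> = v then lookup (cc \<gamma> (Ls \<gamma> (sg i))) j else 0)" if \<gamma>: "\<gamma> \<in> arcs G" for \<gamma>
      proof (cases "head G \<gamma> = v")
        case True
        have "keys (nf (Ls \<gamma> (sg i))) \<subseteq> IX t (Suc d) (tail G \<gamma>)"
          by (intro keys_nf_IX keys_Ls \<gamma>) (simp add: True IX_PT[OF i])
        then show ?thesis
          using j True by (simp add: A_def cc_def lookup_mat_map[where S = "IX t (Suc d) (tail G \<gamma>)"]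
            if_distrib[of "\<lambda>x. x * _"] sum.delta cong: if_cong)
      next
        case False
        then show ?thesis
          using IX_unique[OF j] by (auto simp: A_def intro!: sum.neutral)
      qed
      have e2: "(\<Sum>i'\<in>IX t d (head G \<gamma>). \<Sum>j'\<in>IX s c (tail G \<gamma>).
          (if i = i' then lookup (nf (L \<gamma> (sg j'))) j else 0) * y (Inr (\<gamma>, i', j'))) =
        (if head G \<gamma> = v then lookup (nf (L \<gamma> (zz \<gamma> (sg i)))) j else 0)" if \<gamma>: "\<gamma> \<in> arcs G" for \<gamma>
      proof (cases "head G \<gamma> = v")
        case True
        have "(\<Sum>i'\<in>IX t d (head G \<gamma>). \<Sum>j'\<in>IX s c (tail G \<gamma>).
          (if i = i' then lookup (nf (L \<gamma> (sg j'))) j else 0) * y (Inr (\<gamma>, i', j'))) =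
          (\<Sum>i'\<in>IX t d (head G \<gamma>). if i = i' then \<Sum>j'\<in>IX s c (tail G \<gamma>). lookup (nf (L \<gamma> (sg j'))) j * y (Inr (\<gamma>, i', j')) else 0)"
          by (intro sum.cong refl) auto
        also have "\<dots> = (\<Sum>j'\<in>IX s c (tail G \<gamma>). lookup (nf (L \<gamma> (sg j'))) j * y (Inr (\<gamma>, i, j')))"
          using i True by (simp add: sum.delta)
        also have "\<dots> = lookup (nf (L \<gamma> (zz \<gamma> (sg i)))) j"
          unfolding lookup_linmap[OF linmap_comp[OF linmap_nf linmap_L] finite_IX zz_keys]
          by (intro sum.cong refl) (simp add: zz_def lookup_mat_map_sg[OF i] mult.commute)
        finally show ?thesis using True by simp
      next
        case False
        then show ?thesis
          using IX_unique[OF i] by (auto intro!: sum.neutral)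
      qed
      have e3: "(\<Sum>i'\<in>IX t d (head G \<gamma>). \<Sum>j'\<in>IX s c (tail G \<gamma>).
          (if j = j' then lookup (nf (L \<gamma> (sg i))) i' else 0) * y (Inr (\<gamma>, i', j'))) =
        (if tail G \<gamma> = v then lookup (zz \<gamma> (L \<gamma> (sg i))) j else 0)" if \<gamma>: "\<gamma> \<in> arcs G" for \<gamma>
      proof (cases "tail G \<gamma> = v")
        case True
        have "keys (nf (L \<gamma> (sg i))) \<subseteq> IX t d (head G \<gamma>)"
          by (intro keys_nf_L \<gamma>) (simp add: True i)
        then show ?thesis
          using j True by (simp add: zz_def lookup_mat_map[where S = "IX t d (head G \<gamma>)"]
            if_distrib[of "\<lambda>x. x * _"] sum.delta cong: if_cong)
      next
        case False
        then show ?thesis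
          using IX_unique[OF j] by (auto intro!: sum.neutral)
      qed
      have "(\<Sum>\<gamma>\<in>arcs G. if head G \<gamma> = v then lookup (cc \<gamma> (Ls \<gamma> (sg i))) j else 0) +
          (\<Sum>\<gamma>\<in>arcs G. (if head G \<gamma> = v then lookup (nf (L \<gamma> (zz \<gamma> (sg i)))) j else 0) -
             (if tail G \<gamma> = v then lookup (zz \<gamma> (L \<gamma> (sg i))) j else 0)) = 0"
      proof -
        have "A (Inr (\<gamma>, i', j')) (j, i) = (if i = i' then lookup (nf (L \<gamma> (sg j'))) j else 0) -
          (if j = j' then lookup (nf (L \<gamma> (sg i))) i' else 0)" for \<gamma> i' j'
          by (simp add: A_def)
        then have "(\<Sum>i'\<in>IX t d (head G \<gamma>). \<Sum>j'\<in>IX s c (tail G \<gamma>). A (Inr (\<gamma>, i', j')) (j, i) * y (Inr (\<gamma>, i', j'))) =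
          (if head G \<gamma> = v then lookup (nf (L \<gamma> (zz \<gamma> (sg i)))) j else 0) -
          (if tail G \<gamma> = v then lookup (zz \<gamma> (L \<gamma> (sg i))) j else 0)" if "\<gamma> \<in> arcs G" for \<gamma>
          unfolding e2[OF that, symmetric] e3[OF that, symmetric]
          by (simp only: left_diff_distrib sum_subtractf)
        then show ?thesis
          using y[OF p] unfolding sumR by (simp add: e1)
      qed
      then show "lookup (\<Sum>\<gamma>\<in>{\<gamma> \<in> arcs G. tail G \<gamma> = v}. zz \<gamma> (L \<gamma> (sg i))) j =
        lookup (\<Sum>\<gamma>\<in>{\<gamma> \<in> arcs G. head G \<gamma> = v}. nf (L \<gamma> (zz \<gamma> (sg i))) + cc \<gamma> (Ls \<gamma> (sg i))) j"
        by (simp add: lookup_sum lookup_add sum.distrib sum_subtractf sum.inter_filter[symmetric] algebra_simps)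
    qed
    have dual': "(\<Sum>\<gamma>\<in>{\<gamma> \<in> arcs G. tail G \<gamma> = v}. zz \<gamma> (L \<gamma> (sg q))) =
      (\<Sum>\<gamma>\<in>{\<gamma> \<in> arcs G. head G \<gamma> = v}. nf (L \<gamma> (zz \<gamma> (sg q))) + cc \<gamma> (Ls \<gamma> (sg q)))"
      if q: "q \<in> PT t d v" for q v
    proof -
      have "(\<Sum>\<gamma>\<in>{\<gamma> \<in> arcs G. tail G \<gamma> = v}. zz \<gamma> (L \<gamma> (nf (sg q)))) =
        (\<Sum>\<gamma>\<in>{\<gamma> \<in> arcs G. head G \<gamma> = v}. nf (L \<gamma> (zz \<gamma> (nf (sg q)))) + cc \<gamma> (Ls \<gamma> (nf (sg q))))"
      proof (rule linmap_eq_on[where S = "IX t d v" and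
            F = "\<lambda>z. \<Sum>\<gamma>\<in>{\<gamma> \<in> arcs G. tail G \<gamma> = v}. zz \<gamma> (L \<gamma> z)" and
            F' = "\<lambda>z. \<Sum>\<gamma>\<in>{\<gamma> \<in> arcs G. head G \<gamma> = v}. nf (L \<gamma> (zz \<gamma> z)) + cc \<gamma> (Ls \<gamma> z)"])
        show "keys (nf (sg q)) \<subseteq> IX t d v" by (rule keys_nf_sg_IX[OF q])
      qed (rule dual, assumption | intro linmap_sums linmap_plus linmap_comp[OF zz_lin linmap_L] linmap_comp[OF cc_lin linmap_L]
            linmap_comp[OF linmap_comp[OF linmap_nf linmap_L] zz_lin])+
      moreover have "zz \<gamma> (L \<gamma> (nf (sg q))) = zz \<gamma> (L \<gamma> (sg q))" "cc \<gamma> (Ls \<gamma> (nf (sg q))) = cc \<gamma> (Ls \<gamma> (sg q))"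
        if "\<gamma> \<in> arcs G" for \<gamma>
        using zz_nf[of \<gamma> "L \<gamma> (nf (sg q))"] zz_nf[of \<gamma> "L \<gamma> (sg q)"] nf_arr_nf[of "Inl \<gamma>" "sg q"]
          cc_nf[of \<gamma> "Ls \<gamma> (nf (sg q))"] cc_nf[of \<gamma> "Ls \<gamma> (sg q)"] nf_arr_nf[of "Inr \<gamma>" "sg q"] that
        by simp_all
      ultimately show ?thesis by (simp add: zz_nf)
    qed
    \<comment> \<open>The factors -1/a and -1/b turn \<open>dual'\<close> into the hypothesis of
      \<open>universal_property\<close>. With the twist a/b the resulting rule for
      \<open>k (L \<gamma> z)\<close> says that \<open>cc\<close> is the coboundary of
      \<open>k\<close> in the form used by \<open>trace_relation\<close>.\<close>
    obtain k where k: "linmap k" "\<And>v q. q \<in> PT t (Suc d) v \<Longrightarrow> keys (k (sg q)) \<subseteq> IX s c v"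
      "\<And>f v. f \<in> J \<Longrightarrow> keys f \<subseteq> PT t (Suc d) v \<Longrightarrow> k f = 0"
      "\<And>\<gamma> q. \<gamma> \<in> arcs G \<Longrightarrow> q \<in> PT t (Suc d) (tail G \<gamma>) \<Longrightarrow>
         k (L \<gamma> (sg q)) = (a \<gamma> / b \<gamma>) *\<^sub>p nf (L \<gamma> (k (sg q))) + (- 1 / b \<gamma>) *\<^sub>p cc \<gamma> (sg q)"
    proof (rule universal_property[where \<psi> = "\<lambda>\<gamma> z. (- 1 / a \<gamma>) *\<^sub>p zz \<gamma> z" and t = t and d = d and r = s and e = c
        and C = "\<lambda>\<gamma> z. (- 1 / b \<gamma>) *\<^sub>p cc \<gamma> z" and \<tau> = "\<lambda>\<gamma>. a \<gamma> / b \<gamma>"], goal_cases)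
      case (3 \<gamma> q)
      show ?case by (rule order_trans[OF keys_scale zz_keys])
    next
      case (4 \<gamma> q)
      show ?case by (rule order_trans[OF keys_scale cc_keys])
    next
      case (7 v q)
      have "(\<Sum>\<gamma>\<in>{\<gamma> \<in> arcs G. tail G \<gamma> = v}. a \<gamma> *\<^sub>p (- 1 / a \<gamma>) *\<^sub>p zz \<gamma> (L \<gamma> (sg q))) =
        - (\<Sum>\<gamma>\<in>{\<gamma> \<in> arcs G. tail G \<gamma> = v}. zz \<gamma> (L \<gamma> (sg q)))"
        unfolding sum_negf[symmetric] by (intro sum.cong refl) (simp add: a_nz)
      also have "\<dots> = (\<Sum>\<gamma>\<in>{\<gamma> \<in> arcs G. head G \<gamma> = v}.
          b \<gamma> *\<^sub>p ((a \<gamma> / b \<gamma>) *\<^sub>p nf (L \<gamma> ((- 1 / a \<gamma>) *\<^sub>p zz \<gamma> (sg q))) + (- 1 / b \<gamma>) *\<^sub>p cc \<gamma> (Ls \<gamma> (sg q))))"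
        unfolding dual'[OF 7(2)] sum_negf[symmetric]
        by (intro sum.cong refl)
          (simp add: pscale_distribs linmap_scale[OF linmap_L] linmap_scale[OF linmap_nf] a_nz b_nz
            linmap_uminus[OF linmap_L] linmap_uminus[OF linmap_nf] pscale_right_diff)
      finally show ?case .
    next
      case (1 \<gamma>)
      show ?case by (rule linmap_scaled[OF zz_lin])
    next
      case (2 \<gamma>)
      show ?case by (rule linmap_scaled[OF cc_lin])
    next
      case (8 F)
      show ?case by (rule 8(1)[OF 8(2,3,4,6)])
    qed (simp_all add: cc_J zz_J)
    have kL: "cc \<gamma> z = a \<gamma> *\<^sub>p nf (L \<gamma> (k z)) - b \<gamma> *\<^sub>p k (L \<gamma> z)"
      if \<gamma>: "\<gamma> \<in> arcs G" and z: "keys z \<subseteq> PT t (Suc d) (tail G \<gamma>)" for \<gamma> z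
    proof (rule linmap_eq_on[OF cc_lin _ _ z])
      fix q assume q: "q \<in> PT t (Suc d) (tail G \<gamma>)"
      have "b \<gamma> *\<^sub>p k (L \<gamma> (sg q)) = a \<gamma> *\<^sub>p nf (L \<gamma> (k (sg q))) - cc \<gamma> (sg q)"
        unfolding k(4)[OF \<gamma> q] using b_nz[OF \<gamma>] by (simp add: pscale_distribs pscale_right_diff)
      then show "cc \<gamma> (sg q) = a \<gamma> *\<^sub>p nf (L \<gamma> (k (sg q))) - b \<gamma> *\<^sub>p k (L \<gamma> (sg q))" by simp
    qed (intro linmap_minus linmap_scaled linmap_comp[OF k(1) linmap_L]
        linmap_comp[OF linmap_comp[OF linmap_nf linmap_L] k(1)])
    have psi_keys: "keys (F (Ls \<gamma> (sg q))) \<subseteq> IX t (Suc d) (tail G \<gamma>)" if "\<gamma> \<in> arcs G" "q \<in> PT s c (head G \<gamma>)" for \<gamma> q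
      by (rule F(2)[OF keys_Ls[OF that(1)]]) (use that in simp)
    \<comment> \<open>On the generators \<open>\<gamma>\<^sup>* q\<close> the homomorphism
      \<open>F\<close> is a solution of the mesh relations, so its trace pairing with the coboundary
      \<open>cc\<close> is zero. This pairing is the product of the right-hand side with
      \<open>y\<close>.\<close>
    have "(\<Sum>\<gamma>\<in>arcs G. \<Sum>j\<in>IX s c (head G \<gamma>).
      lookup (a \<gamma> *\<^sub>p nf (L \<gamma> (k (F (Ls \<gamma> (sg j))))) - b \<gamma> *\<^sub>p k (L \<gamma> (F (Ls \<gamma> (sg j))))) j) = 0"
    proof (rule trace_relation[where \<psi> = "\<lambda>\<gamma> z. F (Ls \<gamma> z)" and r = t and e = "Suc d"])
      show "linmap (\<lambda>z. F (Ls \<gamma> z))" for \<gamma> by (rule linmap_comp[OF F(1) linmap_L])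
      show "F (Ls \<gamma> f) = 0" if "\<gamma> \<in> arcs G" "f \<in> J" "keys f \<subseteq> PT s c (head G \<gamma>)" for \<gamma> f
        using F(3)[OF _ keys_Ls[OF that(1,3)]] arr_mult_J[of "Inr \<gamma>" f] that by simp
      fix v q assume "q \<in> IX s c v"
      then have q: "q \<in> PT s c v" by (rule IX_PT)
      have "F (rel \<star> sg q) = 0"
        by (rule F(3)[OF rel_mult_J keys_rel_mult[OF q]]) (use q in \<open>simp add: PT_def\<close>)
      then have "(\<Sum>\<gamma>\<in>{\<gamma> \<in> arcs G. tail G \<gamma> = v}. a \<gamma> *\<^sub>p F (Ls \<gamma> (L \<gamma> (sg q)))) =
        (\<Sum>\<gamma>\<in>{\<gamma> \<in> arcs G. head G \<gamma> = v}. b \<gamma> *\<^sub>p F (L \<gamma> (Ls \<gamma> (sg q))))"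
        unfolding rel_mult[OF q] by (simp add: linmap_diff[OF F(1)] linmap_sum[OF F(1)] linmap_scale[OF F(1)])
      also have "\<dots> = (\<Sum>\<gamma>\<in>{\<gamma> \<in> arcs G. head G \<gamma> = v}. b \<gamma> *\<^sub>p nf (L \<gamma> (F (Ls \<gamma> (sg q)))))"
      proof (intro sum.cong refl)
        fix \<gamma> assume "\<gamma> \<in> {\<gamma> \<in> arcs G. head G \<gamma> = v}"
        then have "\<gamma> \<in> arcs G" "keys (Ls \<gamma> (sg q)) \<subseteq> PT s (Suc c) (tail G \<gamma>)"
          using q keys_Ls[of \<gamma> "sg q" s c] by simp_all
        from F(4)[OF this] show "b \<gamma> *\<^sub>p F (L \<gamma> (Ls \<gamma> (sg q))) = b \<gamma> *\<^sub>p nf (L \<gamma> (F (Ls \<gamma> (sg q))))" by simp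
      qed
      finally show "(\<Sum>\<gamma>\<in>{\<gamma> \<in> arcs G. tail G \<gamma> = v}. a \<gamma> *\<^sub>p F (Ls \<gamma> (L \<gamma> (sg q)))) =
        (\<Sum>\<gamma>\<in>{\<gamma> \<in> arcs G. head G \<gamma> = v}. b \<gamma> *\<^sub>p nf (L \<gamma> (F (Ls \<gamma> (sg q)))))" .
    qed (use k psi_keys in auto)
    also have "(\<Sum>\<gamma>\<in>arcs G. \<Sum>j\<in>IX s c (head G \<gamma>).
      lookup (a \<gamma> *\<^sub>p nf (L \<gamma> (k (F (Ls \<gamma> (sg j))))) - b \<gamma> *\<^sub>p k (L \<gamma> (F (Ls \<gamma> (sg j))))) j) =
      (\<Sum>r\<in>?R1 <+> ?R2. rhs r * y r)"
    proof -
      have "lookup (a \<gamma> *\<^sub>p nf (L \<gamma> (k (F (Ls \<gamma> (sg j))))) - b \<gamma> *\<^sub>p k (L \<gamma> (F (Ls \<gamma> (sg j))))) j =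
        (\<Sum>i\<in>IX t (Suc d) (tail G \<gamma>). rhs (Inl (\<gamma>, i, j)) * y (Inl (\<gamma>, i, j)))"
        if \<gamma>: "\<gamma> \<in> arcs G" and j: "j \<in> IX s c (head G \<gamma>)" for \<gamma> j
      proof -
        note ks = psi_keys[OF \<gamma> IX_PT[OF j]]
        have "lookup (cc \<gamma> (F (Ls \<gamma> (sg j)))) j =
          (\<Sum>i\<in>IX t (Suc d) (tail G \<gamma>). rhs (Inl (\<gamma>, i, j)) * y (Inl (\<gamma>, i, j)))"
          using j ks nf_id_IX[OF ks] by (simp add: cc_def lookup_mat_map[where S = "IX t (Suc d) (tail G \<gamma>)"] rhs_def)
        then show ?thesis using kL[OF \<gamma> keys_IX_PT[OF ks]] by simp
      qed
      then show ?thesis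
        unfolding sumR by (subst sum.swap) (simp add: rhs_def cong: sum.cong)
    qed
    finally show "(\<Sum>r\<in>?R1 <+> ?R2. rhs r * y r) = 0" .
  qed
  then obtain x where x: "\<And>r. r \<in> ?R1 <+> ?R2 \<Longrightarrow> (\<Sum>p\<in>?I. x p * A r p) = rhs r" by blast
  define h where "h = mat_map (\<lambda>j. IX t d (pend j)) (\<lambda>j i. x (j, i))"
  have h_lin: "linmap h" by (simp add: h_def)
  have h_keys: "keys (h (sg q)) \<subseteq> IX t d v" if "q \<in> PT s c v" for q v
    unfolding h_def
  proof (rule keys_mat_map)
    fix i assume "i \<in> keys (nf (sg q))"
    then have "i \<in> IX s c v" using keys_nf_sg_IX[OF that] by blast
    then show "IX t d (pend i) \<subseteq> IX t d v" by (simp add: IX_end)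
  qed
  have h_nf: "h (nf z) = h z" for z by (simp add: h_def mat_map_def)
  have h_lookup: "lookup (h (sg j)) i = x (j, i)" if "j \<in> IX s c v" "i \<in> IX t d v" for i j v
    using that IX_end[of j] by (simp add: h_def lookup_mat_map_sg[OF that(1)])
  have x_fst: "(\<Sum>p\<in>?I. x p * (if fst p = j then g (snd p) else 0)) = (\<Sum>i\<in>IX t d v. lookup (h (sg j)) i * g i)"
    if j: "j \<in> IX s c v" for j v g
  proof -
    have "(\<Sum>p\<in>?I. x p * (if fst p = j then g (snd p) else 0)) = (\<Sum>p\<in>?I. if fst p = j then x (j, snd p) * g (snd p) else 0)"
      by (intro sum.cong refl) auto
    then show ?thesis by (simp add: sum_pairs_fst[OF j, where g = "\<lambda>i. x (j, i) * g i"] h_lookup[OF j] cong: sum.cong)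
  qed
  have x_snd: "(\<Sum>p\<in>?I. x p * (if snd p = i then g (fst p) else 0)) = (\<Sum>j\<in>IX s c v. g j * lookup (h (sg j)) i)"
    if i: "i \<in> IX t d v" for i v g
  proof -
    have "(\<Sum>p\<in>?I. x p * (if snd p = i then g (fst p) else 0)) = (\<Sum>p\<in>?I. if snd p = i then g (fst p) * x (fst p, i) else 0)"
      by (intro sum.cong refl) auto
    then show ?thesis by (simp add: sum_pairs_snd[OF i, where g = "\<lambda>j. g j * x (j, i)"] h_lookup[OF _ i] cong: sum.cong)
  qed
  have R1: "F (Ls \<gamma> (sg j)) = nf (Ls \<gamma> (h (sg j)))" if \<gamma>: "\<gamma> \<in> arcs G" and j: "j \<in> IX s c (head G \<gamma>)" for \<gamma> j
  proof (rule poly_mapping_eq_IX[of _ t "Suc d" "tail G \<gamma>"])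
    note hk = h_keys[OF IX_PT[OF j]]
    show "keys (F (Ls \<gamma> (sg j))) \<subseteq> IX t (Suc d) (tail G \<gamma>)"
      by (rule F(2)[OF keys_Ls[OF \<gamma>]]) (use IX_PT[OF j] in simp)
    show "keys (nf (Ls \<gamma> (h (sg j)))) \<subseteq> IX t (Suc d) (tail G \<gamma>)"
      by (intro keys_nf_IX keys_Ls[OF \<gamma>] keys_IX_PT hk)
    fix i assume "i \<in> IX t (Suc d) (tail G \<gamma>)"
    then have "rhs (Inl (\<gamma>, i, j)) = (\<Sum>p\<in>?I. x p * (if fst p = j then lookup (nf (Ls \<gamma> (sg (snd p)))) i else 0))"
      using x[OF InlI[of "(\<gamma>, i, j)" ?R1 ?R2]] \<gamma> j by (simp add: A_def)
    also have "\<dots> = lookup (nf (Ls \<gamma> (h (sg j)))) i"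
      unfolding x_fst[of j _ "\<lambda>i0. lookup (nf (Ls \<gamma> (sg i0))) i", OF j]
        lookup_linmap[OF linmap_comp[OF linmap_nf linmap_L] finite_IX hk] ..
    finally show "lookup (F (Ls \<gamma> (sg j))) i = lookup (nf (Ls \<gamma> (h (sg j)))) i" by (simp add: rhs_def)
  qed
  have R2: "h (L \<gamma> (sg j)) = nf (L \<gamma> (h (sg j)))" if \<gamma>: "\<gamma> \<in> arcs G" and j: "j \<in> IX s c (tail G \<gamma>)" for \<gamma> j
  proof (rule poly_mapping_eq_IX[of _ t d "head G \<gamma>"])
    note hk = h_keys[OF IX_PT[OF j]]
    have lk: "keys (nf (L \<gamma> (sg j))) \<subseteq> IX s c (head G \<gamma>)"
      by (rule keys_nf_L[OF \<gamma>]) (use j in simp)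
    show "keys (h (L \<gamma> (sg j))) \<subseteq> IX t d (head G \<gamma>)"
      by (rule keys_in_linmap[OF h_lin h_keys keys_L[OF \<gamma>]]) (use IX_PT[OF j] in auto)
    show "keys (nf (L \<gamma> (h (sg j)))) \<subseteq> IX t d (head G \<gamma>)"
      by (rule keys_nf_L[OF \<gamma> hk])
    fix i assume i: "i \<in> IX t d (head G \<gamma>)"
    then have "0 = (\<Sum>p\<in>?I. x p * (if snd p = i then lookup (nf (L \<gamma> (sg j))) (fst p) else 0)) -
      (\<Sum>p\<in>?I. x p * (if fst p = j then lookup (nf (L \<gamma> (sg (snd p)))) i else 0))"
      using x[OF InrI[of "(\<gamma>, i, j)" ?R2 ?R1]] \<gamma> j by (simp add: A_def rhs_def right_diff_distrib sum_subtractf)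
    also have "\<dots> = lookup (h (nf (L \<gamma> (sg j)))) i - lookup (nf (L \<gamma> (h (sg j)))) i"
      unfolding x_fst[of j _ "\<lambda>i0. lookup (nf (L \<gamma> (sg i0))) i", OF j]
        x_snd[of i _ "\<lambda>j0. lookup (nf (L \<gamma> (sg j))) j0", OF i] lookup_linmap[OF linmap_comp[OF linmap_nf linmap_L] finite_IX hk]
        lookup_linmap[OF h_lin finite_IX lk] ..
    finally show "lookup (h (L \<gamma> (sg j))) i = lookup (nf (L \<gamma> (h (sg j)))) i" by (simp add: h_nf)
  qed
  show thesis
  proof (rule that)
    show "hom (\<lambda>_. 1) s c t d h"
    proof (rule homI[OF h_lin h_keys])
      show "h f = 0" if "f \<in> J" for f using that by (simp add: h_def mat_map_J)
      fix \<gamma> q assume \<gamma>: "\<gamma> \<in> arcs G" and q: "q \<in> PT s c (tail G \<gamma>)"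
      have "h (L \<gamma> (nf (sg q))) = nf (L \<gamma> (h (nf (sg q))))"
        by (rule linmap_eq_on[OF linmap_comp[OF h_lin linmap_L]
              linmap_comp[OF linmap_comp[OF linmap_nf linmap_L] h_lin] _ keys_nf_sg_IX[OF q]]) (rule R2[OF \<gamma>])
      then show "h (L \<gamma> (sg q)) = 1 *\<^sub>p nf (L \<gamma> (h (sg q)))"
        using h_nf[of "L \<gamma> (nf (sg q))"] h_nf[of "L \<gamma> (sg q)"] nf_arr_nf[of "Inl \<gamma>" "sg q"] \<gamma>
        by (simp add: h_nf)
    qed
    fix \<gamma> q assume \<gamma>: "\<gamma> \<in> arcs G" and q: "q \<in> PT s c (head G \<gamma>)"
    have "F (Ls \<gamma> (nf (sg q))) = nf (Ls \<gamma> (h (nf (sg q))))"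
      by (rule linmap_eq_on[OF linmap_comp[OF F(1) linmap_L]
            linmap_comp[OF linmap_comp[OF linmap_nf linmap_L] h_lin] _ keys_nf_sg_IX[OF q]]) (rule R1[OF \<gamma>])
    moreover have "F (Ls \<gamma> (nf (sg q))) = F (Ls \<gamma> (sg q))"
    proof (rule linmap_nf_cong[OF linmap_comp[OF F(1) linmap_L], of s c "head G \<gamma>"])
      show "F (Ls \<gamma> f) = 0" if "f \<in> J" "keys f \<subseteq> PT s c (head G \<gamma>)" for f
        using F(3)[OF _ keys_Ls[OF \<gamma> that(2)]] arr_mult_J[of "Inr \<gamma>" f] that \<gamma> by simp
    qed (use q in simp)
    ultimately show "F (Ls \<gamma> (sg q)) = nf (Ls \<gamma> (h (sg q)))" by (simp add: h_nf)
  qed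
qed

section \<open>Vanishing of homomorphisms and scalar endomorphisms\<close>

lemma PT_induct [consumes 1, case_names Nil Inl Inr]:
  assumes "(u, es) \<in> PT t d v"
    and "\<And>u. u \<in> verts G \<Longrightarrow> u = t \<Longrightarrow> d = 0 \<Longrightarrow> P u [] u"
    and "\<And>u es \<gamma>. \<gamma> \<in> arcs G \<Longrightarrow> (u, es) \<in> PT t d (tail G \<gamma>) \<Longrightarrow> P u es (tail G \<gamma>) \<Longrightarrow> P u (es @ [Inl \<gamma>]) (head G \<gamma>)"
    and "\<And>u es \<gamma> c. \<gamma> \<in> arcs G \<Longrightarrow> d = Suc c \<Longrightarrow> (u, es) \<in> PT t c (head G \<gamma>) \<Longrightarrow> P u (es @ [Inr \<gamma>]) (tail G \<gamma>)"
  shows "P u es v"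
  using assms(1)
proof (induction es arbitrary: v rule: rev_induct)
  case Nil
  then show ?case using assms(2) by (auto simp: PT_def path_class_def H.qpaths_Nil)
next
  case (snoc \<alpha> es)
  show ?case
  proof (cases \<alpha>)
    case (Inl \<gamma>)
    then show ?thesis using snoc assms(3) by (auto simp: PT_snoc)
  next
    case (Inr \<gamma>)
    then show ?thesis using snoc assms(4) by (auto simp: PT_snoc)
  qed
qed

lemma arr_mult_pair:
  "(u, es) \<in> PT t d (tail H \<alpha>) \<Longrightarrow> \<alpha> \<in> arcs H \<Longrightarrow> sg (u, es @ [\<alpha>]) = arr \<alpha> \<star> sg (u, es)"
  using arr_mult_PT(1)[of "(u, es)"] by simp

text \<open>Every term of an element of \<open>J\<close> contains a starred arrow, so degree 0 is
  the path algebra of \<Gamma> without relations.\<close>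

lemma nf_degree_0:
  assumes "keys z \<subseteq> PT t 0 v"
  shows "nf z = z"
proof -
  have "keys (z - nf z) \<subseteq> PT t 0 v"
    by (rule keys_diff_subset[OF assms keys_IX_PT[OF keys_nf_IX[OF assms]]])
  then have "keys (z - nf z) = {}"
    using J_star_degree[OF nf_cong_J[of z]] by (fastforce simp: PT_def path_class_def)
  then show ?thesis by simp
qed

text \<open>Over the path algebra of \<Gamma> the module is generated by the trivial path if
  \<open>c = 0\<close> and by the products \<open>\<gamma>\<^sup>* q\<close> otherwise. Comparison
  is with a multiple of \<open>nf\<close> since this acts as the identity; \<open>l = 0\<close>
  gives vanishing.\<close>

lemma hom_eq_if_generators:
  assumes F: "hom (\<lambda>_. 1) s c t d F"
    and 0: "c = 0 \<Longrightarrow> s \<in> verts G \<Longrightarrow> F (sg (s, [])) = l *\<^sub>p nf (sg (s, []))"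
    and Suc: "\<And>c' \<gamma> q. c = Suc c' \<Longrightarrow> \<gamma> \<in> arcs G \<Longrightarrow> q \<in> PT s c' (head G \<gamma>) \<Longrightarrow> F (Ls \<gamma> (sg q)) = l *\<^sub>p nf (Ls \<gamma> (sg q))"
    and q: "q \<in> PT s c v"
  shows "F (sg q) = l *\<^sub>p nf (sg q)"
proof -
  have "(fst q, snd q) \<in> PT s c v" using q by simp
  then have "F (sg (fst q, snd q)) = l *\<^sub>p nf (sg (fst q, snd q))"
  proof (induction rule: PT_induct)
    case (Inl u es \<gamma>)
    then have "sg (u, es @ [Inl \<gamma>]) = L \<gamma> (sg (u, es))" by (intro arr_mult_pair) auto
    then show ?case
      using Inl homD(4)[OF F Inl(1), of "sg (u, es)"] nf_arr_nf[of "Inl \<gamma>" "sg (u, es)"]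
      by (simp add: linmap_scale[OF linmap_L] linmap_scale[OF linmap_nf])
  next
    case (Inr u es \<gamma> c)
    then have "sg (u, es @ [Inr \<gamma>]) = Ls \<gamma> (sg (u, es))" by (intro arr_mult_pair) auto
    then show ?case using Suc[OF Inr(2,1,3)] by simp
  qed (use 0 in auto)
  then show ?thesis by simp
qed

text \<open>Lifting brings both modules down to degree 0. There the generator is sent into the
  component at \<open>s\<close> of the projective module at \<open>t\<close>, which is zero when no
  path of \<Gamma> leads from \<open>t\<close> to \<open>s\<close>.\<close>

lemma hom_zero_same_degree:
  assumes "hom (\<lambda>_. 1) s c t c F" "PT t 0 s = {}" "q \<in> PT s c v"
  shows "F (sg q) = 0"
  using assms(1,3)
proof (induction c arbitrary: F q v)
  case 0
  have "keys (F (sg (s, []))) \<subseteq> IX t 0 s" if "s \<in> verts G"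
    by (rule homD(2)[OF 0(1)]) (use that in \<open>auto simp: PT_def path_class_def H.qpaths_Nil\<close>)
  then have "F (sg (s, [])) = 0" if "s \<in> verts G"
    using assms(2) that by (auto simp: IX_def)
  then show ?case
    using hom_eq_if_generators[OF 0(1) _ _ 0(2), of 0] by simp
next
  case (Suc c)
  obtain h where h: "hom (\<lambda>_. 1) s c t c h"
    "\<And>\<gamma> q. \<gamma> \<in> arcs G \<Longrightarrow> q \<in> PT s c (head G \<gamma>) \<Longrightarrow> F (Ls \<gamma> (sg q)) = nf (Ls \<gamma> (h (sg q)))"
    using hom_lift[OF Suc.prems(1)] by blast
  show ?case
    using hom_eq_if_generators[OF Suc.prems(1) _ _ Suc.prems(2), of 0] h(2) Suc.IH[OF h(1)]
    by (simp add: linmap_0[OF linmap_L] linmap_0[OF linmap_nf])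
qed

lemma PT_0_trancl: "(u, es) \<in> PT t 0 v \<Longrightarrow> es = [] \<and> v = u \<or> (v, u) \<in> arrow_rel\<^sup>+"
proof (induction rule: PT_induct)
  case (Inl u es \<gamma>)
  have "(head G \<gamma>, tail G \<gamma>) \<in> arrow_rel" using Inl(1) by (auto simp: arrow_rel_def)
  then show ?case using Inl(3) by (auto intro: trancl_into_trancl2)
qed auto

lemma no_closed_walk: "(v, v) \<notin> arrow_rel\<^sup>+"
  using wf_acyclic[OF wf_arrow_rel] by (simp add: acyclic_def)

lemma PT_0_self: "PT t 0 t \<subseteq> {(t, [])}"
proof
  fix p assume p: "p \<in> PT t 0 t"
  then have "fst p = t" by (simp add: PT_def path_class_def)
  then show "p \<in> {(t, [])}"
    using PT_0_trancl[of "fst p" "snd p" t t] p no_closed_walk[of t] by (cases p) auto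
qed

lemma PT_0_arc: "\<gamma> \<in> arcs G \<Longrightarrow> PT (head G \<gamma>) 0 (tail G \<gamma>) = {}"
proof (rule ccontr)
  assume \<gamma>: "\<gamma> \<in> arcs G" and "PT (head G \<gamma>) 0 (tail G \<gamma>) \<noteq> {}"
  then obtain u es where *: "(u, es) \<in> PT (head G \<gamma>) 0 (tail G \<gamma>)" by auto
  then have "u = head G \<gamma>" by (simp add: PT_def path_class_def)
  moreover have "(head G \<gamma>, tail G \<gamma>) \<in> arrow_rel" using \<gamma> by (auto simp: arrow_rel_def)
  ultimately have "(u, u) \<in> arrow_rel\<^sup>+"
    using PT_0_trancl[OF *] by (auto intro: trancl_into_trancl2)
  then show False using no_closed_walk by blast
qed

text \<open>Again by lifting down to degree 0, where the component at \<open>t\<close> of the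
  projective module at \<open>t\<close> is spanned by the trivial path, as there are no oriented
  cycles.\<close>

lemma hom_scalar:
  assumes "hom (\<lambda>_. 1) t c t c F"
  shows "\<exists>l. \<forall>v. \<forall>q\<in>PT t c v. F (sg q) = l *\<^sub>p nf (sg q)"
  using assms
proof (induction c arbitrary: F)
  case 0
  have "\<exists>l. t \<in> verts G \<longrightarrow> F (sg (t, [])) = l *\<^sub>p nf (sg (t, []))"
  proof (cases "t \<in> verts G")
    case True
    then have t: "(t, []) \<in> PT t 0 t" by (auto simp: PT_def path_class_def H.qpaths_Nil)
    then have nt: "nf (sg (t, [])) = sg (t, [])" by (intro nf_degree_0) simp
    have "keys (F (sg (t, []))) \<subseteq> {(t, [])}"
      using homD(2)[OF 0, of "sg (t, [])" t] t IX_subset PT_0_self by fastforce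
    then have "F (sg (t, [])) = lookup (F (sg (t, []))) (t, []) *\<^sub>p sg (t, [])"
      using sum_sg_superset[of "{(t, [])}" "F (sg (t, []))"] by simp
    then show ?thesis by (auto simp: nt)
  qed auto
  then obtain l where "t \<in> verts G \<longrightarrow> F (sg (t, [])) = l *\<^sub>p nf (sg (t, []))" by blast
  then show ?case
    using hom_eq_if_generators[OF 0, of l] by blast
next
  case (Suc c)
  obtain h where h: "hom (\<lambda>_. 1) t c t c h"
    "\<And>\<gamma> q. \<gamma> \<in> arcs G \<Longrightarrow> q \<in> PT t c (head G \<gamma>) \<Longrightarrow> F (Ls \<gamma> (sg q)) = nf (Ls \<gamma> (h (sg q)))"
    using hom_lift[OF Suc.prems(1)] by blast
  obtain l where l: "\<forall>v. \<forall>q\<in>PT t c v. h (sg q) = l *\<^sub>p nf (sg q)"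
    using Suc.IH[OF h(1)] by blast
  have "F (Ls \<gamma> (sg q)) = l *\<^sub>p nf (Ls \<gamma> (sg q))" if "\<gamma> \<in> arcs G" "q \<in> PT t c (head G \<gamma>)" for \<gamma> q
    using h(2)[OF that] l that nf_arr_nf[of "Inr \<gamma>" "sg q"]
    by (simp add: linmap_scale[OF linmap_L] linmap_scale[OF linmap_nf])
  then show ?case
    using hom_eq_if_generators[OF Suc.prems(1), of l] by blast
qed

lemma lookup_arr_mult:
  assumes "keys z \<subseteq> PT t d (tail H \<alpha>)" "\<alpha> \<in> arcs H"
  shows "lookup (arr \<alpha> \<star> z) (u, es @ [\<beta>]) = (if \<alpha> = \<beta> then lookup z (u, es) else 0)"
proof -
  have "lookup (arr \<alpha> \<star> z) (u, es @ [\<beta>]) = (\<Sum>p\<in>keys z. lookup z p * lookup (arr \<alpha> \<star> sg p) (u, es @ [\<beta>]))"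
    by (rule lookup_linmap[OF linmap_L]) auto
  also have "\<dots> = (\<Sum>p\<in>keys z. if p = (u, es) then if \<alpha> = \<beta> then lookup z (u, es) else 0 else 0)"
  proof (rule sum.cong)
    fix p assume "p \<in> keys z"
    then have p: "p \<in> PT t d (tail H \<alpha>)" using assms(1) by blast
    show "lookup z p * lookup (arr \<alpha> \<star> sg p) (u, es @ [\<beta>]) =
      (if p = (u, es) then if \<alpha> = \<beta> then lookup z (u, es) else 0 else 0)"
      unfolding arr_mult_PT(1)[OF p assms(2)] by (cases p) (auto simp: lookup_single when_def)
  qed simp
  also have "\<dots> = (if \<alpha> = \<beta> then lookup z (u, es) else 0)"
    by (simp add: in_keys_iff)
  finally show ?thesis .
qed

text \<open>Induction on the vertex, beginning with the sinks, using the relation at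
  \<open>v\<close>. Its terms \<open>\<gamma>\<^sup>* \<gamma> q\<close> are sent to zero by the
  induction hypothesis. The images of the other terms are multiples of
  \<open>\<gamma> F(\<gamma>\<^sup>* q)\<close> and end in distinct arrows, so each of them is zero,
  there being no relations in degree 0.\<close>

lemma hom_one_zero:
  assumes F: "hom (\<lambda>_. 1) s (Suc 0) t 0 F" and "\<gamma> \<in> arcs G" "q \<in> PT s 0 (head G \<gamma>)"
  shows "F (Ls \<gamma> (sg q)) = 0"
proof -
  have "\<forall>\<gamma>\<in>arcs G. head G \<gamma> = v \<longrightarrow> (\<forall>q\<in>PT s 0 v. F (Ls \<gamma> (sg q)) = 0)" for v
  proof (induction v rule: wf_induct_rule[OF wf_arrow_rel])
    case (1 v)
    show ?case
    proof (intro ballI impI)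
      fix \<gamma>0 q assume \<gamma>0: "\<gamma>0 \<in> arcs G" "head G \<gamma>0 = v" and q: "q \<in> PT s 0 v"
      note F = homD[OF F]
      have keysF: "keys (F (Ls \<gamma> (sg q))) \<subseteq> PT t 0 (tail G \<gamma>)" if "\<gamma> \<in> arcs G" "head G \<gamma> = v" for \<gamma>
        by (rule keys_IX_PT[OF F(2)[OF keys_Ls[OF that(1)]]]) (use that q in simp)
      have "F (rel \<star> sg q) = 0"
        by (rule F(3)[OF rel_mult_J keys_rel_mult[OF q]]) (use q in \<open>simp add: PT_def\<close>)
      moreover have "F (Ls \<gamma> (L \<gamma> (sg q))) = 0" if "\<gamma> \<in> arcs G" "tail G \<gamma> = v" for \<gamma>
      proof (rule linmap_eq_on[OF linmap_comp[OF F(1) linmap_L] linmap_zero])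
        show "keys (L \<gamma> (sg q)) \<subseteq> PT s 0 (head G \<gamma>)"
          by (rule keys_L[OF that(1)]) (use q that in simp)
        fix p assume "p \<in> PT s 0 (head G \<gamma>)"
        then show "F (Ls \<gamma> (sg p)) = 0"
          using 1[of "head G \<gamma>"] that by (auto simp: arrow_rel_def)
      qed
      ultimately have 0: "(\<Sum>\<gamma>\<in>{\<gamma> \<in> arcs G. head G \<gamma> = v}. b \<gamma> *\<^sub>p F (L \<gamma> (Ls \<gamma> (sg q)))) = 0"
        unfolding rel_mult[OF q] by (simp add: linmap_diff[OF F(1)] linmap_sum[OF F(1)] linmap_scale[OF F(1)])
      have "F (L \<gamma> (Ls \<gamma> (sg q))) = L \<gamma> (F (Ls \<gamma> (sg q)))" if "\<gamma> \<in> arcs G" "head G \<gamma> = v" for \<gamma>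
        using F(4)[OF that(1) keys_Ls[OF that(1), of "sg q" s 0]] q that
          nf_degree_0[OF keys_L[OF that(1) keysF[OF that]]] by simp
      with 0 have 0: "(\<Sum>\<gamma>\<in>{\<gamma> \<in> arcs G. head G \<gamma> = v}. b \<gamma> *\<^sub>p L \<gamma> (F (Ls \<gamma> (sg q)))) = 0"
        by simp
      have "lookup (F (Ls \<gamma>0 (sg q))) (u, es) = 0" for u es
      proof -
        have "0 = (\<Sum>\<gamma>\<in>{\<gamma> \<in> arcs G. head G \<gamma> = v}. b \<gamma> * lookup (L \<gamma> (F (Ls \<gamma> (sg q)))) (u, es @ [Inl \<gamma>0]))"
          using arg_cong[OF 0, of "\<lambda>z. lookup z (u, es @ [Inl \<gamma>0])"] by (simp add: lookup_lincomb)
        also have "\<dots> = (\<Sum>\<gamma>\<in>{\<gamma> \<in> arcs G. head G \<gamma> = v}. if \<gamma> = \<gamma>0 then b \<gamma>0 * lookup (F (Ls \<gamma>0 (sg q))) (u, es) else 0)"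
          by (intro sum.cong refl) (auto simp: lookup_arr_mult[of _ t 0 "Inl _"] keysF)
        finally show ?thesis using \<gamma>0 b_nz[of \<gamma>0] by simp
      qed
      then show "F (Ls \<gamma>0 (sg q)) = 0" by (intro poly_mapping_eqI) auto
    qed
  qed
  then show ?thesis using assms(2,3) by blast
qed

lemma hom_zero_lower_degree:
  assumes "hom (\<lambda>_. 1) s (Suc c) t c F" "q \<in> PT s (Suc c) v"
  shows "F (sg q) = 0"
  using assms
proof (induction c arbitrary: F q v)
  case 0
  show ?case
    using hom_eq_if_generators[OF 0(1) _ _ 0(2), of 0] hom_one_zero[OF 0(1)] by simp
next
  case (Suc c)
  obtain h where h: "hom (\<lambda>_. 1) s (Suc c) t c h"
    "\<And>\<gamma> q. \<gamma> \<in> arcs G \<Longrightarrow> q \<in> PT s (Suc c) (head G \<gamma>) \<Longrightarrow> F (Ls \<gamma> (sg q)) = nf (Ls \<gamma> (h (sg q)))"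
    using hom_lift[OF Suc.prems(1)] by blast
  show ?case
    using hom_eq_if_generators[OF Suc.prems(1) _ _ Suc.prems(2), of 0] h(2) Suc.IH[OF h(1)]
    by (simp add: linmap_0[OF linmap_L] linmap_0[OF linmap_nf])
qed

text \<open>The automorphism \<open>\<gamma> \<mapsto> \<sigma>\<^sub>\<gamma> \<gamma>\<close>, \<open>\<gamma>\<^sup>* \<mapsto> \<sigma>\<^sub>\<gamma>\<inverse> \<gamma>\<^sup>*\<close> of the path algebra preserves the relations; it is used to
  straighten twisted homomorphisms.\<close>

fun awt :: "('e \<Rightarrow> 'k) \<Rightarrow> 'e + 'e \<Rightarrow> 'k" where
  "awt \<sigma> (Inl \<gamma>) = \<sigma> \<gamma>"
| "awt \<sigma> (Inr \<gamma>) = inverse (\<sigma> \<gamma>)"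

definition wt :: "('e \<Rightarrow> 'k) \<Rightarrow> ('v, 'e + 'e) qpath \<Rightarrow> 'k" where
  "wt \<sigma> p = prod_list (map (awt \<sigma>) (snd p))"

definition WT :: "('e \<Rightarrow> 'k) \<Rightarrow> (('v, 'e + 'e) qpath \<Rightarrow>\<^sub>0 'k) \<Rightarrow> (('v, 'e + 'e) qpath \<Rightarrow>\<^sub>0 'k)" where
  "WT \<sigma> = lext (\<lambda>p. wt \<sigma> p *\<^sub>p sg p)"

lemma linmap_WT [simp]: "linmap (WT \<sigma>)"
  by (simp add: WT_def)

lemma WT_sg: "WT \<sigma> (sg p) = wt \<sigma> p *\<^sub>p sg p"
  by (simp add: WT_def)

lemma wt_inverse:
  assumes "p \<in> qpaths H" "\<And>\<gamma>. \<gamma> \<in> arcs G \<Longrightarrow> \<sigma> \<gamma> \<noteq> 0"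
  shows "wt \<sigma> p * wt (\<lambda>\<gamma>. inverse (\<sigma> \<gamma>)) p = 1"
proof -
  have "wt \<sigma> (u, es) * wt (\<lambda>\<gamma>. inverse (\<sigma> \<gamma>)) (u, es) = 1" if "(u, es) \<in> qpaths H" for u es
    using that
  proof (induction es arbitrary: u)
    case (Cons \<alpha> es)
    have "awt \<sigma> \<alpha> * awt (\<lambda>\<gamma>. inverse (\<sigma> \<gamma>)) \<alpha> = 1"
      using Cons.prems assms(2) by (cases \<alpha>) (auto simp: H.qpaths_Cons)
    moreover have "wt \<sigma> (head H \<alpha>, es) * wt (\<lambda>\<gamma>. inverse (\<sigma> \<gamma>)) (head H \<alpha>, es) = 1"
      using Cons by (auto simp: H.qpaths_Cons)
    ultimately show ?case by (simp add: wt_def algebra_simps)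
  qed (simp add: wt_def)
  from this[of "fst p" "snd p"] show ?thesis using assms(1) by simp
qed

text \<open>In each term of the relation the weights of \<alpha> and \<open>bar \<alpha>\<close>
  cancel, so a generator of \<open>J\<close> is merely multiplied by the weights of \<open>p\<close>
  and \<open>q\<close>.\<close>

lemma WT_J:
  assumes "\<And>\<gamma>. \<gamma> \<in> arcs G \<Longrightarrow> \<sigma> \<gamma> \<noteq> 0" "f \<in> J"
  shows "WT \<sigma> f \<in> J"
proof (rule J_induct[OF assms(2) linmap_WT subspace_J])
  fix p q assume pq: "p \<in> qpaths H" "q \<in> qpaths H"
  have "awt \<sigma> \<alpha> * awt \<sigma> (bar \<alpha>) = 1" if "\<alpha> \<in> arcs H" for \<alpha>
    using that assms(1) by (cases \<alpha>) auto
  then have "wt \<sigma> (fst q, snd q @ [\<alpha>, bar \<alpha>] @ snd p) = wt \<sigma> p * wt \<sigma> q" if "\<alpha> \<in> arcs H" for \<alpha>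
    using that by (simp add: wt_def)
  then have "WT \<sigma> (sg p \<star> rel \<star> sg q) = (wt \<sigma> p * wt \<sigma> q) *\<^sub>p (sg p \<star> rel \<star> sg q)"
    unfolding gen_eq linmap_sum[OF linmap_WT] linmap_scale[OF linmap_WT] pscale_sum
    by (intro sum.cong refl) (auto simp: WT_sg linmap_0[OF linmap_WT] mult.commute)
  then show "WT \<sigma> (sg p \<star> rel \<star> sg q) \<in> J"
    using J_gen[OF pq] J_scale by simp
qed

lemma WT_J_iff:
  assumes "\<And>\<gamma>. \<gamma> \<in> arcs G \<Longrightarrow> \<sigma> \<gamma> \<noteq> 0" "keys f \<subseteq> qpaths H" "WT \<sigma> f \<in> J"
  shows "f \<in> J"
proof -
  have "WT (\<lambda>\<gamma>. inverse (\<sigma> \<gamma>)) (WT \<sigma> f) \<in> J"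
    by (rule WT_J[OF _ assms(3)]) (use assms(1) in simp)
  also have "WT (\<lambda>\<gamma>. inverse (\<sigma> \<gamma>)) (WT \<sigma> f) = f"
    by (rule linmap_eq_on[OF linmap_comp[OF linmap_WT linmap_WT] linmap_id _ assms(2)])
      (simp add: WT_sg linmap_scale[OF linmap_WT] wt_inverse assms(1))
  finally show ?thesis .
qed

lemma wt_snoc: "wt \<sigma> (u, es @ [\<alpha>]) = wt \<sigma> (u, es) * awt \<sigma> \<alpha>"
  by (simp add: wt_def)

lemma keys_WT: "keys z \<subseteq> T \<Longrightarrow> keys (WT \<sigma> z) \<subseteq> T"
  by (rule keys_in_linmap[OF linmap_WT, of T], unfold WT_sg, rule keys_scale_subset) simp_all

text \<open>Precomposition with the inverse reweighting contributes a factor that cancels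
  \<open>\<sigma> \<gamma>\<close>; the results on ordinary homomorphisms thus carry over to twisted
  ones.\<close>

lemma hom_untwist:
  assumes F: "hom \<sigma> s c t d F" and \<sigma>: "\<And>\<gamma>. \<gamma> \<in> arcs G \<Longrightarrow> \<sigma> \<gamma> \<noteq> 0"
  shows "hom (\<lambda>_. 1) s c t d (\<lambda>z. F (WT (\<lambda>\<gamma>. inverse (\<sigma> \<gamma>)) z))"
proof (rule homI)
  note F = homD[OF F]
  show "linmap (\<lambda>z. F (WT (\<lambda>\<gamma>. inverse (\<sigma> \<gamma>)) z))" by (rule linmap_comp[OF F(1) linmap_WT])
  show "keys (F (WT (\<lambda>\<gamma>. inverse (\<sigma> \<gamma>)) (sg q))) \<subseteq> IX t d v" if "q \<in> PT s c v" for v q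
    by (rule F(2)[OF keys_WT]) (use that in simp)
  show "F (WT (\<lambda>\<gamma>. inverse (\<sigma> \<gamma>)) f) = 0" if "f \<in> J" "keys f \<subseteq> PT s c v" for v f
    by (rule F(3)[OF WT_J keys_WT]) (use that \<sigma> in auto)
  fix \<gamma> q assume \<gamma>: "\<gamma> \<in> arcs G" and q: "q \<in> PT s c (tail G \<gamma>)"
  have "WT (\<lambda>\<gamma>. inverse (\<sigma> \<gamma>)) (L \<gamma> (sg q)) = inverse (\<sigma> \<gamma>) *\<^sub>p L \<gamma> (WT (\<lambda>\<gamma>. inverse (\<sigma> \<gamma>)) (sg q))"
    using arr_mult_PT(1)[of q s c "Inl \<gamma>"] \<gamma> q
    by (simp add: WT_sg wt_snoc linmap_scale[OF linmap_L] mult.commute)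
  moreover have "F (L \<gamma> (WT (\<lambda>\<gamma>. inverse (\<sigma> \<gamma>)) (sg q))) = \<sigma> \<gamma> *\<^sub>p nf (L \<gamma> (F (WT (\<lambda>\<gamma>. inverse (\<sigma> \<gamma>)) (sg q))))"
    by (rule F(4)[OF \<gamma> keys_WT]) (use q in simp)
  ultimately show "F (WT (\<lambda>\<gamma>. inverse (\<sigma> \<gamma>)) (L \<gamma> (sg q))) = 1 *\<^sub>p nf (L \<gamma> (F (WT (\<lambda>\<gamma>. inverse (\<sigma> \<gamma>)) (sg q))))"
    using \<sigma>[OF \<gamma>] by (simp add: linmap_scale[OF F(1)])
qed

lemma hom_untwist_sg:
  assumes F: "hom \<sigma> s c t d F" and \<sigma>: "\<And>\<gamma>. \<gamma> \<in> arcs G \<Longrightarrow> \<sigma> \<gamma> \<noteq> 0" and q: "q \<in> PT s c v"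
  shows "F (sg q) = wt \<sigma> q *\<^sub>p F (WT (\<lambda>\<gamma>. inverse (\<sigma> \<gamma>)) (sg q))"
  using wt_inverse[of q \<sigma>, OF _ \<sigma>] q by (simp add: WT_sg linmap_scale[OF homD(1)[OF F]] PT_def)

lemma twisted_hom_zero:
  assumes F: "hom \<sigma> s c t d F" and \<sigma>: "\<And>\<gamma>. \<gamma> \<in> arcs G \<Longrightarrow> \<sigma> \<gamma> \<noteq> 0" and q: "q \<in> PT s c v"
    and "c = d \<and> PT t 0 s = {} \<or> c = Suc d"
  shows "F (sg q) = 0"
  using assms(4) hom_untwist_sg[OF F \<sigma> q] hom_zero_same_degree[of s c t _ q v] hom_zero_lower_degree[of s d t _ q v]
    hom_untwist[OF F \<sigma>] q by auto

lemma twisted_hom_scalar: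
  assumes F: "hom \<sigma> t c t c F" and \<sigma>: "\<And>\<gamma>. \<gamma> \<in> arcs G \<Longrightarrow> \<sigma> \<gamma> \<noteq> 0"
  obtains l where "\<And>z. keys z \<subseteq> PTs t c \<Longrightarrow> F z = l *\<^sub>p nf (WT \<sigma> z)"
proof -
  obtain l where l: "\<forall>v. \<forall>q\<in>PT t c v. F (WT (\<lambda>\<gamma>. inverse (\<sigma> \<gamma>)) (sg q)) = l *\<^sub>p nf (sg q)"
    using hom_scalar[OF hom_untwist[OF F \<sigma>]] by blast
  show thesis
  proof (rule that, rule linmap_eq_on[OF homD(1)[OF F] linmap_scaled[OF linmap_comp[OF linmap_nf linmap_WT]]])
    fix q assume "q \<in> PTs t c"
    then obtain v where q: "q \<in> PT t c v" by (auto simp: PTs_UN)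
    show "F (sg q) = l *\<^sub>p nf (WT \<sigma> (sg q))"
      using hom_untwist_sg[OF F \<sigma> q] l q by (simp add: WT_sg linmap_scale[OF linmap_nf] mult.commute)
  qed
qed

text \<open>Here \<open>c\<close> describes an extension of \<open>V\<^sup>r\<^sub>e\<close> by
  \<open>V\<^sup>t\<^sub>d\<close>, and the functionals \<Phi> cut out a subspace of
  \<open>V\<^sup>r\<^sub>e\<close>. The obstructions to making \<open>c\<close> a coboundary on that
  subspace are the solutions \<psi> with values in it; by \<open>unique\<close> there are none
  except zero. For \<open>Z = {}\<close> this is the passage from Hom = 0 to Ext = 0.\<close>

lemma ext_vanish:
  fixes \<Phi> :: "'z \<Rightarrow> ('v, 'e + 'e) qpath \<Rightarrow> 'k"
  assumes Z: "finite Z"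
    and unique: "\<And>\<psi> \<gamma> j. (\<And>\<gamma>. linmap (\<psi> \<gamma>)) \<Longrightarrow> (\<And>\<gamma> z. keys (\<psi> \<gamma> z) \<subseteq> IX r e (tail G \<gamma>)) \<Longrightarrow>
      (\<And>\<gamma> f. f \<in> J \<Longrightarrow> \<psi> \<gamma> f = 0) \<Longrightarrow>
      (\<And>v q. q \<in> PT t d v \<Longrightarrow>
        (\<Sum>\<gamma>\<in>{\<gamma> \<in> arcs G. tail G \<gamma> = v}. a \<gamma> *\<^sub>p \<psi> \<gamma> (L \<gamma> (sg q))) =
        (\<Sum>\<gamma>\<in>{\<gamma> \<in> arcs G. head G \<gamma> = v}. b \<gamma> *\<^sub>p nf (L \<gamma> (\<psi> \<gamma> (sg q))))) \<Longrightarrow>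
      (\<And>\<zeta> \<gamma> j. \<zeta> \<in> Z \<Longrightarrow> \<gamma> \<in> arcs G \<Longrightarrow> j \<in> IX t d (head G \<gamma>) \<Longrightarrow>
        (\<Sum>i\<in>IX r e (tail G \<gamma>). lookup (\<psi> \<gamma> (sg j)) i * \<Phi> \<zeta> i) = 0) \<Longrightarrow>
      \<gamma> \<in> arcs G \<Longrightarrow> j \<in> IX t d (head G \<gamma>) \<Longrightarrow> \<psi> \<gamma> (sg j) = 0"
    and c: "\<And>\<gamma>. linmap (c \<gamma>)"
      "\<And>\<gamma> q. \<gamma> \<in> arcs G \<Longrightarrow> q \<in> PT r e (tail G \<gamma>) \<Longrightarrow> keys (c \<gamma> (sg q)) \<subseteq> IX t d (head G \<gamma>)"
      "\<And>\<gamma> f. \<gamma> \<in> arcs G \<Longrightarrow> f \<in> J \<Longrightarrow> keys f \<subseteq> PT r e (tail G \<gamma>) \<Longrightarrow> c \<gamma> f = 0"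
  obtains k where "linmap k" "\<And>v z. keys z \<subseteq> PT r e v \<Longrightarrow> keys (k z) \<subseteq> IX t d v" "\<And>f. f \<in> J \<Longrightarrow> k f = 0"
    "\<And>\<gamma> z. \<gamma> \<in> arcs G \<Longrightarrow> keys z \<subseteq> PT r e (tail G \<gamma>) \<Longrightarrow>
      (\<And>\<zeta>. \<zeta> \<in> Z \<Longrightarrow> (\<Sum>i\<in>IX r e (tail G \<gamma>). lookup (nf z) i * \<Phi> \<zeta> i) = 0) \<Longrightarrow>
      c \<gamma> z = a \<gamma> *\<^sub>p nf (L \<gamma> (k z)) - b \<gamma> *\<^sub>p k (L \<gamma> z)"
proof -
  \<comment> \<open>\<open>?I\<close> indexes the entries of \<open>c\<close> and, dually, of
    \<psi>. The coefficients found for the rows \<open>?R1\<close> will be the matrix entries of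
    \<open>k\<close>; those for \<open>?R2\<close> are multipliers of the functionals \<Phi> and
    disappear on their common kernel.\<close>
  let ?I = "SIGMA \<gamma>:arcs G. IX r e (tail G \<gamma>) \<times> IX t d (head G \<gamma>)"
  let ?R1 = "SIGMA v:verts G. IX r e v \<times> IX t d v"
  let ?R2 = "SIGMA \<gamma>:arcs G. Z \<times> IX t d (head G \<gamma>)"
  define A1 where "A1 = (\<lambda>v (i :: ('v, 'e + 'e) qpath) (j :: ('v, 'e + 'e) qpath) \<gamma> i1 j1. if tail G \<gamma> = v \<and> i1 = i then a \<gamma> * lookup (nf (L \<gamma> (sg j))) j1 else 0)"
  define A2 where "A2 = (\<lambda>v (i :: ('v, 'e + 'e) qpath) (j :: ('v, 'e + 'e) qpath) \<gamma> i1 j1. if head G \<gamma> = v \<and> j1 = j then b \<gamma> * lookup (nf (L \<gamma> (sg i1))) i else 0)"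
  define A3 where "A3 = (\<lambda>(\<gamma>' :: 'e) \<zeta> (j :: ('v, 'e + 'e) qpath) \<gamma> i1 j1. if \<gamma>' = \<gamma> \<and> j1 = j then \<Phi> \<zeta> i1 else 0)"
  define A where "A = (\<lambda>r p. case p of (\<gamma>, i1, j1) \<Rightarrow> (case r of
      Inl (v, i, j) \<Rightarrow> A1 v i j \<gamma> i1 j1 - A2 v i j \<gamma> i1 j1
    | Inr (\<gamma>', \<zeta>, j) \<Rightarrow> A3 \<gamma>' \<zeta> j \<gamma> i1 j1))"
  have A_simps: "A (Inl (v, i, j)) (\<gamma>, i1, j1) = A1 v i j \<gamma> i1 j1 - A2 v i j \<gamma> i1 j1"
    "A (Inr (\<gamma>', \<zeta>, j)) (\<gamma>, i1, j1) = A3 \<gamma>' \<zeta> j \<gamma> i1 j1" for v i j \<gamma> i1 j1 \<gamma>' \<zeta>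
    by (simp_all add: A_def)
  have fR: "finite (?R1 <+> ?R2)" and fI: "finite ?I" using Z by auto
  have sumI: "(\<Sum>p\<in>?I. f p) = (\<Sum>\<gamma>\<in>arcs G. \<Sum>i\<in>IX r e (tail G \<gamma>). \<Sum>j\<in>IX t d (head G \<gamma>). f (\<gamma>, i, j))" for f :: "_ \<Rightarrow> 'k"
    by (rule sum_triple) auto
  have sumR: "(\<Sum>p\<in>?R1 <+> ?R2. f p) =
      (\<Sum>v\<in>verts G. \<Sum>i\<in>IX r e v. \<Sum>j\<in>IX t d v. f (Inl (v, i, j))) +
      (\<Sum>\<gamma>\<in>arcs G. \<Sum>\<zeta>\<in>Z. \<Sum>j\<in>IX t d (head G \<gamma>). f (Inr (\<gamma>, \<zeta>, j)))" for f :: "_ \<Rightarrow> 'k"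
    using Z by (subst sum.Plus) (auto simp: sum_triple)
  let ?c = "\<lambda>(\<gamma>, i, j). lookup (c \<gamma> (sg i)) j"
  have "\<exists>y. \<forall>p\<in>?I. ?c p = (\<Sum>r\<in>?R1 <+> ?R2. y r * A r p)"
  proof (rule fredholm[OF fR fI])
    fix x assume x: "\<And>s. s \<in> ?R1 <+> ?R2 \<Longrightarrow> (\<Sum>p\<in>?I. A s p * x p) = 0"
    define \<psi> where "\<psi> = (\<lambda>\<gamma>. mat_map (\<lambda>_. IX r e (tail G \<gamma>)) (\<lambda>j i. x (\<gamma>, i, j)))"
    have lin: "linmap (\<psi> \<gamma>)" for \<gamma> by (simp add: \<psi>_def)
    have keys: "keys (\<psi> \<gamma> z) \<subseteq> IX r e (tail G \<gamma>)" for \<gamma> z by (simp add: \<psi>_def keys_mat_map)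
    have \<psi>J: "\<psi> \<gamma> f = 0" if "f \<in> J" for \<gamma> f using that by (simp add: \<psi>_def mat_map_J)
    have \<psi>_nf: "\<psi> \<gamma> (nf z) = \<psi> \<gamma> z" for \<gamma> z by (simp add: \<psi>_def mat_map_def)
    have lookup_\<psi>: "lookup (\<psi> \<gamma> (sg j)) i = x (\<gamma>, i, j)" if "j \<in> IX t d w" "i \<in> IX r e (tail G \<gamma>)" for \<gamma> i j w
      using that(2) by (simp add: \<psi>_def lookup_mat_map_sg[OF that(1)])
    have rel0: "(\<Sum>\<gamma>\<in>{\<gamma> \<in> arcs G. tail G \<gamma> = v}. a \<gamma> *\<^sub>p \<psi> \<gamma> (L \<gamma> (sg j))) =
        (\<Sum>\<gamma>\<in>{\<gamma> \<in> arcs G. head G \<gamma> = v}. b \<gamma> *\<^sub>p nf (L \<gamma> (\<psi> \<gamma> (sg j))))" if j: "j \<in> IX t d v" for v j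
    proof (rule poly_mapping_eq_IX[of _ r e v])
      show "keys (\<Sum>\<gamma>\<in>{\<gamma> \<in> arcs G. tail G \<gamma> = v}. a \<gamma> *\<^sub>p \<psi> \<gamma> (L \<gamma> (sg j))) \<subseteq> IX r e v"
      proof (intro keys_sum_subset keys_scale_subset)
        fix \<gamma> assume "\<gamma> \<in> {\<gamma> \<in> arcs G. tail G \<gamma> = v}"
        then show "keys (\<psi> \<gamma> (L \<gamma> (sg j))) \<subseteq> IX r e v" using keys[of \<gamma> "L \<gamma> (sg j)"] by simp
      qed
      show "keys (\<Sum>\<gamma>\<in>{\<gamma> \<in> arcs G. head G \<gamma> = v}. b \<gamma> *\<^sub>p nf (L \<gamma> (\<psi> \<gamma> (sg j)))) \<subseteq> IX r e v"
      proof (intro keys_sum_subset keys_scale_subset)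
        fix \<gamma> assume "\<gamma> \<in> {\<gamma> \<in> arcs G. head G \<gamma> = v}"
        then show "keys (nf (L \<gamma> (\<psi> \<gamma> (sg j)))) \<subseteq> IX r e v" using keys_nf_L[OF _ keys, of \<gamma> "sg j"] by simp
      qed
      fix i assume i: "i \<in> IX r e v"
      have f1: "(\<Sum>i1\<in>IX r e (tail G \<gamma>). \<Sum>j1\<in>IX t d (head G \<gamma>). A1 v i j \<gamma> i1 j1 * x (\<gamma>, i1, j1)) =
        (if tail G \<gamma> = v then lookup (a \<gamma> *\<^sub>p \<psi> \<gamma> (L \<gamma> (sg j))) i else 0)" if \<gamma>: "\<gamma> \<in> arcs G" for \<gamma>
      proof (cases "tail G \<gamma> = v")
        case True
        have k: "keys (nf (L \<gamma> (sg j))) \<subseteq> IX t d (head G \<gamma>)"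
          by (rule keys_nf_L[OF \<gamma>]) (use j True in simp)
        have "(\<Sum>i1\<in>IX r e (tail G \<gamma>). \<Sum>j1\<in>IX t d (head G \<gamma>). A1 v i j \<gamma> i1 j1 * x (\<gamma>, i1, j1)) =
          (\<Sum>i1\<in>IX r e (tail G \<gamma>). if i1 = i then \<Sum>j1\<in>IX t d (head G \<gamma>). a \<gamma> * lookup (nf (L \<gamma> (sg j))) j1 * x (\<gamma>, i, j1) else 0)"
          using True by (intro sum.cong refl) (auto simp: A1_def)
        also have "\<dots> = a \<gamma> * (\<Sum>j1\<in>IX t d (head G \<gamma>). lookup (nf (L \<gamma> (sg j))) j1 * x (\<gamma>, i, j1))"
          using i True by (simp add: sum_distrib_left mult.assoc)
        also have "(\<Sum>j1\<in>IX t d (head G \<gamma>). lookup (nf (L \<gamma> (sg j))) j1 * x (\<gamma>, i, j1)) = lookup (\<psi> \<gamma> (nf (L \<gamma> (sg j)))) i"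
          unfolding lookup_linmap[OF lin finite_IX k]
          by (intro sum.cong refl) (use i True in \<open>simp add: lookup_\<psi>\<close>)
        finally show ?thesis using True by (simp add: \<psi>_nf lookup_scale)
      qed (simp add: A1_def)
      have f2: "(\<Sum>i1\<in>IX r e (tail G \<gamma>). \<Sum>j1\<in>IX t d (head G \<gamma>). A2 v i j \<gamma> i1 j1 * x (\<gamma>, i1, j1)) =
        (if head G \<gamma> = v then lookup (b \<gamma> *\<^sub>p nf (L \<gamma> (\<psi> \<gamma> (sg j)))) i else 0)" if \<gamma>: "\<gamma> \<in> arcs G" for \<gamma>
      proof (cases "head G \<gamma> = v")
        case True
        have "(\<Sum>j1\<in>IX t d (head G \<gamma>). A2 v i j \<gamma> i1 j1 * x (\<gamma>, i1, j1)) =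
          b \<gamma> * (lookup (\<psi> \<gamma> (sg j)) i1 * lookup (nf (L \<gamma> (sg i1))) i)" if "i1 \<in> IX r e (tail G \<gamma>)" for i1
        proof -
          have "(\<Sum>j1\<in>IX t d (head G \<gamma>). A2 v i j \<gamma> i1 j1 * x (\<gamma>, i1, j1)) =
            (\<Sum>j1\<in>IX t d (head G \<gamma>). if j1 = j then b \<gamma> * lookup (nf (L \<gamma> (sg i1))) i * x (\<gamma>, i1, j) else 0)"
            using True by (intro sum.cong refl) (auto simp: A2_def)
          then show ?thesis using j True by (simp add: lookup_\<psi>[OF j that])
        qed
        then have "(\<Sum>i1\<in>IX r e (tail G \<gamma>). \<Sum>j1\<in>IX t d (head G \<gamma>). A2 v i j \<gamma> i1 j1 * x (\<gamma>, i1, j1)) =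
          b \<gamma> * (\<Sum>i1\<in>IX r e (tail G \<gamma>). lookup (\<psi> \<gamma> (sg j)) i1 * lookup (nf (L \<gamma> (sg i1))) i)"
          by (simp add: sum_distrib_left)
        then show ?thesis
          using True by (simp add: lookup_scale lookup_linmap[OF linmap_comp[OF linmap_nf linmap_L] finite_IX keys])
      qed (simp add: A2_def)
      have "0 = (\<Sum>p\<in>?I. A (Inl (v, i, j)) p * x p)"
        by (rule x[symmetric], rule InlI) (use i j IX_verts in auto)
      also have "\<dots> = (\<Sum>\<gamma>\<in>arcs G. (if tail G \<gamma> = v then lookup (a \<gamma> *\<^sub>p \<psi> \<gamma> (L \<gamma> (sg j))) i else 0) -
          (if head G \<gamma> = v then lookup (b \<gamma> *\<^sub>p nf (L \<gamma> (\<psi> \<gamma> (sg j)))) i else 0))"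
        unfolding sumI A_simps left_diff_distrib sum_subtractf
        by (intro arg_cong2[where f = "(-)"] sum.cong refl f1 f2)
      also have "\<dots> = lookup (\<Sum>\<gamma>\<in>{\<gamma> \<in> arcs G. tail G \<gamma> = v}. a \<gamma> *\<^sub>p \<psi> \<gamma> (L \<gamma> (sg j))) i -
        lookup (\<Sum>\<gamma>\<in>{\<gamma> \<in> arcs G. head G \<gamma> = v}. b \<gamma> *\<^sub>p nf (L \<gamma> (\<psi> \<gamma> (sg j)))) i"
        by (auto simp: lookup_sum sum_subtractf sum.inter_filter intro!: arg_cong2[where f = "(-)"] sum.cong)
      finally show "lookup (\<Sum>\<gamma>\<in>{\<gamma> \<in> arcs G. tail G \<gamma> = v}. a \<gamma> *\<^sub>p \<psi> \<gamma> (L \<gamma> (sg j))) i =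
        lookup (\<Sum>\<gamma>\<in>{\<gamma> \<in> arcs G. head G \<gamma> = v}. b \<gamma> *\<^sub>p nf (L \<gamma> (\<psi> \<gamma> (sg j)))) i" by simp
    qed
    have zero: "\<psi> \<gamma> (sg j) = 0" if "\<gamma> \<in> arcs G" "j \<in> IX t d (head G \<gamma>)" for \<gamma> j
    proof (rule unique[OF lin keys \<psi>J _ _ that])
      fix v q assume q: "q \<in> PT t d v"
      have "(\<Sum>\<gamma>\<in>{\<gamma> \<in> arcs G. tail G \<gamma> = v}. a \<gamma> *\<^sub>p \<psi> \<gamma> (L \<gamma> (nf (sg q)))) =
        (\<Sum>\<gamma>\<in>{\<gamma> \<in> arcs G. head G \<gamma> = v}. b \<gamma> *\<^sub>p nf (L \<gamma> (\<psi> \<gamma> (nf (sg q)))))"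
      proof (rule linmap_eq_on[where S = "IX t d v" and
            F = "\<lambda>z. \<Sum>\<gamma>\<in>{\<gamma> \<in> arcs G. tail G \<gamma> = v}. a \<gamma> *\<^sub>p \<psi> \<gamma> (L \<gamma> z)" and
            F' = "\<lambda>z. \<Sum>\<gamma>\<in>{\<gamma> \<in> arcs G. head G \<gamma> = v}. b \<gamma> *\<^sub>p nf (L \<gamma> (\<psi> \<gamma> z))"])
        show "keys (nf (sg q)) \<subseteq> IX t d v" by (rule keys_nf_sg_IX[OF q])
      qed (rule rel0, assumption | intro linmap_sums linmap_scaled linmap_comp[OF lin linmap_L]
            linmap_comp[OF linmap_comp[OF linmap_nf linmap_L] lin])+
      moreover have "\<psi> \<gamma> (L \<gamma> (nf (sg q))) = \<psi> \<gamma> (L \<gamma> (sg q))" if "\<gamma> \<in> arcs G" for \<gamma>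
        using \<psi>_nf[of \<gamma> "L \<gamma> (nf (sg q))"] \<psi>_nf[of \<gamma> "L \<gamma> (sg q)"] nf_arr_nf[of "Inl \<gamma>" "sg q"] that by simp
      ultimately show "(\<Sum>\<gamma>\<in>{\<gamma> \<in> arcs G. tail G \<gamma> = v}. a \<gamma> *\<^sub>p \<psi> \<gamma> (L \<gamma> (sg q))) =
        (\<Sum>\<gamma>\<in>{\<gamma> \<in> arcs G. head G \<gamma> = v}. b \<gamma> *\<^sub>p nf (L \<gamma> (\<psi> \<gamma> (sg q))))"
        by (simp add: \<psi>_nf)
    next
      fix \<zeta> \<gamma> j assume *: "\<zeta> \<in> Z" "\<gamma> \<in> arcs G" "j \<in> IX t d (head G \<gamma>)"
      have "0 = (\<Sum>p\<in>?I. A (Inr (\<gamma>, \<zeta>, j)) p * x p)"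
        by (rule x[symmetric], rule InrI) (use * in auto)
      also have "\<dots> = (\<Sum>\<gamma>'\<in>arcs G. if \<gamma>' = \<gamma> then \<Sum>i\<in>IX r e (tail G \<gamma>). \<Phi> \<zeta> i * x (\<gamma>, i, j) else 0)"
        unfolding sumI A_simps
      proof (intro sum.cong refl)
        fix \<gamma>'
        have "(\<Sum>j1\<in>IX t d (head G \<gamma>). A3 \<gamma> \<zeta> j \<gamma> i j1 * x (\<gamma>, i, j1)) = \<Phi> \<zeta> i * x (\<gamma>, i, j)" for i
        proof -
          have "(\<Sum>j1\<in>IX t d (head G \<gamma>). A3 \<gamma> \<zeta> j \<gamma> i j1 * x (\<gamma>, i, j1)) =
            (\<Sum>j1\<in>IX t d (head G \<gamma>). if j1 = j then \<Phi> \<zeta> i * x (\<gamma>, i, j) else 0)"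
            by (intro sum.cong refl) (auto simp: A3_def)
          then show ?thesis using * by simp
        qed
        then show "(\<Sum>i\<in>IX r e (tail G \<gamma>'). \<Sum>j1\<in>IX t d (head G \<gamma>'). A3 \<gamma> \<zeta> j \<gamma>' i j1 * x (\<gamma>', i, j1)) =
          (if \<gamma>' = \<gamma> then \<Sum>i\<in>IX r e (tail G \<gamma>). \<Phi> \<zeta> i * x (\<gamma>, i, j) else 0)"
          by (cases "\<gamma>' = \<gamma>") (auto simp: A3_def)
      qed
      finally show "(\<Sum>i\<in>IX r e (tail G \<gamma>). lookup (\<psi> \<gamma> (sg j)) i * \<Phi> \<zeta> i) = 0"
        using *(2) by (simp add: lookup_\<psi>[OF *(3)] mult.commute)
    qed
    have "x (\<gamma>, i, j) = 0" if "\<gamma> \<in> arcs G" "i \<in> IX r e (tail G \<gamma>)" "j \<in> IX t d (head G \<gamma>)" for \<gamma> i j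
      using lookup_\<psi>[OF that(3,2)] zero[OF that(1,3)] by simp
    then show "(\<Sum>p\<in>?I. ?c p * x p) = 0"
      unfolding sumI by simp
  qed
  then obtain y where y: "\<And>\<gamma> i j. \<gamma> \<in> arcs G \<Longrightarrow> i \<in> IX r e (tail G \<gamma>) \<Longrightarrow> j \<in> IX t d (head G \<gamma>) \<Longrightarrow>
    lookup (c \<gamma> (sg i)) j = (\<Sum>r\<in>?R1 <+> ?R2. y r * A r (\<gamma>, i, j))" by fastforce
  define k where "k = mat_map (\<lambda>i. IX t d (pend i)) (\<lambda>i j. y (Inl (pend i, i, j)))"
  have k_lin: "linmap k" by (simp add: k_def)
  have kJ: "k f = 0" if "f \<in> J" for f using that by (simp add: k_def mat_map_J)
  have k_nf: "k (nf z) = k z" for z by (simp add: k_def mat_map_def)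
  have k_keys: "keys (k z) \<subseteq> IX t d v" if "keys z \<subseteq> PT r e v" for z v
    unfolding k_def
  proof (rule keys_mat_map)
    fix i assume "i \<in> keys (nf z)"
    then have "i \<in> IX r e v" using keys_nf_IX[OF that] by blast
    then show "IX t d (pend i) \<subseteq> IX t d v" by (simp add: IX_end)
  qed
  have k_lookup: "lookup (k (sg i)) j = y (Inl (v, i, j))" if "i \<in> IX r e v" "j \<in> IX t d v" for i j v
    using that IX_end[of i] by (simp add: k_def lookup_mat_map_sg[OF that(1)])
  have cij: "lookup (c \<gamma> (sg i)) j = lookup (a \<gamma> *\<^sub>p nf (L \<gamma> (k (sg i))) - b \<gamma> *\<^sub>p k (L \<gamma> (sg i))) j +
      (\<Sum>\<zeta>\<in>Z. y (Inr (\<gamma>, \<zeta>, j)) * \<Phi> \<zeta> i)"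
    if \<gamma>: "\<gamma> \<in> arcs G" and i: "i \<in> IX r e (tail G \<gamma>)" and j: "j \<in> IX t d (head G \<gamma>)" for \<gamma> i j
  proof -
    have ki: "keys (k (sg i)) \<subseteq> IX t d (tail G \<gamma>)" by (rule k_keys) (use IX_PT[OF i] in simp)
    have Li: "keys (nf (L \<gamma> (sg i))) \<subseteq> IX r e (head G \<gamma>)"
      by (rule keys_nf_L[OF \<gamma>]) (use i in simp)
    have g1: "(\<Sum>v\<in>verts G. \<Sum>i'\<in>IX r e v. \<Sum>j'\<in>IX t d v. y (Inl (v, i', j')) * A1 v i' j' \<gamma> i j) =
      lookup (a \<gamma> *\<^sub>p nf (L \<gamma> (k (sg i)))) j"
    proof -
      have "(\<Sum>v\<in>verts G. \<Sum>i'\<in>IX r e v. \<Sum>j'\<in>IX t d v. y (Inl (v, i', j')) * A1 v i' j' \<gamma> i j) =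
        (\<Sum>v\<in>verts G. if v = tail G \<gamma> then \<Sum>i'\<in>IX r e (tail G \<gamma>). if i' = i then
          a \<gamma> * (\<Sum>j'\<in>IX t d (tail G \<gamma>). y (Inl (tail G \<gamma>, i, j')) * lookup (nf (L \<gamma> (sg j'))) j) else 0 else 0)"
      proof (intro sum.cong refl)
        fix v
        have "(\<Sum>j'\<in>IX t d (tail G \<gamma>). y (Inl (tail G \<gamma>, i', j')) * A1 (tail G \<gamma>) i' j' \<gamma> i j) =
          (if i' = i then a \<gamma> * (\<Sum>j'\<in>IX t d (tail G \<gamma>). y (Inl (tail G \<gamma>, i, j')) * lookup (nf (L \<gamma> (sg j'))) j) else 0)" for i'
          by (cases "i' = i") (simp_all add: A1_def sum_distrib_left mult.left_commute)
        then show "(\<Sum>i'\<in>IX r e v. \<Sum>j'\<in>IX t d v. y (Inl (v, i', j')) * A1 v i' j' \<gamma> i j) =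
          (if v = tail G \<gamma> then \<Sum>i'\<in>IX r e (tail G \<gamma>). if i' = i then
            a \<gamma> * (\<Sum>j'\<in>IX t d (tail G \<gamma>). y (Inl (tail G \<gamma>, i, j')) * lookup (nf (L \<gamma> (sg j'))) j) else 0 else 0)"
          by (cases "v = tail G \<gamma>") (simp_all add: A1_def)
      qed
      also have "\<dots> = a \<gamma> * (\<Sum>j'\<in>IX t d (tail G \<gamma>). y (Inl (tail G \<gamma>, i, j')) * lookup (nf (L \<gamma> (sg j'))) j)"
        using \<gamma> i by simp
      also have "(\<Sum>j'\<in>IX t d (tail G \<gamma>). y (Inl (tail G \<gamma>, i, j')) * lookup (nf (L \<gamma> (sg j'))) j) =
        lookup (nf (L \<gamma> (k (sg i)))) j"
        unfolding lookup_linmap[OF linmap_comp[OF linmap_nf linmap_L] finite_IX ki]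
        by (intro sum.cong refl) (simp add: k_lookup[OF i])
      finally show ?thesis by (simp add: lookup_scale)
    qed
    have g2: "(\<Sum>v\<in>verts G. \<Sum>i'\<in>IX r e v. \<Sum>j'\<in>IX t d v. y (Inl (v, i', j')) * A2 v i' j' \<gamma> i j) =
      lookup (b \<gamma> *\<^sub>p k (L \<gamma> (sg i))) j"
    proof -
      have "(\<Sum>v\<in>verts G. \<Sum>i'\<in>IX r e v. \<Sum>j'\<in>IX t d v. y (Inl (v, i', j')) * A2 v i' j' \<gamma> i j) =
        (\<Sum>v\<in>verts G. if v = head G \<gamma> then \<Sum>i'\<in>IX r e (head G \<gamma>). \<Sum>j'\<in>IX t d (head G \<gamma>). if j' = j then
          b \<gamma> * (lookup (nf (L \<gamma> (sg i))) i' * y (Inl (head G \<gamma>, i', j))) else 0 else 0)"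
      proof (intro sum.cong refl)
        fix v
        have "y (Inl (head G \<gamma>, i', j')) * A2 (head G \<gamma>) i' j' \<gamma> i j =
          (if j' = j then b \<gamma> * (lookup (nf (L \<gamma> (sg i))) i' * y (Inl (head G \<gamma>, i', j))) else 0)" for i' j'
          by (cases "j' = j") (simp_all add: A2_def mult_ac)
        then show "(\<Sum>i'\<in>IX r e v. \<Sum>j'\<in>IX t d v. y (Inl (v, i', j')) * A2 v i' j' \<gamma> i j) =
          (if v = head G \<gamma> then \<Sum>i'\<in>IX r e (head G \<gamma>). \<Sum>j'\<in>IX t d (head G \<gamma>). if j' = j then
            b \<gamma> * (lookup (nf (L \<gamma> (sg i))) i' * y (Inl (head G \<gamma>, i', j))) else 0 else 0)"
          by (cases "v = head G \<gamma>") (simp_all add: A2_def)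
      qed
      also have "\<dots> = b \<gamma> * (\<Sum>i'\<in>IX r e (head G \<gamma>). lookup (nf (L \<gamma> (sg i))) i' * y (Inl (head G \<gamma>, i', j)))"
        using \<gamma> j by (simp add: sum_distrib_left)
      also have "(\<Sum>i'\<in>IX r e (head G \<gamma>). lookup (nf (L \<gamma> (sg i))) i' * y (Inl (head G \<gamma>, i', j))) =
        lookup (k (nf (L \<gamma> (sg i)))) j"
        unfolding lookup_linmap[OF k_lin finite_IX Li]
        by (intro sum.cong refl) (simp add: k_lookup[OF _ j])
      finally show ?thesis by (simp add: lookup_scale k_nf)
    qed
    have g3: "(\<Sum>\<gamma>'\<in>arcs G. \<Sum>\<zeta>\<in>Z. \<Sum>j'\<in>IX t d (head G \<gamma>'). y (Inr (\<gamma>', \<zeta>, j')) * A3 \<gamma>' \<zeta> j' \<gamma> i j) =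
      (\<Sum>\<zeta>\<in>Z. y (Inr (\<gamma>, \<zeta>, j)) * \<Phi> \<zeta> i)"
    proof -
      have "(\<Sum>\<gamma>'\<in>arcs G. \<Sum>\<zeta>\<in>Z. \<Sum>j'\<in>IX t d (head G \<gamma>'). y (Inr (\<gamma>', \<zeta>, j')) * A3 \<gamma>' \<zeta> j' \<gamma> i j) =
        (\<Sum>\<gamma>'\<in>arcs G. if \<gamma>' = \<gamma> then \<Sum>\<zeta>\<in>Z. \<Sum>j'\<in>IX t d (head G \<gamma>). if j' = j then y (Inr (\<gamma>, \<zeta>, j)) * \<Phi> \<zeta> i else 0 else 0)"
      proof (intro sum.cong refl)
        fix \<gamma>'
        have "y (Inr (\<gamma>, \<zeta>, j')) * A3 \<gamma> \<zeta> j' \<gamma> i j = (if j' = j then y (Inr (\<gamma>, \<zeta>, j)) * \<Phi> \<zeta> i else 0)" for \<zeta> j'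
          by (cases "j' = j") (simp_all add: A3_def)
        then show "(\<Sum>\<zeta>\<in>Z. \<Sum>j'\<in>IX t d (head G \<gamma>'). y (Inr (\<gamma>', \<zeta>, j')) * A3 \<gamma>' \<zeta> j' \<gamma> i j) =
          (if \<gamma>' = \<gamma> then \<Sum>\<zeta>\<in>Z. \<Sum>j'\<in>IX t d (head G \<gamma>). if j' = j then y (Inr (\<gamma>, \<zeta>, j)) * \<Phi> \<zeta> i else 0 else 0)"
          by (cases "\<gamma>' = \<gamma>") (simp_all add: A3_def)
      qed
      also have "\<dots> = (\<Sum>\<zeta>\<in>Z. y (Inr (\<gamma>, \<zeta>, j)) * \<Phi> \<zeta> i)"
        using \<gamma> j by simp
      finally show ?thesis .
    qed
    show ?thesis
      unfolding y[OF \<gamma> i j] sumR A_simps right_diff_distrib sum_subtractf g1 g2 g3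
      by (simp add: lookup_minus)
  qed
  show thesis
  proof (rule that[OF k_lin k_keys kJ])
    fix \<gamma> z assume \<gamma>: "\<gamma> \<in> arcs G" and z: "keys z \<subseteq> PT r e (tail G \<gamma>)"
      and ann: "\<And>\<zeta>. \<zeta> \<in> Z \<Longrightarrow> (\<Sum>i\<in>IX r e (tail G \<gamma>). lookup (nf z) i * \<Phi> \<zeta> i) = 0"
    let ?D = "\<lambda>z. a \<gamma> *\<^sub>p nf (L \<gamma> (k z)) - b \<gamma> *\<^sub>p k (L \<gamma> z)"
    have linD: "linmap ?D"
      by (intro linmap_minus linmap_scaled linmap_comp[OF k_lin linmap_L]
        linmap_comp[OF linmap_comp[OF linmap_nf linmap_L] k_lin])
    note nz = keys_nf_IX[OF z]
    have "c \<gamma> (nf z) = ?D (nf z)"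
    proof (rule poly_mapping_eq_IX[of _ t d "head G \<gamma>"])
      show "keys (c \<gamma> (nf z)) \<subseteq> IX t d (head G \<gamma>)"
        by (rule keys_in_linmap[OF c(1) c(2)[OF \<gamma>] keys_IX_PT[OF nz]])
      show "keys (?D (nf z)) \<subseteq> IX t d (head G \<gamma>)"
        by (intro keys_diff_subset keys_scale_subset keys_nf_L[OF \<gamma>] k_keys keys_L[OF \<gamma>] keys_IX_PT[OF nz])
      fix j assume j: "j \<in> IX t d (head G \<gamma>)"
      have "lookup (c \<gamma> (nf z)) j = (\<Sum>i\<in>IX r e (tail G \<gamma>). lookup (nf z) i * (lookup (?D (sg i)) j + (\<Sum>\<zeta>\<in>Z. y (Inr (\<gamma>, \<zeta>, j)) * \<Phi> \<zeta> i)))"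
        unfolding lookup_linmap[OF c(1) finite_IX nz]
        by (intro sum.cong refl arg_cong2[where f = "(*)"] cij \<gamma> j)
      also have "\<dots> = (\<Sum>i\<in>IX r e (tail G \<gamma>). lookup (nf z) i * lookup (?D (sg i)) j) +
        (\<Sum>i\<in>IX r e (tail G \<gamma>). \<Sum>\<zeta>\<in>Z. y (Inr (\<gamma>, \<zeta>, j)) * (lookup (nf z) i * \<Phi> \<zeta> i))"
        by (simp only: distrib_left sum.distrib sum_distrib_left mult.left_commute)
      also have "(\<Sum>i\<in>IX r e (tail G \<gamma>). lookup (nf z) i * lookup (?D (sg i)) j) = lookup (?D (nf z)) j"
        by (rule lookup_linmap[OF linD finite_IX nz, symmetric])
      also have "(\<Sum>i\<in>IX r e (tail G \<gamma>). \<Sum>\<zeta>\<in>Z. y (Inr (\<gamma>, \<zeta>, j)) * (lookup (nf z) i * \<Phi> \<zeta> i)) = 0"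
        by (subst sum.swap) (simp add: sum_distrib_left[symmetric] ann)
      finally show "lookup (c \<gamma> (nf z)) j = lookup (?D (nf z)) j" by simp
    qed
    moreover have "c \<gamma> (nf z) = c \<gamma> z"
      by (rule linmap_nf_cong[OF c(1) c(3)[OF \<gamma>] z])
    moreover have "k (L \<gamma> (nf z)) = k (L \<gamma> z)"
      using k_nf[of "L \<gamma> (nf z)"] k_nf[of "L \<gamma> z"] nf_arr_nf[of "Inl \<gamma>" z] \<gamma> by simp
    ultimately show "c \<gamma> z = a \<gamma> *\<^sub>p nf (L \<gamma> (k z)) - b \<gamma> *\<^sub>p k (L \<gamma> z)" by (simp add: k_nf)
  qed
qed

text \<open>Values of a \<open>hom\<close> are normal forms, so \<open>nf\<close> is the identity of
  \<open>V\<^sup>t\<^sub>d\<close> in this setting.\<close>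

lemma hom_nf: "hom (\<lambda>_. 1) t d t d nf"
proof (rule homI[OF linmap_nf])
  fix \<gamma> q assume "\<gamma> \<in> arcs G"
  then show "nf (L \<gamma> (sg q)) = 1 *\<^sub>p nf (L \<gamma> (nf (sg q)))"
    using nf_arr_nf[of "Inl \<gamma>" "sg q"] by simp
qed (auto simp: nf_J intro: keys_nf_sg_IX[THEN subsetD])

text \<open>The case \<open>C = 0\<close>, \<open>\<tau> = 1\<close> of
  \<open>universal_property\<close>; it turns the solutions \<psi> that occur in
  \<open>ext_vanish\<close> into homomorphisms, for which vanishing theorems are available.\<close>

lemma solution_hom:
  assumes lin: "\<And>\<gamma>. linmap (\<psi> \<gamma>)" and keys: "\<And>\<gamma> z. keys (\<psi> \<gamma> z) \<subseteq> IX r e (tail G \<gamma>)"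
    and \<psi>J: "\<And>\<gamma> f. f \<in> J \<Longrightarrow> \<psi> \<gamma> f = 0"
    and rel: "\<And>v q. q \<in> PT t d v \<Longrightarrow>
        (\<Sum>\<gamma>\<in>{\<gamma> \<in> arcs G. tail G \<gamma> = v}. a \<gamma> *\<^sub>p \<psi> \<gamma> (L \<gamma> (sg q))) =
        (\<Sum>\<gamma>\<in>{\<gamma> \<in> arcs G. head G \<gamma> = v}. b \<gamma> *\<^sub>p nf (L \<gamma> (\<psi> \<gamma> (sg q))))"
  obtains F where "hom (\<lambda>_. 1) t (Suc d) r e F"
    "\<And>\<gamma> q. \<gamma> \<in> arcs G \<Longrightarrow> q \<in> PT t d (head G \<gamma>) \<Longrightarrow> F (Ls \<gamma> (sg q)) = \<psi> \<gamma> (sg q)"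
proof (rule universal_property[where \<psi> = \<psi> and C = "\<lambda>_ _. 0" and \<tau> = "\<lambda>_. 1" and t = t and d = d and r = r and e = e], goal_cases)
  case (8 F)
  have "hom (\<lambda>_. 1) t (Suc d) r e F"
    by (rule homI) (use 8 in auto)
  then show ?case using 8(5) that by blast
qed (use lin keys \<psi>J rel in \<open>auto simp: linmap_zero\<close>)

section \<open>Spanning by right multiplication\<close>

lemma PT_PTs: "q \<in> PT t d v \<Longrightarrow> q \<in> PTs t d"
  using PT_subset_PTs by blast

lemma PTs_PT: "q \<in> PTs t d \<Longrightarrow> q \<in> PT t d (pend q)"
  by (auto simp: PTs_def PT_def path_class_def)

lemma PTs_qpaths: "PTs t d \<subseteq> qpaths H"
  by (auto simp: PTs_def)

lemma keys_nf_IXs: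
  assumes "keys z \<subseteq> PTs t d" shows "keys (nf z) \<subseteq> IXs t d"
proof (rule keys_in_linmap[OF linmap_nf _ assms])
  fix q assume "q \<in> PTs t d"
  from keys_nf_sg_IX[OF PTs_PT[OF this]] show "keys (nf (sg q)) \<subseteq> IXs t d"
    using IXs_end by blast
qed

text \<open>The composite of the two maps of the almost split sequence, written out;
  \<open>mult_rel_J\<close> says that it is zero.\<close>

lemma mult_rel:
  assumes "keys z \<subseteq> PTs t d"
  shows "z \<star> rel = (\<Sum>\<alpha>\<in>{\<alpha> \<in> arcs H. tail H \<alpha> = t}. eps \<alpha> *\<^sub>p (z \<star> arr (bar \<alpha>) \<star> arr \<alpha>))"
proof (rule linmap_eq_on[where S = "PTs t d", OF linmap_mult_left' _ _ assms])
  show "linmap (\<lambda>z. \<Sum>\<alpha>\<in>{\<alpha> \<in> arcs H. tail H \<alpha> = t}. eps \<alpha> *\<^sub>p (z \<star> arr (bar \<alpha>) \<star> arr \<alpha>))"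
    by (intro linmap_sums linmap_scaled linmap_mult_left linmap_id)
  fix q assume "q \<in> PTs t d"
  then have q: "fst q = t" by (simp add: PTs_def)
  have "sg q \<star> rel = (\<Sum>\<alpha>\<in>arcs H. if tail H \<alpha> = t then eps \<alpha> *\<^sub>p (sg q \<star> arr (bar \<alpha>) \<star> arr \<alpha>) else 0)"
    unfolding rel_def linmap_sum[OF linmap_mult_right'] qpath_mult_scale_right
    by (intro sum.cong refl) (auto simp: sg_mult_sg sg_mult_arr qpath_end_Cons q)
  then show "sg q \<star> rel = (\<Sum>\<alpha>\<in>{\<alpha> \<in> arcs H. tail H \<alpha> = t}. eps \<alpha> *\<^sub>p (sg q \<star> arr (bar \<alpha>) \<star> arr \<alpha>))"
    by (simp add: sum.inter_filter)
qed

lemma mult_rel_J: "keys z \<subseteq> PTs t d \<Longrightarrow> z \<star> rel \<in> J"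
  by (rule mult_J_left[OF rel_in_J]) (use PTs_qpaths in blast)

lemma keys_mult_arr_PTs:
  assumes "\<alpha> \<in> arcs H" "keys z \<subseteq> PTs (head H \<alpha>) d"
  shows "keys (z \<star> arr \<alpha>) \<subseteq> PTs (tail H \<alpha>) (d + deg \<alpha>)"
proof (rule keys_in_linmap[OF linmap_R _ assms(2)])
  fix q assume "q \<in> PTs (head H \<alpha>) d"
  from mult_arr_PT[OF PTs_PT[OF this] assms(1)] show "keys (sg q \<star> arr \<alpha>) \<subseteq> PTs (tail H \<alpha>) (d + deg \<alpha>)"
    using PT_PTs by simp
qed

lemma strip_PT:
  assumes "q \<in> PT t (Suc d) v" "\<alpha> \<in> arcs H" "tail H \<alpha> = t"
  shows "keys (strip \<alpha> (sg q)) \<subseteq> PT (head H \<alpha>) (Suc d - deg \<alpha>) v"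
proof (cases "strip \<alpha> (sg q) = 0")
  case False
  then obtain u es where q: "q = (u, \<alpha> # es)"
    by (cases q; cases "snd q") (auto simp: strip_sg split: if_splits)
  have "(head H \<alpha>, es) \<in> PT (head H \<alpha>) (Suc d - deg \<alpha>) v"
    using assms(1) unfolding q PT_def path_class_def by (simp add: H.qpaths_Cons qpath_end_Cons) linarith
  moreover have "strip \<alpha> (sg q) = sg (head H \<alpha>, es)"
    using False by (simp add: q strip_sg split: if_splits)
  ultimately show ?thesis by simp
qed simp

lemma linmap_nf_all:
  assumes "linmap k" "\<And>f. f \<in> J \<Longrightarrow> k f = 0"
  shows "k (nf z) = k z"
  using assms(2)[OF nf_cong_J[of z]] by (simp add: linmap_diff[OF assms(1)])

text \<open>The linear functional on \<open>V\<^sup>t\<^sub>d\<close> with values \<open>f\<close>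
  on the chosen basis. Going through \<open>nf\<close> makes it independent of the representative
  modulo \<open>J\<close>.\<close>

definition basis_functional :: "'v \<Rightarrow> nat \<Rightarrow> (('v, 'e + 'e) qpath \<Rightarrow> 'k) \<Rightarrow> (('v, 'e + 'e) qpath \<Rightarrow>\<^sub>0 'k) \<Rightarrow> 'k" where
  "basis_functional t d f z = (\<Sum>i\<in>IXs t d. lookup (nf z) i * f i)"

lemma basis_functional_linear:
  "basis_functional t d f (x + y) = basis_functional t d f x + basis_functional t d f y" "basis_functional t d f (c *\<^sub>p x) = c * basis_functional t d f x"
  "basis_functional t d f 0 = 0" "basis_functional t d f (nf x) = basis_functional t d f x"
  by (simp_all add: basis_functional_def linmap_add[OF linmap_nf] linmap_scale[OF linmap_nf] linmap_0[OF linmap_nf]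
    lookup_add lookup_scale distrib_right sum.distrib sum_distrib_left mult.assoc)

lemma basis_functional_J: "x \<in> J \<Longrightarrow> basis_functional t d f x = 0"
  by (simp add: basis_functional_def nf_J)

lemma basis_functional_expand:
  assumes "linmap F" "finite S" "keys z \<subseteq> S"
  shows "basis_functional t d f (F z) = (\<Sum>p\<in>S. lookup z p * basis_functional t d f (F (sg p)))"
proof -
  have "basis_functional t d f (\<Sum>p\<in>S. lookup z p *\<^sub>p F (sg p)) = (\<Sum>p\<in>S. lookup z p * basis_functional t d f (F (sg p)))"
    using assms(2) by (induction S rule: finite_induct) (simp_all add: basis_functional_linear)
  then show ?thesis using linmap_expand[OF assms] by simp
qed

lemma basis_functional_zero_on:
  assumes "linmap F" "\<And>p. p \<in> S \<Longrightarrow> basis_functional t d f (F (sg p)) = 0" "keys z \<subseteq> S"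
  shows "basis_functional t d f (F z) = 0"
  by (subst basis_functional_expand[OF assms(1) finite_keys order_refl]) (use assms(2,3) in \<open>auto intro!: sum.neutral\<close>)

text \<open>A path of positive degree is cut after its last starred arrow. The induction needs the
  claim for all products with a further path \<open>p\<close> of \<Gamma>, into which the trailing
  arrows are collected.\<close>

lemma path_decomposition:
  assumes F: "\<And>\<gamma> q p. \<gamma> \<in> arcs G \<Longrightarrow> q \<in> PT t d (head G \<gamma>) \<Longrightarrow> p \<in> (\<Union>v\<in>verts G. PTs v 0) \<Longrightarrow>
      basis_functional t (Suc d) f (sg p \<star> Ls \<gamma> (sg q)) = 0"
    and u: "u \<in> PT t (Suc d) v"
  shows "basis_functional t (Suc d) f (sg u) = 0"
proof -
  have "(fst u, snd u) \<in> PT t (Suc d) v" using u by simp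
  then have "\<forall>p\<in>(\<Union>v\<in>verts G. PTs v 0). basis_functional t (Suc d) f (sg p \<star> sg (fst u, snd u)) = 0"
  proof (induction rule: PT_induct)
    case (Inl u es \<gamma>)
    show ?case
    proof
      fix p assume p: "p \<in> (\<Union>v\<in>verts G. PTs v 0)"
      have eq: "sg p \<star> sg (u, es @ [Inl \<gamma>]) = sg p \<star> arr (Inl \<gamma>) \<star> sg (u, es)"
        using arr_mult_pair[of u es t "Suc d" "Inl \<gamma>"] Inl by (simp add: qpath_mult_assoc)
      show "basis_functional t (Suc d) f (sg p \<star> sg (u, es @ [Inl \<gamma>])) = 0"
      proof (cases "head G \<gamma> = fst p")
        case True
        have "(tail G \<gamma>, Inl \<gamma> # snd p) \<in> PTs (tail G \<gamma>) 0"
          using p True Inl(1) by (cases p) (auto simp: PTs_def H.qpaths_Cons)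
        then have "(tail G \<gamma>, Inl \<gamma> # snd p) \<in> (\<Union>v\<in>verts G. PTs v 0)"
          by (rule UN_I[OF tail_in_verts[OF Inl(1)]])
        from bspec[OF Inl(3) this] show ?thesis using True by (simp add: eq sg_mult_arr)
      next
        case False
        then show ?thesis by (simp add: eq sg_mult_arr basis_functional_linear)
      qed
    qed
  next
    case (Inr u es \<gamma> c)
    then show ?case
      using F[of \<gamma> "(u, es)"] arr_mult_pair[of u es t d "Inr \<gamma>"] by simp
  qed simp
  moreover have v: "v \<in> verts G" using H.qpath_end_verts[of u] u by (auto simp: PT_def path_class_def)
  then have "(v, []) \<in> (\<Union>v\<in>verts G. PTs v 0)" by (auto simp: PTs_def H.qpaths_Nil)
  ultimately have "basis_functional t (Suc d) f (sg (v, []) \<star> sg (fst u, snd u)) = 0" by blast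
  moreover have "sg (v, []) \<star> sg u = sg u"
    using u by (cases u) (auto simp: sg_mult_sg PT_def path_class_def)
  ultimately show ?thesis by simp
qed

text \<open>For \<open>x \<noteq> 0\<close> in \<open>V\<^sup>t\<^sub>d\<close> let \<open>w\<^sub>j\<close> be the coordinates, with respect to the bases of the neighbouring
  modules, of the image of \<open>x\<close> in the middle term of the almost split sequence. Then \<open>V\<^sup>t\<^sub>d\<^sub>+\<^sub>1\<close> is the sum of
  the submodules \<open>V w\<^sub>j\<close>: an irreducible map is injective or surjective.\<close>

definition coord_vec :: "'v \<Rightarrow> (('v, 'e + 'e) qpath \<Rightarrow>\<^sub>0 'k) \<Rightarrow> ('v, 'e + 'e) qpath \<Rightarrow> (('v, 'e + 'e) qpath \<Rightarrow>\<^sub>0 'k)" where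
  "coord_vec t x j = (\<Sum>\<alpha>\<in>{\<alpha> \<in> arcs H. tail H \<alpha> = t}. (lookup (nf (x \<star> arr (bar \<alpha>))) j * eps \<alpha>) *\<^sub>p arr \<alpha>)"

text \<open>The spanning claim in dual form: a functional that kills all the products is zero. If it
  were not, the largest submodule in its kernel would be proper, and the class of the almost split
  sequence would be trivial on it as well as on the neighbouring modules. The two trivialisations
  differ by twisted homomorphisms from the neighbouring modules to \<open>V\<^sup>t\<^sub>d\<close>,
  which are zero; evaluated at the components of \<open>x\<close>, this puts \<open>x\<close> into
  \<open>J\<close>.\<close>

lemma multiplication_spans:
  assumes x: "keys x \<subseteq> PTs t d" "x \<notin> J"
    and f0: "\<And>\<alpha> j q. \<alpha> \<in> arcs H \<Longrightarrow> tail H \<alpha> = t \<Longrightarrow> j \<in> IXs (head H \<alpha>) (Suc d - deg \<alpha>) \<Longrightarrow>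
      q \<in> PTs (head H \<alpha>) (Suc d - deg \<alpha>) \<Longrightarrow> basis_functional t (Suc d) f (sg q \<star> coord_vec t x j) = 0"
    and u0: "u0 \<in> PTs t (Suc d)"
  shows "basis_functional t (Suc d) f (sg u0) = 0"
proof (rule ccontr)
  assume fu0: "basis_functional t (Suc d) f (sg u0) \<noteq> 0"
  let ?O = "{\<alpha> \<in> arcs H. tail H \<alpha> = t}"
  let ?basis_functional = "basis_functional t (Suc d) f"
  \<comment> \<open>If two maps have the same coboundary, their difference \<open>D\<close>
    satisfies \<open>a L D = b D L\<close>, which is the rule for a homomorphism with twist
    a/b.\<close>
  let ?\<sigma> = "\<lambda>\<gamma>. a \<gamma> / b \<gamma>"
  have \<sigma>: "\<gamma> \<in> arcs G \<Longrightarrow> ?\<sigma> \<gamma> \<noteq> 0" for \<gamma> using a_nz b_nz by simp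
  have fO: "finite ?O" by simp
  have degs: "d + deg (bar \<alpha>) = Suc d - deg \<alpha>" "Suc d - deg \<alpha> + deg \<alpha> = Suc d" for \<alpha>
    using deg_le_1[of \<alpha>] by simp_all
  obtain v0 where u0: "u0 \<in> PT t (Suc d) v0" using u0 by (auto simp: PTs_UN)
  \<comment> \<open>Since \<open>f\<close> is not zero, neither is
    \<open>V\<^sup>t\<^sub>d\<^sub>+\<^sub>1\<close>, and it is generated by the products
    \<open>\<gamma>\<^sup>* q\<close>; so one of these has a nonzero coordinate.\<close>
  obtain \<gamma>0 j0 i0 where \<gamma>0: "\<gamma>0 \<in> arcs G" and j0: "j0 \<in> IX t d (head G \<gamma>0)"
    and i0: "lookup (nf (Ls \<gamma>0 (sg j0))) i0 \<noteq> 0"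
  proof -
    have "\<exists>\<gamma>\<in>arcs G. \<exists>j\<in>IX t d (head G \<gamma>). nf (Ls \<gamma> (sg j)) \<noteq> 0"
    proof (rule ccontr)
      assume "\<not> ?thesis"
      then have *: "nf (Ls \<gamma> (sg j)) = 0" if "\<gamma> \<in> arcs G" "j \<in> IX t d (head G \<gamma>)" for \<gamma> j using that by blast
      have "nf (Ls \<gamma> (sg q)) = 0" if \<gamma>: "\<gamma> \<in> arcs G" and q: "q \<in> PT t d (head G \<gamma>)" for \<gamma> q
      proof -
        have "nf (Ls \<gamma> (nf (sg q))) = 0"
          by (rule linmap_eq_on[OF linmap_comp[OF linmap_nf linmap_L] linmap_zero _ keys_nf_sg_IX[OF q]]) (rule *[OF \<gamma>])
        then show ?thesis using nf_arr_nf[of "Inr \<gamma>" "sg q"] \<gamma> by simp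
      qed
      then have "nf (sg u0) = 0 *\<^sub>p nf (sg u0)"
        by (intro hom_eq_if_generators[OF hom_nf _ _ u0]) auto
      then show False using fu0 by (simp add: basis_functional_def)
    qed
    then show thesis using that by (metis poly_mapping_eqI lookup_zero)
  qed
  \<comment> \<open>A cocycle for extensions of \<open>V\<^sup>t\<^sub>d\<^sub>+\<^sub>1\<close> by
    \<open>V\<^sup>t\<^sub>d\<close> with one nonzero matrix entry. Its trace pairing with the
    identity, that is with \<psi> = left multiplication by \<open>\<gamma>\<^sup>*\<close>, is the
    coordinate just found, so it is not a coboundary.\<close>
  define cc where "cc = (\<lambda>\<gamma> z. if \<gamma> = \<gamma>0 then lookup (nf z) i0 *\<^sub>p sg j0 else 0)"
  have cc_lin: "linmap (cc \<gamma>)" for \<gamma>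
    unfolding cc_def by (cases "\<gamma> = \<gamma>0") (simp_all add: linmap_zero linmap_comp[OF linmap_coord linmap_nf])
  have cc_keys: "keys (cc \<gamma> z) \<subseteq> IX t d (head G \<gamma>)" for \<gamma> z
    unfolding cc_def using j0 keys_scale[of "lookup (nf z) i0" "sg j0"] by auto
  have cc_J: "f \<in> J \<Longrightarrow> cc \<gamma> f = 0" for f \<gamma> by (simp add: cc_def nf_J)
  \<comment> \<open>Pulled back along right multiplication by \<alpha>, the cocycle becomes the
    coboundary of some \<open>k\<close>, because there are no nonzero homomorphisms from
    \<open>V\<^sup>t\<^sub>d\<^sub>+\<^sub>1\<close> to the neighbouring module. The factors
    \<open>eps \<alpha>\<close> make these pullbacks add up to \<open>cc \<gamma>\<close> of
    \<open>z \<star> rel\<close>.\<close>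
  have "\<forall>\<alpha>\<in>?O. \<exists>k. linmap k \<and> (\<forall>v z. keys z \<subseteq> PT (head H \<alpha>) (Suc d - deg \<alpha>) v \<longrightarrow> keys (k z) \<subseteq> IX t d v) \<and>
      (\<forall>f\<in>J. k f = 0) \<and> (\<forall>\<gamma>\<in>arcs G. \<forall>z. keys z \<subseteq> PT (head H \<alpha>) (Suc d - deg \<alpha>) (tail G \<gamma>) \<longrightarrow>
        cc \<gamma> (eps \<alpha> *\<^sub>p (z \<star> arr \<alpha>)) = a \<gamma> *\<^sub>p nf (L \<gamma> (k z)) - b \<gamma> *\<^sub>p k (L \<gamma> z))" (is "\<forall>\<alpha>\<in>_. \<exists>k. ?P \<alpha> k")
  proof
    fix \<alpha> assume \<alpha>: "\<alpha> \<in> ?O"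
    show "\<exists>k. ?P \<alpha> k"
    proof (rule ext_vanish[of "{} :: unit set" "head H \<alpha>" "Suc d - deg \<alpha>" t d "\<lambda>_ _. 0" "\<lambda>\<gamma> z. cc \<gamma> (eps \<alpha> *\<^sub>p (z \<star> arr \<alpha>))"], goal_cases)
      case (2 \<psi> \<gamma> j)
      obtain F where F: "hom (\<lambda>_. 1) t (Suc d) (head H \<alpha>) (Suc d - deg \<alpha>) F"
        "\<And>\<gamma> q. \<gamma> \<in> arcs G \<Longrightarrow> q \<in> PT t d (head G \<gamma>) \<Longrightarrow> F (Ls \<gamma> (sg q)) = \<psi> \<gamma> (sg q)"
        using solution_hom[OF 2(1,2,3,4)] by blast
      have *: "F (sg q) = 0" if "q \<in> PT t (Suc d) v" for q v
      proof (cases \<alpha>)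
        case (Inl \<beta>)
        then show ?thesis
          using hom_zero_same_degree[of t "Suc d" "head G \<beta>" F q v] F(1) PT_0_arc[of \<beta>] \<alpha> that by auto
      next
        case (Inr \<beta>)
        then show ?thesis
          using hom_zero_lower_degree[of t d "tail G \<beta>" F q v] F(1) that by simp
      qed
      have "F (Ls \<gamma> (sg j)) = 0"
        using *[OF arr_mult_PT(2)[of j t d "Inr \<gamma>", simplified]] arr_mult_PT(1)[of j t d "Inr \<gamma>"] 2(6) IX_PT[OF 2(7)]
        by simp
      then show ?case using F(2)[OF 2(6) IX_PT[OF 2(7)]] by simp
    next
      case (3 \<gamma>)
      show ?case by (rule linmap_comp[OF cc_lin linmap_scaled[OF linmap_R]])
    next
      case (4 \<gamma> q)
      show ?case by (rule cc_keys)
    next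
      case (5 \<gamma> f)
      then show ?case by (intro cc_J J_scale J_mult_arr) (use \<alpha> in auto)
    next
      case (6 k)
      then show ?case by (intro exI[of _ k]) blast
    qed simp
  qed
  then obtain k where "\<forall>\<alpha>\<in>?O. ?P \<alpha> (k \<alpha>)" by (rule bchoice[THEN exE])
  then have k_lin: "\<And>\<alpha>. \<alpha> \<in> ?O \<Longrightarrow> linmap (k \<alpha>)"
    and k_keys: "\<And>\<alpha> v z. \<alpha> \<in> ?O \<Longrightarrow> keys z \<subseteq> PT (head H \<alpha>) (Suc d - deg \<alpha>) v \<Longrightarrow> keys (k \<alpha> z) \<subseteq> IX t d v"
    and k_J: "\<And>\<alpha> f. \<alpha> \<in> ?O \<Longrightarrow> f \<in> J \<Longrightarrow> k \<alpha> f = 0"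
    and k_eq: "\<And>\<alpha> \<gamma> z. \<alpha> \<in> ?O \<Longrightarrow> \<gamma> \<in> arcs G \<Longrightarrow> keys z \<subseteq> PT (head H \<alpha>) (Suc d - deg \<alpha>) (tail G \<gamma>) \<Longrightarrow>
        cc \<gamma> (eps \<alpha> *\<^sub>p (z \<star> arr \<alpha>)) = a \<gamma> *\<^sub>p nf (L \<gamma> (k \<alpha> z)) - b \<gamma> *\<^sub>p k \<alpha> (L \<gamma> z)"
    by blast+
  \<comment> \<open>The maps \<open>k \<alpha>\<close> after the first map of the sequence. The
    coboundary is \<open>cc\<close> applied to \<open>z \<star> rel\<close>, hence zero, so \<kappa>
    is a twisted endomorphism and therefore a scalar up to reweighting.\<close>
  define \<kappa> where "\<kappa> = (\<lambda>z. \<Sum>\<alpha>\<in>?O. k \<alpha> (z \<star> arr (bar \<alpha>)))"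
  have \<kappa>_lin: "linmap \<kappa>"
    unfolding \<kappa>_def by (intro linmap_sums linmap_comp[OF k_lin linmap_R])
  have zbar: "keys (z \<star> arr (bar \<alpha>)) \<subseteq> PT (head H \<alpha>) (Suc d - deg \<alpha>) v" if "\<alpha> \<in> ?O" "keys z \<subseteq> PT t d v" for \<alpha> z v
    using keys_mult_arr[of "bar \<alpha>" z d v] that degs(1)[of \<alpha>] by simp
  have hom_\<kappa>: "hom ?\<sigma> t d t d \<kappa>"
  proof (rule homI[OF \<kappa>_lin])
    show "keys (\<kappa> (sg q)) \<subseteq> IX t d v" if "q \<in> PT t d v" for v q
      unfolding \<kappa>_def by (intro keys_sum_subset k_keys zbar) (use that in auto)
    show "\<kappa> f = 0" if "f \<in> J" for f
      unfolding \<kappa>_def by (intro sum.neutral ballI k_J J_mult_arr that) auto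
    fix \<gamma> q assume \<gamma>: "\<gamma> \<in> arcs G" and q: "q \<in> PT t d (tail G \<gamma>)"
    have "b \<gamma> *\<^sub>p \<kappa> (L \<gamma> (sg q)) = (\<Sum>\<alpha>\<in>?O. b \<gamma> *\<^sub>p k \<alpha> (L \<gamma> (sg q \<star> arr (bar \<alpha>))))"
      by (simp add: \<kappa>_def pscale_sum qpath_mult_assoc)
    also have "\<dots> = (\<Sum>\<alpha>\<in>?O. a \<gamma> *\<^sub>p nf (L \<gamma> (k \<alpha> (sg q \<star> arr (bar \<alpha>)))) - cc \<gamma> (eps \<alpha> *\<^sub>p (sg q \<star> arr (bar \<alpha>) \<star> arr \<alpha>)))"
      by (intro sum.cong refl) (use k_eq[OF _ \<gamma> zbar] q in simp)
    also have "\<dots> = a \<gamma> *\<^sub>p nf (L \<gamma> (\<kappa> (sg q))) - cc \<gamma> (sg q \<star> rel)"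
      using mult_rel[of "sg q" t d] q PT_PTs
      by (simp add: \<kappa>_def sum_subtractf linmap_sum[OF linmap_L] linmap_sum[OF linmap_nf] pscale_sum linmap_sum[OF cc_lin])
    also have "cc \<gamma> (sg q \<star> rel) = 0"
      by (rule cc_J[OF mult_rel_J]) (use q PT_PTs in simp)
    finally have "b \<gamma> *\<^sub>p \<kappa> (L \<gamma> (sg q)) = a \<gamma> *\<^sub>p nf (L \<gamma> (\<kappa> (sg q)))" by simp
    then have "inverse (b \<gamma>) *\<^sub>p b \<gamma> *\<^sub>p \<kappa> (L \<gamma> (sg q)) = inverse (b \<gamma>) *\<^sub>p a \<gamma> *\<^sub>p nf (L \<gamma> (\<kappa> (sg q)))" by (rule arg_cong)
    then show "\<kappa> (L \<gamma> (sg q)) = ?\<sigma> \<gamma> *\<^sub>p nf (L \<gamma> (\<kappa> (sg q)))"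
      using b_nz[OF \<gamma>] by (simp add: divide_inverse mult.commute)
  qed
  obtain l where l: "\<And>z. keys z \<subseteq> PTs t d \<Longrightarrow> \<kappa> z = l *\<^sub>p nf (WT ?\<sigma> z)"
    using twisted_hom_scalar[OF hom_\<kappa> \<sigma>] by blast
  \<comment> \<open>If \<kappa> vanished, exactness would let the maps \<open>k \<alpha>\<close>
    descend from the middle term to a map \<open>k'\<close> on
    \<open>V\<^sup>t\<^sub>d\<^sub>+\<^sub>1\<close> with coboundary \<open>cc\<close>, against the
    nonzero pairing with the identity.\<close>
  have "l \<noteq> 0"
  proof
    assume "l = 0"
    then have \<kappa>0: "\<kappa> z = 0" if "keys z \<subseteq> PTs t d" for z using l[OF that] by simp
    define k' where "k' = (\<lambda>z. \<Sum>\<alpha>\<in>?O. inverse (eps \<alpha>) *\<^sub>p k \<alpha> (strip \<alpha> z))"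
    have k'_lin: "linmap k'"
      unfolding k'_def by (intro linmap_sums linmap_scaled linmap_comp[OF k_lin linmap_strip])
    have k'_keys: "keys (k' (sg q)) \<subseteq> IX t d v" if "q \<in> PT t (Suc d) v" for q v
      unfolding k'_def
    proof (intro keys_sum_subset keys_scale_subset)
      fix \<alpha> assume \<alpha>: "\<alpha> \<in> ?O"
      then have "keys (strip \<alpha> (sg q)) \<subseteq> PT (head H \<alpha>) (Suc d - deg \<alpha>) v"
        by (intro strip_PT[OF that]) auto
      then show "keys (k \<alpha> (strip \<alpha> (sg q))) \<subseteq> IX t d v" by (rule k_keys[OF \<alpha>])
    qed
    have k'_J: "k' g = 0" if g: "g \<in> J" "keys g \<subseteq> PT t (Suc d) v" for g v
    proof -
      obtain y where y: "keys y \<subseteq> PTs t d"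
        "\<forall>\<alpha>\<in>arcs H. tail H \<alpha> = t \<longrightarrow> strip \<alpha> g - eps \<alpha> *\<^sub>p (y \<star> arr (bar \<alpha>)) \<in> J"
        using J_strip_homogeneous[OF g(1) order_trans[OF g(2) PT_subset_PTs]] by blast
      have "inverse (eps \<alpha>) *\<^sub>p k \<alpha> (strip \<alpha> g) = k \<alpha> (y \<star> arr (bar \<alpha>))" if \<alpha>: "\<alpha> \<in> ?O" for \<alpha>
        using k_J[OF \<alpha>, of "strip \<alpha> g - eps \<alpha> *\<^sub>p (y \<star> arr (bar \<alpha>))"] y(2) \<alpha> eps_nz[of \<alpha>]
        by (simp add: linmap_diff[OF k_lin[OF \<alpha>]] linmap_scale[OF k_lin[OF \<alpha>]])
      then have "k' g = \<kappa> y" by (simp add: k'_def \<kappa>_def)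
      then show ?thesis using \<kappa>0[OF y(1)] by simp
    qed
    have cc_eq: "cc \<gamma> (sg q) = a \<gamma> *\<^sub>p nf (L \<gamma> (k' (sg q))) - b \<gamma> *\<^sub>p k' (L \<gamma> (sg q))"
      if \<gamma>: "\<gamma> \<in> arcs G" and q: "q \<in> PT t (Suc d) (tail G \<gamma>)" for \<gamma> q
    proof -
      have "snd q \<noteq> []" using q by (auto simp: PT_def path_class_def)
      then obtain \<alpha> es where qe: "q = (t, \<alpha> # es)"
        using q by (cases q; cases "snd q") (auto simp: PT_def path_class_def)
      have \<alpha>: "\<alpha> \<in> ?O" using q by (auto simp: qe PT_def path_class_def H.qpaths_Cons)
      have es: "(head H \<alpha>, es) \<in> PT (head H \<alpha>) (Suc d - deg \<alpha>) (tail G \<gamma>)"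
        using q by (auto simp: qe PT_def path_class_def H.qpaths_Cons qpath_end_Cons)
      have Lq: "L \<gamma> (sg q) = sg (t, \<alpha> # es @ [Inl \<gamma>])"
        using arr_mult_PT(1)[of q t "Suc d" "Inl \<gamma>"] q \<gamma> by (simp add: qe)
      have Les: "L \<gamma> (sg (head H \<alpha>, es)) = sg (head H \<alpha>, es @ [Inl \<gamma>])"
        using arr_mult_pair[of "head H \<alpha>" es "head H \<alpha>" "Suc d - deg \<alpha>" "Inl \<gamma>"] es \<gamma> by simp
      have k'1: "k' (sg (t, \<alpha> # es')) = inverse (eps \<alpha>) *\<^sub>p k \<alpha> (sg (head H \<alpha>, es'))" for es'
      proof -
        have "k' (sg (t, \<alpha> # es')) = (\<Sum>\<beta>\<in>?O. if \<beta> = \<alpha> then inverse (eps \<alpha>) *\<^sub>p k \<alpha> (sg (head H \<alpha>, es')) else 0)"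
          unfolding k'_def by (intro sum.cong refl) (use \<alpha> in \<open>auto simp: strip_sg linmap_0[OF k_lin]\<close>)
        then show ?thesis using \<alpha> by simp
      qed
      have "eps \<alpha> *\<^sub>p cc \<gamma> (sg q) = a \<gamma> *\<^sub>p nf (L \<gamma> (k \<alpha> (sg (head H \<alpha>, es)))) - b \<gamma> *\<^sub>p k \<alpha> (L \<gamma> (sg (head H \<alpha>, es)))"
        using k_eq[OF \<alpha> \<gamma>, of "sg (head H \<alpha>, es)"] es \<alpha>
        by (simp add: sg_mult_arr qe linmap_scale[OF cc_lin])
      then have "inverse (eps \<alpha>) *\<^sub>p eps \<alpha> *\<^sub>p cc \<gamma> (sg q) =
        inverse (eps \<alpha>) *\<^sub>p (a \<gamma> *\<^sub>p nf (L \<gamma> (k \<alpha> (sg (head H \<alpha>, es)))) - b \<gamma> *\<^sub>p k \<alpha> (L \<gamma> (sg (head H \<alpha>, es))))"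
        by (rule arg_cong)
      then show ?thesis
        unfolding Lq unfolding Les qe k'1 using \<alpha> eps_nz[of \<alpha>]
        by (simp add: pscale_right_diff linmap_scale[OF linmap_L] linmap_scale[OF linmap_nf] mult.commute)
    qed
    have \<psi>_keys: "keys (nf (Ls \<gamma> (sg q))) \<subseteq> IX t (Suc d) (tail G \<gamma>)" if "\<gamma> \<in> arcs G" "q \<in> PT t d (head G \<gamma>)" for \<gamma> q
      by (intro keys_nf_IX keys_Ls that) (use that in simp)
    have "(\<Sum>\<gamma>\<in>arcs G. \<Sum>j\<in>IX t d (head G \<gamma>).
      lookup (a \<gamma> *\<^sub>p nf (L \<gamma> (k' (nf (Ls \<gamma> (sg j))))) - b \<gamma> *\<^sub>p k' (L \<gamma> (nf (Ls \<gamma> (sg j))))) j) = 0"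
    proof (rule trace_relation[where \<psi> = "\<lambda>\<gamma> z. nf (Ls \<gamma> z)" and r = t and e = "Suc d"])
      show "linmap (\<lambda>z. nf (Ls \<gamma> z))" for \<gamma> by (rule linmap_comp[OF linmap_nf linmap_L])
      show "nf (Ls \<gamma> f) = 0" if "\<gamma> \<in> arcs G" "f \<in> J" for \<gamma> f
        using arr_mult_J[of "Inr \<gamma>" f] that by (simp add: nf_J)
      fix v q assume "q \<in> IX t d v"
      then have q: "q \<in> PT t d v" by (rule IX_PT)
      have "nf (rel \<star> sg q) = 0"
        by (rule nf_J[OF rel_mult_J]) (use q in \<open>simp add: PT_def\<close>)
      then have "(\<Sum>\<gamma>\<in>{\<gamma> \<in> arcs G. tail G \<gamma> = v}. a \<gamma> *\<^sub>p nf (Ls \<gamma> (L \<gamma> (sg q)))) =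
        (\<Sum>\<gamma>\<in>{\<gamma> \<in> arcs G. head G \<gamma> = v}. b \<gamma> *\<^sub>p nf (L \<gamma> (Ls \<gamma> (sg q))))"
        unfolding rel_mult[OF q] by (simp add: linmap_diff[OF linmap_nf] linmap_sum[OF linmap_nf] linmap_scale[OF linmap_nf])
      then show "(\<Sum>\<gamma>\<in>{\<gamma> \<in> arcs G. tail G \<gamma> = v}. a \<gamma> *\<^sub>p nf (Ls \<gamma> (L \<gamma> (sg q)))) =
        (\<Sum>\<gamma>\<in>{\<gamma> \<in> arcs G. head G \<gamma> = v}. b \<gamma> *\<^sub>p nf (L \<gamma> (nf (Ls \<gamma> (sg q)))))"
        using nf_arr_nf[of "Inl _"] by simp
    qed (use k'_lin k'_keys k'_J \<psi>_keys in auto)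
    also have "(\<Sum>\<gamma>\<in>arcs G. \<Sum>j\<in>IX t d (head G \<gamma>).
      lookup (a \<gamma> *\<^sub>p nf (L \<gamma> (k' (nf (Ls \<gamma> (sg j))))) - b \<gamma> *\<^sub>p k' (L \<gamma> (nf (Ls \<gamma> (sg j))))) j) =
      (\<Sum>\<gamma>\<in>arcs G. \<Sum>j\<in>IX t d (head G \<gamma>). lookup (cc \<gamma> (nf (Ls \<gamma> (sg j)))) j)"
    proof (intro sum.cong refl)
      fix \<gamma> j assume \<gamma>: "\<gamma> \<in> arcs G" and j: "j \<in> IX t d (head G \<gamma>)"
      have "cc \<gamma> (nf (Ls \<gamma> (sg j))) = a \<gamma> *\<^sub>p nf (L \<gamma> (k' (nf (Ls \<gamma> (sg j))))) - b \<gamma> *\<^sub>p k' (L \<gamma> (nf (Ls \<gamma> (sg j))))"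
        by (rule linmap_eq_on[OF cc_lin _ cc_eq[OF \<gamma>] keys_IX_PT[OF \<psi>_keys[OF \<gamma> IX_PT[OF j]]]],
            intro linmap_minus linmap_scaled linmap_comp[OF k'_lin linmap_L]
              linmap_comp[OF linmap_comp[OF linmap_nf linmap_L] k'_lin]) assumption
      then show "lookup (a \<gamma> *\<^sub>p nf (L \<gamma> (k' (nf (Ls \<gamma> (sg j))))) - b \<gamma> *\<^sub>p k' (L \<gamma> (nf (Ls \<gamma> (sg j))))) j =
        lookup (cc \<gamma> (nf (Ls \<gamma> (sg j)))) j" by simp
    qed
    also have "\<dots> = (\<Sum>\<gamma>\<in>arcs G. if \<gamma> = \<gamma>0 then \<Sum>j\<in>IX t d (head G \<gamma>0). if j = j0 then lookup (nf (Ls \<gamma>0 (sg j0))) i0 else 0 else 0)"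
    proof (intro sum.cong refl)
      fix \<gamma>
      have "lookup (cc \<gamma>0 (nf (Ls \<gamma>0 (sg j)))) j = (if j = j0 then lookup (nf (Ls \<gamma>0 (sg j0))) i0 else 0)" for j
        by (simp add: cc_def lookup_scale lookup_single when_def)
      then show "(\<Sum>j\<in>IX t d (head G \<gamma>). lookup (cc \<gamma> (nf (Ls \<gamma> (sg j)))) j) =
        (if \<gamma> = \<gamma>0 then \<Sum>j\<in>IX t d (head G \<gamma>0). if j = j0 then lookup (nf (Ls \<gamma>0 (sg j0))) i0 else 0 else 0)"
        by (cases "\<gamma> = \<gamma>0") (simp_all add: cc_def)
    qed
    also have "\<dots> = lookup (nf (Ls \<gamma>0 (sg j0))) i0"
      using \<gamma>0 j0 by simp
    finally show False using i0 by simp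
  qed
  \<comment> \<open>The functionals obtained from \<open>f\<close> by multiplying with paths of
    \<Gamma> first cut out the largest submodule in the kernel of \<open>f\<close>. An endomorphism
    with values there is a scalar \<mu>, and \<mu> \<noteq> 0 would give \<open>f = 0\<close> by
    \<open>path_decomposition\<close>. Hence \<open>cc\<close> is a coboundary on this
    submodule.\<close>
  let ?Z = "\<Union>v\<in>verts G. PTs v 0"
  obtain k2 where k2_lin: "linmap k2" and k2_keys: "\<And>v z. keys z \<subseteq> PT t (Suc d) v \<Longrightarrow> keys (k2 z) \<subseteq> IX t d v"
    and k2_J: "\<And>f. f \<in> J \<Longrightarrow> k2 f = 0"
    and k2_eq: "\<And>\<gamma> z. \<gamma> \<in> arcs G \<Longrightarrow> keys z \<subseteq> PT t (Suc d) (tail G \<gamma>) \<Longrightarrow>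
      (\<And>p. p \<in> ?Z \<Longrightarrow> (\<Sum>i\<in>IX t (Suc d) (tail G \<gamma>). lookup (nf z) i * ?basis_functional (sg p \<star> sg i)) = 0) \<Longrightarrow>
      cc \<gamma> z = a \<gamma> *\<^sub>p nf (L \<gamma> (k2 z)) - b \<gamma> *\<^sub>p k2 (L \<gamma> z)"
  proof (rule ext_vanish[of ?Z t "Suc d" t d "\<lambda>p i. ?basis_functional (sg p \<star> sg i)" cc], goal_cases)
    case (2 \<psi> \<gamma> j)
    obtain F where F: "hom (\<lambda>_. 1) t (Suc d) t (Suc d) F"
      "\<And>\<gamma> q. \<gamma> \<in> arcs G \<Longrightarrow> q \<in> PT t d (head G \<gamma>) \<Longrightarrow> F (Ls \<gamma> (sg q)) = \<psi> \<gamma> (sg q)"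
      using solution_hom[OF 2(2,3,4,5)] by blast
    obtain \<mu> where \<mu>: "\<forall>v. \<forall>q\<in>PT t (Suc d) v. F (sg q) = \<mu> *\<^sub>p nf (sg q)"
      using hom_scalar[OF F(1)] by blast
    have \<psi>_eq: "\<psi> \<gamma> (sg q) = \<mu> *\<^sub>p nf (Ls \<gamma> (sg q))" if "\<gamma> \<in> arcs G" "q \<in> PT t d (head G \<gamma>)" for \<gamma> q
    proof -
      have "F (Ls \<gamma> (sg q)) = \<mu> *\<^sub>p nf (Ls \<gamma> (sg q))"
        using \<mu> arr_mult_PT[of q t d "Inr \<gamma>"] that by simp
      then show ?thesis using F(2)[OF that] by simp
    qed
    have "\<mu> = 0"
    proof (rule ccontr)
      assume \<mu>0: "\<mu> \<noteq> 0"
      have "?basis_functional (sg p \<star> Ls \<gamma> (sg q)) = 0" if \<gamma>: "\<gamma> \<in> arcs G" and q: "q \<in> PT t d (head G \<gamma>)" and p: "p \<in> ?Z" for \<gamma> q p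
      proof -
        have pH: "keys (sg p :: _ \<Rightarrow>\<^sub>0 'k) \<subseteq> qpaths H" using p PTs_qpaths by auto
        have "?basis_functional (sg p \<star> Ls \<gamma> (sg j)) = 0" if j: "j \<in> IX t d (head G \<gamma>)" for j
        proof -
          have "0 = (\<Sum>i\<in>IX t (Suc d) (tail G \<gamma>). lookup (\<psi> \<gamma> (sg j)) i * ?basis_functional (sg p \<star> sg i))"
            by (rule 2(6)[OF p \<gamma> j, symmetric])
          also have "\<dots> = ?basis_functional (sg p \<star> \<psi> \<gamma> (sg j))"
            by (rule basis_functional_expand[OF linmap_mult_right' finite_IX 2(3), symmetric])
          also have "\<dots> = \<mu> * ?basis_functional (sg p \<star> nf (Ls \<gamma> (sg j)))"
            by (simp add: \<psi>_eq[OF \<gamma> IX_PT[OF j]] qpath_mult_scale_right basis_functional_linear)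
          also have "?basis_functional (sg p \<star> nf (Ls \<gamma> (sg j))) = ?basis_functional (sg p \<star> Ls \<gamma> (sg j))"
            using mult_J_left[OF nf_cong_J pH, of "Ls \<gamma> (sg j)"] basis_functional_linear(1)[of t "Suc d" f "sg p \<star> nf (Ls \<gamma> (sg j))" "sg p \<star> (Ls \<gamma> (sg j) - nf (Ls \<gamma> (sg j)))"]
              basis_functional_J[of "sg p \<star> (Ls \<gamma> (sg j) - nf (Ls \<gamma> (sg j)))" t "Suc d" f]
            by (simp add: linmap_diff[OF linmap_mult_right'])
          finally show ?thesis using \<mu>0 by simp
        qed
        then have "?basis_functional (sg p \<star> Ls \<gamma> (nf (sg q))) = 0"
          by (intro basis_functional_zero_on[OF linmap_comp[OF linmap_mult_right' linmap_L] _ keys_nf_sg_IX[OF q]])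
        moreover have "sg p \<star> Ls \<gamma> (sg q - nf (sg q)) \<in> J"
          by (intro mult_J_left[OF _ pH] arr_mult_J nf_cong_J) (use \<gamma> in simp)
        ultimately show ?thesis
          using basis_functional_linear(1)[of t "Suc d" f "sg p \<star> Ls \<gamma> (nf (sg q))" "sg p \<star> Ls \<gamma> (sg q - nf (sg q))"]
            basis_functional_J[of "sg p \<star> Ls \<gamma> (sg q - nf (sg q))" t "Suc d" f]
          by (simp add: linmap_diff[OF linmap_L] linmap_diff[OF linmap_mult_right'])
      qed
      then show False using path_decomposition[OF _ u0] fu0 by blast
    qed
    then show ?case using \<psi>_eq[OF 2(7) IX_PT[OF 2(8)]] by simp
  next
    case (6 k)
    show ?case by (rule 6(1)[OF 6(2,3,4,5)])
  qed (use cc_lin cc_keys cc_J in auto)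
  define co where "co = (\<lambda>\<alpha> j. lookup (nf (x \<star> arr (bar \<alpha>))) j)"
  have xbar: "keys (x \<star> arr (bar \<alpha>)) \<subseteq> PTs (head H \<alpha>) (Suc d - deg \<alpha>)" if "\<alpha> \<in> ?O" for \<alpha>
    using keys_mult_arr_PTs[of "bar \<alpha>" x d] x(1) that degs(1)[of \<alpha>] by simp
  have co_IX: "j \<in> IXs (head H \<alpha>) (Suc d - deg \<alpha>)" if "\<alpha> \<in> ?O" "co \<alpha> j \<noteq> 0" for \<alpha> j
    using keys_nf_IXs[OF xbar[OF that(1)]] that(2) by (auto simp: co_def in_keys_iff)
  \<comment> \<open>Both terms have as coboundary the pullback of \<open>cc\<close> along right
    multiplication by \<open>coord_vec t x j\<close>: the first by the choice of \<open>k\<close>,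
    the second because \<open>f0\<close> places the products in the submodule on which
    \<open>k2\<close> was found. So the difference is a twisted homomorphism to
    \<open>V\<^sup>t\<^sub>d\<close>.\<close>
  define \<kappa>j where "\<kappa>j = (\<lambda>j z. (\<Sum>\<alpha>\<in>?O. co \<alpha> j *\<^sub>p k \<alpha> z) - k2 (z \<star> coord_vec t x j))"
  have coord_vec: "z \<star> coord_vec t x j = (\<Sum>\<alpha>\<in>?O. co \<alpha> j *\<^sub>p eps \<alpha> *\<^sub>p (z \<star> arr \<alpha>))" for z j
    by (simp add: coord_vec_def co_def linmap_sum[OF linmap_mult_right'] qpath_mult_scale_right)
  have \<kappa>j0: "\<kappa>j j (sg j) = 0" if \<beta>: "\<beta> \<in> ?O" "co \<beta> j \<noteq> 0" for \<beta> j
  proof -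
    let ?r = "head H \<beta>" and ?e = "Suc d - deg \<beta>"
    have j: "j \<in> IXs ?r ?e" by (rule co_IX[OF \<beta>])
    \<comment> \<open>A basis path determines its start and its degree. So all arrows that
      contribute to \<open>coord_vec t x j\<close> lead to one neighbouring module; parallel arrows
      may contribute together.\<close>
    have same: "head H \<alpha> = ?r \<and> Suc d - deg \<alpha> = ?e" if "\<alpha> \<in> ?O" "co \<alpha> j \<noteq> 0" for \<alpha>
      using co_IX[OF that] j IX_unique unfolding IXs_iff by blast
    have zw: "keys (z \<star> coord_vec t x j) \<subseteq> PT t (Suc d) v" if z: "keys z \<subseteq> PT ?r ?e v" for z v
      unfolding coord_vec
    proof (rule keys_sum_subset)
      fix \<alpha> assume \<alpha>: "\<alpha> \<in> ?O"
      show "keys (co \<alpha> j *\<^sub>p eps \<alpha> *\<^sub>p (z \<star> arr \<alpha>)) \<subseteq> PT t (Suc d) v"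
      proof (cases "co \<alpha> j = 0")
        case False
        have "keys (z \<star> arr \<alpha>) \<subseteq> PT (tail H \<alpha>) (?e + deg \<alpha>) v"
          by (rule keys_mult_arr) (use \<alpha> z same[OF \<alpha> False] in auto)
        then show ?thesis
          using \<alpha> same[OF \<alpha> False] degs(2)[of \<alpha>] by (intro keys_scale_subset) simp
      qed simp
    qed
    have \<kappa>j_lin: "linmap (\<kappa>j j)"
      unfolding \<kappa>j_def
      by (intro linmap_minus linmap_sums linmap_scaled k_lin linmap_comp[OF k2_lin linmap_mult_left'])
    have "hom ?\<sigma> ?r ?e t d (\<kappa>j j)"
    proof (rule homI[OF \<kappa>j_lin])
      fix v q assume q: "q \<in> PT ?r ?e v"
      have "keys (co \<alpha> j *\<^sub>p k \<alpha> (sg q)) \<subseteq> IX t d v" if \<alpha>: "\<alpha> \<in> ?O" for \<alpha>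
      proof (cases "co \<alpha> j = 0")
        case False
        show ?thesis
          by (intro keys_scale_subset k_keys[OF \<alpha>]) (use q same[OF \<alpha> False] in simp)
      qed simp
      then show "keys (\<kappa>j j (sg q)) \<subseteq> IX t d v"
        unfolding \<kappa>j_def by (intro keys_diff_subset keys_sum_subset k2_keys zw) (use q in auto)
    next
      fix v g assume g: "g \<in> J"
      have "g \<star> coord_vec t x j \<in> J"
        unfolding coord_vec by (intro J_sum J_scale J_mult_arr g) auto
      then show "\<kappa>j j g = 0" using g by (simp add: \<kappa>j_def k2_J k_J)
    next
      fix \<gamma> q assume \<gamma>: "\<gamma> \<in> arcs G" and q: "q \<in> PT ?r ?e (tail G \<gamma>)"
      have k1: "b \<gamma> *\<^sub>p co \<alpha> j *\<^sub>p k \<alpha> (L \<gamma> (sg q)) = a \<gamma> *\<^sub>p co \<alpha> j *\<^sub>p nf (L \<gamma> (k \<alpha> (sg q))) - cc \<gamma> (co \<alpha> j *\<^sub>p eps \<alpha> *\<^sub>p (sg q \<star> arr \<alpha>))"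
        if \<alpha>: "\<alpha> \<in> ?O" for \<alpha>
      proof (cases "co \<alpha> j = 0")
        case False
        have "co \<alpha> j *\<^sub>p cc \<gamma> (eps \<alpha> *\<^sub>p (sg q \<star> arr \<alpha>)) = co \<alpha> j *\<^sub>p (a \<gamma> *\<^sub>p nf (L \<gamma> (k \<alpha> (sg q))) - b \<gamma> *\<^sub>p k \<alpha> (L \<gamma> (sg q)))"
          by (subst k_eq[OF \<alpha> \<gamma>]) (use q same[OF \<alpha> False] in simp_all)
        then show ?thesis
          unfolding linmap_scale[OF cc_lin, of \<gamma> "co \<alpha> j"] by (simp add: pscale_right_diff mult.commute)
      qed (simp add: linmap_0[OF cc_lin])
      have k2: "b \<gamma> *\<^sub>p k2 (L \<gamma> (sg q) \<star> coord_vec t x j) = a \<gamma> *\<^sub>p nf (L \<gamma> (k2 (sg q \<star> coord_vec t x j))) - cc \<gamma> (sg q \<star> coord_vec t x j)"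
      proof -
        have zq: "keys (sg q \<star> coord_vec t x j) \<subseteq> PT t (Suc d) (tail G \<gamma>)"
          by (rule zw) (use q in simp)
        have "cc \<gamma> (sg q \<star> coord_vec t x j) = a \<gamma> *\<^sub>p nf (L \<gamma> (k2 (sg q \<star> coord_vec t x j))) - b \<gamma> *\<^sub>p k2 (L \<gamma> (sg q \<star> coord_vec t x j))"
        proof (rule k2_eq[OF \<gamma> zq])
          fix p assume p: "p \<in> ?Z"
          have pH: "keys (sg p :: _ \<Rightarrow>\<^sub>0 'k) \<subseteq> qpaths H" using p PTs_qpaths by auto
          have "(\<Sum>i\<in>IX t (Suc d) (tail G \<gamma>). lookup (nf (sg q \<star> coord_vec t x j)) i * ?basis_functional (sg p \<star> sg i)) =
            ?basis_functional (sg p \<star> nf (sg q \<star> coord_vec t x j))"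
            by (rule basis_functional_expand[OF linmap_mult_right' finite_IX keys_nf_IX[OF zq], symmetric])
          also have "\<dots> = ?basis_functional (sg p \<star> (sg q \<star> coord_vec t x j))"
            using mult_J_left[OF nf_cong_J pH, of "sg q \<star> coord_vec t x j"]
              basis_functional_linear(1)[of t "Suc d" f "sg p \<star> nf (sg q \<star> coord_vec t x j)" "sg p \<star> (sg q \<star> coord_vec t x j - nf (sg q \<star> coord_vec t x j))"]
              basis_functional_J[of "sg p \<star> (sg q \<star> coord_vec t x j - nf (sg q \<star> coord_vec t x j))" t "Suc d" f]
            by (simp add: linmap_diff[OF linmap_mult_right'])
          also have "\<dots> = ?basis_functional ((sg p \<star> sg q) \<star> coord_vec t x j)"
            by (simp add: qpath_mult_assoc)
          also have "\<dots> = 0"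
          proof (cases "pend q = fst p")
            case True
            have "(fst q, snd q @ snd p) \<in> PTs ?r ?e"
              using qpaths_comp[of p q] p q True by (auto simp: PTs_def PT_def path_class_def)
            then show ?thesis
              using f0[of \<beta> j "(fst q, snd q @ snd p)"] \<beta> j True by (simp add: sg_mult_sg)
          qed (simp add: sg_mult_sg basis_functional_linear)
          finally show "(\<Sum>i\<in>IX t (Suc d) (tail G \<gamma>). lookup (nf (sg q \<star> coord_vec t x j)) i * ?basis_functional (sg p \<star> sg i)) = 0" .
        qed
        then show ?thesis by (simp add: qpath_mult_assoc)
      qed
      have "b \<gamma> *\<^sub>p \<kappa>j j (L \<gamma> (sg q)) = (\<Sum>\<alpha>\<in>?O. b \<gamma> *\<^sub>p co \<alpha> j *\<^sub>p k \<alpha> (L \<gamma> (sg q))) - b \<gamma> *\<^sub>p k2 (L \<gamma> (sg q) \<star> coord_vec t x j)"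
        by (simp only: \<kappa>j_def pscale_right_diff pscale_sum)
      also have "\<dots> = (\<Sum>\<alpha>\<in>?O. a \<gamma> *\<^sub>p co \<alpha> j *\<^sub>p nf (L \<gamma> (k \<alpha> (sg q)))) - cc \<gamma> (\<Sum>\<alpha>\<in>?O. co \<alpha> j *\<^sub>p eps \<alpha> *\<^sub>p (sg q \<star> arr \<alpha>)) -
          (a \<gamma> *\<^sub>p nf (L \<gamma> (k2 (sg q \<star> coord_vec t x j))) - cc \<gamma> (sg q \<star> coord_vec t x j))"
        unfolding k2 linmap_sum[OF cc_lin] sum_subtractf[symmetric] using k1 by simp
      also have "\<dots> = a \<gamma> *\<^sub>p nf (L \<gamma> (\<kappa>j j (sg q)))"
        unfolding coord_vec[symmetric] \<kappa>j_def linmap_diff[OF linmap_L] linmap_diff[OF linmap_nf] linmap_sum[OF linmap_L]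
          linmap_sum[OF linmap_nf] linmap_scale[OF linmap_L] linmap_scale[OF linmap_nf] pscale_right_diff pscale_sum
        by simp
      finally have "inverse (b \<gamma>) *\<^sub>p b \<gamma> *\<^sub>p \<kappa>j j (L \<gamma> (sg q)) = inverse (b \<gamma>) *\<^sub>p a \<gamma> *\<^sub>p nf (L \<gamma> (\<kappa>j j (sg q)))"
        by (rule arg_cong)
      then show "\<kappa>j j (L \<gamma> (sg q)) = ?\<sigma> \<gamma> *\<^sub>p nf (L \<gamma> (\<kappa>j j (sg q)))"
        using b_nz[OF \<gamma>] by (simp add: divide_inverse mult.commute)
    qed
    then show ?thesis
    proof (rule twisted_hom_zero[OF _ \<sigma>])
      show "j \<in> PT ?r ?e (pend j)" using j by (simp add: IXs_iff IX_PT)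
      show "?e = d \<and> PT t 0 ?r = {} \<or> ?e = Suc d"
        using \<beta>(1) PT_0_arc by (cases \<beta>) auto
    qed
  qed
  let ?JJ = "\<Union>\<alpha>\<in>?O. keys (nf (x \<star> arr (bar \<alpha>)))"
  have fJJ: "finite ?JJ" by simp
  have coJ: "nf (x \<star> arr (bar \<alpha>)) = (\<Sum>j\<in>?JJ. co \<alpha> j *\<^sub>p sg j)" if "\<alpha> \<in> ?O" for \<alpha>
    unfolding co_def by (rule sum_sg_superset[OF fJJ]) (use that in blast)
  \<comment> \<open>Summation over \<open>j\<close> puts the components of \<open>x\<close> together
    again: the first terms add up to \<open>\<kappa> x\<close>, and the arguments of
    \<open>k2\<close> to \<open>x \<star> rel\<close> modulo \<open>J\<close>.\<close>
  have "0 = (\<Sum>j\<in>?JJ. \<kappa>j j (sg j))"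
    by (rule sum.neutral[symmetric]) (use \<kappa>j0 in \<open>auto simp: co_def in_keys_iff\<close>)
  also have "\<dots> = (\<Sum>j\<in>?JJ. \<Sum>\<alpha>\<in>?O. co \<alpha> j *\<^sub>p k \<alpha> (sg j)) - k2 (\<Sum>j\<in>?JJ. \<Sum>\<alpha>\<in>?O. co \<alpha> j *\<^sub>p eps \<alpha> *\<^sub>p (sg j \<star> arr \<alpha>))"
    by (simp only: \<kappa>j_def sum_subtractf linmap_sum[OF k2_lin, symmetric] coord_vec)
  also have "(\<Sum>j\<in>?JJ. \<Sum>\<alpha>\<in>?O. co \<alpha> j *\<^sub>p k \<alpha> (sg j)) = \<kappa> x"
  proof -
    have "(\<Sum>j\<in>?JJ. \<Sum>\<alpha>\<in>?O. co \<alpha> j *\<^sub>p k \<alpha> (sg j)) = (\<Sum>\<alpha>\<in>?O. \<Sum>j\<in>?JJ. co \<alpha> j *\<^sub>p k \<alpha> (sg j))"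
      by (rule sum.swap)
    also have "\<dots> = (\<Sum>\<alpha>\<in>?O. k \<alpha> (x \<star> arr (bar \<alpha>)))"
    proof (rule sum.cong[OF refl])
      fix \<alpha> assume \<alpha>: "\<alpha> \<in> ?O"
      have "(\<Sum>j\<in>?JJ. co \<alpha> j *\<^sub>p k \<alpha> (sg j)) = k \<alpha> (\<Sum>j\<in>?JJ. co \<alpha> j *\<^sub>p sg j)"
        by (simp only: linmap_sum[OF k_lin[OF \<alpha>]] linmap_scale[OF k_lin[OF \<alpha>]])
      also have "\<dots> = k \<alpha> (nf (x \<star> arr (bar \<alpha>)))" by (rule arg_cong[OF coJ[OF \<alpha>, symmetric]])
      also have "\<dots> = k \<alpha> (x \<star> arr (bar \<alpha>))" by (rule linmap_nf_all[OF k_lin[OF \<alpha>] k_J[OF \<alpha>]])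
      finally show "(\<Sum>j\<in>?JJ. co \<alpha> j *\<^sub>p k \<alpha> (sg j)) = k \<alpha> (x \<star> arr (bar \<alpha>))" .
    qed
    finally show ?thesis by (simp only: \<kappa>_def)
  qed
  also have "k2 (\<Sum>j\<in>?JJ. \<Sum>\<alpha>\<in>?O. co \<alpha> j *\<^sub>p eps \<alpha> *\<^sub>p (sg j \<star> arr \<alpha>)) = 0"
  proof (rule k2_J)
    have "(\<Sum>j\<in>?JJ. \<Sum>\<alpha>\<in>?O. co \<alpha> j *\<^sub>p eps \<alpha> *\<^sub>p (sg j \<star> arr \<alpha>)) = (\<Sum>\<alpha>\<in>?O. \<Sum>j\<in>?JJ. co \<alpha> j *\<^sub>p eps \<alpha> *\<^sub>p (sg j \<star> arr \<alpha>))"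
      by (rule sum.swap)
    also have "\<dots> = (\<Sum>\<alpha>\<in>?O. eps \<alpha> *\<^sub>p ((\<Sum>j\<in>?JJ. co \<alpha> j *\<^sub>p sg j) \<star> arr \<alpha>))"
      by (simp add: linmap_sum[OF linmap_R] qpath_mult_scale_left pscale_sum mult.commute)
    also have "\<dots> = (\<Sum>\<alpha>\<in>?O. eps \<alpha> *\<^sub>p (nf (x \<star> arr (bar \<alpha>)) \<star> arr \<alpha>))"
    proof (intro sum.cong refl)
      fix \<alpha> assume \<alpha>: "\<alpha> \<in> ?O"
      show "eps \<alpha> *\<^sub>p ((\<Sum>j\<in>?JJ. co \<alpha> j *\<^sub>p sg j) \<star> arr \<alpha>) = eps \<alpha> *\<^sub>p (nf (x \<star> arr (bar \<alpha>)) \<star> arr \<alpha>)"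
        by (rule arg_cong[OF coJ[OF \<alpha>, symmetric]])
    qed
    also have "\<dots> = x \<star> rel - (\<Sum>\<alpha>\<in>?O. eps \<alpha> *\<^sub>p ((x \<star> arr (bar \<alpha>) - nf (x \<star> arr (bar \<alpha>))) \<star> arr \<alpha>))"
      unfolding mult_rel[OF x(1)] by (simp add: linmap_diff[OF linmap_R] pscale_right_diff sum_subtractf)
    also have "\<dots> \<in> J"
      by (intro J_diff mult_rel_J[OF x(1)] J_sum J_scale J_mult_arr nf_cong_J) auto
    finally show "(\<Sum>j\<in>?JJ. \<Sum>\<alpha>\<in>?O. co \<alpha> j *\<^sub>p eps \<alpha> *\<^sub>p (sg j \<star> arr \<alpha>)) \<in> J" .
  qed
  finally have "l *\<^sub>p nf (WT ?\<sigma> x) = 0" using l[OF x(1)] by simp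
  then have "inverse l *\<^sub>p l *\<^sub>p nf (WT ?\<sigma> x) = 0" by simp
  then have "WT ?\<sigma> x \<in> J" using \<open>l \<noteq> 0\<close> by (simp add: nf_eq_0_iff)
  then have "x \<in> J"
    by (rule WT_J_iff[OF \<sigma>, rotated 2]) (use x(1) PTs_qpaths in auto)
  then show False using x(2) by simp
qed

end

text \<open>Gaussian elimination, one row at a time: a pivot \<open>A r i0\<close> removes the
  unknown \<open>i0\<close> from the remaining rows and afterwards determines its value.\<close>

lemma homogeneous_solution:
  fixes A :: "'r \<Rightarrow> 'i \<Rightarrow> 'k::field"
  assumes "finite R" "finite I" "card R < card I"
  shows "\<exists>x. (\<exists>i\<in>I. x i \<noteq> 0) \<and> (\<forall>r\<in>R. (\<Sum>i\<in>I. A r i * x i) = 0)"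
  using assms
proof (induction R arbitrary: I A rule: finite_induct)
  case empty
  then obtain i where "i \<in> I" by fastforce
  then show ?case by (intro exI[of _ "\<lambda>_. 1"]) auto
next
  case (insert r R)
  show ?case
  proof (cases "\<forall>i\<in>I. A r i = 0")
    case True
    then show ?thesis using insert.IH[of I A] insert.prems insert.hyps by auto
  next
    case False
    then obtain i0 where i0: "i0 \<in> I" "A r i0 \<noteq> 0" by blast
    define I' where "I' = I - {i0}"
    have I': "finite I'" "card R < card I'" "i0 \<notin> I'" and I: "I = insert i0 I'"
      using insert.prems insert.hyps i0 by (auto simp: I'_def)
    obtain x where x: "\<exists>i\<in>I'. x i \<noteq> 0"
      "\<forall>s\<in>R. (\<Sum>i\<in>I'. (A s i - A s i0 / A r i0 * A r i) * x i) = 0"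
      using insert.IH[OF I'(1,2), of "\<lambda>s i. A s i - A s i0 / A r i0 * A r i"] by auto
    define y where "y = x(i0 := - (\<Sum>i\<in>I'. A r i * x i) / A r i0)"
    have sum_y: "(\<Sum>i\<in>I. A s i * y i) = (\<Sum>i\<in>I'. A s i * x i) - A s i0 / A r i0 * (\<Sum>i\<in>I'. A r i * x i)" for s
    proof -
      have "(\<Sum>i\<in>I'. A s i * y i) = (\<Sum>i\<in>I'. A s i * x i)"
        by (intro sum.cong refl) (use I'(3) in \<open>auto simp: y_def\<close>)
      then show ?thesis using I' by (simp add: I y_def)
    qed
    have "(\<Sum>i\<in>I. A s i * y i) = 0" if "s \<in> insert r R" for s
    proof (cases "s = r")
      case False
      then have "(\<Sum>i\<in>I'. (A s i - A s i0 / A r i0 * A r i) * x i) = 0" using x(2) that by blast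
      then show ?thesis unfolding sum_y by (simp add: left_diff_distrib sum_subtractf sum_distrib_left mult.assoc)
    qed (use i0 in \<open>simp add: sum_y\<close>)
    moreover have "\<exists>i\<in>I. y i \<noteq> 0" using x(1) I'(3) by (auto simp: I y_def)
    ultimately show ?thesis by blast
  qed
qed

subsection \<open>Families of vectors of generic rank\<close>

text \<open>Formulated for families, so that equal vectors at different indices count as dependent,
  unlike with a predicate on sets of vectors.\<close>

definition indep :: "'i set \<Rightarrow> 'r set \<Rightarrow> ('r \<Rightarrow> 'i \<Rightarrow> 'k::field) \<Rightarrow> bool" where
  "indep I R v \<longleftrightarrow> (\<forall>s. (\<forall>i\<in>I. (\<Sum>r\<in>R. s r * v r i) = 0) \<longrightarrow> (\<forall>r\<in>R. s r = 0))"

lemma indepD: "indep I R v \<Longrightarrow> (\<And>i. i \<in> I \<Longrightarrow> (\<Sum>r\<in>R. s r * v r i) = 0) \<Longrightarrow> r \<in> R \<Longrightarrow> s r = 0"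
  unfolding indep_def by blast

lemma poly_det:
  assumes "M \<in> carrier_mat n n"
  shows "poly (det M) (t :: 'k::comm_ring_1) = det (map_mat (\<lambda>p. poly p t) M)"
proof -
  interpret comm_ring_hom "\<lambda>p. poly p t"
    by unfold_locales auto
  show ?thesis by simp
qed

text \<open>Independence of \<open>p\<close> yields dual vectors \<open>X\<close>. The matrix of
  products of \<open>X\<close> with the family at \<open>t\<close> has a determinant that is
  polynomial in \<open>t\<close> and equal to 1 at \<open>t = 0\<close>; dependence is possible only
  at its finitely many roots.\<close>

lemma indep_line:
  fixes p q :: "'r \<Rightarrow> 'i \<Rightarrow> 'k::field"
  assumes "finite R" "finite I" "indep I R p"
  shows "finite {t. \<not> indep I R (\<lambda>r i. p r i + t * q r i)}"
proof -
  have "\<exists>x. \<forall>r\<in>R. (\<Sum>i\<in>I. x i * p r i) = (if r = r0 then 1 else 0)" if "r0 \<in> R" for r0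
  proof (rule fredholm_solvable[OF assms(1,2)])
    fix y assume "\<And>i. i \<in> I \<Longrightarrow> (\<Sum>r\<in>R. p r i * y r) = 0"
    then have "y r = 0" if "r \<in> R" for r
      using indepD[OF assms(3), of y r] that by (simp add: mult.commute)
    then show "(\<Sum>r\<in>R. (if r = r0 then 1 else 0) * y r) = 0" by simp
  qed
  then obtain X where X: "\<And>r0 r. r0 \<in> R \<Longrightarrow> r \<in> R \<Longrightarrow> (\<Sum>i\<in>I. X r0 i * p r i) = (if r = r0 then 1 else 0)"
    by metis
  obtain e where e: "bij_betw e {0..<card R} R" using ex_bij_betw_nat_finite[OF assms(1)] by blast
  have eR: "e j \<in> R" if "j < card R" for j using bij_betwE[OF e] that by simp
  have e_inj: "e i = e j \<longleftrightarrow> i = j" if "i < card R" "j < card R" for i j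
    using e that unfolding bij_betw_def inj_on_def by auto
  define M where "M = mat (card R) (card R) (\<lambda>(i, j). [:\<Sum>k\<in>I. X (e i) k * p (e j) k, \<Sum>k\<in>I. X (e i) k * q (e j) k:])"
  have M: "M \<in> carrier_mat (card R) (card R)" by (simp add: M_def)
  have "map_mat (\<lambda>p. poly p 0) M = 1\<^sub>m (card R)"
    by (intro eq_matI) (auto simp: M_def X eR e_inj)
  then have "poly (det M) 0 = 1" using poly_det[OF M, of 0] by simp
  then have "det M \<noteq> 0" by auto
  then have "finite {t. poly (det M) t = 0}" by (rule poly_roots_finite)
  moreover have "indep I R (\<lambda>r i. p r i + t * q r i)" if t: "poly (det M) t \<noteq> 0" for t
    unfolding indep_def
  proof (intro allI impI)
    fix s assume s: "\<forall>i\<in>I. (\<Sum>r\<in>R. s r * (p r i + t * q r i)) = 0"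
    let ?Mt = "map_mat (\<lambda>p. poly p t) M" and ?v = "vec (card R) (\<lambda>j. s (e j))"
    have "?Mt *\<^sub>v ?v = 0\<^sub>v (card R)"
    proof (rule eq_vecI)
      fix i assume "i < dim_vec (0\<^sub>v (card R))"
      then have i: "i < card R" by simp
      have "(?Mt *\<^sub>v ?v) $ i = (\<Sum>j\<in>{0..<card R}. (\<Sum>k\<in>I. X (e i) k * (p (e j) k + t * q (e j) k)) * s (e j))"
        using i by (simp add: M_def scalar_prod_def distrib_left sum.distrib sum_distrib_left mult.left_commute)
      also have "\<dots> = (\<Sum>r\<in>R. (\<Sum>k\<in>I. X (e i) k * (p r k + t * q r k)) * s r)"
        by (rule sum.reindex_bij_betw[OF e])
      also have "\<dots> = (\<Sum>r\<in>R. \<Sum>k\<in>I. X (e i) k * (s r * (p r k + t * q r k)))"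
        by (simp add: sum_distrib_left sum_distrib_right mult_ac)
      also have "\<dots> = (\<Sum>k\<in>I. X (e i) k * (\<Sum>r\<in>R. s r * (p r k + t * q r k)))"
        by (subst sum.swap) (simp add: sum_distrib_left)
      also have "\<dots> = 0" using s by simp
      finally show "(?Mt *\<^sub>v ?v) $ i = 0\<^sub>v (card R) $ i" using i by simp
    qed (simp add: M_def)
    moreover have "?Mt \<in> carrier_mat (card R) (card R)" using M by simp
    moreover have "det ?Mt \<noteq> 0" using t poly_det[OF M] by simp
    ultimately have v0: "?v = 0\<^sub>v (card R)"
      using det_0_iff_vec_prod_zero_field by (metis vec_carrier)
    have se: "s (e j) = 0" if "j < card R" for j
    proof -
      have "s (e j) = ?v $ j" using that by simp
      also have "\<dots> = 0" unfolding v0 using that by simp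
      finally show ?thesis .
    qed
    show "\<forall>r\<in>R. s r = 0"
    proof
      fix r assume "r \<in> R"
      then obtain j where "j < card R" "r = e j"
        using bij_betw_imp_surj_on[OF e] by fastforce
      then show "s r = 0" using se by simp
    qed
  qed
  ultimately show ?thesis by (elim finite_subset[rotated]) blast
qed

text \<open>Where the rank of a linear family of matrices is maximal, all matrices of the family map the kernel
  into the image; \<open>sep\<close> excludes this for a proper image.\<close>

lemma full_rank_exists:
  fixes col :: "'z \<Rightarrow> 'c \<Rightarrow> 'i \<Rightarrow> 'k::field"
  assumes inf: "infinite (UNIV :: 'k set)" and fin: "finite C" "finite I" and card: "card C = card I"
    and z0: "z0 \<in> B" and BT: "B \<subseteq> T"
    and col_line: "\<And>z z' t c i. z \<in> B \<Longrightarrow> z' \<in> T \<Longrightarrow> c \<in> C \<Longrightarrow> i \<in> I \<Longrightarrow>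
      col (line z z' t) c i = col z c i + t * col z' c i"
    and B_line: "\<And>z z'. z \<in> B \<Longrightarrow> z' \<in> T \<Longrightarrow> finite {t. line z z' t \<notin> B}"
    and sep: "\<And>z s \<phi> i. z \<in> B \<Longrightarrow> \<exists>c\<in>C. s c \<noteq> 0 \<Longrightarrow> (\<And>i. i \<in> I \<Longrightarrow> (\<Sum>c\<in>C. s c * col z c i) = 0) \<Longrightarrow>
      (\<And>z'. z' \<in> T \<Longrightarrow> (\<Sum>i\<in>I. \<phi> i * (\<Sum>c\<in>C. s c * col z' c i)) = 0) \<Longrightarrow> i \<in> I \<Longrightarrow> \<phi> i = 0"
  shows "\<exists>z\<in>B. indep I C (col z)"
proof (rule ccontr)
  assume no: "\<not> ?thesis"
  define Q where "Q = (\<lambda>n. \<exists>z\<in>B. \<exists>R\<subseteq>C. card R = n \<and> indep I R (col z))"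
  have "Q 0" unfolding Q_def using z0 by (intro bexI[of _ z0] exI[of _ "{}"]) (auto simp: indep_def)
  moreover have bound: "\<forall>n. Q n \<longrightarrow> n \<le> card C" using card_mono[OF fin(1)] by (auto simp: Q_def)
  ultimately obtain n where n: "Q n" "\<forall>m. Q m \<longrightarrow> m \<le> n"
    using Nat.ex_has_greatest_nat[of Q 0 "card C"] by auto
  then obtain z R where z: "z \<in> B" and R: "R \<subseteq> C" "card R = n" "indep I R (col z)"
    unfolding Q_def by blast
  have fR: "finite R" using R(1) fin(1) finite_subset by blast
  have "R \<noteq> C" using no z R by blast
  then obtain c0 where c0: "c0 \<in> C" "c0 \<notin> R" using R(1) by blast
  have max: "\<not> indep I (insert c R) (col z')" if "z' \<in> B" "c \<in> C" "c \<notin> R" for z' c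
  proof
    assume "indep I (insert c R) (col z')"
    then have "Q (Suc n)" unfolding Q_def using that R fR
      by (intro bexI[of _ z'] exI[of _ "insert c R"]) auto
    then show False using n(2) by fastforce
  qed
  have span: "\<exists>s. \<forall>i\<in>I. col z c i = (\<Sum>r\<in>R. s r * col z r i)" if c: "c \<in> C" for c
  proof (cases "c \<in> R")
    case True
    then show ?thesis using fR by (intro exI[of _ "\<lambda>r. if r = c then 1 else 0"]) (simp add: if_distrib[of "\<lambda>x. x * _"] cong: if_cong)
  next
    case False
    obtain s where s: "\<forall>i\<in>I. (\<Sum>r\<in>insert c R. s r * col z r i) = 0" "\<exists>r\<in>insert c R. s r \<noteq> 0"
      using max[OF z c False] unfolding indep_def by blast
    have sum0: "s c * col z c i + (\<Sum>r\<in>R. s r * col z r i) = 0" if "i \<in> I" for i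
      using s(1) that fR False by simp
    have "s c \<noteq> 0"
    proof
      assume 0: "s c = 0"
      then have "s r = 0" if "r \<in> R" for r
        using indepD[OF R(3), of s r] sum0 that by simp
      then show False using s(2) 0 by blast
    qed
    then have "col z c i = (\<Sum>r\<in>R. (- s r / s c) * col z r i)" if "i \<in> I" for i
    proof -
      have "(\<Sum>r\<in>R. (- s r / s c) * col z r i) = (- 1 / s c) * (\<Sum>r\<in>R. s r * col z r i)"
        unfolding sum_distrib_left by (intro sum.cong refl) simp
      also have "(\<Sum>r\<in>R. s r * col z r i) = - (s c * col z c i)"
        using sum0[OF that] by (simp add: add_eq_0_iff)
      finally show ?thesis using \<open>s c \<noteq> 0\<close> by simp
    qed
    then show ?thesis by (intro exI[of _ "\<lambda>r. - s r / s c"]) blast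
  qed
  have "card R < card I"
    using R(1) \<open>R \<noteq> C\<close> psubset_card_mono[OF fin(1), of R] card by auto
  then obtain \<phi> where \<phi>: "\<exists>i\<in>I. \<phi> i \<noteq> 0" "\<forall>r\<in>R. (\<Sum>i\<in>I. col z r i * \<phi> i) = 0"
    using homogeneous_solution[OF fR fin(2), of "col z"] by blast
  obtain s0 where s0: "\<forall>i\<in>I. col z c0 i = (\<Sum>r\<in>R. s0 r * col z r i)" using span[OF c0(1)] by blast
  \<comment> \<open>The dependence of column \<open>c0\<close> on the columns in \<open>R\<close>,
    as a vector of the kernel at \<open>z\<close>. The functional \<phi> above annihilates the image
    at \<open>z\<close>.\<close>
  define s where "s = (\<lambda>c. if c = c0 then 1 else if c \<in> R then - s0 c else 0)"
  have sum_s: "(\<Sum>c\<in>C. s c * g c) = g c0 - (\<Sum>r\<in>R. s0 r * g r)" for g :: "'c \<Rightarrow> 'k"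
  proof -
    have "(\<Sum>c\<in>C. s c * g c) = (\<Sum>c\<in>insert c0 R. s c * g c)"
      by (rule sum.mono_neutral_right) (use fin R(1) c0 in \<open>auto simp: s_def\<close>)
    also have "\<dots> = g c0 + (\<Sum>r\<in>R. s r * g r)" using fR c0 by (simp add: s_def)
    also have "(\<Sum>r\<in>R. s r * g r) = (\<Sum>r\<in>R. - (s0 r * g r))"
      by (intro sum.cong refl) (use c0 in \<open>auto simp: s_def\<close>)
    finally show ?thesis by (simp add: sum_negf)
  qed
  obtain i1 where i1: "i1 \<in> I" "\<phi> i1 \<noteq> 0" using \<phi>(1) by blast
  have "\<phi> i1 = 0"
  proof (rule sep[OF z _ _ _ i1(1)])
    show "\<exists>c\<in>C. s c \<noteq> 0" using c0 by (intro bexI[of _ c0]) (auto simp: s_def)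
    show "(\<Sum>c\<in>C. s c * col z c i) = 0" if "i \<in> I" for i
      using s0 that by (simp add: sum_s)
    fix z' assume z': "z' \<in> T"
    define v where "v = (\<lambda>i. \<Sum>c\<in>C. s c * col z' c i)"
    show "(\<Sum>i\<in>I. \<phi> i * (\<Sum>c\<in>C. s c * col z' c i)) = 0"
    proof (rule ccontr)
      assume "(\<Sum>i\<in>I. \<phi> i * (\<Sum>c\<in>C. s c * col z' c i)) \<noteq> 0"
      then have \<phi>v: "(\<Sum>i\<in>I. \<phi> i * v i) \<noteq> 0" by (simp add: v_def)
      \<comment> \<open>Column \<open>c0\<close> is replaced by \<open>v\<close>, which stays fixed
        along the line while the columns in \<open>R\<close> move. At \<open>t = 0\<close> this
        family is independent, as \<phi> kills the columns in \<open>R\<close> but not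
        \<open>v\<close>.\<close>
      let ?p = "\<lambda>r i. if r = c0 then v i else col z r i"
      let ?q = "\<lambda>r i. if r = c0 then 0 else col z' r i"
      have sum_ins: "(\<Sum>r\<in>insert c0 R. g r * (if r = c0 then x else y r)) = g c0 * x + (\<Sum>r\<in>R. g r * y r)" for g x and y :: "'c \<Rightarrow> 'k"
      proof -
        have "(\<Sum>r\<in>R. g r * (if r = c0 then x else y r)) = (\<Sum>r\<in>R. g r * y r)"
          by (intro sum.cong refl) (use c0 in auto)
        then show ?thesis using fR c0 by simp
      qed
      have "indep I (insert c0 R) ?p"
        unfolding indep_def
      proof (intro allI impI)
        fix g assume g: "\<forall>i\<in>I. (\<Sum>r\<in>insert c0 R. g r * ?p r i) = 0"
        have g': "g c0 * v i + (\<Sum>r\<in>R. g r * col z r i) = 0" if "i \<in> I" for i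
          using g that by (simp only: sum_ins)
        have "0 = (\<Sum>i\<in>I. \<phi> i * (g c0 * v i + (\<Sum>r\<in>R. g r * col z r i)))" using g' by simp
        also have "\<dots> = g c0 * (\<Sum>i\<in>I. \<phi> i * v i) + (\<Sum>i\<in>I. \<Sum>r\<in>R. g r * (col z r i * \<phi> i))"
          by (simp add: distrib_left sum.distrib sum_distrib_left mult_ac)
        also have "(\<Sum>i\<in>I. \<Sum>r\<in>R. g r * (col z r i * \<phi> i)) = 0"
          using \<phi>(2) by (subst sum.swap) (simp add: sum_distrib_left[symmetric])
        finally have 0: "g c0 = 0" using \<phi>v by simp
        then have "g r = 0" if "r \<in> R" for r
          using indepD[OF R(3), of g r] g' that by simp
        then show "\<forall>r\<in>insert c0 R. g r = 0" using 0 by blast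
      qed
      then have "finite {t. \<not> indep I (insert c0 R) (\<lambda>r i. ?p r i + t * ?q r i)}"
        by (intro indep_line) (use fR fin in auto)
      then have "finite ({t. \<not> indep I (insert c0 R) (\<lambda>r i. ?p r i + t * ?q r i)} \<union> {t. line z z' t \<notin> B} \<union> {0})"
        by (intro finite_UnI B_line[OF z z']) auto
      from ex_new_if_finite[OF inf this] obtain t where
        "t \<notin> {t. \<not> indep I (insert c0 R) (\<lambda>r i. ?p r i + t * ?q r i)} \<union> {t. line z z' t \<notin> B} \<union> {0}"
        by (rule exE)
      then have t: "indep I (insert c0 R) (\<lambda>r i. ?p r i + t * ?q r i)" "line z z' t \<in> B" "t \<noteq> 0"
        by (simp_all only: Un_iff mem_Collect_eq de_Morgan_disj not_not singleton_iff not_False_eq_True)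
      let ?zt = "line z z' t"
      have colt: "col ?zt c i = col z c i + t * col z' c i" if "c \<in> C" "i \<in> I" for c i
        by (rule col_line[OF z z' that])
      have "indep I (insert c0 R) (col ?zt)"
        unfolding indep_def
      proof (intro allI impI)
        fix g assume g: "\<forall>i\<in>I. (\<Sum>r\<in>insert c0 R. g r * col ?zt r i) = 0"
        \<comment> \<open>As \<open>s\<close> is in the kernel at \<open>z\<close>, its combination
          of the columns at \<open>?zt\<close> equals \<open>t * v\<close>. Substituting for column
          \<open>c0\<close> turns a relation with coefficients \<open>g\<close> into one between
          \<open>v\<close> and the columns in \<open>R\<close> with coefficients \<open>h\<close>.
          Dividing by \<open>t\<close> recovers \<open>g c0\<close>, which is why
          \<open>t = 0\<close> was excluded.\<close>
        define h where "h = (\<lambda>r. if r = c0 then g c0 * t else g r + g c0 * s0 r)"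
        have h: "(\<Sum>r\<in>insert c0 R. h r * (?p r i + t * ?q r i)) = 0" if i: "i \<in> I" for i
        proof -
          have "(\<Sum>r\<in>insert c0 R. h r * (?p r i + t * ?q r i)) =
            (\<Sum>r\<in>insert c0 R. h r * (if r = c0 then v i else col ?zt r i))"
            by (intro sum.cong refl) (use colt[OF _ i] R(1) in auto)
          also have "\<dots> = g c0 * t * v i + (\<Sum>r\<in>R. h r * col ?zt r i)"
            unfolding sum_ins by (simp add: h_def)
          also have "(\<Sum>r\<in>R. h r * col ?zt r i) = (\<Sum>r\<in>R. g r * col ?zt r i + g c0 * (s0 r * col ?zt r i))"
            by (intro sum.cong refl) (use c0 in \<open>auto simp: h_def distrib_right mult.assoc\<close>)
          also have "\<dots> = (\<Sum>r\<in>R. g r * col ?zt r i) + g c0 * (\<Sum>r\<in>R. s0 r * col ?zt r i)"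
            by (simp add: sum.distrib sum_distrib_left)
          also have "(\<Sum>r\<in>R. s0 r * col ?zt r i) = col ?zt c0 i - t * v i"
          proof -
            have "(\<Sum>c\<in>C. s c * col ?zt c i) = (\<Sum>c\<in>C. s c * col z c i) + t * v i"
              unfolding v_def sum_distrib_left sum.distrib[symmetric]
              by (intro sum.cong refl) (simp add: colt[OF _ i] distrib_left mult.left_commute)
            also have "(\<Sum>c\<in>C. s c * col z c i) = 0" using s0 i by (simp add: sum_s)
            finally show ?thesis unfolding sum_s by (simp add: algebra_simps)
          qed
          also have "(\<Sum>r\<in>R. g r * col ?zt r i) = - (g c0 * col ?zt c0 i)"
            using bspec[OF g i] fR c0 by (simp add: add_eq_0_iff)
          finally show ?thesis by (simp add: algebra_simps)
        qed
        have h0: "h r = 0" if "r \<in> insert c0 R" for r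
          by (rule indepD[OF t(1) h that])
        have g0: "g c0 = 0" using h0[of c0] t(3) by (simp add: h_def)
        show "\<forall>r\<in>insert c0 R. g r = 0"
        proof
          fix r assume "r \<in> insert c0 R"
          then show "g r = 0" using h0[of r] g0 by (cases "r = c0") (simp_all add: h_def)
        qed
      qed
      then show False using max[OF t(2) c0] by blast
    qed
  qed
  then show False using i1 by blast
qed

subsection \<open>Zariski density\<close>

lemma poly_funs_sum:
  "(\<And>s. s \<in> S \<Longrightarrow> f s \<in> poly_funs L) \<Longrightarrow> (\<lambda>x. \<Sum>s\<in>S. f s x) \<in> poly_funs L"
  by (induction S rule: infinite_finite_induct) (auto intro: poly_funs.intros)

lemma poly_funs_prod:
  "(\<And>s. s \<in> S \<Longrightarrow> f s \<in> poly_funs L) \<Longrightarrow> (\<lambda>x. \<Prod>s\<in>S. f s x) \<in> poly_funs L"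
  by (induction S rule: infinite_finite_induct) (auto intro: poly_funs.intros)

lemma poly_funs_det:
  assumes "\<And>i j. i < n \<Longrightarrow> j < n \<Longrightarrow> (\<lambda>x. g x i j) \<in> poly_funs L"
  shows "(\<lambda>x. det (mat n n (\<lambda>(i, j). g x i j))) \<in> poly_funs L"
proof -
  have "det (mat n n (\<lambda>(i, j). g x i j)) =
    (\<Sum>p\<in>{p. p permutes {0..<n}}. signof p * (\<Prod>i\<in>{0..<n}. g x i (p i)))" for x
    unfolding det_def by (auto intro!: sum.cong prod.cong arg_cong2[where f = "(*)"] dest: permutes_in_image[THEN iffD2])
  moreover have "(\<lambda>x. \<Sum>p\<in>{p. p permutes {0..<n}}. signof p * (\<Prod>i\<in>{0..<n}. g x i (p i))) \<in> poly_funs L"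
    by (intro poly_funs_sum poly_funs.mult poly_funs.const poly_funs_prod assms)
      (auto dest: permutes_in_image)
  ultimately show ?thesis by simp
qed

lemma poly_funs_line:
  assumes "f \<in> poly_funs L" "\<And>g. g \<in> L \<Longrightarrow> \<exists>p. \<forall>t. g (line t) = poly p t"
  shows "\<exists>p. \<forall>t. f (line t) = poly p t"
  using assms(1)
proof induction
  case (const c)
  show ?case by (intro exI[of _ "[:c:]"]) simp
next
  case (add f g)
  then obtain p q where "\<forall>t. f (line t) = poly p t" "\<forall>t. g (line t) = poly q t" by blast
  then show ?case by (intro exI[of _ "p + q"]) simp
next
  case (mult f g)
  then obtain p q where "\<forall>t. f (line t) = poly p t" "\<forall>t. g (line t) = poly q t" by blast
  then show ?case by (intro exI[of _ "p * q"]) simp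
qed (use assms(2) in blast)

text \<open>A neighbourhood of \<open>x\<close> contains a set where some polynomial function
  \<open>g\<close> with \<open>g x \<noteq> 0\<close> does not vanish. On the line from
  \<open>x\<close> to \<open>x0\<close> both \<open>f\<close> and \<open>g\<close> are nonzero
  polynomials in one variable, and an infinite field has a point that is a root of neither.\<close>

lemma zariski_nonvanishing_dense:
  fixes L :: "('b \<Rightarrow> 'k::field) set"
  assumes inf: "infinite (UNIV :: 'k set)" and f: "f \<in> poly_funs L" and x0: "x0 \<in> X" "f x0 \<noteq> 0"
    and line: "\<And>x y. x \<in> X \<Longrightarrow> y \<in> X \<Longrightarrow> \<exists>line. (\<forall>t. line t \<in> X) \<and> line 0 = x \<and> line 1 = y \<and>
      (\<forall>g\<in>L. \<exists>p. \<forall>t. g (line t) = poly p t)"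
  shows "openin (zariski_topology X L) {x \<in> X. f x \<noteq> 0}"
    "zariski_topology X L closure_of {x \<in> X. f x \<noteq> 0} = X"
proof -
  show "openin (zariski_topology X L) {x \<in> X. f x \<noteq> 0}"
    unfolding openin_zariski_topology using f by (intro exI[of _ "{f}"]) auto
  have "X \<subseteq> zariski_topology X L closure_of {x \<in> X. f x \<noteq> 0}"
  proof
    fix x assume x: "x \<in> X"
    show "x \<in> zariski_topology X L closure_of {x \<in> X. f x \<noteq> 0}"
      unfolding in_closure_of topspace_zariski_topology
    proof (intro conjI x allI impI)
      fix U assume U: "x \<in> U \<and> openin (zariski_topology X L) U"
      then obtain F where F: "F \<subseteq> poly_funs L" "U = X - {x \<in> X. \<forall>f\<in>F. f x = 0}"
        unfolding openin_zariski_topology by blast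
      then obtain g where g: "g \<in> F" "g x \<noteq> 0" using U by blast
      obtain ln where ln: "\<forall>t. ln t \<in> X" "ln 0 = x" "ln 1 = x0" "\<forall>g\<in>L. \<exists>p. \<forall>t. g (ln t) = poly p t"
        using line[OF x x0(1)] by blast
      obtain p where p: "\<forall>t. g (ln t) = poly p t" using poly_funs_line[of g L ln] g F ln by blast
      obtain q where q: "\<forall>t. f (ln t) = poly q t" using poly_funs_line[OF f, of ln] ln by blast
      have "p \<noteq> 0" "q \<noteq> 0" using p q g x0 ln by (metis poly_0)+
      then have "finite {t. poly (p * q) t = 0}" by (intro poly_roots_finite) simp
      then obtain t where "poly (p * q) t \<noteq> 0" using ex_new_if_finite[OF inf] by blast
      then have "g (ln t) \<noteq> 0" "f (ln t) \<noteq> 0" using p q by auto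
      then show "\<exists>y. y \<in> {x \<in> X. f x \<noteq> 0} \<and> y \<in> U"
        using ln(1) F(2) g(1) by (intro exI[of _ "ln t"]) auto
    qed
  qed
  then show "zariski_topology X L closure_of {x \<in> X. f x \<noteq> 0} = X"
    using closure_of_subset_topspace[of "zariski_topology X L"] unfolding topspace_zariski_topology by blast
qed

subsection \<open>Passage to the quotient algebra\<close>

text \<open>Over a finite field, one plus the product of all X - c would be a polynomial of positive
  degree without a root.\<close>

lemma infinite_alg_closed: "infinite (UNIV :: 'k::alg_closed_field set)"
proof
  assume fin: "finite (UNIV :: 'k set)"
  let ?p = "(\<Prod>c\<in>UNIV. [:- c, 1:]) :: 'k poly"
  have deg: "degree ?p = card (UNIV :: 'k set)"
    by (subst degree_prod_eq_sum_degree) auto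
  moreover have "card (UNIV :: 'k set) > 0" using fin by (simp add: card_gt_0_iff)
  ultimately have "degree (?p + 1) > 0" by (simp add: degree_add_eq_left)
  then obtain x where "poly (?p + 1) x = 0" using alg_closed_imp_poly_has_root by blast
  moreover have "poly ?p x = 0" using fin by (simp add: poly_prod)
  ultimately show False by simp
qed

lemma finsum_mat_index:
  assumes "finite S" "f \<in> S \<rightarrow> carrier_mat n k" "p < n" "q < k"
  shows "finsum (module_mat TYPE('k::field) n k) f S $$ (p, q) = (\<Sum>v\<in>S. f v $$ (p, q))"
proof -
  interpret abelian_group "module_mat TYPE('k) n k" by (rule abelian_group_mat)
  have "finsum (module_mat TYPE('k) n k) f S \<in> carrier_mat n k \<and>
    finsum (module_mat TYPE('k) n k) f S $$ (p, q) = (\<Sum>v\<in>S. f v $$ (p, q))"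
    using assms(1,2)
  proof (induction S rule: finite_induct)
    case empty
    then show ?case using assms(3,4) by (simp add: module_mat_simps)
  next
    case (insert x S)
    have "finsum (module_mat TYPE('k) n k) f (insert x S) = f x + finsum (module_mat TYPE('k) n k) f S"
      using insert by (subst finsum_insert) (auto simp: module_mat_simps)
    then show ?case using insert assms(3,4) by (auto simp: Pi_iff)
  qed
  then show ?thesis ..
qed

text \<open>Passes from independence of a set of matrices to independence of the indexed family.
  Injectivity of \<open>M\<close> is what allows coefficients on indices to be carried to
  coefficients on matrices.\<close>

lemma matrix_indep:
  fixes M :: "nat \<Rightarrow> 'k::field mat"
  assumes M: "\<And>j. j < num \<Longrightarrow> M j \<in> carrier_mat n k" and inj: "inj_on M {..<num}"
    and li: "\<not> LinearCombinations.module.lin_dep class_ring (module_mat TYPE('k) n k) (M ` {..<num})"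
    and zero: "\<And>p q. p < n \<Longrightarrow> q < k \<Longrightarrow> (\<Sum>j<num. s j * M j $$ (p, q)) = 0" and j: "j < num"
  shows "s j = 0"
proof (rule ccontr)
  assume nz: "s j \<noteq> 0"
  interpret vectorspace class_ring "module_mat TYPE('k) n k" by (rule matrix_vs)
  let ?a = "\<lambda>v. s (the_inv_into {..<num} M v)"
  have a: "?a (M i) = s i" if "i < num" for i
    using the_inv_into_f_f[OF inj] that by simp
  have "lincomb ?a (M ` {..<num}) = 0\<^sub>m n k"
  proof (rule eq_matI)
    have f: "(\<lambda>v. ?a v \<odot>\<^bsub>module_mat TYPE('k) n k\<^esub> v) \<in> M ` {..<num} \<rightarrow> carrier_mat n k"
      using M by (auto simp: module_mat_simps)
    have "lincomb ?a (M ` {..<num}) \<in> carrier (module_mat TYPE('k) n k)"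
      by (rule lincomb_closed) (use M in \<open>auto simp: module_mat_simps\<close>)
    then show "dim_row (lincomb ?a (M ` {..<num})) = dim_row (0\<^sub>m n k)" "dim_col (lincomb ?a (M ` {..<num})) = dim_col (0\<^sub>m n k)"
      by (auto simp: module_mat_simps)
    fix p q assume "p < dim_row (0\<^sub>m n k)" "q < dim_col (0\<^sub>m n k)"
    then have pq: "p < n" "q < k" by auto
    have "lincomb ?a (M ` {..<num}) $$ (p, q) = (\<Sum>v\<in>M ` {..<num}. (?a v \<odot>\<^bsub>module_mat TYPE('k) n k\<^esub> v) $$ (p, q))"
      unfolding lincomb_def by (rule finsum_mat_index[OF _ f pq]) simp
    also have "\<dots> = (\<Sum>i<num. (?a (M i) \<odot>\<^bsub>module_mat TYPE('k) n k\<^esub> M i) $$ (p, q))"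
      using inj by (simp add: sum.reindex)
    also have "\<dots> = (\<Sum>i<num. s i * M i $$ (p, q))"
    proof (intro sum.cong refl)
      fix i assume i: "i \<in> {..<num}"
      then have "M i \<in> carrier_mat n k" using M by simp
      then show "(?a (M i) \<odot>\<^bsub>module_mat TYPE('k) n k\<^esub> M i) $$ (p, q) = s i * M i $$ (p, q)"
        using a i pq by (simp add: module_mat_simps)
    qed
    finally show "lincomb ?a (M ` {..<num}) $$ (p, q) = 0\<^sub>m n k $$ (p, q)"
      using zero[OF pq] pq by simp
  qed
  then have "lin_dep (M ` {..<num})"
    unfolding lin_dep_def using nz j a[OF j]
    by (intro exI[of _ "M ` {..<num}"] exI[of _ ?a] exI[of _ "M j"]) (auto simp: module_mat_simps)
  then show False using li by simp
qed

section \<open>Coordinates and bases in the quotient algebra\<close>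

context preproj
begin

sublocale VS: vectorspace "class_ring :: 'k ring" "preproj_algebra G a b"
  by (rule vectorspace_preproj_algebra) (rule fin_digraph_axioms)

abbreviation P where "P \<equiv> preproj_algebra G a b"
abbreviation cls where "cls \<equiv> preproj_proj G a b"

lemma cls_facts:
  shows cls_carrier: "keys f \<subseteq> qpaths H \<Longrightarrow> cls f \<in> carrier P"
    and carrier_cls: "X \<in> carrier P \<Longrightarrow> \<exists>f. keys f \<subseteq> qpaths H \<and> X = cls f"
    and cls_add: "keys f \<subseteq> qpaths H \<Longrightarrow> keys g \<subseteq> qpaths H \<Longrightarrow> cls f \<oplus>\<^bsub>P\<^esub> cls g = cls (f + g)"
    and cls_mult: "keys f \<subseteq> qpaths H \<Longrightarrow> keys g \<subseteq> qpaths H \<Longrightarrow> cls f \<otimes>\<^bsub>P\<^esub> cls g = cls (f \<star> g)"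
    and cls_scale: "keys f \<subseteq> qpaths H \<Longrightarrow> c \<odot>\<^bsub>P\<^esub> cls f = cls (c *\<^sub>p f)"
    and cls_eq_iff: "keys f \<subseteq> qpaths H \<Longrightarrow> keys g \<subseteq> qpaths H \<Longrightarrow> cls f = cls g \<longleftrightarrow> f - g \<in> J"
    and cls_zero: "\<zero>\<^bsub>P\<^esub> = cls 0"
proof -
  let ?A = "path_algebra H :: ('k, ('v, 'e + 'e) qpath \<Rightarrow>\<^sub>0 'k) module"
  have id: "ideal J ?A" using ideal_preproj_ideal[OF fin_digraph_axioms, of a b] by (simp add: ideal_eq_J)
  then interpret ideal J ?A .
  have cls: "cls f = J +>\<^bsub>?A\<^esub> f" for f by (simp add: preproj_proj_def ideal_eq_J)
  have P: "P = algebra_Quot ?A J" by (simp add: preproj_algebra_def ideal_eq_J)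
  have car: "carrier P = a_rcosets\<^bsub>?A\<^esub> J" by (simp add: P algebra_Quot_def FactRing_def)
  show "cls f \<in> carrier P" if "keys f \<subseteq> qpaths H" for f
    using that unfolding car A_RCOSETS_def' cls by auto
  show "\<exists>f. keys f \<subseteq> qpaths H \<and> X = cls f" if "X \<in> carrier P" for X
    using that unfolding car A_RCOSETS_def' cls by auto
  fix f g :: "('v, 'e + 'e) qpath \<Rightarrow>\<^sub>0 'k" and c
  assume f: "keys f \<subseteq> qpaths H"
  show "c \<odot>\<^bsub>P\<^esub> cls f = cls (c *\<^sub>p f)"
    unfolding P cls using algebra_Quot_smult[OF H.fin_digraph_axioms id, of f c] f by simp
  assume g: "keys g \<subseteq> qpaths H"
  show "cls f \<oplus>\<^bsub>P\<^esub> cls g = cls (f + g)"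
    using f g a_rcos_sum[of f g] by (simp add: P cls algebra_Quot_def FactRing_def)
  show "cls f \<otimes>\<^bsub>P\<^esub> cls g = cls (f \<star> g)"
    using f g rcoset_mult_add[of f g] by (simp add: P cls algebra_Quot_def FactRing_def)
  have "\<ominus>\<^bsub>?A\<^esub> g = - g" by (rule minus_equality) (use g in auto)
  then have "f \<ominus>\<^bsub>?A\<^esub> g = f - g" by (simp add: a_minus_def)
  then show "cls f = cls g \<longleftrightarrow> f - g \<in> J"
    using quotient_eq_iff_same_a_r_cos[OF id, of f g] f g by (simp add: cls)
next
  let ?A = "path_algebra H :: ('k, ('v, 'e + 'e) qpath \<Rightarrow>\<^sub>0 'k) module"
  have id: "ideal J ?A" using ideal_preproj_ideal[OF fin_digraph_axioms, of a b] by (simp add: ideal_eq_J)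
  then interpret ideal J ?A .
  have "\<zero>\<^bsub>P\<^esub> = J" by (simp add: preproj_algebra_def ideal_eq_J algebra_Quot_def FactRing_def)
  moreover have "cls 0 = J"
    using a_coset_join2[of "0"] a_subgroup additive_subgroup.zero_closed[OF is_additive_subgroup]
    by (simp add: preproj_proj_def ideal_eq_J)
  ultimately show "\<zero>\<^bsub>P\<^esub> = cls 0" by simp
qed

lemma keys_sum_qpaths: "(\<And>s. s \<in> S \<Longrightarrow> keys (f s) \<subseteq> T) \<Longrightarrow> keys (\<Sum>s\<in>S. c s *\<^sub>p f s) \<subseteq> T"
  by (intro keys_sum_subset keys_scale_subset)

lemma cls_finsum:
  assumes "finite S" "\<And>s. s \<in> S \<Longrightarrow> keys (f s) \<subseteq> qpaths H"
  shows "(\<Oplus>\<^bsub>P\<^esub>s\<in>S. cls (f s)) = cls (\<Sum>s\<in>S. f s)"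
  using assms
proof (induction S rule: finite_induct)
  case (insert x S)
  have "(\<Oplus>\<^bsub>P\<^esub>s\<in>insert x S. cls (f s)) = cls (f x) \<oplus>\<^bsub>P\<^esub> (\<Oplus>\<^bsub>P\<^esub>s\<in>S. cls (f s))"
    using insert by (intro VS.M.finsum_insert) (auto intro!: cls_carrier)
  then show ?case using insert by (simp add: cls_add keys_sum_subset)
qed (simp add: cls_zero)

text \<open>The choice of a representative is harmless because \<open>nf\<close> is constant on the
  cosets of \<open>J\<close> (\<open>crd_cls\<close>); the result is the coordinate vector of the
  class in the basis of normal paths.\<close>

definition crd :: "(('v, 'e + 'e) qpath \<Rightarrow>\<^sub>0 'k) set \<Rightarrow> (('v, 'e + 'e) qpath \<Rightarrow>\<^sub>0 'k)" where
  "crd X = nf (SOME f. keys f \<subseteq> qpaths H \<and> X = cls f)"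

lemma keys_nf_qpaths: "keys f \<subseteq> qpaths H \<Longrightarrow> keys (nf f) \<subseteq> qpaths H"
  by (rule keys_in_linmap[OF linmap_nf]) (rule keys_nf_sg_qpaths)

lemma crd_cls:
  assumes "keys f \<subseteq> qpaths H" shows "crd (cls f) = nf f"
proof -
  let ?g = "SOME g. keys g \<subseteq> qpaths H \<and> cls f = cls g"
  have "keys ?g \<subseteq> qpaths H \<and> cls f = cls ?g"
    by (rule someI_ex) (use assms in blast)
  then show ?thesis using assms cls_eq_iff[of ?g f] by (simp add: crd_def nf_eq_iff)
qed

lemma cls_nf: "keys f \<subseteq> qpaths H \<Longrightarrow> cls (nf f) = cls f"
  using cls_eq_iff[of f "nf f"] keys_nf_qpaths[of f] nf_cong_J[of f] by simp

lemma crd_carrier: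
  assumes "X \<in> carrier P"
  shows "cls (crd X) = X" "keys (crd X) \<subseteq> qpaths H" "nf (crd X) = crd X"
proof -
  obtain f where f: "keys f \<subseteq> qpaths H" "X = cls f" using carrier_cls[OF assms] by blast
  then show "cls (crd X) = X" "keys (crd X) \<subseteq> qpaths H" "nf (crd X) = crd X"
    by (simp_all add: crd_cls cls_nf keys_nf_qpaths)
qed

lemma crd_add: "X \<in> carrier P \<Longrightarrow> Y \<in> carrier P \<Longrightarrow> crd (X \<oplus>\<^bsub>P\<^esub> Y) = crd X + crd Y"
  using crd_carrier[of X] crd_carrier[of Y] cls_add[of "crd X" "crd Y"] crd_cls[of "crd X + crd Y"]
  by (simp add: keys_add_subset linmap_add[OF linmap_nf])

lemma crd_scale: "X \<in> carrier P \<Longrightarrow> crd (c \<odot>\<^bsub>P\<^esub> X) = c *\<^sub>p crd X"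
  using crd_carrier[of X] cls_scale[of "crd X" c] crd_cls[of "c *\<^sub>p crd X"]
  by (simp add: keys_scale_subset linmap_scale[OF linmap_nf])

lemma span_cls:
  assumes "finite I" "\<And>i. i \<in> I \<Longrightarrow> keys (u i) \<subseteq> qpaths H"
  shows "VS.span ((\<lambda>i. cls (u i)) ` I) = {cls (\<Sum>i\<in>I. c i *\<^sub>p u i) | c. True}" (is "_ = ?R")
proof
  have carr: "(\<lambda>i. cls (u i)) ` I \<subseteq> carrier P" using assms(2) cls_carrier by blast
  have ks: "keys (\<Sum>i\<in>I. c i *\<^sub>p u i) \<subseteq> qpaths H" for c using assms(2) by (rule keys_sum_qpaths)
  have memR: "cls (\<Sum>i\<in>I. c i *\<^sub>p u i) \<in> ?R" for c
    by (rule CollectI, rule exI[of _ c], rule conjI[OF refl TrueI])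
  show "VS.span ((\<lambda>i. cls (u i)) ` I) \<subseteq> ?R"
  proof (rule VS.span_is_subset)
    show "(\<lambda>i. cls (u i)) ` I \<subseteq> ?R"
    proof
      fix X assume "X \<in> (\<lambda>i. cls (u i)) ` I"
      then obtain j where j: "j \<in> I" "X = cls (u j)" by blast
      have "(\<Sum>i\<in>I. (if i = j then 1 else 0) *\<^sub>p u i) = (\<Sum>i\<in>I. if i = j then u j else 0)"
        by (intro sum.cong refl) auto
      also have "\<dots> = u j" using j assms(1) by simp
      finally have "X = cls (\<Sum>i\<in>I. (if i = j then 1 else 0) *\<^sub>p u i)" using j by simp
      then show "X \<in> ?R" using memR by (simp only:)
    qed
    show "LinearCombinations.submodule class_ring ?R P"
      unfolding LinearCombinations.submodule_def
    proof (intro conjI allI impI)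
      show "Module.module class_ring P" by (rule VS.module_axioms)
      show "?R \<subseteq> carrier P" using ks cls_carrier by blast
      have "cls 0 = cls (\<Sum>i\<in>I. 0 *\<^sub>p u i)" by simp
      then show "\<zero>\<^bsub>P\<^esub> \<in> ?R" unfolding cls_zero using memR by (simp only:)
      fix X assume "X \<in> ?R"
      then obtain c where c: "X = cls (\<Sum>i\<in>I. c i *\<^sub>p u i)" by blast
      have "l \<odot>\<^bsub>P\<^esub> X = cls (\<Sum>i\<in>I. (l * c i) *\<^sub>p u i)" for l
        using ks by (simp add: c cls_scale pscale_sum)
      then show "l \<odot>\<^bsub>P\<^esub> X \<in> ?R" for l using memR by (simp only:)
      fix Y assume "Y \<in> ?R"
      then obtain c' where c': "Y = cls (\<Sum>i\<in>I. c' i *\<^sub>p u i)" by blast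
      have "X \<oplus>\<^bsub>P\<^esub> Y = cls (\<Sum>i\<in>I. (c i + c' i) *\<^sub>p u i)"
        using ks by (simp add: c c' cls_add pscale_distribs sum.distrib)
      then show "X \<oplus>\<^bsub>P\<^esub> Y \<in> ?R" using memR by (simp only:)
    qed
  qed
  have sm: "LinearCombinations.submodule class_ring (VS.span ((\<lambda>i. cls (u i)) ` I)) P"
    by (rule VS.span_is_submodule[OF carr])
  have "cls (\<Sum>i\<in>K. c i *\<^sub>p u i) \<in> VS.span ((\<lambda>i. cls (u i)) ` I)" if "finite K" "K \<subseteq> I" for K c
    using that
  proof (induction K rule: finite_induct)
    case empty
    then show ?case using sm by (simp add: LinearCombinations.submodule_def cls_zero[symmetric])
  next
    case (insert x K)
    have "cls (u x) \<in> VS.span ((\<lambda>i. cls (u i)) ` I)"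
      using VS.in_own_span[OF carr] insert.prems by auto
    then have "c x \<odot>\<^bsub>P\<^esub> cls (u x) \<in> VS.span ((\<lambda>i. cls (u i)) ` I)"
      using sm by (simp add: LinearCombinations.submodule_def)
    moreover have "cls (\<Sum>i\<in>insert x K. c i *\<^sub>p u i) = c x \<odot>\<^bsub>P\<^esub> cls (u x) \<oplus>\<^bsub>P\<^esub> cls (\<Sum>i\<in>K. c i *\<^sub>p u i)"
    proof -
      have "keys (u x) \<subseteq> qpaths H" "keys (\<Sum>i\<in>K. c i *\<^sub>p u i) \<subseteq> qpaths H"
        using assms(2) insert.prems by (auto intro!: keys_sum_qpaths)
      then show ?thesis using insert.hyps by (simp add: cls_scale cls_add keys_scale_subset)
    qed
    ultimately show ?case using insert sm by (simp add: LinearCombinations.submodule_def)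
  qed
  then show "?R \<subseteq> VS.span ((\<lambda>i. cls (u i)) ` I)" using assms(1) by blast
qed

text \<open>Translates independence of a family modulo \<open>J\<close> into the set-based notion.
  That notion alone would miss repetitions, so injectivity of the family is recorded with
  it.\<close>

lemma independent_cls:
  assumes I: "finite I" and u: "\<And>i. i \<in> I \<Longrightarrow> keys (u i) \<subseteq> qpaths H"
    and ind: "\<And>c i. (\<Sum>i\<in>I. c i *\<^sub>p u i) \<in> J \<Longrightarrow> i \<in> I \<Longrightarrow> c i = (0 :: 'k)"
  shows "inj_on (\<lambda>i. cls (u i)) I" "\<not> VS.lin_dep ((\<lambda>i. cls (u i)) ` I)"
proof -
  show inj: "inj_on (\<lambda>i. cls (u i)) I"
  proof (rule inj_onI, rule ccontr)
    fix i j assume ij: "i \<in> I" "j \<in> I" "cls (u i) = cls (u j)" "i \<noteq> j"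
    have "(\<Sum>k\<in>I. ((if k = i then 1 else 0) - (if k = j then 1 else 0)) *\<^sub>p u k) =
      (\<Sum>k\<in>I. if k = i then u i else 0) - (\<Sum>k\<in>I. if k = j then u j else 0)"
      unfolding sum_subtractf[symmetric] by (intro sum.cong refl) (auto simp: pscale_left_diff)
    also have "\<dots> = u i - u j" using ij I by simp
    also have "\<dots> \<in> J" using ij u by (simp add: cls_eq_iff)
    finally have "(\<Sum>k\<in>I. ((if k = i then 1 else 0) - (if k = j then 1 else 0)) *\<^sub>p u k) \<in> J" .
    from ind[OF this ij(1)] show False using ij(4) by simp
  qed
  show "\<not> VS.lin_dep ((\<lambda>i. cls (u i)) ` I)"
  proof (rule VS.finite_lin_indpt2)
    fix c assume c: "VS.lincomb c ((\<lambda>i. cls (u i)) ` I) = \<zero>\<^bsub>P\<^esub>"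
    have "VS.lincomb c ((\<lambda>i. cls (u i)) ` I) = (\<Oplus>\<^bsub>P\<^esub>i\<in>I. c (cls (u i)) \<odot>\<^bsub>P\<^esub> cls (u i))"
      unfolding VS.lincomb_def
      by (rule VS.M.finsum_reindex[OF _ inj]) (use u cls_carrier in \<open>auto intro!: VS.smult_closed\<close>)
    also have "\<dots> = (\<Oplus>\<^bsub>P\<^esub>i\<in>I. cls (c (cls (u i)) *\<^sub>p u i))"
    proof (rule VS.M.finsum_cong'[OF refl])
      show "(\<lambda>i. cls (c (cls (u i)) *\<^sub>p u i)) \<in> I \<rightarrow> carrier P"
        by (rule Pi_I, rule cls_carrier, rule keys_scale_subset, rule u)
      show "c (cls (u i)) \<odot>\<^bsub>P\<^esub> cls (u i) = cls (c (cls (u i)) *\<^sub>p u i)" if "i \<in> I" for i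
        by (rule cls_scale[OF u[OF that]])
    qed
    also have "\<dots> = cls (\<Sum>i\<in>I. c (cls (u i)) *\<^sub>p u i)"
      by (rule cls_finsum[OF I]) (intro keys_scale_subset u)
    finally have "cls (\<Sum>i\<in>I. c (cls (u i)) *\<^sub>p u i) = cls 0" using c by (simp add: cls_zero)
    then have "(\<Sum>i\<in>I. c (cls (u i)) *\<^sub>p u i) \<in> J"
      using cls_eq_iff[of "\<Sum>i\<in>I. c (cls (u i)) *\<^sub>p u i" 0] u by (simp add: keys_sum_qpaths)
    then have "c (cls (u i)) = 0" if "i \<in> I" for i using ind[of "\<lambda>i. c (cls (u i))"] that by blast
    then show "\<forall>v\<in>(\<lambda>i. cls (u i)) ` I. c v = \<zero>\<^bsub>class_ring\<^esub>" by simp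
  qed (use I u cls_carrier in auto)
qed

lemma vectorspace_span: "S \<subseteq> carrier P \<Longrightarrow> vectorspace class_ring (P\<lparr>carrier := VS.span S\<rparr>)"
  by (intro VS.subspace_is_vs VS.span_is_subspace)

lemma basis_span_cls:
  assumes I: "finite I" and u: "\<And>i. i \<in> I \<Longrightarrow> keys (u i) \<subseteq> qpaths H"
    and ind: "\<And>c i. (\<Sum>i\<in>I. c i *\<^sub>p u i) \<in> J \<Longrightarrow> i \<in> I \<Longrightarrow> c i = (0 :: 'k)"
    and S: "S = (\<lambda>i. cls (u i)) ` I"
  shows "vectorspace.basis class_ring (P\<lparr>carrier := VS.span S\<rparr>) S" "subspace_dim P (VS.span S) = card I"
proof -
  have carr: "S \<subseteq> carrier P" using u cls_carrier by (auto simp: S)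
  have ic: "inj_on (\<lambda>i. cls (u i)) I" "\<not> VS.lin_dep ((\<lambda>i. cls (u i)) ` I)"
    using independent_cls[of I u] I u ind by blast+
  interpret W: vectorspace class_ring "P\<lparr>carrier := VS.span S\<rparr>" by (rule vectorspace_span[OF carr])
  have sm: "LinearCombinations.submodule class_ring (VS.span S) P" by (rule VS.span_is_submodule[OF carr])
  note nd = VS.span_li_not_depend[OF VS.in_own_span[OF carr] sm]
  show b: "W.basis S"
    unfolding W.basis_def nd using ic(2) VS.in_own_span[OF carr] by (simp add: S)
  have "W.dim = card S" by (rule W.dim_basis[OF _ b]) (simp add: S I)
  also have "card S = card I" unfolding S by (rule card_image[OF ic(1)])
  finally show "subspace_dim P (VS.span S) = card I" by (simp add: subspace_dim_def)
qed

lemma preproj_V_span: "preproj_V G a b t d = VS.span ((\<lambda>q. cls (sg q)) ` PTs t d)"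
  by (simp add: preproj_V_def PTs_def conj_commute Collect_conj_eq conj_left_commute cong: conj_cong)

lemma preproj_V_eq: "preproj_V G a b t d = {cls z | z. keys z \<subseteq> PTs t d}"
proof -
  have "preproj_V G a b t d = {cls (\<Sum>q\<in>PTs t d. c q *\<^sub>p sg q) | c. True}"
    unfolding preproj_V_span by (rule span_cls) (use PTs_qpaths in auto)
  also have "\<dots> = {cls z | z. keys z \<subseteq> PTs t d}"
  proof (intro Set.set_eqI iffI)
    fix X assume "X \<in> {cls (\<Sum>q\<in>PTs t d. c q *\<^sub>p sg q) | c. True}"
    then obtain c where "X = cls (\<Sum>q\<in>PTs t d. c q *\<^sub>p sg q)" by blast
    moreover have "keys (\<Sum>q\<in>PTs t d. c q *\<^sub>p sg q) \<subseteq> PTs t d" by (rule keys_sum_qpaths) simp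
    ultimately show "X \<in> {cls z | z. keys z \<subseteq> PTs t d}" by blast
  next
    fix X assume "X \<in> {cls z | z. keys z \<subseteq> PTs t d}"
    then obtain z where z: "X = cls z" "keys z \<subseteq> PTs t d" by blast
    have "X = cls (\<Sum>q\<in>PTs t d. lookup z q *\<^sub>p sg q)"
      unfolding z(1) by (rule arg_cong[OF sum_sg_superset[OF finite_PTs z(2)]])
    then show "X \<in> {cls (\<Sum>q\<in>PTs t d. c q *\<^sub>p sg q) | c. True}"
      by (intro CollectI exI[of _ "lookup z"] conjI TrueI)
  qed
  finally show ?thesis .
qed

lemma IXs_PTs: "IXs t d \<subseteq> PTs t d"
  using IX_subset by (fastforce simp: IXs_def PTs_UN)

lemma IXs_qpaths: "IXs t d \<subseteq> qpaths H"
  by (rule order_trans[OF IXs_PTs PTs_qpaths])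

lemma IXs_basis_paths: "IXs t d \<subseteq> basis_paths"
  by (auto simp: IXs_def IX_def)

lemma nf_id_IXs: "keys z \<subseteq> IXs t d \<Longrightarrow> nf z = z"
  using IXs_basis_paths by (intro nf_id) blast

lemma preproj_V_basis_span: "preproj_V G a b t d = VS.span ((\<lambda>q. cls (sg q)) ` IXs t d)"
proof -
  have "VS.span ((\<lambda>q. cls (sg q)) ` IXs t d) = {cls (\<Sum>q\<in>IXs t d. c q *\<^sub>p sg q) | c. True}"
    by (rule span_cls) (use IXs_qpaths in auto)
  also have "\<dots> = {cls z | z. keys z \<subseteq> PTs t d}"
  proof (intro Set.set_eqI iffI)
    fix X assume "X \<in> {cls (\<Sum>q\<in>IXs t d. c q *\<^sub>p sg q) | c. True}"
    then obtain c where "X = cls (\<Sum>q\<in>IXs t d. c q *\<^sub>p sg q)" by blast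
    moreover have "keys (\<Sum>q\<in>IXs t d. c q *\<^sub>p sg q) \<subseteq> PTs t d"
      by (rule keys_sum_qpaths) (use IXs_PTs in auto)
    ultimately show "X \<in> {cls z | z. keys z \<subseteq> PTs t d}" by blast
  next
    fix X assume "X \<in> {cls z | z. keys z \<subseteq> PTs t d}"
    then obtain z where z: "X = cls z" "keys z \<subseteq> PTs t d" by blast
    have "cls z = cls (nf z)" by (rule cls_nf[symmetric]) (use z PTs_qpaths in blast)
    also have "nf z = (\<Sum>q\<in>IXs t d. lookup (nf z) q *\<^sub>p sg q)"
      by (rule sum_sg_superset[OF finite_IXs keys_nf_IXs[OF z(2)]])
    finally have "X = cls (\<Sum>q\<in>IXs t d. lookup (nf z) q *\<^sub>p sg q)" using z(1) by simp
    then show "X \<in> {cls (\<Sum>q\<in>IXs t d. c q *\<^sub>p sg q) | c. True}"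
      by (intro CollectI exI[of _ "lookup (nf z)"] conjI TrueI)
  qed
  finally show ?thesis by (simp add: preproj_V_eq)
qed

lemma IXs_independent: "(\<Sum>i\<in>IXs t d. c i *\<^sub>p sg i) \<in> J \<Longrightarrow> i \<in> IXs t d \<Longrightarrow> c i = (0::'k)"
proof -
  assume J: "(\<Sum>i\<in>IXs t d. c i *\<^sub>p sg i) \<in> J" and i: "i \<in> IXs t d"
  have "keys (\<Sum>i\<in>IXs t d. c i *\<^sub>p sg i) \<subseteq> IXs t d" by (rule keys_sum_qpaths) simp
  then have "(\<Sum>i\<in>IXs t d. c i *\<^sub>p sg i) = 0" using nf_J[OF J] nf_id_IXs by simp
  then have "lookup (\<Sum>i\<in>IXs t d. c i *\<^sub>p sg i) i = 0" by simp
  then show "c i = 0" using i by (simp add: lookup_sum_sg)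
qed

lemma preproj_V_basis:
  shows "vectorspace class_ring (P\<lparr>carrier := preproj_V G a b t d\<rparr>)"
    "vectorspace.basis class_ring (P\<lparr>carrier := preproj_V G a b t d\<rparr>) ((\<lambda>q. cls (sg q)) ` IXs t d)"
    "subspace_dim P (preproj_V G a b t d) = card (IXs t d)"
    "LinearCombinations.submodule class_ring (preproj_V G a b t d) P"
proof -
  have ks: "keys (sg i) \<subseteq> qpaths H" if "i \<in> IXs t d" for i
    using subsetD[OF IXs_qpaths that] by simp
  have carr: "(\<lambda>q. cls (sg q)) ` IXs t d \<subseteq> carrier P" using ks cls_carrier by blast
  show "vectorspace class_ring (P\<lparr>carrier := preproj_V G a b t d\<rparr>)"
    unfolding preproj_V_basis_span by (rule vectorspace_span[OF carr])
  show "LinearCombinations.submodule class_ring (preproj_V G a b t d) P"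
    unfolding preproj_V_basis_span by (rule VS.span_is_submodule[OF carr])
  show "vectorspace.basis class_ring (P\<lparr>carrier := preproj_V G a b t d\<rparr>) ((\<lambda>q. cls (sg q)) ` IXs t d)"
    "subspace_dim P (preproj_V G a b t d) = card (IXs t d)"
    unfolding preproj_V_basis_span
    by (rule basis_span_cls[where I = "IXs t d" and u = sg, OF finite_IXs _ _ refl],
        erule ks, erule IXs_independent, assumption)+
qed

lemma preproj_V_crd:
  assumes "X \<in> preproj_V G a b t d"
  shows "X \<in> carrier P" "keys (crd X) \<subseteq> IXs t d" "cls (crd X) = X"
proof -
  obtain z where z: "X = cls z" "keys z \<subseteq> PTs t d" using assms unfolding preproj_V_eq by blast
  then have zq: "keys z \<subseteq> qpaths H" using PTs_qpaths by blast
  then show "X \<in> carrier P" using z cls_carrier by simp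
  then show "cls (crd X) = X" by (rule crd_carrier)
  show "keys (crd X) \<subseteq> IXs t d" using z zq keys_nf_IXs by (simp add: crd_cls)
qed

text \<open>All paths occurring in \<open>J\<close> have length at least two, so arrows stay
  independent in the quotient. Hence the dimension of \<open>W\<^sub>i\<close> is the number of
  arrows involved.\<close>

lemma arrows_dim:
  assumes "finite S" "S \<subseteq> arcs H"
  shows "subspace_dim P (VS.span (preproj_arrow G a b ` S)) = card S"
proof (rule basis_span_cls(2)[where u = arr])
  show "keys (arr \<alpha>) \<subseteq> qpaths H" if "\<alpha> \<in> S" for \<alpha> using that assms(2) by (intro arcs_keys) blast
  fix c \<alpha> assume J: "(\<Sum>\<alpha>\<in>S. c \<alpha> *\<^sub>p arr \<alpha>) \<in> J" and \<alpha>: "\<alpha> \<in> S"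
  have "lookup (\<Sum>\<beta>\<in>S. c \<beta> *\<^sub>p arr \<beta>) (tail H \<alpha>, [\<alpha>]) = (\<Sum>\<beta>\<in>S. if \<beta> = \<alpha> then c \<alpha> else 0)"
    unfolding lookup_lincomb by (intro sum.cong refl) (auto simp: arrow_elem_def lookup_single when_def)
  also have "\<dots> = c \<alpha>" using \<alpha> assms(1) by simp
  finally show "c \<alpha> = 0"
    using J_length[OF J, of "(tail H \<alpha>, [\<alpha>])"] by (auto simp: in_keys_iff)
qed (use assms in \<open>auto simp: preproj_arrow_def\<close>)

end

text \<open>Here \<open>Suc d\<close> plays the role of the \<open>d\<close> of the theorem. \<open>nbr_vertex i\<close> and \<open>nbr_degree i\<close> are the vertex and
  the degree of \<open>V\<^sub>i\<close>, and a tuple \<open>z\<close> stands for the tuple \<open>b'\<close> of the classes of its entries.\<close>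

locale preproj_nbr = preproj G a b for G :: "('v, 'e) pre_digraph" and a b :: "'e \<Rightarrow> 'k::field" +
  fixes t :: 'v and d :: nat and ss us :: "'v list" and \<beta> :: "nat \<Rightarrow> 'e list"
    and num :: "nat \<Rightarrow> nat" and m :: "nat \<Rightarrow> nat \<Rightarrow> 'k mat"
  assumes enum: "nbr_enum G t ss us \<beta>"
begin

definition l where "l = length ss + length us"
definition nbr_arrow where "nbr_arrow i q = (if i < length ss then Inr (\<beta> i ! q) else Inl (\<beta> i ! q))"
definition nbr_vertex where "nbr_vertex i = (if i < length ss then ss ! i else us ! (i - length ss))"
definition nbr_degree where "nbr_degree i = (if i < length ss then d else Suc d)"
abbreviation IV where "IV i \<equiv> IXs (nbr_vertex i) (nbr_degree i)"
abbreviation IU where "IU \<equiv> IXs t (Suc d)"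
abbreviation dimV where "dimV i \<equiv> card (IV i)"
abbreviation dimW where "dimW i \<equiv> length (\<beta> i)"
text \<open>A representative of the basis vector \<open>w\<^sub>i\<^sub>,\<^sub>q\<close> of
  \<open>W\<^sub>i\<close>; \<open>eps\<close> supplies the coefficient, a or -b, which is also that
  of the mesh relation.\<close>

definition w where "w i q = eps (nbr_arrow i q) *\<^sub>p arr (nbr_arrow i q)"

lemma enumD:
  shows "distinct ss" "set ss = {s. \<exists>\<gamma>\<in>arcs G. tail G \<gamma> = s \<and> head G \<gamma> = t}"
    "distinct us" "set us = {u. \<exists>\<gamma>\<in>arcs G. tail G \<gamma> = t \<and> head G \<gamma> = u}"
    "i < length ss \<Longrightarrow> set (\<beta> i) = {\<gamma> \<in> arcs G. tail G \<gamma> = ss ! i \<and> head G \<gamma> = t}"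
    "\<not> i < length ss \<Longrightarrow> i < l \<Longrightarrow> set (\<beta> i) = {\<gamma> \<in> arcs G. tail G \<gamma> = t \<and> head G \<gamma> = us ! (i - length ss)}"
    "i < l \<Longrightarrow> distinct (\<beta> i)"
proof -
  note e = enum[unfolded nbr_enum_def]
  show "distinct ss" "set ss = {s. \<exists>\<gamma>\<in>arcs G. tail G \<gamma> = s \<and> head G \<gamma> = t}"
    "distinct us" "set us = {u. \<exists>\<gamma>\<in>arcs G. tail G \<gamma> = t \<and> head G \<gamma> = u}"
    using e by blast+
  show "i < length ss \<Longrightarrow> set (\<beta> i) = {\<gamma> \<in> arcs G. tail G \<gamma> = ss ! i \<and> head G \<gamma> = t}"
    using e by blast
  have 2: "\<forall>i<length us. distinct (\<beta> (length ss + i)) \<and>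
    set (\<beta> (length ss + i)) = {\<gamma> \<in> arcs G. tail G \<gamma> = t \<and> head G \<gamma> = us ! i}"
    using e by blast
  show "set (\<beta> i) = {\<gamma> \<in> arcs G. tail G \<gamma> = t \<and> head G \<gamma> = us ! (i - length ss)}" if "\<not> i < length ss" "i < l"
    using 2[rule_format, of "i - length ss"] that by (simp add: l_def)
  show "distinct (\<beta> i)" if "i < l"
  proof (cases "i < length ss")
    case True
    then show ?thesis using e by blast
  next
    case False
    then show ?thesis using 2[rule_format, of "i - length ss"] that by (simp add: l_def)
  qed
qed

lemma nbr_arrow_arc:
  assumes "i < l" "q < dimW i"
  shows "nbr_arrow i q \<in> arcs H" "tail H (nbr_arrow i q) = t" "head H (nbr_arrow i q) = nbr_vertex i" "nbr_degree i = Suc d - deg (nbr_arrow i q)"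
    "nbr_degree i + deg (nbr_arrow i q) = Suc d"
proof -
  have "\<beta> i ! q \<in> set (\<beta> i)" using assms(2) by simp
  then show "nbr_arrow i q \<in> arcs H" "tail H (nbr_arrow i q) = t" "head H (nbr_arrow i q) = nbr_vertex i" "nbr_degree i = Suc d - deg (nbr_arrow i q)"
    "nbr_degree i + deg (nbr_arrow i q) = Suc d"
    using enumD(5)[of i] enumD(6)[of i] assms(1) by (auto simp: nbr_arrow_def nbr_vertex_def nbr_degree_def)
qed

lemma nbr_arrow_surj:
  assumes "\<alpha> \<in> arcs H" "tail H \<alpha> = t"
  obtains i q where "i < l" "q < dimW i" "nbr_arrow i q = \<alpha>"
proof (cases \<alpha>)
  case (Inl \<gamma>)
  then have "head G \<gamma> \<in> set us" using assms enumD(4) by auto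
  then obtain i where i: "i < length us" "us ! i = head G \<gamma>" by (auto simp: in_set_conv_nth)
  then have "\<gamma> \<in> set (\<beta> (length ss + i))"
    using enumD(6)[of "length ss + i"] assms Inl by (simp add: l_def)
  then obtain q where "q < dimW (length ss + i)" "\<beta> (length ss + i) ! q = \<gamma>" by (auto simp: in_set_conv_nth)
  then show ?thesis using that[of "length ss + i" q] i Inl by (simp add: l_def nbr_arrow_def)
next
  case (Inr \<gamma>)
  then have "tail G \<gamma> \<in> set ss" using assms enumD(2) by auto
  then obtain i where i: "i < length ss" "ss ! i = tail G \<gamma>" by (auto simp: in_set_conv_nth)
  then have "\<gamma> \<in> set (\<beta> i)"
    using enumD(5)[of i] assms Inr by simp
  then obtain q where "q < dimW i" "\<beta> i ! q = \<gamma>" by (auto simp: in_set_conv_nth)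
  then show ?thesis using that[of i q] i Inr by (simp add: l_def nbr_arrow_def)
qed

text \<open>The degree tells the neighbours along arrows into \<open>t\<close> from those along
  arrows out of \<open>t\<close>; within each kind the vertices are listed without
  repetition.\<close>

lemma nbr_vertex_nbr_degree_inj:
  assumes "i < l" "j < l" "nbr_vertex i = nbr_vertex j" "nbr_degree i = nbr_degree j"
  shows "i = j"
proof (cases "i < length ss")
  case True
  then have "j < length ss" using assms(4) by (auto simp: nbr_degree_def split: if_splits)
  then show ?thesis using True assms(3) enumD(1) by (simp add: nbr_vertex_def nth_eq_iff_index_eq)
next
  case False
  then have "\<not> j < length ss" using assms(4) by (auto simp: nbr_degree_def split: if_splits)
  then show ?thesis using False assms enumD(3) by (simp add: nbr_vertex_def l_def nth_eq_iff_index_eq)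
qed

lemma nbr_arrow_inj:
  assumes "i < l" "q < dimW i" "j < l" "q' < dimW j" "nbr_arrow i q = nbr_arrow j q'"
  shows "i = j \<and> q = q'"
proof -
  have "i = j"
    by (rule nbr_vertex_nbr_degree_inj) (use nbr_arrow_arc[OF assms(1,2)] nbr_arrow_arc[OF assms(3,4)] assms in auto)
  moreover have "\<beta> i ! q = \<beta> j ! q'" using assms(5) by (auto simp: nbr_arrow_def split: if_splits)
  ultimately show ?thesis using assms enumD(7)[of i] by (simp add: nth_eq_iff_index_eq)
qed

lemma sum_out: "(\<Sum>\<alpha>\<in>{\<alpha> \<in> arcs H. tail H \<alpha> = t}. f \<alpha>) = (\<Sum>i<l. \<Sum>q<dimW i. f (nbr_arrow i q) :: 'z::comm_monoid_add)"
proof -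
  have "inj_on (\<lambda>(i, q). nbr_arrow i q) (SIGMA i:{..<l}. {..<dimW i})"
    using nbr_arrow_inj by (fastforce simp: inj_on_def)
  moreover have "{\<alpha> \<in> arcs H. tail H \<alpha> = t} = (\<lambda>(i, q). nbr_arrow i q) ` (SIGMA i:{..<l}. {..<dimW i})"
  proof (intro Set.set_eqI iffI)
    fix \<alpha> assume "\<alpha> \<in> {\<alpha> \<in> arcs H. tail H \<alpha> = t}"
    then obtain i q where "i < l" "q < dimW i" "nbr_arrow i q = \<alpha>" using nbr_arrow_surj by blast
    then show "\<alpha> \<in> (\<lambda>(i, q). nbr_arrow i q) ` (SIGMA i:{..<l}. {..<dimW i})" by (intro image_eqI[of _ _ "(i, q)"]) auto
  qed (use nbr_arrow_arc in auto)
  ultimately show ?thesis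
    by (simp only: sum.reindex) (simp add: sum.Sigma split_beta)
qed

lemma sum_pair_delta:
  assumes "i < l" "q < dimW i"
  shows "(\<Sum>i'<l. \<Sum>q'<dimW i'. if nbr_arrow i q = nbr_arrow i' q' then f i' q' else 0) = (f i q :: 'z::comm_monoid_add)"
proof -
  have "(\<Sum>i'<l. \<Sum>q'<dimW i'. if nbr_arrow i q = nbr_arrow i' q' then f i' q' else 0) =
    (\<Sum>i'<l. if i' = i then \<Sum>q'<dimW i. if q' = q then f i q else 0 else 0)"
  proof (intro sum.cong refl)
    fix i' assume i': "i' \<in> {..<l}"
    have "(if nbr_arrow i q = nbr_arrow i' q' then f i' q' else 0) = (if i' = i then if q' = q then f i q else 0 else 0)" if "q' < dimW i'" for q'
    proof (cases "nbr_arrow i q = nbr_arrow i' q'")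
      case True
      then show ?thesis using nbr_arrow_inj[OF assms _ that] i' by simp
    next
      case False
      then show ?thesis by (cases "i' = i"; cases "q' = q") simp_all
    qed
    then show "(\<Sum>q'<dimW i'. if nbr_arrow i q = nbr_arrow i' q' then f i' q' else 0) =
      (if i' = i then \<Sum>q'<dimW i. if q' = q then f i q else 0 else 0)" by auto
  qed
  then show ?thesis using assms by simp
qed

text \<open>The product \<open>b'\<^sub>i M x\<^sub>i\<close> computed with representatives in the
  path algebra; \<open>row_mat_col_eq\<close> relates it to the quotient.\<close>

definition row_product :: "(nat \<Rightarrow> nat \<Rightarrow> 'k) \<Rightarrow> (nat \<Rightarrow> nat \<Rightarrow> (('v, 'e + 'e) qpath \<Rightarrow>\<^sub>0 'k)) \<Rightarrow> nat \<Rightarrow> (('v, 'e + 'e) qpath \<Rightarrow>\<^sub>0 'k)" where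
  "row_product M z i = (\<Sum>q<dimW i. (\<Sum>p<dimV i. M p q *\<^sub>p z i p) \<star> w i q)"

definition row_tuples :: "(nat \<Rightarrow> nat \<Rightarrow> (('v, 'e + 'e) qpath \<Rightarrow>\<^sub>0 'k)) set" where
  "row_tuples = {z. \<forall>i<l. \<forall>p<dimV i. keys (z i p) \<subseteq> IV i}"

text \<open>Tuples whose rows are bases of the \<open>V\<^sub>i\<close>, since each row has as many
  entries as the dimension. For these a nonzero combination of the matrices cannot annihilate the
  row.\<close>

definition indep_tuples :: "(nat \<Rightarrow> nat \<Rightarrow> (('v, 'e + 'e) qpath \<Rightarrow>\<^sub>0 'k)) set" where
  "indep_tuples = {z \<in> row_tuples. \<forall>i<l. indep (IV i) {..<dimV i} (\<lambda>p. lookup (z i p))}"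

definition col_index :: "(nat \<times> nat) set" where "col_index = (SIGMA i:{..<l}. {..<num i})"

abbreviation mat_entry :: "nat \<times> nat \<Rightarrow> nat \<Rightarrow> nat \<Rightarrow> 'k" where
  "mat_entry c p q \<equiv> m (fst c) (snd c) $$ (p, q)"

definition col :: "(nat \<Rightarrow> nat \<Rightarrow> (('v, 'e + 'e) qpath \<Rightarrow>\<^sub>0 'k)) \<Rightarrow> nat \<times> nat \<Rightarrow> ('v, 'e + 'e) qpath \<Rightarrow> 'k" where
  "col z c u = lookup (nf (row_product (mat_entry c) z (fst c))) u"

text \<open>By bilinearity a combination of the columns with coefficients \<open>s\<close> is the
  sum over \<open>i\<close> of the products formed with these combined matrices
  (\<open>sum_col\<close>).\<close>

definition comb_mat :: "(nat \<times> nat \<Rightarrow> 'k) \<Rightarrow> nat \<Rightarrow> nat \<Rightarrow> nat \<Rightarrow> 'k" where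
  "comb_mat s i p q = (\<Sum>j<num i. s (i, j) * m i j $$ (p, q))"

section \<open>The linear family of columns and its rank\<close>

lemma keys_mult_w:
  assumes "i < l" "q < dimW i" "keys z \<subseteq> PTs (nbr_vertex i) (nbr_degree i)"
  shows "keys (z \<star> w i q) \<subseteq> PTs t (Suc d)"
  using keys_mult_arr_PTs[of "nbr_arrow i q" z "nbr_degree i"] nbr_arrow_arc[OF assms(1,2)] assms(3)
  by (simp add: w_def qpath_mult_scale_right keys_scale_subset)

lemma keys_row_product:
  assumes "z \<in> row_tuples" "i < l"
  shows "keys (row_product M z i) \<subseteq> PTs t (Suc d)"
  unfolding row_product_def
proof (rule keys_sum_subset)
  fix q assume "q \<in> {..<dimW i}"
  then have q: "q < dimW i" by simp
  have "keys (\<Sum>p<dimV i. M p q *\<^sub>p z i p) \<subseteq> IV i"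
    by (rule keys_sum_qpaths) (use assms in \<open>auto simp: row_tuples_def\<close>)
  then have "keys (\<Sum>p<dimV i. M p q *\<^sub>p z i p) \<subseteq> PTs (nbr_vertex i) (nbr_degree i)" by (rule order_trans[OF _ IXs_PTs])
  then show "keys ((\<Sum>p<dimV i. M p q *\<^sub>p z i p) \<star> w i q) \<subseteq> PTs t (Suc d)"
    by (rule keys_mult_w[OF assms(2) q])
qed

lemma row_product_lincomb: "row_product (comb_mat s i) z i = (\<Sum>j<num i. s (i, j) *\<^sub>p row_product (mat_entry (i, j)) z i)"
proof -
  have "(\<Sum>p<dimV i. comb_mat s i p q *\<^sub>p z i p) = (\<Sum>j<num i. s (i, j) *\<^sub>p (\<Sum>p<dimV i. mat_entry (i, j) p q *\<^sub>p z i p))" for q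
  proof -
    have "comb_mat s i p q *\<^sub>p z i p = (\<Sum>j<num i. s (i, j) *\<^sub>p mat_entry (i, j) p q *\<^sub>p z i p)" for p
      by (intro poly_mapping_eqI) (simp add: lookup_scale lookup_sum comb_mat_def sum_distrib_right mult.assoc)
    then have "(\<Sum>p<dimV i. comb_mat s i p q *\<^sub>p z i p) = (\<Sum>p<dimV i. \<Sum>j<num i. s (i, j) *\<^sub>p mat_entry (i, j) p q *\<^sub>p z i p)" by simp
    also have "\<dots> = (\<Sum>j<num i. \<Sum>p<dimV i. s (i, j) *\<^sub>p mat_entry (i, j) p q *\<^sub>p z i p)" by (rule sum.swap)
    finally show ?thesis by (simp add: pscale_sum)
  qed
  then have "row_product (comb_mat s i) z i = (\<Sum>q<dimW i. \<Sum>j<num i. s (i, j) *\<^sub>p ((\<Sum>p<dimV i. mat_entry (i, j) p q *\<^sub>p z i p) \<star> w i q))"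
    by (simp add: row_product_def linmap_sum[OF linmap_mult_left'] qpath_mult_scale_left)
  also have "\<dots> = (\<Sum>j<num i. \<Sum>q<dimW i. s (i, j) *\<^sub>p ((\<Sum>p<dimV i. mat_entry (i, j) p q *\<^sub>p z i p) \<star> w i q))"
    by (rule sum.swap)
  finally show ?thesis by (simp add: row_product_def pscale_sum)
qed

lemma sum_col: "(\<Sum>c\<in>col_index. s c * col z c u) = lookup (nf (\<Sum>i<l. row_product (comb_mat s i) z i)) u"
proof -
  have "(\<Sum>c\<in>col_index. s c * col z c u) = (\<Sum>i<l. \<Sum>j<num i. s (i, j) * col z (i, j) u)"
    unfolding col_index_def by (subst sum.Sigma) (auto simp: split_beta)
  also have "\<dots> = (\<Sum>i<l. lookup (nf (row_product (comb_mat s i) z i)) u)"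
    unfolding row_product_lincomb
    by (simp add: col_def linmap_sum[OF linmap_nf] linmap_scale[OF linmap_nf] lookup_sum lookup_scale)
  finally show ?thesis by (simp add: linmap_sum[OF linmap_nf] lookup_sum)
qed

lemma col_line: "col (\<lambda>i p. z i p + c *\<^sub>p z' i p) x u = col z x u + c * col z' x u"
proof -
  have "row_product M (\<lambda>i p. z i p + c *\<^sub>p z' i p) i = row_product M z i + c *\<^sub>p row_product M z' i" for M i
    by (simp add: row_product_def pscale_distribs sum.distrib pscale_sum qpath_mult_add_left mult.commute
        linmap_sum[OF linmap_mult_left'] qpath_mult_scale_left)
  then show ?thesis
    by (simp add: col_def linmap_add[OF linmap_nf] linmap_scale[OF linmap_nf] lookup_add lookup_scale)
qed

lemma indep_tuples_nonempty: "\<exists>z. z \<in> indep_tuples"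
proof -
  have "\<forall>i. \<exists>e. bij_betw e {0..<dimV i} (IV i)" using ex_bij_betw_nat_finite[OF finite_IXs] by blast
  then obtain e where e: "\<And>i. bij_betw (e i) {0..<dimV i} (IV i)" by metis
  have eI: "e i p \<in> IV i" if "p < dimV i" for i p using bij_betwE[OF e] that by simp
  have e_inj: "e i p = e i p' \<longleftrightarrow> p = p'" if "p < dimV i" "p' < dimV i" for i p p'
    using e[of i] that unfolding bij_betw_def inj_on_def by auto
  define z :: "nat \<Rightarrow> nat \<Rightarrow> (('v, 'e + 'e) qpath \<Rightarrow>\<^sub>0 'k)" where "z = (\<lambda>i p. sg (e i p))"
  have "z \<in> indep_tuples"
    unfolding indep_tuples_def row_tuples_def
  proof (intro CollectI conjI allI impI)
    show "keys (z i p) \<subseteq> IV i" if "p < dimV i" for i p using eI[OF that] by (simp add: z_def)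
    show "indep (IV i) {..<dimV i} (\<lambda>p. lookup (z i p))" for i
      unfolding indep_def
    proof (intro allI impI ballI)
      fix s p assume s: "\<forall>u\<in>IV i. (\<Sum>p<dimV i. s p * lookup (z i p) u) = 0" and "p \<in> {..<dimV i}"
      then have p: "p < dimV i" by simp
      have "0 = (\<Sum>p'<dimV i. s p' * lookup (z i p') (e i p))" using s eI[OF p] by simp
      also have "\<dots> = (\<Sum>p'<dimV i. if p' = p then s p else 0)"
        by (intro sum.cong refl) (auto simp: z_def lookup_single when_def e_inj p)
      finally show "s p = 0" using p by simp
    qed
  qed
  then show ?thesis by blast
qed

lemma indep_tuples_line:
  assumes "z \<in> indep_tuples" "z' \<in> row_tuples"
  shows "finite {c. (\<lambda>i p. z i p + c *\<^sub>p z' i p) \<notin> indep_tuples}"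
proof -
  have T: "(\<lambda>i p. z i p + c *\<^sub>p z' i p) \<in> row_tuples" for c
    unfolding row_tuples_def
    by (intro CollectI allI impI keys_add_subset keys_scale_subset) (use assms in \<open>simp_all add: row_tuples_def indep_tuples_def\<close>)
  have "finite {c. \<not> indep (IV i) {..<dimV i} (\<lambda>p u. lookup (z i p) u + c * lookup (z' i p) u)}" if "i < l" for i
    by (rule indep_line) (use assms that in \<open>auto simp: indep_tuples_def\<close>)
  then have "finite (\<Union>i<l. {c. \<not> indep (IV i) {..<dimV i} (\<lambda>p u. lookup (z i p) u + c * lookup (z' i p) u)})" by blast
  moreover have "{c. (\<lambda>i p. z i p + c *\<^sub>p z' i p) \<notin> indep_tuples} \<subseteq>
    (\<Union>i<l. {c. \<not> indep (IV i) {..<dimV i} (\<lambda>p u. lookup (z i p) u + c * lookup (z' i p) u)})"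
  proof
    fix c assume "c \<in> {c. (\<lambda>i p. z i p + c *\<^sub>p z' i p) \<notin> indep_tuples}"
    then obtain i where i: "i < l" "\<not> indep (IV i) {..<dimV i} (\<lambda>p. lookup (z i p + c *\<^sub>p z' i p))"
      using T[of c] by (auto simp: indep_tuples_def)
    moreover have "(\<lambda>p. lookup (z i p + c *\<^sub>p z' i p)) = (\<lambda>p u. lookup (z i p) u + c * lookup (z' i p) u)"
      by (intro ext) (simp add: lookup_add lookup_scale)
    ultimately show "c \<in> (\<Union>i<l. {c. \<not> indep (IV i) {..<dimV i} (\<lambda>p u. lookup (z i p) u + c * lookup (z' i p) u)})"
      by auto
  qed
  ultimately show ?thesis by (rule finite_subset[rotated])
qed

text \<open>Supplies the assumption \<open>sep\<close> of \<open>full_rank_exists\<close>. A kernel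
  vector \<open>s\<close> gives a relation among the \<open>w i q\<close>, so by exactness its
  coefficients are the components of some \<open>x\<close>. As the rows of \<open>z\<close> are
  bases and the matrices are independent, \<open>s \<noteq> 0\<close> forces \<open>x\<close> to be
  nonzero, and \<open>multiplication_spans\<close> applies to the functional \<phi>.\<close>

lemma kernel_image_separation:
  assumes m_carr: "\<And>i j. i < l \<Longrightarrow> j < num i \<Longrightarrow> m i j \<in> carrier_mat (dimV i) (dimW i)"
    and m_inj: "\<And>i. i < l \<Longrightarrow> inj_on (m i) {..<num i}"
    and m_li: "\<And>i. i < l \<Longrightarrow> \<not> LinearCombinations.module.lin_dep class_ring (module_mat TYPE('k) (dimV i) (dimW i)) (m i ` {..<num i})"
    and z: "z \<in> indep_tuples" and s: "\<exists>c\<in>col_index. s c \<noteq> 0"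
    and ker: "\<And>u. u \<in> IU \<Longrightarrow> (\<Sum>c\<in>col_index. s c * col z c u) = 0"
    and ann: "\<And>z'. z' \<in> row_tuples \<Longrightarrow> (\<Sum>u\<in>IU. \<phi> u * (\<Sum>c\<in>col_index. s c * col z' c u)) = 0"
    and u: "u \<in> IU"
  shows "\<phi> u = 0"
proof -
  have zT: "z \<in> row_tuples" using z by (simp add: indep_tuples_def)
  define Z where "Z = (\<lambda>i q. \<Sum>p<dimV i. comb_mat s i p q *\<^sub>p z i p)"
  have Z_keys: "keys (Z i q) \<subseteq> IV i" if "i < l" for i q
    unfolding Z_def by (rule keys_sum_qpaths) (use zT that in \<open>auto simp: row_tuples_def\<close>)
  have Z_PTs: "keys (Z i q) \<subseteq> PTs (nbr_vertex i) (nbr_degree i)" if "i < l" for i q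
    by (rule order_trans[OF Z_keys[OF that] IXs_PTs])
  define f where "f = (\<Sum>i<l. row_product (comb_mat s i) z i)"
  have f_eq: "f = (\<Sum>i<l. \<Sum>q<dimW i. Z i q \<star> w i q)"
    by (simp add: f_def row_product_def Z_def)
  have f_keys: "keys f \<subseteq> PTs t (Suc d)"
    unfolding f_def by (rule keys_sum_subset) (use keys_row_product[OF zT] in auto)
  have "nf f = 0"
  proof (rule poly_mapping_eqI)
    fix v show "lookup (nf f) v = lookup 0 v"
      using ker[of v] keys_nf_IXs[OF f_keys] unfolding sum_col f_def[symmetric]
      by (cases "v \<in> IU") (auto simp: in_keys_iff)
  qed
  then have fJ: "f \<in> J" by (simp add: nf_eq_0_iff)
  have strip_f: "strip (nbr_arrow i q) f = eps (nbr_arrow i q) *\<^sub>p Z i q" if iq: "i < l" "q < dimW i" for i q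
  proof -
    have "strip (nbr_arrow i q) (Z i' q' \<star> w i' q') = (if nbr_arrow i q = nbr_arrow i' q' then eps (nbr_arrow i' q') *\<^sub>p Z i' q' else 0)"
      if "i' < l" "q' < dimW i'" for i' q'
    proof -
      have "fst p = head H (nbr_arrow i' q')" if "p \<in> keys (Z i' q')" for p
        using Z_PTs[OF \<open>i' < l\<close>, of q'] that nbr_arrow_arc(3)[OF \<open>i' < l\<close> \<open>q' < dimW i'\<close>] by (auto simp: PTs_def)
      then show ?thesis
        by (simp add: w_def qpath_mult_scale_right linmap_scale[OF linmap_strip] strip_mult_arr)
    qed
    then have "strip (nbr_arrow i q) f = (\<Sum>i'<l. \<Sum>q'<dimW i'. if nbr_arrow i q = nbr_arrow i' q' then eps (nbr_arrow i' q') *\<^sub>p Z i' q' else 0)"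
      by (simp add: f_eq linmap_sum[OF linmap_strip])
    then show ?thesis by (simp only: sum_pair_delta[OF iq])
  qed
  obtain x where x: "keys x \<subseteq> PTs t d"
    "\<forall>\<alpha>\<in>arcs H. tail H \<alpha> = t \<longrightarrow> strip \<alpha> f - eps \<alpha> *\<^sub>p (x \<star> arr (bar \<alpha>)) \<in> J"
    using J_strip_homogeneous[OF fJ f_keys] by blast
  have Zx: "nf (x \<star> arr (bar (nbr_arrow i q))) = Z i q" if iq: "i < l" "q < dimW i" for i q
  proof -
    have "strip (nbr_arrow i q) f - eps (nbr_arrow i q) *\<^sub>p (x \<star> arr (bar (nbr_arrow i q))) \<in> J"
      using x(2) nbr_arrow_arc[OF iq] by blast
    then have "eps (nbr_arrow i q) *\<^sub>p (Z i q - x \<star> arr (bar (nbr_arrow i q))) \<in> J"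
      unfolding strip_f[OF iq] pscale_right_diff .
    then have "nf (Z i q) = nf (x \<star> arr (bar (nbr_arrow i q)))"
      using J_scale_iff[OF eps_nz[OF nbr_arrow_arc(1)[OF iq]]] by (simp add: nf_eq_iff)
    then show ?thesis using nf_id_IXs[OF Z_keys[OF iq(1)]] by simp
  qed
  have "x \<notin> J"
  proof
    assume "x \<in> J"
    then have Z0: "Z i q = 0" if "i < l" "q < dimW i" for i q
      using Zx[OF that] J_mult_arr[of "bar (nbr_arrow i q)" x] nbr_arrow_arc(1)[OF that] by (simp add: nf_J)
    have "comb_mat s i p q = 0" if i: "i < l" and p: "p < dimV i" and q: "q < dimW i" for i p q
    proof (rule indepD[of "IV i" "{..<dimV i}" "\<lambda>p. lookup (z i p)" "\<lambda>p. comb_mat s i p q"])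
      show "indep (IV i) {..<dimV i} (\<lambda>p. lookup (z i p))" using z i by (simp add: indep_tuples_def)
      show "(\<Sum>p<dimV i. comb_mat s i p q * lookup (z i p) v) = 0" for v
        using arg_cong[OF Z0[OF i q], of "\<lambda>f. lookup f v"] by (simp add: Z_def lookup_lincomb)
    qed (use p in simp)
    then have "s (i, j) = 0" if "i < l" "j < num i" for i j
      using matrix_indep[of "num i" "m i" "dimV i" "dimW i" "\<lambda>j. s (i, j)" j] m_carr m_inj m_li that
      unfolding comb_mat_def by blast
    then show False using s by (auto simp: col_index_def)
  qed
  have "basis_functional t (Suc d) \<phi> (sg u) = 0"
  proof (rule multiplication_spans[OF x(1) \<open>x \<notin> J\<close>])
    fix \<alpha> j q assume \<alpha>: "\<alpha> \<in> arcs H" "tail H \<alpha> = t" and j: "j \<in> IXs (head H \<alpha>) (Suc d - deg \<alpha>)"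
      and q: "q \<in> PTs (head H \<alpha>) (Suc d - deg \<alpha>)"
    obtain i1 q1 where i1: "i1 < l" "q1 < dimW i1" "nbr_arrow i1 q1 = \<alpha>" using nbr_arrow_surj[OF \<alpha>] by blast
    have j: "j \<in> IV i1" and q: "q \<in> PTs (nbr_vertex i1) (nbr_degree i1)"
      using j q nbr_arrow_arc(3,4)[OF i1(1,2)] i1(3) by simp_all
    \<comment> \<open>The linear map of \<open>V\<^sub>i\<close> for \<open>i = i1\<close> that
      sends the basis path \<open>j\<close> to \<open>q\<close> and the other basis paths to zero,
      applied to the entries of row \<open>i1\<close>; the other rows are zero. In this way the
      image under the family becomes \<open>q\<close> times \<open>coord_vec t x j\<close> modulo
      \<open>J\<close>.\<close>
    define z' where "z' = (\<lambda>i p. if i = i1 then lookup (z i1 p) j *\<^sub>p nf (sg q) else 0)"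
    have z'T: "z' \<in> row_tuples"
      unfolding row_tuples_def z'_def using keys_nf_IXs[of "sg q" "nbr_vertex i1" "nbr_degree i1"] q
      by (simp add: keys_scale_subset)
    have "row_product (comb_mat s i) z' i = 0" if "i \<noteq> i1" for i
      using that by (simp add: row_product_def z'_def)
    then have "(\<Sum>i<l. row_product (comb_mat s i) z' i) = (\<Sum>i<l. if i = i1 then row_product (comb_mat s i1) z' i1 else 0)"
      by (intro sum.cong refl) auto
    also have "\<dots> = row_product (comb_mat s i1) z' i1" using i1 by simp
    also have "\<dots> = (\<Sum>q'<dimW i1. lookup (Z i1 q') j *\<^sub>p (nf (sg q) \<star> w i1 q'))"
    proof -
      have "(\<Sum>p<dimV i1. comb_mat s i1 p q' *\<^sub>p z' i1 p) = lookup (Z i1 q') j *\<^sub>p nf (sg q)" for q'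
        by (intro poly_mapping_eqI)
          (simp add: z'_def Z_def lookup_lincomb lookup_sum lookup_scale sum_distrib_right mult.assoc)
      then show ?thesis by (simp add: row_product_def qpath_mult_scale_left)
    qed
    finally have eq1: "(\<Sum>i<l. row_product (comb_mat s i) z' i) = (\<Sum>q'<dimW i1. lookup (Z i1 q') j *\<^sub>p (nf (sg q) \<star> w i1 q'))" .
    have "sg q \<star> coord_vec t x j = (\<Sum>i<l. \<Sum>q'<dimW i. lookup (Z i q') j *\<^sub>p (sg q \<star> w i q'))"
      unfolding coord_vec_def sum_out linmap_sum[OF linmap_mult_right']
      by (intro sum.cong refl) (simp add: Zx w_def qpath_mult_scale_right)
    also have "\<dots> = (\<Sum>i<l. if i = i1 then \<Sum>q'<dimW i1. lookup (Z i1 q') j *\<^sub>p (sg q \<star> w i1 q') else 0)"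
    proof (intro sum.cong refl)
      fix i assume i: "i \<in> {..<l}"
      show "(\<Sum>q'<dimW i. lookup (Z i q') j *\<^sub>p (sg q \<star> w i q')) =
        (if i = i1 then \<Sum>q'<dimW i1. lookup (Z i1 q') j *\<^sub>p (sg q \<star> w i1 q') else 0)"
      proof (cases "i = i1")
        case False
        have "j \<notin> IV i"
        proof
          assume "j \<in> IV i"
          then have "nbr_vertex i = nbr_vertex i1 \<and> nbr_degree i = nbr_degree i1" using j IX_unique unfolding IXs_iff by blast
          then show False using nbr_vertex_nbr_degree_inj[of i i1] i i1 False by simp
        qed
        then have "lookup (Z i q') j = 0" for q' using Z_keys[of i q'] i by (auto simp: in_keys_iff)
        then show ?thesis using False by simp
      qed simp
    qed
    also have "\<dots> = (\<Sum>q'<dimW i1. lookup (Z i1 q') j *\<^sub>p (sg q \<star> w i1 q'))" using i1 by simp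
    also have "\<dots> = (\<Sum>i<l. row_product (comb_mat s i) z' i) + (\<Sum>q'<dimW i1. lookup (Z i1 q') j *\<^sub>p ((sg q - nf (sg q)) \<star> w i1 q'))"
      unfolding eq1 sum.distrib[symmetric]
      by (intro sum.cong refl) (simp add: linmap_diff[OF linmap_mult_left'] pscale_right_diff)
    finally have eq2: "sg q \<star> coord_vec t x j = (\<Sum>i<l. row_product (comb_mat s i) z' i) + (\<Sum>q'<dimW i1. lookup (Z i1 q') j *\<^sub>p ((sg q - nf (sg q)) \<star> w i1 q'))" .
    have "(\<Sum>q'<dimW i1. lookup (Z i1 q') j *\<^sub>p ((sg q - nf (sg q)) \<star> w i1 q')) \<in> J"
      by (intro J_sum J_scale) (use nbr_arrow_arc(1)[OF i1(1)] in \<open>auto simp: w_def qpath_mult_scale_right intro!: J_scale J_mult_arr nf_cong_J\<close>)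
    then have "basis_functional t (Suc d) \<phi> (sg q \<star> coord_vec t x j) = basis_functional t (Suc d) \<phi> (\<Sum>i<l. row_product (comb_mat s i) z' i)"
      unfolding eq2 by (simp add: basis_functional_linear basis_functional_J)
    also have "\<dots> = (\<Sum>u\<in>IU. \<phi> u * (\<Sum>c\<in>col_index. s c * col z' c u))"
      unfolding sum_col by (simp add: basis_functional_def mult.commute)
    also have "\<dots> = 0" by (rule ann[OF z'T])
    finally show "basis_functional t (Suc d) \<phi> (sg q \<star> coord_vec t x j) = 0" .
  qed (use u IXs_PTs in blast)
  moreover have "nf (sg u :: _ \<Rightarrow>\<^sub>0 'k) = sg u" by (rule nf_id_IXs) (use u in simp)
  then have "basis_functional t (Suc d) \<phi> (sg u) = (\<Sum>i\<in>IU. if i = u then \<phi> u else 0)"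
    unfolding basis_functional_def by (intro sum.cong refl) (auto simp: lookup_single when_def)
  ultimately show ?thesis using u by simp
qed

lemma independent_columns_exist:
  assumes "\<And>i j. i < l \<Longrightarrow> j < num i \<Longrightarrow> m i j \<in> carrier_mat (dimV i) (dimW i)"
    and "\<And>i. i < l \<Longrightarrow> inj_on (m i) {..<num i}"
    and "\<And>i. i < l \<Longrightarrow> \<not> LinearCombinations.module.lin_dep class_ring (module_mat TYPE('k) (dimV i) (dimW i)) (m i ` {..<num i})"
    and num: "(\<Sum>i<l. num i) = card IU" and inf: "infinite (UNIV :: 'k set)"
  shows "\<exists>z\<in>indep_tuples. indep IU col_index (col z)"
proof -
  obtain z0 where z0: "z0 \<in> indep_tuples" using indep_tuples_nonempty by blast
  have fC: "finite col_index" by (simp add: col_index_def)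
  have cC: "card col_index = card IU" using num by (simp add: col_index_def)
  show ?thesis
  proof (rule full_rank_exists[where line = "\<lambda>z z' c i p. z i p + c *\<^sub>p z' i p" and T = row_tuples, OF inf fC finite_IXs cC z0])
    show "indep_tuples \<subseteq> row_tuples" by (auto simp: indep_tuples_def)
    show "col (\<lambda>i p. z i p + c *\<^sub>p z' i p) x u = col z x u + c * col z' x u" for z z' c x u
      by (rule col_line)
    show "finite {c. (\<lambda>i p. z i p + c *\<^sub>p z' i p) \<notin> indep_tuples}" if "z \<in> indep_tuples" "z' \<in> row_tuples" for z z'
      using that by (rule indep_tuples_line)
    show "\<phi> u = 0" if "z \<in> indep_tuples" "\<exists>c\<in>col_index. s c \<noteq> 0" "\<And>u. u \<in> IU \<Longrightarrow> (\<Sum>c\<in>col_index. s c * col z c u) = 0"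
      "\<And>z'. z' \<in> row_tuples \<Longrightarrow> (\<Sum>u\<in>IU. \<phi> u * (\<Sum>c\<in>col_index. s c * col z' c u)) = 0" "u \<in> IU" for z s \<phi> u
      by (rule kernel_image_separation[OF assms(1-3)]) (fact that | assumption)+
  qed
qed

end

text \<open>The bijections number rows and columns, as determinants require; the choice affects at
  most the sign, so the criterion is independent of it.\<close>

lemma det_nonzero_iff_indep:
  fixes v :: "'c \<Rightarrow> 'i \<Rightarrow> 'k::field"
  assumes e1: "bij_betw e1 {0..<N} I" and e2: "bij_betw e2 {0..<N} C"
  shows "det (mat N N (\<lambda>(r, c). v (e2 c) (e1 r))) \<noteq> 0 \<longleftrightarrow> indep I C v"
proof -
  let ?A = "mat N N (\<lambda>(r, c). v (e2 c) (e1 r))"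
  have A: "?A \<in> carrier_mat N N" by simp
  have mv: "(?A *\<^sub>v vec N (\<lambda>c. s (e2 c))) $ r = (\<Sum>c\<in>C. s c * v c (e1 r))" if r: "r < N" for s r
  proof -
    have "(?A *\<^sub>v vec N (\<lambda>c. s (e2 c))) $ r = (\<Sum>c\<in>{0..<N}. s (e2 c) * v (e2 c) (e1 r))"
      using r by (simp add: scalar_prod_def mult.commute)
    also have "\<dots> = (\<Sum>c\<in>C. s c * v c (e1 r))" by (rule sum.reindex_bij_betw[OF e2])
    finally show ?thesis .
  qed
  have e1I: "e1 r \<in> I" if "r < N" for r using bij_betwE[OF e1] that by simp
  have e1_ex: "\<exists>r<N. u = e1 r" if "u \<in> I" for u using e1 that unfolding bij_betw_def by fastforce
  have e2_ex: "\<exists>r<N. c = e2 r" if "c \<in> C" for c using e2 that unfolding bij_betw_def by fastforce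
  have "indep I C v" if det: "det ?A \<noteq> 0"
    unfolding indep_def
  proof (intro allI impI ballI)
    fix s c assume s: "\<forall>u\<in>I. (\<Sum>c\<in>C. s c * v c u) = 0" and c: "c \<in> C"
    have "?A *\<^sub>v vec N (\<lambda>c. s (e2 c)) = 0\<^sub>v N"
    proof (rule eq_vecI)
      fix r assume "r < dim_vec (0\<^sub>v N)"
      then show "(?A *\<^sub>v vec N (\<lambda>c. s (e2 c))) $ r = 0\<^sub>v N $ r" using s e1I by (simp only: mv index_zero_vec)
    qed simp
    then have "vec N (\<lambda>c. s (e2 c)) = 0\<^sub>v N"
      using det det_0_iff_vec_prod_zero_field[OF A] by (metis vec_carrier)
    moreover obtain r where "r < N" "c = e2 r" using e2_ex[OF c] by blast
    ultimately show "s c = 0" by (metis index_vec index_zero_vec(1))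
  qed
  moreover have "det ?A \<noteq> 0" if ind: "indep I C v"
  proof
    assume "det ?A = 0"
    then obtain x where x: "x \<in> carrier_vec N" "x \<noteq> 0\<^sub>v N" "?A *\<^sub>v x = 0\<^sub>v N"
      using det_0_iff_vec_prod_zero_field[OF A] by blast
    define s where "s = (\<lambda>c. x $ (the_inv_into {0..<N} e2 c))"
    have xs: "x = vec N (\<lambda>c. s (e2 c))"
      using x(1) the_inv_into_f_f[OF bij_betw_imp_inj_on[OF e2]] by (intro eq_vecI) (auto simp: s_def)
    have "s c = 0" if "c \<in> C" for c
    proof (rule indepD[OF ind _ that])
      fix u assume "u \<in> I"
      then obtain r where r: "r < N" "u = e1 r" using e1_ex by blast
      show "(\<Sum>c\<in>C. s c * v c u) = 0"
        using mv[OF r(1), of s] x(3) r by (simp only: xs[symmetric] index_zero_vec)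
    qed
    then have "x = 0\<^sub>v N"
      using bij_betwE[OF e2] by (subst xs) (intro eq_vecI, auto)
    then show False using x(2) by contradiction
  qed
  ultimately show ?thesis by blast
qed

section \<open>From generic independence to a dense open set of bases\<close>

context preproj_nbr
begin

abbreviation Vs where "Vs \<equiv> nbr_V G a b (Suc d) ss us"
abbreviation xs where "xs \<equiv> nbr_x G a b ss \<beta>"
abbreviation U where "U \<equiv> preproj_V G a b t (Suc d)"
abbreviation coords :: "(nat \<Rightarrow> nat \<Rightarrow> (('v, 'e + 'e) qpath \<Rightarrow>\<^sub>0 'k) set) \<Rightarrow> nat \<Rightarrow> nat \<Rightarrow> (('v, 'e + 'e) qpath \<Rightarrow>\<^sub>0 'k)"
  where "coords b' \<equiv> \<lambda>i p. crd (b' i p)"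

lemma Vs_eq: "Vs i = preproj_V G a b (nbr_vertex i) (nbr_degree i)"
  by (simp add: nbr_V_def nbr_vertex_def nbr_degree_def)

lemma dim_Vs: "subspace_dim P (Vs i) = dimV i"
  unfolding Vs_eq by (rule preproj_V_basis)

lemma dim_W:
  assumes "i < l"
  shows "subspace_dim P (nbr_W G a b ss \<beta> i) = dimW i"
proof -
  let ?S = "(\<lambda>\<gamma>. if i < length ss then Inr \<gamma> else Inl \<gamma>) ` set (\<beta> i) :: ('e + 'e) set"
  have "?S \<subseteq> arcs H"
  proof
    fix \<alpha> assume "\<alpha> \<in> ?S"
    then obtain \<gamma> where \<gamma>: "\<gamma> \<in> set (\<beta> i)" "\<alpha> = (if i < length ss then Inr \<gamma> else Inl \<gamma>)" by blast
    then obtain q where "q < dimW i" "\<gamma> = \<beta> i ! q" by (auto simp: in_set_conv_nth)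
    with \<gamma>(2) have "q < dimW i" "\<alpha> = nbr_arrow i q" by (simp_all add: nbr_arrow_def)
    then show "\<alpha> \<in> arcs H" using nbr_arrow_arc(1)[OF assms] by simp
  qed
  then have "subspace_dim P (VS.span (preproj_arrow G a b ` ?S)) = card ?S" by (intro arrows_dim) auto
  moreover have "card ?S = card (set (\<beta> i))" by (rule card_image) (auto simp: inj_on_def)
  moreover have "nbr_W G a b ss \<beta> i = VS.span (preproj_arrow G a b ` ?S)" unfolding nbr_W_def image_image ..
  ultimately show ?thesis by (simp only: distinct_card[OF enumD(7)[OF assms]])
qed

lemma keys_w: "i < l \<Longrightarrow> q < dimW i \<Longrightarrow> keys (w i q) \<subseteq> qpaths H"
  unfolding w_def by (intro keys_scale_subset arcs_keys nbr_arrow_arc)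

lemma xs_eq:
  assumes "i < l" "q < dimW i"
  shows "xs i q = cls (w i q)"
  using cls_scale[OF arcs_keys[OF nbr_arrow_arc(1)[OF assms]], of "eps (nbr_arrow i q)"]
  by (auto simp: nbr_x_def Let_def preproj_arrow_def w_def nbr_arrow_def)

lemma nbr_B_coords:
  assumes "b' \<in> nbr_B P l Vs" "i < l" "p < dimV i"
  shows "b' i p \<in> Vs i" "b' i p \<in> carrier P" "keys (crd (b' i p)) \<subseteq> IV i" "cls (crd (b' i p)) = b' i p"
proof -
  show "b' i p \<in> Vs i" using assms by (auto simp: nbr_B_def dim_Vs dest!: PiE_mem)
  then show "b' i p \<in> carrier P" "keys (crd (b' i p)) \<subseteq> IV i" "cls (crd (b' i p)) = b' i p"
    unfolding Vs_eq by (rule preproj_V_crd)+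
qed

lemma coords_row_tuples: "b' \<in> nbr_B P l Vs \<Longrightarrow> coords b' \<in> row_tuples"
  by (simp add: row_tuples_def nbr_B_coords)

lemma row_mat_col_eq:
  assumes b': "b' \<in> nbr_B P l Vs" and i: "i < l" and M: "M \<in> carrier_mat (dimV i) (dimW i)"
  shows "row_mat_col P (b' i) M (xs i) = cls (row_product (\<lambda>p q. M $$ (p, q)) (coords b') i)"
proof -
  let ?y = "\<lambda>q. \<Sum>p<dimV i. M $$ (p, q) *\<^sub>p crd (b' i p)"
  have kc: "keys (crd (b' i p)) \<subseteq> qpaths H" if "p < dimV i" for p
    using nbr_B_coords(3)[OF b' i that] IXs_qpaths by (rule order_trans)
  have ky: "keys (?y q) \<subseteq> qpaths H" for q by (rule keys_sum_qpaths) (use kc in simp)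
  have inner: "(\<Oplus>\<^bsub>P\<^esub>p\<in>{..<dimV i}. M $$ (p, q) \<odot>\<^bsub>P\<^esub> b' i p) = cls (?y q)" for q
  proof -
    have "(\<Oplus>\<^bsub>P\<^esub>p\<in>{..<dimV i}. M $$ (p, q) \<odot>\<^bsub>P\<^esub> b' i p) = (\<Oplus>\<^bsub>P\<^esub>p\<in>{..<dimV i}. cls (M $$ (p, q) *\<^sub>p crd (b' i p)))"
    proof (rule VS.M.finsum_cong'[OF refl])
      show "(\<lambda>p. cls (M $$ (p, q) *\<^sub>p crd (b' i p))) \<in> {..<dimV i} \<rightarrow> carrier P"
        by (intro Pi_I cls_carrier keys_scale_subset kc) simp
      show "M $$ (p, q) \<odot>\<^bsub>P\<^esub> b' i p = cls (M $$ (p, q) *\<^sub>p crd (b' i p))" if "p \<in> {..<dimV i}" for p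
        using cls_scale[OF kc, of p "M $$ (p, q)"] nbr_B_coords(4)[OF b' i, of p] that by simp
    qed
    also have "\<dots> = cls (?y q)"
      by (rule cls_finsum) (use kc in \<open>auto intro!: keys_scale_subset\<close>)
    finally show ?thesis .
  qed
  have kyw: "keys (?y q \<star> w i q) \<subseteq> qpaths H" if "q < dimW i" for q
  proof (rule order_trans[OF keys_mult_w[OF i that] PTs_qpaths], rule order_trans[OF _ IXs_PTs])
    show "keys (?y q) \<subseteq> IV i" by (rule keys_sum_qpaths) (use nbr_B_coords(3)[OF b' i] in simp)
  qed
  have "row_mat_col P (b' i) M (xs i) = (\<Oplus>\<^bsub>P\<^esub>q\<in>{..<dimW i}. cls (?y q) \<otimes>\<^bsub>P\<^esub> xs i q)"
    unfolding row_mat_col_def carrier_matD[OF M] inner ..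
  also have "\<dots> = (\<Oplus>\<^bsub>P\<^esub>q\<in>{..<dimW i}. cls (?y q \<star> w i q))"
  proof (rule VS.M.finsum_cong'[OF refl])
    show "(\<lambda>q. cls (?y q \<star> w i q)) \<in> {..<dimW i} \<rightarrow> carrier P"
      by (intro Pi_I cls_carrier kyw) simp
    show "cls (?y q) \<otimes>\<^bsub>P\<^esub> xs i q = cls (?y q \<star> w i q)" if "q \<in> {..<dimW i}" for q
      using that xs_eq[OF i, of q] cls_mult[OF ky keys_w[OF i, of q], of q] by simp
  qed
  also have "\<dots> = cls (\<Sum>q<dimW i. ?y q \<star> w i q)"
    by (rule cls_finsum) (use kyw in auto)
  finally show ?thesis by (simp add: row_product_def)
qed

text \<open>Writes the entries as linear forms in the coordinates of the tuple; so the determinant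
  is a polynomial function on \<open>B'\<close>.\<close>

lemma col_expand:
  assumes "z \<in> row_tuples" "fst c < l"
  shows "col z c u = (\<Sum>q<dimW (fst c). \<Sum>p<dimV (fst c). \<Sum>v\<in>IV (fst c).
    mat_entry c p q * lookup (nf (sg v \<star> w (fst c) q)) u * lookup (z (fst c) p) v)"
proof -
  let ?i = "fst c"
  have "col z c u = (\<Sum>q<dimW ?i. \<Sum>p<dimV ?i. mat_entry c p q * lookup (nf (z ?i p \<star> w ?i q)) u)"
    by (simp add: col_def row_product_def linmap_sum[OF linmap_nf] linmap_sum[OF linmap_mult_left']
        qpath_mult_scale_left linmap_scale[OF linmap_nf] lookup_sum lookup_scale)
  also have "\<dots> = (\<Sum>q<dimW ?i. \<Sum>p<dimV ?i. \<Sum>v\<in>IV ?i.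
    mat_entry c p q * lookup (nf (sg v \<star> w ?i q)) u * lookup (z ?i p) v)"
  proof (intro sum.cong refl)
    fix p q assume "p \<in> {..<dimV ?i}"
    then have "keys (z ?i p) \<subseteq> IV ?i" using assms by (simp add: row_tuples_def)
    then have "lookup (nf (z ?i p \<star> w ?i q)) u = (\<Sum>v\<in>IV ?i. lookup (z ?i p) v * lookup (nf (sg v \<star> w ?i q)) u)"
      by (intro lookup_linmap[where F = "\<lambda>f. nf (f \<star> w ?i q)"] linmap_comp[OF linmap_nf linmap_mult_left'] finite_IXs)
    then show "mat_entry c p q * lookup (nf (z ?i p \<star> w ?i q)) u =
      (\<Sum>v\<in>IV ?i. mat_entry c p q * lookup (nf (sg v \<star> w ?i q)) u * lookup (z ?i p) v)"
      by (simp add: sum_distrib_left mult_ac)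
  qed
  finally show ?thesis .
qed

text \<open>Independence of the coordinate columns is enough, because there are as many products as
  the dimension of \<open>U\<close>.\<close>

lemma basis_of_independent_columns:
  assumes b': "b' \<in> nbr_B P l Vs"
    and m_carr: "\<And>i j. i < l \<Longrightarrow> j < num i \<Longrightarrow> m i j \<in> carrier_mat (dimV i) (dimW i)"
    and ind: "indep IU col_index (col (coords b'))" and card: "card col_index = card IU"
  shows "inj_on (\<lambda>(i, j). row_mat_col P (b' i) (m i j) (xs i)) col_index"
    "vectorspace.basis class_ring (P\<lparr>carrier := U\<rparr>) ((\<lambda>(i, j). row_mat_col P (b' i) (m i j) (xs i)) ` col_index)"
proof -
  define u where "u = (\<lambda>c. row_product (mat_entry c) (coords b') (fst c))"
  have fC: "finite col_index" by (simp add: col_index_def)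
  have uk: "keys (u c) \<subseteq> PTs t (Suc d)" if "c \<in> col_index" for c
    unfolding u_def by (rule keys_row_product[OF coords_row_tuples[OF b']]) (use that in \<open>auto simp: col_index_def\<close>)
  have uq: "keys (u c) \<subseteq> qpaths H" if "c \<in> col_index" for c
    using uk[OF that] PTs_qpaths by (rule order_trans)
  have ind': "s c = 0" if J: "(\<Sum>c\<in>col_index. s c *\<^sub>p u c) \<in> J" and c: "c \<in> col_index" for s c
  proof (rule indepD[OF ind _ c])
    fix v assume "v \<in> IU"
    have "lookup (nf (\<Sum>c\<in>col_index. s c *\<^sub>p u c)) v = 0" using nf_J[OF J] by simp
    then show "(\<Sum>c\<in>col_index. s c * col (coords b') c v) = 0"
      by (simp add: col_def u_def linmap_sum[OF linmap_nf] linmap_scale[OF linmap_nf] lookup_sum lookup_scale)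
  qed
  have eq: "(case c of (i, j) \<Rightarrow> row_mat_col P (b' i) (m i j) (xs i)) = cls (u c)" if "c \<in> col_index" for c
    using row_mat_col_eq[OF b', of "fst c" "m (fst c) (snd c)"] m_carr that
    by (auto simp: col_index_def u_def)
  let ?S = "(\<lambda>c. cls (u c)) ` col_index"
  have ic: "inj_on (\<lambda>c. cls (u c)) col_index" "\<not> VS.lin_dep ?S"
    using independent_cls[of col_index u] fC uq ind' by blast+
  show "inj_on (\<lambda>(i, j). row_mat_col P (b' i) (m i j) (xs i)) col_index"
    using ic(1) by (subst inj_on_cong[OF eq])
  interpret W: vectorspace class_ring "P\<lparr>carrier := U\<rparr>" by (rule preproj_V_basis)
  have SU: "?S \<subseteq> U" using uk unfolding preproj_V_eq by blast
  have "W.basis ?S"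
  proof (rule W.dim_li_is_basis)
    have "W.basis ((\<lambda>q. cls (sg q)) ` IU)" by (rule preproj_V_basis)
    then show "W.fin_dim" unfolding W.fin_dim_def W.basis_def by (intro exI[of _ "(\<lambda>q. cls (sg q)) ` IU"]) simp
    show "finite ?S" using fC by simp
    show "?S \<subseteq> carrier (P\<lparr>carrier := U\<rparr>)" using SU by simp
    show "\<not> W.lin_dep ?S" unfolding VS.span_li_not_depend(2)[OF SU preproj_V_basis(4)] by (rule ic(2))
    show "W.dim \<le> card ?S"
      using card_image[OF ic(1)] card preproj_V_basis(3)[of t "Suc d"] by (simp add: subspace_dim_def)
  qed
  moreover have "(\<lambda>(i, j). row_mat_col P (b' i) (m i j) (xs i)) ` col_index = ?S"
    by (rule image_cong[OF refl eq])
  ultimately show "W.basis ((\<lambda>(i, j). row_mat_col P (b' i) (m i j) (xs i)) ` col_index)" by simp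
qed

lemma crd_module_hom: "(\<lambda>X. lookup (crd X) v) \<in> module_hom class_ring (P\<lparr>carrier := Vs i\<rparr>) scalar_module"
  using preproj_V_crd(1)[of _ "nbr_vertex i" "nbr_degree i"] unfolding Vs_eq
  by (simp add: module_hom_def scalar_module_def crd_add crd_scale lookup_add lookup_scale)

lemma nbr_B_line:
  assumes X: "X \<in> nbr_B P l Vs" and Y: "Y \<in> nbr_B P l Vs"
  shows "\<exists>line. (\<forall>s. line s \<in> nbr_B P l Vs) \<and> line 0 = X \<and> line 1 = Y \<and>
    (\<forall>g\<in>nbr_B_coords P l Vs. \<exists>p. \<forall>s. g (line s) = poly p s)"
proof -
  define line where "line = (\<lambda>s. \<lambda>i\<in>{..<l}. \<lambda>p\<in>{..<dimV i}. cls ((1 - s) *\<^sub>p crd (X i p) + s *\<^sub>p crd (Y i p)))"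
  \<comment> \<open>Points of \<open>B'\<close> are extensional functions. For the ends of the line
    to be exactly \<open>X\<close> and \<open>Y\<close>, the values outside the index ranges have to
    agree as well.\<close>
  have ext: "Z = (\<lambda>i\<in>{..<l}. \<lambda>p\<in>{..<dimV i}. cls (crd (Z i p)))" if "Z \<in> nbr_B P l Vs" for Z
  proof (intro ext)
    fix i p
    show "Z i p = (\<lambda>i\<in>{..<l}. \<lambda>p\<in>{..<dimV i}. cls (crd (Z i p))) i p"
    proof (cases "i < l")
      case True
      then have Zi: "Z i \<in> (\<Pi>\<^sub>E p\<in>{..<dimV i}. Vs i)" using PiE_mem[OF that[unfolded nbr_B_def dim_Vs]] by simp
      show ?thesis
        using True nbr_B_coords(4)[OF that True, of p] PiE_arb[OF Zi, of p] by (cases "p < dimV i") simp_all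
    next
      case False
      then show ?thesis using PiE_arb[OF that[unfolded nbr_B_def], of i] by simp
    qed
  qed
  have kx: "keys (crd (Z i p)) \<subseteq> qpaths H" if "Z \<in> nbr_B P l Vs" "i < l" "p < dimV i" for Z i p
    using nbr_B_coords(3)[OF that] IXs_qpaths by (rule order_trans)
  have "line s \<in> nbr_B P l Vs" for s
    unfolding nbr_B_def line_def dim_Vs
  proof (intro restrict_PiE[THEN iffD2] Pi_I)
    fix i p assume "i \<in> {..<l}" "p \<in> {..<dimV i}"
    then have ip: "i < l" "p < dimV i" by simp_all
    have "keys ((1 - s) *\<^sub>p crd (X i p) + s *\<^sub>p crd (Y i p)) \<subseteq> PTs (nbr_vertex i) (nbr_degree i)"
      by (intro keys_add_subset keys_scale_subset order_trans[OF _ IXs_PTs] nbr_B_coords(3) X Y ip)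
    then show "cls ((1 - s) *\<^sub>p crd (X i p) + s *\<^sub>p crd (Y i p)) \<in> Vs i"
      unfolding Vs_eq preproj_V_eq by blast
  qed
  moreover have "line 0 = X"
    by (rule trans[OF _ ext[OF X, symmetric]]) (simp add: line_def)
  moreover have "line 1 = Y"
    by (rule trans[OF _ ext[OF Y, symmetric]]) (simp add: line_def)
  moreover have "\<exists>r. \<forall>s. g (line s) = poly r s" if "g \<in> nbr_B_coords P l Vs" for g
  proof -
    have "\<exists>\<phi> i p. g = (\<lambda>b'. \<phi> (b' i p)) \<and> i < l \<and> p < dimV i \<and>
      \<phi> \<in> module_hom class_ring (P\<lparr>carrier := Vs i\<rparr>) scalar_module"
      using that unfolding nbr_B_coords_def dim_Vs mem_Collect_eq .
    then obtain \<phi> i p where g: "g = (\<lambda>b'. \<phi> (b' i p))" and i: "i < l" and p: "p < dimV i"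
      and \<phi>: "\<phi> \<in> module_hom class_ring (P\<lparr>carrier := Vs i\<rparr>) scalar_module"
      by (elim exE conjE) (rule that)
    interpret W: vectorspace class_ring "P\<lparr>carrier := Vs i\<rparr>" unfolding Vs_eq by (rule preproj_V_basis)
    have mem: "X i p \<in> Vs i" "Y i p \<in> Vs i" using nbr_B_coords(1) X Y i p by blast+
    have sc: "c \<odot>\<^bsub>P\<^esub> Z \<in> Vs i" if "Z \<in> Vs i" for c Z
      using W.smult_closed[of c Z] that by simp
    have \<phi>a: "\<phi> (A \<oplus>\<^bsub>P\<^esub> B) = \<phi> A + \<phi> B" if "A \<in> Vs i" "B \<in> Vs i" for A B
      using \<phi> that by (simp add: module_hom_def scalar_module_def)
    have \<phi>s: "\<phi> (c \<odot>\<^bsub>P\<^esub> A) = c * \<phi> A" if "A \<in> Vs i" for A c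
      using \<phi> that by (simp add: module_hom_def scalar_module_def)
    have "line s i p = ((1 - s) \<odot>\<^bsub>P\<^esub> X i p) \<oplus>\<^bsub>P\<^esub> (s \<odot>\<^bsub>P\<^esub> Y i p)" for s
    proof -
      note kX = kx[OF X i p] and kY = kx[OF Y i p]
      have "((1 - s) \<odot>\<^bsub>P\<^esub> X i p) \<oplus>\<^bsub>P\<^esub> (s \<odot>\<^bsub>P\<^esub> Y i p) = cls ((1 - s) *\<^sub>p crd (X i p) + s *\<^sub>p crd (Y i p))"
        using cls_scale[OF kX, of "1 - s"] cls_scale[OF kY, of s]
          cls_add[OF keys_scale_subset[OF kX] keys_scale_subset[OF kY], of "1 - s" s]
          nbr_B_coords(4)[OF X i p] nbr_B_coords(4)[OF Y i p] by simp
      then show ?thesis using i p by (simp add: line_def)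
    qed
    then have "g (line s) = poly [:\<phi> (X i p), \<phi> (Y i p) - \<phi> (X i p):] s" for s
      by (simp add: g \<phi>a \<phi>s sc mem algebra_simps)
    then show ?thesis by blast
  qed
  ultimately show ?thesis by blast
qed

lemma generic_basis:
  assumes inf: "infinite (UNIV :: 'k set)"
    and num: "(\<Sum>i<l. num i) = subspace_dim P U"
    and m: "\<forall>i<l. \<forall>j<num i. m i j \<in> carrier_mat (subspace_dim P (Vs i)) (subspace_dim P (nbr_W G a b ss \<beta> i))"
      "\<forall>i<l. inj_on (m i) {..<num i} \<and> \<not> LinearCombinations.module.lin_dep class_ring
        (module_mat TYPE('k) (subspace_dim P (Vs i)) (subspace_dim P (nbr_W G a b ss \<beta> i))) (m i ` {..<num i})"
  shows "\<exists>E. openin (nbr_B_zariski P l Vs) E \<and> nbr_B_zariski P l Vs closure_of E = nbr_B P l Vs \<and>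
    (\<forall>b'\<in>E. inj_on (\<lambda>(i, j). row_mat_col P (b' i) (m i j) (xs i)) (SIGMA i:{..<l}. {..<num i}) \<and>
      vectorspace.basis class_ring (P\<lparr>carrier := U\<rparr>)
        ((\<lambda>(i, j). row_mat_col P (b' i) (m i j) (xs i)) ` (SIGMA i:{..<l}. {..<num i})))"
proof -
  have m_carr: "m i j \<in> carrier_mat (dimV i) (dimW i)" if "i < l" "j < num i" for i j
    using m(1) that by (simp add: dim_Vs dim_W)
  have m_inj: "inj_on (m i) {..<num i}" if "i < l" for i using m(2) that by blast
  have m_li: "\<not> LinearCombinations.module.lin_dep class_ring (module_mat TYPE('k) (dimV i) (dimW i)) (m i ` {..<num i})"
    if "i < l" for i using m(2) that by (simp add: dim_Vs dim_W)
  have num': "(\<Sum>i<l. num i) = card IU" using num preproj_V_basis(3)[of t "Suc d"] by simp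
  obtain z where z: "z \<in> indep_tuples" "indep IU col_index (col z)"
    using independent_columns_exist[OF m_carr m_inj m_li num' inf] by blast
  have fC: "finite col_index" by (simp add: col_index_def)
  have cC: "card col_index = card IU" using num' by (simp add: col_index_def)
  define N where "N = card IU"
  obtain e1 where e1: "bij_betw e1 {0..<N} IU"
    using ex_bij_betw_nat_finite[OF finite_IXs] unfolding N_def by blast
  obtain e2 where e2: "bij_betw e2 {0..<N} col_index"
    using ex_bij_betw_nat_finite[OF fC] unfolding N_def cC[symmetric] by blast
  have e2C: "e2 c \<in> col_index" if "c < N" for c using bij_betwE[OF e2] that by simp
  let ?L = "nbr_B_coords P l Vs"
  define g where "g = (\<lambda>b' r c. \<Sum>q<dimW (fst (e2 c)). \<Sum>p<dimV (fst (e2 c)). \<Sum>v\<in>IV (fst (e2 c)).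
    mat_entry (e2 c) p q * lookup (nf (sg v \<star> w (fst (e2 c)) q)) (e1 r) * lookup (coords b' (fst (e2 c)) p) v)"
  \<comment> \<open>The determinant of the products in coordinates of \<open>U\<close>. Its
    nonvanishing set is the required \<open>E\<close>; the formula \<open>g\<close> is used for the
    entries because it is visibly polynomial on all tuples, while it agrees with \<open>col\<close>
    on \<open>B'\<close>.\<close>
  define D where "D = (\<lambda>b'. det (mat N N (\<lambda>(r, c). g b' r c)))"
  have g_poly: "(\<lambda>b'. g b' r c) \<in> poly_funs ?L" if "r < N" "c < N" for r c
    unfolding g_def
  proof (intro poly_funs_sum poly_funs.mult poly_funs.const poly_funs.coord)
    fix q p v assume "p \<in> {..<dimV (fst (e2 c))}"
    moreover have "fst (e2 c) < l" using e2C[OF that(2)] by (auto simp: col_index_def)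
    ultimately show "(\<lambda>b'. lookup (coords b' (fst (e2 c)) p) v) \<in> ?L"
      unfolding nbr_B_coords_def dim_Vs
      by (intro CollectI exI[of _ "\<lambda>X. lookup (crd X) v"] exI[of _ "fst (e2 c)"] exI[of _ p] conjI refl crd_module_hom) simp_all
  qed
  have D_poly: "D \<in> poly_funs ?L" unfolding D_def by (rule poly_funs_det) (rule g_poly)
  have D_iff: "D b' \<noteq> 0 \<longleftrightarrow> indep IU col_index (col (coords b'))" if "b' \<in> nbr_B P l Vs" for b'
  proof -
    have "g b' r c = col (coords b') (e2 c) (e1 r)" if "c < N" for r c
      unfolding g_def
      by (rule col_expand[symmetric]) (use coords_row_tuples \<open>b' \<in> nbr_B P l Vs\<close> e2C[OF that] in \<open>auto simp: col_index_def\<close>)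
    then have "mat N N (\<lambda>(r, c). g b' r c) = mat N N (\<lambda>(r, c). col (coords b') (e2 c) (e1 r))"
      by (intro eq_matI) auto
    then show ?thesis unfolding D_def by (simp only: det_nonzero_iff_indep[OF e1 e2])
  qed
  \<comment> \<open>The tuple of maximal rank, carried to the quotient; it shows that
    \<open>D\<close> is not identically zero on \<open>B'\<close>.\<close>
  define b0 where "b0 = (\<lambda>i\<in>{..<l}. \<lambda>p\<in>{..<dimV i}. cls (z i p))"
  have zk: "keys (z i p) \<subseteq> IV i" if "i < l" "p < dimV i" for i p
    using z(1) that by (simp add: indep_tuples_def row_tuples_def)
  have b0: "b0 \<in> nbr_B P l Vs"
    unfolding nbr_B_def b0_def dim_Vs
  proof (intro restrict_PiE[THEN iffD2] Pi_I)
    fix i p assume "i \<in> {..<l}" "p \<in> {..<dimV i}"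
    then have "keys (z i p) \<subseteq> PTs (nbr_vertex i) (nbr_degree i)" by (intro order_trans[OF zk IXs_PTs]) simp_all
    then show "cls (z i p) \<in> Vs i" unfolding Vs_eq preproj_V_eq by blast
  qed
  have crd0: "coords b0 i p = z i p" if "i < l" "p < dimV i" for i p
    using that crd_cls[OF order_trans[OF zk IXs_qpaths], of i p] nf_id_IXs[OF zk, of i p] by (simp add: b0_def)
  have "col (coords b0) c = col z c" if "c \<in> col_index" for c
    using that crd0[of "fst c"] by (intro ext) (auto simp: col_def row_product_def col_index_def intro!: arg_cong2[where f = lookup] arg_cong[where f = nf] sum.cong)
  then have "indep IU col_index (col (coords b0))" using z(2) by (simp add: indep_def)
  then have D0: "D b0 \<noteq> 0" using D_iff[OF b0] by simp
  note dense = zariski_nonvanishing_dense[OF inf D_poly b0 D0 nbr_B_line]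
  show ?thesis
    unfolding nbr_B_zariski_def col_index_def[symmetric]
  proof (intro exI[of _ "{b' \<in> nbr_B P l Vs. D b' \<noteq> 0}"] conjI ballI)
    fix b' assume "b' \<in> {b' \<in> nbr_B P l Vs. D b' \<noteq> 0}"
    then have "b' \<in> nbr_B P l Vs" "indep IU col_index (col (coords b'))" using D_iff by auto
    note B = basis_of_independent_columns[OF this(1) m_carr this(2) cC]
    show "inj_on (\<lambda>(i, j). row_mat_col P (b' i) (m i j) (xs i)) col_index"
      "vectorspace.basis class_ring (P\<lparr>carrier := U\<rparr>) ((\<lambda>(i, j). row_mat_col P (b' i) (m i j) (xs i)) ` col_index)"
      by (rule B; assumption)+
  qed (rule dense; assumption)+
qed

end

theorem corollary4p2:
  fixes G :: "('v, 'e) pre_digraph"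
    and a b :: "'e \<Rightarrow> 'k::alg_closed_field"
    and t :: 'v and d :: nat
    and ss us :: "'v list" and \<beta> :: "nat \<Rightarrow> 'e list"
    and num :: "nat \<Rightarrow> nat" and m :: "nat \<Rightarrow> nat \<Rightarrow> 'k mat"
  defines "P \<equiv> preproj_algebra G a b"
    and "U \<equiv> preproj_V G a b t d"
    and "l \<equiv> length ss + length us"
    and "V \<equiv> nbr_V G a b d ss us"
    and "W \<equiv> nbr_W G a b ss \<beta>"
    and "x \<equiv> nbr_x G a b ss \<beta>"
  assumes "fin_digraph G"
    and "\<nexists>c. pre_digraph.cycle G c"
    and "\<forall>\<gamma>\<in>arcs G. a \<gamma> \<noteq> 0 \<and> b \<gamma> \<noteq> 0"
    and "t \<in> verts G"
    and "d > 0"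
    and "U \<noteq> {\<zero>\<^bsub>P\<^esub>}"
    and "nbr_enum G t ss us \<beta>"
    and "\<forall>i<l. num i \<le> subspace_dim P (V i) * subspace_dim P (W i)"
    and "(\<Sum>i<l. num i) = subspace_dim P U"
    and "\<forall>i<l. \<forall>j<num i. m i j \<in> carrier_mat (subspace_dim P (V i)) (subspace_dim P (W i))"
    and "\<forall>i<l. inj_on (m i) {..<num i} \<and>
           \<not> LinearCombinations.module.lin_dep class_ring
               (module_mat TYPE('k) (subspace_dim P (V i)) (subspace_dim P (W i)))
               (m i ` {..<num i})"
  shows "\<exists>E. openin (nbr_B_zariski P l V) E \<and>
             nbr_B_zariski P l V closure_of E = nbr_B P l V \<and>
             (\<forall>b'\<in>E.
                inj_on (\<lambda>(i, j). row_mat_col P (b' i) (m i j) (x i)) (SIGMA i:{..<l}. {..<num i}) \<and>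
                VectorSpace.vectorspace.basis class_ring (P\<lparr>carrier := U\<rparr>)
                  ((\<lambda>(i, j). row_mat_col P (b' i) (m i j) (x i)) ` (SIGMA i:{..<l}. {..<num i})))"
proof -
  obtain d' where d: "d = Suc d'" using \<open>d > 0\<close> gr0_conv_Suc by blast
  interpret fin_digraph G by fact
  interpret N: preproj_nbr G a b t d' ss us \<beta> num m
    by unfold_locales (use assms(8,9,13) in simp_all)
  have l: "l = N.l" by (simp add: l_def N.l_def)
  show ?thesis
    unfolding P_def U_def V_def x_def l d
    by (rule N.generic_basis[OF infinite_alg_closed])
      (use assms(15-17) in \<open>simp_all only: P_def U_def V_def W_def l d\<close>)
qed

end
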